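(* Let $M$ be a complex manifold, $\dim M=n\geq 2$, endowed with a projective structure, given by the torsion free $\rho$-connection $\nabla$, and suppose that there exists a line bundle $L$ over $M$ such that $L^{n+1}=\Lambda^n(TM)$. Then $\nabla$ is flat if and only if there exists a (globally defined) local diffeomorphism from a covering space of $M$ to $\mathbb{C}P^n$ mapping the geodesics into projective lines.
   Context: Everything is in the category of complex manifolds: vector bundles, sections, functions, forms, connections are holomorphic; maps are holomorphic, so "local diffeomorphism" means local biholomorphism; $TM$ is the holomorphic tangent bundle; "dimension" is complex dimension. $L^{n+1}=\Lambda^n(TM)$ means isomorphism of line bundles, $L^{n+1}$ being the tensor power. A covering space of $M$ carries the pulled-back complex and projective structures, and "the geodesics" are those of this projective structure. Projective structures. Two connections on a manifold are projectively equivalent if they have the same geodesics up to parametrizations. A projective covering on $M$ is a family $\{\nabla^U\}_{U\in\mathcal U}$, where $\mathcal U$ is an open covering of $M$, $\nabla^U$ is a torsion free connection on $U$ for each nonempty $U\in\mathcal U$, and $\nabla^U,\nabla^V$ are projectively equivalent on $U\cap V$ for any overlapping $U,V\in\mathcal U$. Two projective coverings are equivalent if their union is a projective covering. A projective structure is an equivalence class of projective coverings; its geodesics are the (immersed, unparametrized complex) curves which are locally geodesics of the connections $\nabla^U$. The bundle $E$. $\det(TM)$ denotes the principal $\mathbb{C}\setminus\{0\}$-bundle of nonzero elements of $\Lambda^n(TM)$. $E=T(\det(TM))/(\mathbb{C}\setminus\{0\})$ is the vector bundle over $M$ of rank $n+1$ whose sections over an open set are the $\mathbb{C}\setminus\{0\}$-invariant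 vector fields on the corresponding restriction of $\det(TM)$; $\rho:E\to TM$ is induced by the differential of the projection $\det(TM)\to M$, and there is an exact sequence $0\to M\times\mathbb{C}\to E\overset{\rho}{\to}TM\to 0$, in which the constant section $1$ of $M\times\mathbb{C}$ is mapped to the section $\mathbf 1$ of $E$ given by the Euler vector field (infinitesimal generator of the fibrewise scaling). The bracket $[\cdot,\cdot]$ of local sections of $E$ is the Lie bracket of the corresponding invariant vector fields. $\rho$-connections. A $\rho$-connection on a vector bundle $F$ over $M$ is a linear sheaf morphism $\nabla:\Gamma(F)\to\Gamma(\mathrm{Hom}(E,F))$ such that $\nabla_s(ft)=\rho(s)(f)\,t+f\nabla_s t$ for any local function $f$ on $M$ and local sections $s$ of $E$ and $t$ of $F$. Its curvature form is $R(s_1,s_2)t=[\nabla_{s_1},\nabla_{s_2}]t-\nabla_{[s_1,s_2]}t$; $\nabla$ is flat if $R=0$. The torsion of a $\rho$-connection on $E$ is $T(s_1,s_2)=\nabla_{s_1}s_2-\nabla_{s_2}s_1-[s_1,s_2]$. The $\rho$-connection giving a projective structure. Each projective structure on $M$ is given by a unique torsion free $\rho$-connection $\nabla$ on $E$ such that: (ii1) $\nabla_{\mathbf 1}s=-\frac{1}{n+1}s$ for any local section $s$ of $E$; (ii2) the $\rho$-connection induced by $\nabla$ on $\Lambda^{n+1}E$ corresponds to the canonical $\rho$-connection of $\Lambda^n(TM)$, under the isomorphism $\Lambda^{n+1}E=\Lambda^n(TM)$ whose dual is $\omega\mapsto\alpha\wedge\rho^*\omega$ ($\alpha$ any local section of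 $E^*$ with $\alpha(\mathbf 1)=1$); here the canonical $\rho$-connection of $\Lambda^n(TM)$ is the dual of the $\rho$-connection on $\Lambda^n(T^*M)$ for which $\nabla_s\omega$ corresponds to $s(f_\omega)$, $f_\omega$ being the fibrewise linear function on $\det(TM)$ defined by $\omega$; (ii3) $\mathrm{Ric}=0$, where $\mathrm{Ric}(s_1,s_2)=\mathrm{trace}(t\mapsto R(t,s_2)s_1)$. That the projective structure is given by $\nabla$ means: over any open $U\subseteq M$ for which there is a section $c_U:TU\to E|_U$ of $\rho$, it is represented by the connection $\nabla^U_XY=\rho\bigl(\nabla_{c_U(X)}(c_U(Y))\bigr)$; equivalently, its geodesics are the immersed curves $c$ for which, locally, there is a section $s$ of $E$ over $c$ with $\rho\circ s=\dot c$ and $\nabla_s s=0$. *)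

theory Defs
  imports "HOL-Analysis.Analysis" "HOL-Library.Function_Algebras"
begin

text \<open>
  Conventions.  A complex manifold of dimension \<open>CARD('n)\<close> is given by a holomorphic atlas on a
  set of points; its topology is the one defined by the atlas.  Locally defined objects (vector
  fields, sections, forms) are total functions that vanish outside their domain, and fibrewise
  functionals vanish outside their fibre; so equality of such objects is equality of
  functions.  Sums and zeros of such objects are the pointwise ones of
  \<^theory>\<open>HOL-Library.Function_Algebras\<close>.
\<close>

section \<open>Complex manifolds\<close>

type_synonym ('a, 'n) atlas = "('a set \<times> ('a \<Rightarrow> complex ^ 'n)) set"

definition holo :: "(complex ^ 'n::finite) set \<Rightarrow> (complex ^ 'n \<Rightarrow> complex) \<Rightarrow> bool" where
  "holo S f \<longleftrightarrow> open S \<and>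
     (\<forall>x\<in>S. \<exists>a :: complex ^ 'n. (f has_derivative (\<lambda>h. \<Sum>i\<in>UNIV. a $ i * h $ i)) (at x))"

definition points :: "('a, 'n::finite) atlas \<Rightarrow> 'a set" where
  "points A = \<Union> (fst ` A)"

definition mopen :: "('a, 'n::finite) atlas \<Rightarrow> 'a set \<Rightarrow> bool" where
  "mopen A W \<longleftrightarrow> W \<subseteq> points A \<and> (\<forall>(U, \<phi>)\<in>A. open (\<phi> ` (U \<inter> W)))"

definition mtop :: "('a, 'n::finite) atlas \<Rightarrow> 'a topology" where
  "mtop A = topology (mopen A)"

definition complex_manifold :: "('a, 'n::finite) atlas \<Rightarrow> bool" where
  "complex_manifold A \<longleftrightarrow>
     (\<forall>(U, \<phi>)\<in>A. inj_on \<phi> U \<and> open (\<phi> ` U)) \<and>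
     (\<forall>(U, \<phi>)\<in>A. \<forall>(V, \<psi>)\<in>A. \<forall>i. holo (\<phi> ` (U \<inter> V)) (\<lambda>x. \<psi> (inv_into U \<phi> x) $ i)) \<and>
     Hausdorff_space (mtop A) \<and>
     second_countable (mtop A)"

definition holo_on :: "('a, 'n::finite) atlas \<Rightarrow> 'a set \<Rightarrow> ('a \<Rightarrow> complex) \<Rightarrow> bool" where
  "holo_on A W f \<longleftrightarrow> mopen A W \<and> (\<forall>(U, \<phi>)\<in>A. holo (\<phi> ` (U \<inter> W)) (\<lambda>x. f (inv_into U \<phi> x)))"

definition holo_map ::
    "('a, 'n::finite) atlas \<Rightarrow> ('b, 'm::finite) atlas \<Rightarrow> 'a set \<Rightarrow> ('a \<Rightarrow> 'b) \<Rightarrow> bool" where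
  "holo_map A B W f \<longleftrightarrow> mopen A W \<and> f ` W \<subseteq> points B \<and>
     (\<forall>(U, \<phi>)\<in>A. \<forall>(V, \<psi>)\<in>B. \<forall>i.
        holo (\<phi> ` (U \<inter> W \<inter> f -` V)) (\<lambda>x. \<psi> (f (inv_into U \<phi> x)) $ i))"

definition biholo_on ::
    "('a, 'n::finite) atlas \<Rightarrow> ('b, 'm::finite) atlas \<Rightarrow> 'a set \<Rightarrow> ('a \<Rightarrow> 'b) \<Rightarrow> bool" where
  "biholo_on A B W f \<longleftrightarrow> holo_map A B W f \<and> inj_on f W \<and> mopen B (f ` W) \<and>
     holo_map B A (f ` W) (inv_into W f)"

definition local_biholo ::
    "('a, 'n::finite) atlas \<Rightarrow> ('b, 'm::finite) atlas \<Rightarrow> ('a \<Rightarrow> 'b) \<Rightarrow> bool" where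
  "local_biholo A B f \<longleftrightarrow> (\<forall>x\<in>points A. \<exists>W. x \<in> W \<and> biholo_on A B W f)"

definition std_atlas :: "(complex, 1) atlas" where
  "std_atlas = {(UNIV, \<lambda>z. \<chi> i. z)}"


section \<open>Holomorphic tangent vectors and vector fields\<close>

text \<open>Tangent vectors are the derivations of the algebra of germs of holomorphic functions.\<close>

type_synonym 'a tvec = "('a \<Rightarrow> complex) \<Rightarrow> complex"
type_synonym 'a vfield = "'a \<Rightarrow> 'a tvec"

definition holo_near :: "('a, 'n::finite) atlas \<Rightarrow> 'a \<Rightarrow> ('a \<Rightarrow> complex) \<Rightarrow> bool" where
  "holo_near A p f \<longleftrightarrow> (\<exists>W. p \<in> W \<and> holo_on A W f)"

definition tangent :: "('a, 'n::finite) atlas \<Rightarrow> 'a \<Rightarrow> 'a tvec set" where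
  "tangent A p = {v.
     (\<forall>f. \<not> holo_near A p f \<longrightarrow> v f = 0) \<and>
     (\<forall>f g W. holo_near A p f \<and> mopen A W \<and> p \<in> W \<and> (\<forall>x\<in>W. f x = g x) \<longrightarrow> v f = v g) \<and>
     (\<forall>f g. holo_near A p f \<and> holo_near A p g \<longrightarrow>
        v (\<lambda>x. f x + g x) = v f + v g \<and>
        v (\<lambda>x. f x * g x) = f p * v g + g p * v f) \<and>
     (\<forall>f c. holo_near A p f \<longrightarrow> v (\<lambda>x. c * f x) = c * v f)}"

text \<open>The differential of \<open>F\<close> at a point with image \<open>q\<close>, the target having atlas \<open>B\<close>.\<close>

definition tmap :: "('b, 'm::finite) atlas \<Rightarrow> ('a \<Rightarrow> 'b) \<Rightarrow> 'b \<Rightarrow> 'a tvec \<Rightarrow> 'b tvec" where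
  "tmap B F q v = (\<lambda>f. if holo_near B q f then v (\<lambda>x. f (F x)) else 0)"

definition vfields :: "('a, 'n::finite) atlas \<Rightarrow> 'a set \<Rightarrow> 'a vfield set" where
  "vfields A W = {X.
     (\<forall>p\<in>W. X p \<in> tangent A p) \<and> (\<forall>p. p \<notin> W \<longrightarrow> X p = 0) \<and>
     (\<forall>V f. V \<subseteq> W \<and> holo_on A V f \<longrightarrow> holo_on A V (\<lambda>p. X p f))}"

definition vapply :: "'a vfield \<Rightarrow> ('a \<Rightarrow> complex) \<Rightarrow> ('a \<Rightarrow> complex)" where
  "vapply X f = (\<lambda>p. X p f)"

definition vscale :: "complex \<Rightarrow> 'a tvec \<Rightarrow> 'a tvec" where
  "vscale c v = (\<lambda>f. c * v f)"

definition vmul :: "('a \<Rightarrow> complex) \<Rightarrow> 'a vfield \<Rightarrow> 'a vfield" where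
  "vmul g X = (\<lambda>p. vscale (g p) (X p))"

definition vres :: "'a set \<Rightarrow> 'a vfield \<Rightarrow> 'a vfield" where
  "vres V X = (\<lambda>p. if p \<in> V then X p else 0)"

definition lie_bracket ::
    "('a, 'n::finite) atlas \<Rightarrow> 'a set \<Rightarrow> 'a vfield \<Rightarrow> 'a vfield \<Rightarrow> 'a vfield" where
  "lie_bracket A W X Y =
     (\<lambda>p f. if p \<in> W \<and> holo_near A p f then X p (vapply Y f) - Y p (vapply X f) else 0)"


section \<open>Multilinear algebra\<close>

text \<open>
  \<open>T\<close> is a linear subspace of a type with scalar multiplication \<open>sc\<close>.  The arguments of a
  multilinear form are indexed by a finite type \<open>'i\<close>, so a form of degree \<open>CARD('i)\<close> is meant.
\<close>

definition multilinear_forms ::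
    "(complex \<Rightarrow> 'v \<Rightarrow> 'v) \<Rightarrow> 'v::ab_group_add set \<Rightarrow> (('i::finite \<Rightarrow> 'v) \<Rightarrow> complex) set" where
  "multilinear_forms sc T = {\<omega>.
     (\<forall>v. (\<exists>i. v i \<notin> T) \<longrightarrow> \<omega> v = 0) \<and>
     (\<forall>v i x y. (\<forall>j. v j \<in> T) \<and> x \<in> T \<and> y \<in> T \<longrightarrow>
        \<omega> (v(i := x + y)) = \<omega> (v(i := x)) + \<omega> (v(i := y))) \<and>
     (\<forall>v i x c. (\<forall>j. v j \<in> T) \<and> x \<in> T \<longrightarrow> \<omega> (v(i := sc c x)) = c * \<omega> (v(i := x)))}"

definition alternating_forms ::
    "(complex \<Rightarrow> 'v \<Rightarrow> 'v) \<Rightarrow> 'v::ab_group_add set \<Rightarrow> (('i::finite \<Rightarrow> 'v) \<Rightarrow> complex) set" where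
  "alternating_forms sc T =
     {\<omega> \<in> multilinear_forms sc T. \<forall>v i j. i \<noteq> j \<and> v i = v j \<longrightarrow> \<omega> v = 0}"

text \<open>
  The dual space of a space of forms.  For finite dimensional \<open>T\<close>, the dual of the alternating
  (multilinear) forms of degree \<open>k\<close> is the exterior (tensor) power of degree \<open>k\<close> of \<open>T\<close>, the
  product of \<open>v\<^sub>1, \<dots>, v\<^sub>k\<close> being the evaluation at \<open>(v\<^sub>1, \<dots>, v\<^sub>k)\<close>.
\<close>

definition dual_of :: "('x \<Rightarrow> complex) set \<Rightarrow> (('x \<Rightarrow> complex) \<Rightarrow> complex) set" where
  "dual_of K = {e.
     (\<forall>\<omega>. \<omega> \<notin> K \<longrightarrow> e \<omega> = 0) \<and>
     (\<forall>\<omega>\<in>K. \<forall>\<eta>\<in>K. e (\<omega> + \<eta>) = e \<omega> + e \<eta>) \<and>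
     (\<forall>\<omega>\<in>K. \<forall>c. e (\<lambda>v. c * \<omega> v) = c * e \<omega>)}"

definition exterior_power ::
    "(complex \<Rightarrow> 'v \<Rightarrow> 'v) \<Rightarrow> 'v::ab_group_add set \<Rightarrow>
       ((('i::finite \<Rightarrow> 'v) \<Rightarrow> complex) \<Rightarrow> complex) set" where
  "exterior_power sc T = dual_of (alternating_forms sc T)"

definition ext_prod ::
    "(complex \<Rightarrow> 'v \<Rightarrow> 'v) \<Rightarrow> 'v::ab_group_add set \<Rightarrow> ('i::finite \<Rightarrow> 'v) \<Rightarrow>
       (('i \<Rightarrow> 'v) \<Rightarrow> complex) \<Rightarrow> complex" where
  "ext_prod sc T v = (\<lambda>\<omega>. if \<omega> \<in> alternating_forms sc T then \<omega> v else 0)"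

definition tensor_power ::
    "(complex \<Rightarrow> 'v \<Rightarrow> 'v) \<Rightarrow> 'v::ab_group_add set \<Rightarrow>
       ((('i::finite \<Rightarrow> 'v) \<Rightarrow> complex) \<Rightarrow> complex) set" where
  "tensor_power sc T = dual_of (multilinear_forms sc T)"

definition tensor_prod ::
    "(complex \<Rightarrow> 'v \<Rightarrow> 'v) \<Rightarrow> 'v::ab_group_add set \<Rightarrow> ('i::finite \<Rightarrow> 'v) \<Rightarrow>
       (('i \<Rightarrow> 'v) \<Rightarrow> complex) \<Rightarrow> complex" where
  "tensor_prod sc T v = (\<lambda>\<omega>. if \<omega> \<in> multilinear_forms sc T then \<omega> v else 0)"


section \<open>The line bundle \<open>\<Lambda>\<^sup>n(TM)\<close> and the principal bundle \<open>det(TM)\<close>\<close>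

type_synonym ('a, 'n) nform = "('n \<Rightarrow> 'a tvec) \<Rightarrow> complex"
type_synonym ('a, 'n) nvec = "('a, 'n) nform \<Rightarrow> complex"

definition nforms_at :: "('a, 'n::finite) atlas \<Rightarrow> 'a \<Rightarrow> ('a, 'n) nform set" where
  "nforms_at A p = alternating_forms vscale (tangent A p)"

definition nvecs_at :: "('a, 'n::finite) atlas \<Rightarrow> 'a \<Rightarrow> ('a, 'n) nvec set" where
  "nvecs_at A p = exterior_power vscale (tangent A p)"

text \<open>Holomorphic sections over \<open>U\<close> of \<open>\<Lambda>\<^sup>n(T\<^sup>*M)\<close> and of \<open>\<Lambda>\<^sup>n(TM)\<close>.\<close>

definition nforms :: "('a, 'n::finite) atlas \<Rightarrow> 'a set \<Rightarrow> ('a \<Rightarrow> ('a, 'n) nform) set" where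
  "nforms A U = {\<omega>.
     (\<forall>p\<in>U. \<omega> p \<in> nforms_at A p) \<and> (\<forall>p. p \<notin> U \<longrightarrow> \<omega> p = 0) \<and>
     (\<forall>V X. mopen A V \<and> V \<subseteq> U \<and> (\<forall>i. X i \<in> vfields A V) \<longrightarrow>
        holo_on A V (\<lambda>p. \<omega> p (\<lambda>i. X i p)))}"

definition nvecs :: "('a, 'n::finite) atlas \<Rightarrow> 'a set \<Rightarrow> ('a \<Rightarrow> ('a, 'n) nvec) set" where
  "nvecs A U = {u.
     (\<forall>p\<in>U. u p \<in> nvecs_at A p) \<and> (\<forall>p. p \<notin> U \<longrightarrow> u p = 0) \<and>
     (\<forall>V \<omega>. mopen A V \<and> V \<subseteq> U \<and> \<omega> \<in> nforms A V \<longrightarrow> holo_on A V (\<lambda>p. u p (\<omega> p)))}"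

type_synonym ('a, 'n) dpoint = "'a \<times> ('a, 'n) nvec"

definition det_over :: "('a, 'n::finite) atlas \<Rightarrow> 'a set \<Rightarrow> ('a, 'n) dpoint set" where
  "det_over A U = {(p, e). p \<in> U \<and> p \<in> points A \<and> e \<in> nvecs_at A p \<and> e \<noteq> 0}"

definition det_scale :: "complex \<Rightarrow> ('a, 'n) dpoint \<Rightarrow> ('a, 'n) dpoint" where
  "det_scale c x = (fst x, \<lambda>\<omega>. c * snd x \<omega>)"

text \<open>The form \<open>dz\<^sub>1 \<and> \<dots> \<and> dz\<^sub>n\<close> at \<open>p\<close>, where \<open>\<phi> = (z\<^sub>1, \<dots>, z\<^sub>n)\<close>.\<close>

definition coord_form ::
    "('a, 'n::finite) atlas \<Rightarrow> ('a \<Rightarrow> complex ^ 'n) \<Rightarrow> 'a \<Rightarrow> ('a, 'n) nform" where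
  "coord_form A \<phi> p = (\<lambda>v. if \<forall>j. v j \<in> tangent A p
     then det (\<chi> i j. v j (\<lambda>x. \<phi> x $ i)) else 0)"

definition det_atlas :: "('a, 'n::finite) atlas \<Rightarrow> (('a, 'n) dpoint, 'n option) atlas" where
  "det_atlas A = {(det_over A U,
     \<lambda>x. \<chi> k. case k of None \<Rightarrow> snd x (coord_form A \<phi> (fst x)) | Some i \<Rightarrow> \<phi> (fst x) $ i)
     | U \<phi>. (U, \<phi>) \<in> A}"


section \<open>The bundle \<open>E\<close>\<close>

text \<open>
  An element of the fibre \<open>E\<^sub>p\<close> of \<open>T(det(TM))/(\<complex> - {0})\<close>, that is an orbit of tangent vectors,
  is an invariant vector field along the fibre of \<open>det(TM)\<close> over \<open>p\<close>.  The value at \<open>p\<close> of the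
  section \<open>s\<close> is \<open>eres {p} s\<close>.
\<close>

type_synonym ('a, 'n) esec = "('a, 'n) dpoint vfield"

definition invariant_over :: "('a, 'n::finite) atlas \<Rightarrow> 'a set \<Rightarrow> ('a, 'n) esec \<Rightarrow> bool" where
  "invariant_over A U s \<longleftrightarrow> (\<forall>x\<in>det_over A U. \<forall>c. c \<noteq> 0 \<longrightarrow>
     s (det_scale c x) = tmap (det_atlas A) (det_scale c) (det_scale c x) (s x))"

definition Esec :: "('a, 'n::finite) atlas \<Rightarrow> 'a set \<Rightarrow> ('a, 'n) esec set" where
  "Esec A U = {s \<in> vfields (det_atlas A) (det_over A U). invariant_over A U s}"

definition Efibre :: "('a, 'n::finite) atlas \<Rightarrow> 'a \<Rightarrow> ('a, 'n) esec set" where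
  "Efibre A p = {v.
     (\<forall>x\<in>det_over A {p}. v x \<in> tangent (det_atlas A) x) \<and>
     (\<forall>x. x \<notin> det_over A {p} \<longrightarrow> v x = 0) \<and> invariant_over A {p} v}"

definition eres :: "'a set \<Rightarrow> ('a, 'n) esec \<Rightarrow> ('a, 'n) esec" where
  "eres V s = (\<lambda>x. if fst x \<in> V then s x else 0)"

definition emul :: "('a \<Rightarrow> complex) \<Rightarrow> ('a, 'n) esec \<Rightarrow> ('a, 'n) esec" where
  "emul g s = vmul (\<lambda>x. g (fst x)) s"

definition escale :: "complex \<Rightarrow> ('a, 'n) esec \<Rightarrow> ('a, 'n) esec" where
  "escale c = emul (\<lambda>_. c)"

text \<open>By invariance the choice of the point of the fibre is immaterial.\<close>

definition rho :: "('a, 'n::finite) atlas \<Rightarrow> ('a, 'n) esec \<Rightarrow> 'a vfield" where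
  "rho A s = (\<lambda>p. tmap A fst p (s (SOME x. x \<in> det_over A {p})))"

text \<open>The restriction to \<open>U\<close> of the section \<open>\<one>\<close>.\<close>

definition euler :: "('a, 'n::finite) atlas \<Rightarrow> 'a set \<Rightarrow> ('a, 'n) esec" where
  "euler A U = (\<lambda>x f. if x \<in> det_over A U \<and> holo_near (det_atlas A) x f
     then deriv (\<lambda>c. f (det_scale c x)) 1 else 0)"

definition ebracket ::
    "('a, 'n::finite) atlas \<Rightarrow> 'a set \<Rightarrow> ('a, 'n) esec \<Rightarrow> ('a, 'n) esec \<Rightarrow> ('a, 'n) esec" where
  "ebracket A U = lie_bracket (det_atlas A) (det_over A U)"


section \<open>\<open>\<rho>\<close>-connections on \<open>E\<close>\<close>

text \<open>\<open>N U s t\<close> is \<open>\<nabla>\<^sub>s t\<close> for sections \<open>s\<close> and \<open>t\<close> over \<open>U\<close>.\<close>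

type_synonym ('a, 'n) econn =
  "'a set \<Rightarrow> ('a, 'n) esec \<Rightarrow> ('a, 'n) esec \<Rightarrow> ('a, 'n) esec"

definition rho_connection :: "('a, 'n::finite) atlas \<Rightarrow> ('a, 'n) econn \<Rightarrow> bool" where
  "rho_connection A N \<longleftrightarrow> (\<forall>U. mopen A U \<longrightarrow> (\<forall>s\<in>Esec A U. \<forall>t\<in>Esec A U.
     N U s t \<in> Esec A U \<and>
     (\<forall>V. mopen A V \<and> V \<subseteq> U \<longrightarrow> N V (eres V s) (eres V t) = eres V (N U s t)) \<and>
     (\<forall>s'\<in>Esec A U. N U (s + s') t = N U s t + N U s' t) \<and>
     (\<forall>t'\<in>Esec A U. N U s (t + t') = N U s t + N U s t') \<and>
     (\<forall>g. holo_on A U g \<longrightarrow>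
        N U (emul g s) t = emul g (N U s t) \<and>
        N U s (emul g t) = emul (vapply (rho A s) g) t + emul g (N U s t))))"

definition rho_torsion_free :: "('a, 'n::finite) atlas \<Rightarrow> ('a, 'n) econn \<Rightarrow> bool" where
  "rho_torsion_free A N \<longleftrightarrow> (\<forall>U. mopen A U \<longrightarrow> (\<forall>s1\<in>Esec A U. \<forall>s2\<in>Esec A U.
     N U s1 s2 - N U s2 s1 - ebracket A U s1 s2 = 0))"

definition rho_curvature ::
    "('a, 'n::finite) atlas \<Rightarrow> ('a, 'n) econn \<Rightarrow> 'a set \<Rightarrow>
       ('a, 'n) esec \<Rightarrow> ('a, 'n) esec \<Rightarrow> ('a, 'n) esec \<Rightarrow> ('a, 'n) esec" where
  "rho_curvature A N U s1 s2 t =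
     N U s1 (N U s2 t) - N U s2 (N U s1 t) - N U (ebracket A U s1 s2) t"

definition rho_flat :: "('a, 'n::finite) atlas \<Rightarrow> ('a, 'n) econn \<Rightarrow> bool" where
  "rho_flat A N \<longleftrightarrow> (\<forall>U. mopen A U \<longrightarrow>
     (\<forall>s1\<in>Esec A U. \<forall>s2\<in>Esec A U. \<forall>t\<in>Esec A U. rho_curvature A N U s1 s2 t = 0))"

definition euler_condition :: "('a, 'n::finite) atlas \<Rightarrow> ('a, 'n) econn \<Rightarrow> bool" where
  "euler_condition A N \<longleftrightarrow> (\<forall>U. mopen A U \<longrightarrow> (\<forall>s\<in>Esec A U.
     N U (euler A U) s = escale (- 1 / (of_nat CARD('n) + 1)) s))"

text \<open>Local frames of \<open>E\<close>; the trace of an endomorphism of \<open>E\<close> is computed in a frame.\<close>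

definition is_frame ::
    "('a, 'n::finite) atlas \<Rightarrow> 'a set \<Rightarrow> ('n option \<Rightarrow> ('a, 'n) esec) \<Rightarrow> bool" where
  "is_frame A U b \<longleftrightarrow> mopen A U \<and> (\<forall>i. b i \<in> Esec A U) \<and>
     (\<forall>p\<in>U. \<forall>v\<in>Efibre A p. \<exists>!a. v = (\<Sum>i\<in>UNIV. escale (a i) (eres {p} (b i))))"

definition frame_coords ::
    "('n::finite option \<Rightarrow> ('a, 'n) esec) \<Rightarrow> 'a \<Rightarrow> ('a, 'n) esec \<Rightarrow> 'n option \<Rightarrow> complex" where
  "frame_coords b p s = (THE a. eres {p} s = (\<Sum>i\<in>UNIV. escale (a i) (eres {p} (b i))))"

definition rho_Ricci ::
    "('a, 'n::finite) atlas \<Rightarrow> ('a, 'n) econn \<Rightarrow> 'a set \<Rightarrow> ('n option \<Rightarrow> ('a, 'n) esec) \<Rightarrow>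
       ('a, 'n) esec \<Rightarrow> ('a, 'n) esec \<Rightarrow> 'a \<Rightarrow> complex" where
  "rho_Ricci A N U b s1 s2 p =
     (\<Sum>i\<in>UNIV. frame_coords b p (rho_curvature A N U (b i) s2 s1) i)"

definition Ricci_flat :: "('a, 'n::finite) atlas \<Rightarrow> ('a, 'n) econn \<Rightarrow> bool" where
  "Ricci_flat A N \<longleftrightarrow> (\<forall>U b. is_frame A U b \<longrightarrow>
     (\<forall>s1\<in>Esec A U. \<forall>s2\<in>Esec A U. \<forall>p\<in>U. rho_Ricci A N U b s1 s2 p = 0))"


section \<open>The condition on \<open>\<Lambda>\<^sup>n\<^sup>+\<^sup>1E = \<Lambda>\<^sup>n(TM)\<close>\<close>

definition fibre_fun :: "('a \<Rightarrow> ('a, 'n) nform) \<Rightarrow> ('a, 'n) dpoint \<Rightarrow> complex" where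
  "fibre_fun \<omega> x = snd x (\<omega> (fst x))"

text \<open>The canonical \<open>\<rho>\<close>-connections of \<open>\<Lambda>\<^sup>n(T\<^sup>*M)\<close> and of its dual \<open>\<Lambda>\<^sup>n(TM)\<close>.\<close>

definition can_form ::
    "('a, 'n::finite) atlas \<Rightarrow> 'a set \<Rightarrow> ('a, 'n) esec \<Rightarrow>
       ('a \<Rightarrow> ('a, 'n) nform) \<Rightarrow> ('a \<Rightarrow> ('a, 'n) nform)" where
  "can_form A U s \<omega> = (THE \<eta>. \<eta> \<in> nforms A U \<and>
     (\<forall>x\<in>det_over A U. fibre_fun \<eta> x = s x (fibre_fun \<omega>)))"

definition can_nvec ::
    "('a, 'n::finite) atlas \<Rightarrow> 'a set \<Rightarrow> ('a, 'n) esec \<Rightarrow>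
       ('a \<Rightarrow> ('a, 'n) nvec) \<Rightarrow> ('a \<Rightarrow> ('a, 'n) nvec)" where
  "can_nvec A U s u = (THE w. w \<in> nvecs A U \<and>
     (\<forall>V \<omega>. mopen A V \<and> V \<subseteq> U \<and> \<omega> \<in> nforms A V \<longrightarrow> (\<forall>p\<in>V.
        w p (\<omega> p) = rho A s p (\<lambda>q. u q (\<omega> q)) - u p (can_form A V (eres V s) \<omega> p))))"

text \<open>Local sections \<open>\<alpha>\<close> of \<open>E\<^sup>*\<close> with \<open>\<alpha>(\<one>) = 1\<close>.\<close>

definition normalized_dual_sections ::
    "('a, 'n::finite) atlas \<Rightarrow> 'a set \<Rightarrow> ('a \<Rightarrow> ('a, 'n) esec \<Rightarrow> complex) set" where
  "normalized_dual_sections A U = {\<alpha>.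
     (\<forall>p\<in>U. \<forall>v\<in>Efibre A p. \<forall>w\<in>Efibre A p. \<alpha> p (v + w) = \<alpha> p v + \<alpha> p w) \<and>
     (\<forall>p\<in>U. \<forall>v\<in>Efibre A p. \<forall>c. \<alpha> p (escale c v) = c * \<alpha> p v) \<and>
     (\<forall>V s. mopen A V \<and> V \<subseteq> U \<and> s \<in> Esec A V \<longrightarrow> holo_on A V (\<lambda>p. \<alpha> p (eres {p} s))) \<and>
     (\<forall>p\<in>U. \<alpha> p (eres {p} (euler A U)) = 1)}"

text \<open>
  The form \<open>\<alpha> \<and> \<rho>\<^sup>*\<omega>\<close> at \<open>p\<close>.  The usual formula
  \<open>\<Sum>\<^sub>k (-1)\<^sup>k \<alpha>(v\<^sub>k) \<omega>(\<rho> v\<^sub>0, \<dots>, \<rho> v\<^sub>k\<^sub>-\<^sub>1, \<rho> v\<^sub>k\<^sub>+\<^sub>1, \<dots>, \<rho> v\<^sub>n)\<close> is written with \<open>v\<^sub>0\<close>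
  (index \<open>None\<close>) moved to the free slot \<open>k\<close>, which turns the sign of each term \<open>k > 0\<close> into \<open>-1\<close>.
\<close>

definition wedge_rho ::
    "('a, 'n::finite) atlas \<Rightarrow> 'a \<Rightarrow> (('a, 'n) esec \<Rightarrow> complex) \<Rightarrow> ('a, 'n) nform \<Rightarrow>
       ('n option \<Rightarrow> ('a, 'n) esec) \<Rightarrow> complex" where
  "wedge_rho A p \<alpha> \<omega> = (\<lambda>v. if \<forall>k. v k \<in> Efibre A p
     then \<alpha> (v None) * \<omega> (\<lambda>j. rho A (v (Some j)) p)
        - (\<Sum>k\<in>UNIV. \<alpha> (v (Some k)) * \<omega> ((\<lambda>j. rho A (v (Some j)) p)(k := rho A (v None) p)))
     else 0)"

definition det_iso ::
    "('a, 'n::finite) atlas \<Rightarrow> 'a set \<Rightarrow> ('a \<Rightarrow> ('a, 'n) esec \<Rightarrow> complex) \<Rightarrow>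
       ('a \<Rightarrow> (('n option \<Rightarrow> ('a, 'n) esec) \<Rightarrow> complex) \<Rightarrow> complex) \<Rightarrow> ('a \<Rightarrow> ('a, 'n) nvec)" where
  "det_iso A U \<alpha> \<Psi> = (\<lambda>p \<omega>. if p \<in> U \<and> \<omega> \<in> nforms_at A p
     then \<Psi> p (wedge_rho A p (\<alpha> p) \<omega>) else 0)"

definition ewedge ::
    "('a, 'n::finite) atlas \<Rightarrow> ('n option \<Rightarrow> ('a, 'n) esec) \<Rightarrow>
       'a \<Rightarrow> (('n option \<Rightarrow> ('a, 'n) esec) \<Rightarrow> complex) \<Rightarrow> complex" where
  "ewedge A t = (\<lambda>p. ext_prod escale (Efibre A p) (\<lambda>i. eres {p} (t i)))"

text \<open>
  The induced \<open>\<rho>\<close>-connection on \<open>\<Lambda>\<^sup>n\<^sup>+\<^sup>1E\<close> is defined by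
  \<open>\<nabla>\<^sub>s(t\<^sub>0 \<and> \<dots> \<and> t\<^sub>n) = \<Sum>\<^sub>i t\<^sub>0 \<and> \<dots> \<and> \<nabla>\<^sub>s t\<^sub>i \<and> \<dots> \<and> t\<^sub>n\<close>.  As \<open>\<Lambda>\<^sup>n\<^sup>+\<^sup>1E\<close> is a line bundle, each of
  its sections is locally such a product.
\<close>

definition induced_top ::
    "('a, 'n::finite) atlas \<Rightarrow> ('a, 'n) econn \<Rightarrow> 'a set \<Rightarrow> ('a, 'n) esec \<Rightarrow>
       ('n option \<Rightarrow> ('a, 'n) esec) \<Rightarrow>
       'a \<Rightarrow> (('n option \<Rightarrow> ('a, 'n) esec) \<Rightarrow> complex) \<Rightarrow> complex" where
  "induced_top A N U s t = (\<Sum>i\<in>UNIV. ewedge A (t(i := N U s (t i))))"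

definition det_condition :: "('a, 'n::finite) atlas \<Rightarrow> ('a, 'n) econn \<Rightarrow> bool" where
  "det_condition A N \<longleftrightarrow> (\<forall>U. mopen A U \<longrightarrow>
     (\<forall>\<alpha>\<in>normalized_dual_sections A U. \<forall>s\<in>Esec A U. \<forall>t. (\<forall>i. t i \<in> Esec A U) \<longrightarrow>
        det_iso A U \<alpha> (induced_top A N U s t) = can_nvec A U s (det_iso A U \<alpha> (ewedge A t))))"


section \<open>Projective structures\<close>

type_synonym 'a conn = "'a set \<Rightarrow> 'a vfield \<Rightarrow> 'a vfield \<Rightarrow> 'a vfield"

text \<open>\<open>D V X Y\<close> is \<open>\<nabla>\<^sub>X Y\<close> for vector fields \<open>X\<close> and \<open>Y\<close> on \<open>V \<subseteq> U\<close>.\<close>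

definition torsion_free_connection :: "('a, 'n::finite) atlas \<Rightarrow> 'a set \<Rightarrow> 'a conn \<Rightarrow> bool" where
  "torsion_free_connection A U D \<longleftrightarrow> (\<forall>V. mopen A V \<and> V \<subseteq> U \<longrightarrow>
     (\<forall>X\<in>vfields A V. \<forall>Y\<in>vfields A V.
        D V X Y \<in> vfields A V \<and>
        (\<forall>V'. mopen A V' \<and> V' \<subseteq> V \<longrightarrow> D V' (vres V' X) (vres V' Y) = vres V' (D V X Y)) \<and>
        (\<forall>X'\<in>vfields A V. D V (X + X') Y = D V X Y + D V X' Y) \<and>
        (\<forall>Y'\<in>vfields A V. D V X (Y + Y') = D V X Y + D V X Y') \<and>
        (\<forall>g. holo_on A V g \<longrightarrow>
           D V (vmul g X) Y = vmul g (D V X Y) \<and>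
           D V X (vmul g Y) = vmul (vapply X g) Y + vmul g (D V X Y)) \<and>
        D V X Y - D V Y X = lie_bracket A V X Y))"

definition velocity :: "('a, 'n::finite) atlas \<Rightarrow> (complex \<Rightarrow> 'a) \<Rightarrow> complex \<Rightarrow> 'a tvec" where
  "velocity A \<gamma> z = (\<lambda>f. if holo_near A (\<gamma> z) f then deriv (\<lambda>w. f (\<gamma> w)) z else 0)"

text \<open>
  \<open>\<gamma> : W \<rightarrow> U\<close> is an immersed parametrized curve with \<open>\<nabla>\<^sub>\<gamma>\<^sub>' \<gamma>' = 0\<close>, computed by extending \<open>\<gamma>'\<close>
  locally to a vector field.
\<close>

definition param_geodesic ::
    "('a, 'n::finite) atlas \<Rightarrow> 'a set \<Rightarrow> 'a conn \<Rightarrow> complex set \<Rightarrow> (complex \<Rightarrow> 'a) \<Rightarrow> bool" where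
  "param_geodesic A U D W \<gamma> \<longleftrightarrow> holo_map std_atlas A W \<gamma> \<and> \<gamma> ` W \<subseteq> U \<and>
     (\<forall>z\<in>W. velocity A \<gamma> z \<noteq> 0) \<and>
     (\<forall>z\<in>W. \<exists>W' V X. open W' \<and> z \<in> W' \<and> W' \<subseteq> W \<and>
        mopen A V \<and> V \<subseteq> U \<and> \<gamma> ` W' \<subseteq> V \<and> X \<in> vfields A V \<and>
        (\<forall>w\<in>W'. X (\<gamma> w) = velocity A \<gamma> w \<and> D V X X (\<gamma> w) = 0))"

text \<open>
  An unparametrized curve in \<open>U\<close>: an immersion \<open>c\<close> of a connected Riemann surface \<open>S\<close>.  A connected
  Riemann surface has at most the cardinality of the continuum, so it is no restriction to take
  its points in the type \<open>complex\<close>; its atlas is arbitrary.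
\<close>

definition immersed_curve ::
    "('a, 'n::finite) atlas \<Rightarrow> 'a set \<Rightarrow> (complex, 1) atlas \<Rightarrow> (complex \<Rightarrow> 'a) \<Rightarrow> bool" where
  "immersed_curve A U S c \<longleftrightarrow> complex_manifold S \<and> connected_space (mtop S) \<and>
     holo_map S A (points S) c \<and> c ` points S \<subseteq> U \<and>
     (\<forall>x\<in>points S. \<forall>v\<in>tangent S x. tmap A c (c x) v = 0 \<longrightarrow> v = 0)"

definition geodesic_near ::
    "('a, 'n::finite) atlas \<Rightarrow> 'a set \<Rightarrow> 'a conn \<Rightarrow> (complex, 1) atlas \<Rightarrow> (complex \<Rightarrow> 'a) \<Rightarrow>
       complex \<Rightarrow> bool" where
  "geodesic_near A U D S c x \<longleftrightarrow> (\<exists>W g. biholo_on std_atlas S W g \<and> x \<in> g ` W \<and>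
     param_geodesic A U D W (\<lambda>z. c (g z)))"

definition projectively_equivalent ::
    "('a, 'n::finite) atlas \<Rightarrow> 'a set \<Rightarrow> 'a conn \<Rightarrow> 'a conn \<Rightarrow> bool" where
  "projectively_equivalent A U D D' \<longleftrightarrow> (\<forall>S c. immersed_curve A U S c \<longrightarrow>
     ((\<forall>x\<in>points S. geodesic_near A U D S c x) \<longleftrightarrow> (\<forall>x\<in>points S. geodesic_near A U D' S c x)))"

definition projective_covering ::
    "('a, 'n::finite) atlas \<Rightarrow> ('a set \<times> 'a conn) set \<Rightarrow> bool" where
  "projective_covering A C \<longleftrightarrow> \<Union> (fst ` C) = points A \<and>
     (\<forall>(U, D)\<in>C. mopen A U \<and> (U \<noteq> {} \<longrightarrow> torsion_free_connection A U D)) \<and>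
     (\<forall>(U, D)\<in>C. \<forall>(V, D')\<in>C. U \<inter> V \<noteq> {} \<longrightarrow> projectively_equivalent A (U \<inter> V) D D')"

definition covering_class ::
    "('a, 'n::finite) atlas \<Rightarrow> ('a set \<times> 'a conn) set \<Rightarrow> ('a set \<times> 'a conn) set set" where
  "covering_class A C = {C'. projective_covering A C' \<and> projective_covering A (C \<union> C')}"

definition projective_structure ::
    "('a, 'n::finite) atlas \<Rightarrow> ('a set \<times> 'a conn) set set \<Rightarrow> bool" where
  "projective_structure A P \<longleftrightarrow> (\<exists>C. projective_covering A C \<and> P = covering_class A C)"

definition geodesic ::
    "('a, 'n::finite) atlas \<Rightarrow> ('a set \<times> 'a conn) set set \<Rightarrow>
       (complex, 1) atlas \<Rightarrow> (complex \<Rightarrow> 'a) \<Rightarrow> bool" where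
  "geodesic A P S c \<longleftrightarrow> immersed_curve A (points A) S c \<and>
     (\<forall>x\<in>points S. \<exists>C\<in>P. \<exists>(U, D)\<in>C. geodesic_near A U D S c x)"


section \<open>The projective structure given by a \<open>\<rho>\<close>-connection\<close>

definition apply_bundle_map ::
    "('a \<Rightarrow> 'a tvec \<Rightarrow> ('a, 'n) esec) \<Rightarrow> 'a set \<Rightarrow> 'a vfield \<Rightarrow> ('a, 'n) esec" where
  "apply_bundle_map h V X = (\<lambda>x. if fst x \<in> V then h (fst x) (X (fst x)) x else 0)"

text \<open>\<open>h : TU \<rightarrow> E\<close> is a holomorphic vector bundle map with \<open>\<rho> \<circ> h = id\<close>.\<close>

definition rho_section ::
    "('a, 'n::finite) atlas \<Rightarrow> 'a set \<Rightarrow> ('a \<Rightarrow> 'a tvec \<Rightarrow> ('a, 'n) esec) \<Rightarrow> bool" where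
  "rho_section A U h \<longleftrightarrow>
     (\<forall>p\<in>U. \<forall>v\<in>tangent A p. h p v \<in> Efibre A p \<and> rho A (h p v) p = v \<and>
        (\<forall>w\<in>tangent A p. h p (v + w) = h p v + h p w) \<and>
        (\<forall>c. h p (vscale c v) = escale c (h p v))) \<and>
     (\<forall>V X. mopen A V \<and> V \<subseteq> U \<and> X \<in> vfields A V \<longrightarrow> apply_bundle_map h V X \<in> Esec A V)"

definition induced_conn ::
    "('a, 'n::finite) atlas \<Rightarrow> ('a, 'n) econn \<Rightarrow> ('a \<Rightarrow> 'a tvec \<Rightarrow> ('a, 'n) esec) \<Rightarrow> 'a conn" where
  "induced_conn A N h =
     (\<lambda>V X Y. rho A (N V (apply_bundle_map h V X) (apply_bundle_map h V Y)))"

text \<open>A connection on \<open>U\<close> represents \<open>P\<close> over \<open>U\<close> if it can be added to the coverings in \<open>P\<close>.\<close>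

definition gives_structure ::
    "('a, 'n::finite) atlas \<Rightarrow> ('a, 'n) econn \<Rightarrow> ('a set \<times> 'a conn) set set \<Rightarrow> bool" where
  "gives_structure A N P \<longleftrightarrow> (\<forall>U h. mopen A U \<and> U \<noteq> {} \<and> rho_section A U h \<longrightarrow>
     (\<forall>C\<in>P. insert (U, induced_conn A N h) C \<in> P))"

definition projective_rho_connection ::
    "('a, 'n::finite) atlas \<Rightarrow> ('a set \<times> 'a conn) set set \<Rightarrow> ('a, 'n) econn \<Rightarrow> bool" where
  "projective_rho_connection A P N \<longleftrightarrow>
     rho_connection A N \<and> rho_torsion_free A N \<and>
     euler_condition A N \<and> det_condition A N \<and> Ricci_flat A N \<and> gives_structure A N P"


section \<open>Line bundles and their tensor powers\<close>

text \<open>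
  The fibres \<open>F p\<close> are lines in a complex vector space (type \<open>'v\<close> with scalar multiplication
  \<open>sc\<close>); this is no restriction, as the direct sum of all fibres can be taken.  The holomorphic
  structure is given by a set \<open>\<F>\<close> of nowhere zero local frames.
\<close>

definition line_bundle ::
    "('a, 'n::finite) atlas \<Rightarrow> (complex \<Rightarrow> 'v::ab_group_add \<Rightarrow> 'v) \<Rightarrow> ('a \<Rightarrow> 'v set) \<Rightarrow>
       ('a set \<times> ('a \<Rightarrow> 'v)) set \<Rightarrow> bool" where
  "line_bundle A sc F \<F> \<longleftrightarrow> vector_space sc \<and> \<Union> (fst ` \<F>) = points A \<and>
     (\<forall>(U, \<sigma>)\<in>\<F>. mopen A U \<and> (\<forall>p\<in>U. \<sigma> p \<noteq> 0 \<and> F p = range (\<lambda>c. sc c (\<sigma> p)))) \<and>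
     (\<forall>(U, \<sigma>)\<in>\<F>. \<forall>(V, \<tau>)\<in>\<F>. \<exists>g. holo_on A (U \<inter> V) g \<and> (\<forall>p\<in>U \<inter> V. \<tau> p = sc (g p) (\<sigma> p)))"

definition bundle_sections ::
    "('a, 'n::finite) atlas \<Rightarrow> (complex \<Rightarrow> 'v::ab_group_add \<Rightarrow> 'v) \<Rightarrow> ('a \<Rightarrow> 'v set) \<Rightarrow>
       ('a set \<times> ('a \<Rightarrow> 'v)) set \<Rightarrow> 'a set \<Rightarrow> ('a \<Rightarrow> 'v) set" where
  "bundle_sections A sc F \<F> W = {s. (\<forall>p\<in>W. s p \<in> F p) \<and> (\<forall>p. p \<notin> W \<longrightarrow> s p = 0) \<and>
     (\<forall>(U, \<sigma>)\<in>\<F>. \<exists>g. holo_on A (U \<inter> W) g \<and> (\<forall>p\<in>U \<inter> W. s p = sc (g p) (\<sigma> p)))}"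

text \<open>\<open>\<Phi>\<close> is an isomorphism from the tensor power of order \<open>CARD('n) + 1\<close> onto \<open>\<Lambda>\<^sup>n(TM)\<close>.\<close>

definition power_iso_det ::
    "('a, 'n::finite) atlas \<Rightarrow> (complex \<Rightarrow> 'v::ab_group_add \<Rightarrow> 'v) \<Rightarrow> ('a \<Rightarrow> 'v set) \<Rightarrow>
       ('a set \<times> ('a \<Rightarrow> 'v)) set \<Rightarrow>
       ('a \<Rightarrow> ((('n option \<Rightarrow> 'v) \<Rightarrow> complex) \<Rightarrow> complex) \<Rightarrow> ('a, 'n) nvec) \<Rightarrow> bool" where
  "power_iso_det A sc F \<F> \<Phi> \<longleftrightarrow>
     (\<forall>p\<in>points A. bij_betw (\<Phi> p) (tensor_power sc (F p)) (nvecs_at A p) \<and>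
        (\<forall>e\<in>tensor_power sc (F p). \<forall>e'\<in>tensor_power sc (F p). \<Phi> p (e + e') = \<Phi> p e + \<Phi> p e') \<and>
        (\<forall>e\<in>tensor_power sc (F p). \<forall>c. \<Phi> p (\<lambda>\<omega>. c * e \<omega>) = (\<lambda>\<omega>. c * \<Phi> p e \<omega>))) \<and>
     (\<forall>U s. mopen A U \<and> (\<forall>i. s i \<in> bundle_sections A sc F \<F> U) \<longrightarrow>
        (\<lambda>p. if p \<in> U then \<Phi> p (tensor_prod sc (F p) (\<lambda>i. s i p)) else 0) \<in> nvecs A U)"


section \<open>Covering spaces\<close>

definition covering_map :: "'b topology \<Rightarrow> 'a topology \<Rightarrow> ('b \<Rightarrow> 'a) \<Rightarrow> bool" where
  "covering_map Y X q \<longleftrightarrow> continuous_map Y X q \<and> q ` topspace Y = topspace X \<and>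
     (\<forall>p\<in>topspace X. \<exists>U \<V>. openin X U \<and> p \<in> U \<and>
        (\<forall>V\<in>\<V>. openin Y V) \<and> disjoint \<V> \<and> \<Union>\<V> = {y \<in> topspace Y. q y \<in> U} \<and>
        (\<forall>V\<in>\<V>. homeomorphic_map (subtopology Y V) (subtopology X U) q))"

definition pull_atlas :: "('a, 'n::finite) atlas \<Rightarrow> 'b topology \<Rightarrow> ('b \<Rightarrow> 'a) \<Rightarrow> ('b, 'n) atlas" where
  "pull_atlas A Y q = {(V, \<lambda>y. \<phi> (q y)) | V U \<phi>.
     (U, \<phi>) \<in> A \<and> openin Y V \<and> inj_on q V \<and> q ` V \<subseteq> U}"

text \<open>
  Transport of vector fields, and of a connection, by the biholomorphism \<open>q : V \<rightarrow> q ` V\<close>, where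
  \<open>A\<close> and \<open>B\<close> are atlases of the target and of the source.
\<close>

definition push_vfield ::
    "('a, 'n::finite) atlas \<Rightarrow> ('b \<Rightarrow> 'a) \<Rightarrow> 'b set \<Rightarrow> 'b vfield \<Rightarrow> 'a vfield" where
  "push_vfield A q V X = (\<lambda>p. if p \<in> q ` V then tmap A q p (X (inv_into V q p)) else 0)"

definition pull_vfield ::
    "('b, 'n::finite) atlas \<Rightarrow> ('b \<Rightarrow> 'a) \<Rightarrow> 'b set \<Rightarrow> 'a vfield \<Rightarrow> 'b vfield" where
  "pull_vfield B q V X = (\<lambda>y. if y \<in> V then tmap B (inv_into V q) y (X (q y)) else 0)"

definition pull_conn ::
    "('a, 'n::finite) atlas \<Rightarrow> ('b, 'n) atlas \<Rightarrow> ('b \<Rightarrow> 'a) \<Rightarrow> 'a conn \<Rightarrow> 'b conn" where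
  "pull_conn A B q D = (\<lambda>V X Y.
     pull_vfield B q V (D (q ` V) (push_vfield A q V X) (push_vfield A q V Y)))"

definition pull_covering ::
    "('a, 'n::finite) atlas \<Rightarrow> ('b, 'n) atlas \<Rightarrow> ('b \<Rightarrow> 'a) \<Rightarrow>
       ('a set \<times> 'a conn) set \<Rightarrow> ('b set \<times> 'b conn) set" where
  "pull_covering A B q C = {(V, pull_conn A B q D) | V U D.
     (U, D) \<in> C \<and> mopen B V \<and> inj_on q V \<and> q ` V \<subseteq> U}"

definition pull_structure ::
    "('a, 'n::finite) atlas \<Rightarrow> ('b, 'n) atlas \<Rightarrow> ('b \<Rightarrow> 'a) \<Rightarrow>
       ('a set \<times> 'a conn) set set \<Rightarrow> ('b set \<times> 'b conn) set set" where
  "pull_structure A B q P = (\<Union>C\<in>P. covering_class B (pull_covering A B q C))"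


section \<open>Projective space\<close>

definition cp_points :: "(complex ^ ('n::finite option)) set set" where
  "cp_points = {vec.span {v} | v. v \<noteq> 0}"

text \<open>
  In the affine chart at \<open>i\<close> a point is represented by its vector with \<open>i\<close>th coordinate \<open>1\<close>; the
  remaining coordinates are indexed by \<open>'n\<close>, the index \<open>None\<close> taking the place of \<open>i\<close>.
\<close>

definition cp_atlas :: "((complex ^ ('n::finite option)) set, 'n) atlas" where
  "cp_atlas = {({l \<in> cp_points. \<exists>v\<in>l. v $ i \<noteq> 0},
     \<lambda>l. \<chi> j. (THE v. v \<in> l \<and> v $ i = 1) $ (if i = Some j then None else Some j)) | i. True}"

definition projective_lines :: "(complex ^ ('n::finite option)) set set set" where
  "projective_lines = {{l \<in> cp_points. l \<subseteq> Q} | Q. vec.subspace Q \<and> vec.dim Q = 2}"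

text \<open>
  \<open>\<delta>\<close> is a local diffeomorphism to projective space from the covering space \<open>q : Y \<rightarrow> M\<close>, with the
  pulled back structures, that maps each geodesic into a projective line.
\<close>

definition developing_map ::
    "('a, 'n::finite) atlas \<Rightarrow> ('a set \<times> 'a conn) set set \<Rightarrow> 'b topology \<Rightarrow> ('b \<Rightarrow> 'a) \<Rightarrow>
       ('b \<Rightarrow> (complex ^ ('n option)) set) \<Rightarrow> bool" where
  "developing_map A P Y q \<delta> \<longleftrightarrow> covering_map Y (mtop A) q \<and>
     local_biholo (pull_atlas A Y q) cp_atlas \<delta> \<and>
     (\<forall>S c. geodesic (pull_atlas A Y q) (pull_structure A (pull_atlas A Y q) q P) S c \<longrightarrow>
        (\<exists>l\<in>projective_lines. \<delta> ` c ` points S \<subseteq> l))"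

end

theory Submission
  imports Defs "HOL-Complex_Analysis.Cauchy_Integral_Formula" "HOL-Complex_Analysis.Conformal_Mappings"
begin

text \<open>
If \<open>\<nabla>\<close> is flat, \<open>E\<close> has local frames that are parallel up to a common scalar form, and any two of them
differ by a constant matrix up to a scalar function. Hence the trivializations \<open>h\<close> given by such frames, up
to scaling, form a covering space of \<open>M\<close>, on which \<open>[h(\<one>)]\<close> is a map to projective space. It is a local
diffeomorphism since \<open>\<nabla>\<^sub>s \<one> = - s / (n + 1)\<close>; along a geodesic, \<open>\<nabla>\<^sub>s s = 0\<close> keeps \<open>h(\<one>)\<close> in a fixed plane.

Conversely, in coordinates given by affine charts of projective space the geodesics are straight, so
\<open>\<Gamma>\<^sup>l\<^sub>j\<^sub>k = \<delta>\<^sup>l\<^sub>j a\<^sub>k + \<delta>\<^sup>l\<^sub>k a\<^sub>j\<close>, and then \<open>Ric = 0\<close> forces the curvature to vanish.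
\<close>

text \<open>No nonzero section is parallel for \<open>nabla\<close>: in the direction of the Euler
  field, which annihilates functions of the base, it multiplies sections by \<open>-1/(n+1)\<close>.
  In a chart the parallel equation is therefore imposed only along the coordinate fields, lifted to
  \<open>E\<close> by the coordinates of \<open>det(TM)\<close>. Another chart lifts them with
  additional multiples of the Euler field, so its solutions differ by a scalar function; only
  trivializations up to scaling are independent of the chart, and sheets over a small set correspond
  to constant invertible matrices up to scalars. The solutions come from Frobenius's theorem: Picard
  iteration along rays, then a maximum argument for the errors in the partial derivatives. The
  covering space has to have its points in a fixed type, so a projective class is coded by a set of
  functions from the reals to the manifold. In the converse, the connection of a chart is adjoined
  to a covering of the class, and one of its geodesics is launched from each point in each
  direction, so that straightness constrains every Christoffel symbol.\<close>

abbreviation (input) sum_UNIV :: "('i::finite => 'a::comm_monoid_add) => 'a" (binder "SUM " 10) where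
"sum_UNIV f == sum f UNIV"

section \<open>Holomorphic functions of several variables\<close>

lemmas if_mult_left = if_distrib[of "%x. x * _"]
lemmas if_mult_right = if_distrib[of "%x. _ * x"]

text \<open>Differentiating with \<open>deriv\<close> along a coordinate line makes the one-variable
  Cauchy theory available there; \<open>pd_unique\<close> identifies the result with the coefficient
  of the total derivative in \<open>holo\<close>.\<close>

definition pd :: "'n::finite => (complex ^ 'n => complex) => complex ^ 'n => complex" where
 "pd i f x = deriv (%z. f (x+axis i z)) 0"

lemma axis_add: "axis i (a+b) = axis i a+axis i (b::complex)" by (simp add: vec_eq_iff axis_def)

lemma axis_zero [simp]: "axis i (0::complex) = 0" by (simp add: vec_eq_iff axis_def)

lemma norm_axis_complex [simp]: "norm (axis i (z::complex)) = norm z"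
proof -
 have "(SUM j. (norm (axis i z$j))\<^sup>2) = (SUM j. if j = i then (norm z)\<^sup>2 else 0)" by (rule sum.cong) (auto simp: axis_def)
 thus ?thesis by (simp add: norm_vec_def L2_set_def)
qed

lemma bounded_linear_axis: "bounded_linear (axis i :: complex => complex ^ 'n::finite)"
proof (rule bounded_linear_intro[where K=1])
 show "axis i (r *\<^sub>R x) = r *\<^sub>R (axis i x :: complex^'n)" for r x by (simp add: vec_eq_iff axis_def)
qed (auto simp: axis_add)

lemmas continuous_on_axis [continuous_intros] =
 bounded_linear.continuous_on[OF bounded_linear_axis]

lemma sum_mult_axis: "(SUM j. a j * (axis i z :: complex ^ 'n::finite)$j) = a i * z" by (simp add: axis_def if_mult_right cong: if_cong)

lemma pd_unique:
 assumes "(f has_derivative (%h. SUM i. a i * h$i)) (at x)"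
 shows "((%z. f (x+axis i z)) has_field_derivative a i) (at 0)" "pd i f x = a i"
proof -
 have "((%z. x+axis i z) has_derivative (%z. axis i z)) (at 0)"
  by (auto intro!: derivative_eq_intros bounded_linear.has_derivative[OF bounded_linear_axis])
 moreover have "(f has_derivative (%h. SUM i. a i * h$i)) (at (x+axis i 0))" using assms by simp
 ultimately have "((%z. f (x+axis i z)) has_derivative (%z. SUM j. a j * (axis i z)$j)) (at 0)" by (rule has_derivative_compose)
 thus *: "((%z. f (x+axis i z)) has_field_derivative a i) (at 0)" by (simp add: sum_mult_axis has_field_derivative_def)
 thus "pd i f x = a i" unfolding pd_def by (rule DERIV_imp_deriv)
qed

lemma holo_open: "holo S f ==> open S" by (simp add: holo_def)

lemma holo_has_derivative:
 assumes "holo S f" "x : S"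
 shows "(f has_derivative (%h. SUM i. pd i f x * h$i)) (at x)"
proof -
 obtain a :: "complex^'a" where a: "(f has_derivative (%h. SUM i. a$i * h$i)) (at x)" using assms by (auto simp: holo_def)
 show ?thesis using a pd_unique(2)[OF a] by simp
qed

lemma holoI:
 assumes "open S"
  and "!!x. x : S ==> (f has_derivative (%h. SUM i. a x i * h$i)) (at x)"
 shows "holo S f" unfolding holo_def
proof (intro conjI ballI)
 fix x assume "x : S"
 thus "EX b::complex^'a. (f has_derivative (%h. SUM i. b$i * h$i)) (at x)"
  using assms(2)[of x] by (intro exI[of _ "\<chi> i. a x i"]) simp
qed fact

lemma holo_continuous_on: "holo S f ==> continuous_on S f"
 by (meson holo_has_derivative has_derivative_continuous continuous_at_imp_continuous_on)

lemma holo_subset: "holo S f ==> open T ==> T <= S ==> holo T f" by (auto simp: holo_def)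

lemma holo_cong:
 fixes f g :: "complex ^ 'n::finite => complex"
 assumes "!!x. x : S ==> f x = g x"
 shows "holo S f \<longleftrightarrow> holo S g"
proof -
 have "holo S g" if H: "!!x. x : S ==> f x = g x" "holo S f" for f g :: "complex^'n => complex" unfolding holo_def
 proof (intro conjI ballI)
  show "open S" using H by (simp add: holo_open)
  fix x assume x: "x : S"
  obtain a :: "complex^'n" where "(f has_derivative (%h. SUM i. a$i * h$i)) (at x)" using H(2) x by (auto simp: holo_def)
  hence "(g has_derivative (%h. SUM i. a$i * h$i)) (at x)"
   by (rule has_derivative_transform_within_open[where s=S]) (use H x \<open>open S\<close> in auto)
  thus "EX a::complex^'n. (g has_derivative (%h. SUM i. a$i * h$i)) (at x)" ..
 qed
 from this[of f g] this[of g f] assms show ?thesis by metis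
qed

lemma holo_Union: "(!!T. T : F ==> holo T f) ==> holo (\<Union>F) f" by (auto simp: holo_def)

lemma holo_local:
 assumes "!!x. x : S ==> EX T. x : T & T <= S & holo T f"
 shows "holo S f"
proof -
 have "S = \<Union>{T. T <= S & holo T f}" using assms by blast
 thus ?thesis using holo_Union[of "{T. T <= S & holo T f}" f] by auto
qed

lemma pd_cong:
 assumes "open S" "x : S" "!!y. y : S ==> f y = g y"
 shows "pd i f x = pd i g x"
proof -
 have "\<forall>\<^sub>F z in nhds 0. x+axis i z : S"
 proof -
  have "open ((%z. x+axis i z) -` S)" by (intro open_vimage assms continuous_intros)
  thus ?thesis using assms(2) by (auto simp: eventually_nhds intro!: exI[of _ "(%z. x+axis i z) -` S"])
 qed
 hence "\<forall>\<^sub>F z in nhds 0. f (x+axis i z) = g (x+axis i z)" by (rule eventually_mono) (use assms in auto)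
 thus ?thesis unfolding pd_def by (intro deriv_cong_ev) auto
qed

section \<open>Restriction to coordinate lines and separate holomorphy\<close>

lemma line_holomorphic:
 fixes f :: "complex ^ 'n::finite => complex"
 assumes S: "open S"
  and f: "!!x i. x : S ==> (%z. f (x+axis i z)) field_differentiable (at 0)"
 shows "(%z. f (x+axis i z)) holomorphic_on {z. x+axis i z : S}" unfolding holomorphic_on_def
proof
 fix w assume w: "w : {z. x+axis i z : S}"
 have "(%z. f ((x+axis i w)+axis i z)) field_differentiable (at (w - w))" using f w by simp
 hence "(%z. f ((x+axis i w)+axis i z)) \<circ> (%z. z - w) field_differentiable (at w)"
  by (intro field_differentiable_compose) (auto intro!: derivative_intros)
 hence "(%z. f (x+axis i z)) field_differentiable (at w)" by (simp add: o_def axis_add[symmetric] add.assoc)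
 thus "(%z. f (x+axis i z)) field_differentiable at w within {z. x+axis i z : S}" by (rule field_differentiable_at_within)
qed

lemma open_line:
 fixes x :: "complex ^ 'n::finite"
 assumes "open S"
 shows "open {z. x+axis i z : S}"
proof -
 have "continuous_on UNIV (%z. x+axis i z)" by (intro continuous_intros)
 from open_vimage[OF assms this] show ?thesis by (simp add: vimage_def)
qed

lemma line_has_derivative:
 assumes S: "open S"
  and f: "!!x i. x : S ==> (%z. f (x+axis i z)) field_differentiable (at 0)"
  and w: "x+axis i w : S"
 shows "((%z. f (x+axis i z)) has_field_derivative pd i f (x+axis i w)) (at w)"
proof -
 have "(%z. f (x+axis i w+axis i z)) field_differentiable (at (w - w))" using f w by simp
 hence "((%z. f (x+axis i w+axis i z)) has_field_derivative pd i f (x+axis i w)) (at (w - w))"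
  using DERIV_deriv_iff_field_differentiable unfolding pd_def by force
 hence "((%z. f (x+axis i w+axis i z)) \<circ> (%z. z - w) has_field_derivative pd i f (x+axis i w) * 1) (at w)"
  by (intro DERIV_chain) (auto intro!: derivative_eq_intros)
 thus ?thesis by (simp add: o_def axis_add[symmetric] add.assoc)
qed

text \<open>Cauchy's inequality on a circle of radius \<open>r\<close> bounds the difference of two
  partial derivatives by the supremum of the difference of the functions there, and uniform
  continuity on a compact neighbourhood makes that supremum small. The parameter \<open>t\<close>
  prepares differentiation under an integral sign.\<close>

lemma pd_continuous_param:
 fixes f :: "complex ^ 'n::finite => 'k::metric_space => complex"
 assumes S: "open S" and K: "compact K"
  and cont: "continuous_on (S \<times> K) (%(x, t). f x t)"
  and f: "!!x t i. x : S ==> t : K ==> (%z. f (x+axis i z) t) field_differentiable (at 0)"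
 shows "continuous_on (S \<times> K) (%(x, t). pd i (%x. f x t) x)"
proof -
 have *: "EX d>0. ALL x:S. ALL t:K. dist (x, t) (x0, t0) < d -->
     dist (pd i (%x. f x t) x) (pd i (%x. f x t0) x0) < e"
  if x0: "x0 : S" and t0: "t0 : K" and e: "e > 0" for x0 t0 e
 proof -
  obtain R where R: "R > 0" "cball x0 R <= S" using S x0 open_contains_cball by blast
  \<comment> \<open>With half the radius, circles of radius \<open>r\<close> about points at
    distance less than \<open>r\<close> from \<open>x0\<close> stay in
    \<open>cball x0 R\<close>.\<close>
  define r where "r = R / 2"
  have r: "r > 0" using R by (simp add: r_def)
  have "compact (cball x0 R \<times> K)" using K by (intro compact_Times) auto
  moreover have "continuous_on (cball x0 R \<times> K) (%(x, t). f x t)" by (rule continuous_on_subset[OF cont]) (use R in auto)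
  ultimately have "uniformly_continuous_on (cball x0 R \<times> K) (%(x, t). f x t)" by (rule compact_uniformly_continuous[rotated])
  then obtain d where d: "d > 0"
   "!!p q. p : cball x0 R \<times> K ==> q : cball x0 R \<times> K ==> dist q p < d ==>
    dist ((%(x, t). f x t) q) ((%(x, t). f x t) p) < e * r / 2"
   unfolding uniformly_continuous_on_def using e r by (metis half_gt_zero mult_pos_pos)
  show ?thesis
  proof (intro exI[of _ "min d r"] conjI ballI impI)
   fix x t assume x: "x : S" and t: "t : K" and dd: "dist (x, t) (x0, t0) < min d r"
   have dx: "dist x x0 < r" using dd by (metis dist_fst_le fst_conv min_less_iff_conj order_le_less_trans)
   define g where "g z = f (x+axis i z) t - f (x0+axis i z) t0" for z
   have inb: "x+axis i z : cball x0 R" "x0+axis i z : cball x0 R" if "norm z <= r" for z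
   proof -
    have "dist x0 (x+axis i z) <= dist x0 x+norm (axis i z)" by (metis dist_triangle dist_norm add_diff_cancel_left' norm_minus_commute)
    thus "x+axis i z : cball x0 R" using dx that by (simp add: r_def dist_commute)
    show "x0+axis i z : cball x0 R" using that r_def r by (simp add: dist_norm)
   qed
   have h1: "((%z. f (x+axis i z) t)) holomorphic_on cball 0 r"
    by (rule holomorphic_on_subset[OF line_holomorphic[OF S f[OF _ t]]]) (use inb R in auto)
   have h2: "((%z. f (x0+axis i z) t0)) holomorphic_on cball 0 r"
    by (rule holomorphic_on_subset[OF line_holomorphic[OF S f[OF _ t0]]]) (use inb R in auto)
   have hg: "g holomorphic_on cball 0 r" unfolding g_def by (intro holomorphic_intros h1 h2)
   have bound: "norm (g z) <= e * r / 2" if "norm (0 - z) = r" for z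
   proof -
    have "dist (x+axis i z, t) (x0+axis i z, t0) = dist (x, t) (x0, t0)" by (simp add: dist_Pair_Pair)
    hence "dist (f (x+axis i z) t) (f (x0+axis i z) t0) < e * r / 2"
     using d(2)[of "(x0+axis i z, t0)" "(x+axis i z, t)"] inb that dd t t0 by auto
    thus ?thesis by (simp add: g_def dist_norm)
   qed
   have "norm ((deriv ^^ 1) g 0) <= fact 1 * (e * r / 2) / r ^ 1"
   proof (rule Cauchy_inequality)
    show "g holomorphic_on ball 0 r" by (rule holomorphic_on_subset[OF hg]) auto
    show "continuous_on (cball 0 r) g" using hg by (rule holomorphic_on_imp_continuous_on)
   qed (use bound r in auto)
   hence "norm (deriv g 0) <= e / 2" using r by simp
   moreover have "deriv g 0 = pd i (%x. f x t) x - pd i (%x. f x t0) x0" unfolding g_def pd_def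
    by (rule deriv_diff) (use f x t x0 t0 in auto)
   ultimately show "dist (pd i (%x. f x t) x) (pd i (%x. f x t0) x0) < e" using e by (simp add: dist_norm)
  qed (use d r in auto)
 qed
 show ?thesis unfolding continuous_on_iff
 proof (intro ballI allI impI)
  fix p and e :: real assume p: "p : S \<times> K" and "0 < e"
  then obtain d where "d > 0" and d: "ALL x:S. ALL t:K. dist (x, t) (fst p, snd p) < d -->
     dist (pd i (%x. f x t) x) (pd i (%x. f x (snd p)) (fst p)) < e" using *[of "fst p" "snd p" e] by auto
  show "EX d>0. ALL q:S \<times> K. dist q p < d -->
    dist (case q of (x, t) => pd i (%x. f x t) x) (case p of (x, t) => pd i (%x. f x t) x) < e"
   using \<open>d > 0\<close> d by (intro exI[of _ d]) (auto simp: split_beta)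
 qed
qed

lemma pd_continuous:
 fixes f :: "complex ^ 'n::finite => complex"
 assumes "open S" "continuous_on S f"
  and "!!x i. x : S ==> (%z. f (x+axis i z)) field_differentiable (at 0)"
 shows "continuous_on S (pd i f)"
proof -
 have "continuous_on (S \<times> {0::real}) (%(x, t::real). f x)" unfolding case_prod_unfold
  by (rule continuous_on_compose2[OF assms(2)]) (auto intro!: continuous_intros)
 hence "continuous_on (S \<times> {0::real}) (%(x, t). pd i (%x. f x) x)" by (intro pd_continuous_param) (use assms in auto)
 hence *: "continuous_on ((%x. (x, 0::real))`S) (%p. pd i f (fst p))" unfolding case_prod_unfold by (rule continuous_on_subset) auto
 hence "continuous_on S ((%p. pd i f (fst p)) \<circ> (%x. (x, 0::real)))"
  by (intro continuous_on_compose) (auto intro!: continuous_intros elim: continuous_on_subset)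
 thus ?thesis by (simp add: o_def)
qed

text \<open>Osgood's lemma.\<close>

lemma holo_separately:
 fixes f :: "complex ^ 'n::finite => complex"
 assumes S: "open S" and cont: "continuous_on S f"
  and f: "!!x i. x : S ==> (%z. f (x+axis i z)) field_differentiable (at 0)"
 shows "holo S f"
proof (rule holoI[OF S])
 fix x assume x: "x : S"
 \<comment> \<open>\<open>R I h\<close> keeps the coordinates of \<open>h\<close> with index in
   \<open>I\<close>. Building up the increment one coordinate at a time turns total
   differentiability into an induction over \<open>I\<close>.\<close>
 define R where "R I h = (\<chi> i. if i : I then h$i else 0)" for I :: "'n set" and h :: "complex^'n"
 have normR: "norm (R I h) <= norm h" for I h unfolding R_def by (rule norm_le_componentwise_cart) auto
 have pdc: "continuous_on S (pd i f)" for i by (rule pd_continuous[OF S cont f])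
 have *: "ALL e>0. EX d>0. ALL h. norm h < d -->
   norm (f (x+R I h) - f x - (SUM i:I. pd i f x * h$i)) <= e * norm h" for I :: "'n set"
 proof (induction I rule: finite_induct[OF finite])
  case 1
  have "R {} h = 0" for h by (simp add: R_def vec_eq_iff)
  thus ?case by (auto intro!: exI[of _ 1])
 next
  case (2 j I)
  show ?case
  proof (intro allI impI)
   fix e :: real assume e: "e > 0"
   obtain d1 where d1: "d1 > 0" "!!h. norm h < d1 ==>
     norm (f (x+R I h) - f x - (SUM i:I. pd i f x * h$i)) <= e/2 * norm h" using 2(3)[rule_format, of "e/2"] e by auto
   obtain d2 where d2: "d2 > 0" "!!y. y : S ==> dist y x < d2 ==> dist (pd j f y) (pd j f x) < e/2"
    using pdc[of j] x e unfolding continuous_on_iff by (metis half_gt_zero)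
   obtain d3 where d3: "d3 > 0" "ball x d3 <= S" using S x open_contains_ball by blast
   show "EX d>0. ALL h. norm h < d -->
     norm (f (x+R (insert j I) h) - f x - (SUM i:insert j I. pd i f x * h$i)) <= e * norm h"
   proof (intro exI[of _ "min d1 (min d2 d3)"] conjI allI impI)
    fix h :: "complex^'n" assume h: "norm h < min d1 (min d2 d3)"
    have Rj: "R (insert j I) h = R I h+axis j (h$j)" using 2(2) by (auto simp: R_def vec_eq_iff axis_def)
    have nearx: "norm (R I h+axis j z) <= norm h" if "norm z <= norm (h$j)" for z :: complex
     by (rule norm_le_componentwise_cart) (use that 2(2) in \<open>auto simp: R_def axis_def\<close>)
    \<comment> \<open>Subtracting the linear term leaves a function of one variable whose derivative
      is a difference of two values of \<open>pd j f\<close>, hence at most \<open>e/2\<close> by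
      continuity.\<close>
    define g where "g z = f (x+R I h+axis j z) - pd j f x * z" for z
    have inS: "x+R I h+axis j z : S" "dist (x+R I h+axis j z) x < d2"
     if "norm z <= norm (h$j)" for z :: complex
     using nearx[OF that] h d3 by (auto simp: dist_norm subset_iff add.assoc norm_minus_commute)
    have "norm (g (h$j) - g 0) <= e/2 * norm (h$j - 0)"
    proof (rule field_differentiable_bound[where S="cball 0 (norm (h$j))" and f'="%z. pd j f (x+R I h+axis j z) - pd j f x"])
     fix z :: complex assume z: "z : cball 0 (norm (h$j))"
     hence z': "norm z <= norm (h$j)" by simp
     have "((%z. f (x+R I h+axis j z)) has_field_derivative pd j f (x+R I h+axis j z)) (at z)"
      by (rule line_has_derivative[OF S f inS(1)[OF z']])
     hence "(g has_field_derivative pd j f (x+R I h+axis j z) - pd j f x) (at z)" unfolding g_def by (auto intro!: derivative_eq_intros)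
     thus "(g has_field_derivative pd j f (x+R I h+axis j z) - pd j f x)
        (at z within cball 0 (norm (h$j)))" by (rule has_field_derivative_at_within)
     show "norm (pd j f (x+R I h+axis j z) - pd j f x) <= e / 2" using d2(2)[OF inS[OF z']] by (simp add: dist_norm)
    qed auto
    also have "... <= e/2 * norm h" using e by (simp add: Finite_Cartesian_Product.norm_nth_le)
    finally have 1: "norm (g (h$j) - g 0) <= e/2 * norm h" .
    have "f (x+R (insert j I) h) - f x - (SUM i:insert j I. pd i f x * h$i) =
     (g (h$j) - g 0)+(f (x+R I h) - f x - (SUM i:I. pd i f x * h$i))" using 2(1,2) by (simp add: g_def Rj add.assoc)
    also have "norm ... <= norm (g (h$j) - g 0)+norm (f (x+R I h) - f x - (SUM i:I. pd i f x * h$i))" by (rule norm_triangle_ineq)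
    also have "... <= e/2 * norm h+e/2 * norm h" by (intro add_mono 1 d1(2)) (use h in auto)
    finally show "norm (f (x+R (insert j I) h) - f x - (SUM i:insert j I. pd i f x * h$i)) <= e * norm h" by (simp add: field_simps)
   qed (use d1 d2 d3 in auto)
  qed
 qed
 have RU: "R UNIV h = h" for h by (simp add: R_def vec_eq_iff)
 have bl: "bounded_linear (%h::complex^'n. SUM i. pd i f x * h$i)"
  by (intro bounded_linear_sum bounded_linear_mult_right[THEN bounded_linear_compose] bounded_linear_vec_nth)
 show "(f has_derivative (%h. SUM i. pd i f x * h$i)) (at x)" unfolding has_derivative_within_alt
 proof (intro conjI bl allI impI)
  fix e :: real assume "e > 0"
  then obtain d where d: "d > 0" "!!h. norm h < d ==> norm (f (x+h) - f x - (SUM i. pd i f x * h$i)) <= e * norm h"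
   using *[of UNIV] by (auto simp: RU)
  show "EX d>0. ALL y:UNIV. norm (y - x) < d -->
    norm (f y - f x - (SUM i. pd i f x * (y - x)$i)) <= e * norm (y - x)"
   using d(1) d(2)[of "y - x" for y] by (intro exI[of _ d]) (auto simp del: vector_minus_component)
 qed
qed

lemma holo_line: "holo S f ==> x : S ==> (%z. f (x+axis i z)) field_differentiable (at 0)"
 unfolding field_differentiable_def by (rule exI, rule pd_unique(1)[OF holo_has_derivative])

text \<open>Leibniz's rule differentiates under the integral along each coordinate line; continuity
  in \<open>x\<close> and \<open>holo_separately\<close> then give holomorphy in all variables
  together.\<close>

lemma holo_integral:
 fixes f :: "complex ^ 'n::finite => real => complex"
 assumes S: "open S"
  and cont: "continuous_on (S \<times> {a..b}) (%(x, t). f x t)"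
  and f: "!!t. t : {a..b} ==> holo S (%x. f x t)"
 shows "holo S (%x. integral {a..b} (f x))"
  and "x : S ==> pd i (%x. integral {a..b} (f x)) x = integral {a..b} (%t. pd i (%x. f x t) x)"
proof -
 have pdc: "continuous_on (S \<times> {a..b}) (%(x, t). pd i (%x. f x t) x)" for i
  by (rule pd_continuous_param[OF S _ cont]) (use holo_line[OF f] in auto)
 have *: "((%z. integral {a..b} (f (x+axis i z))) has_field_derivative
     integral {a..b} (%t. pd i (%x. f x t) x)) (at 0)" if x: "x : S" for x i
 proof -
  have "0 : {z::complex. x+axis i z : S}" using x by simp
  then obtain r where r: "r > 0" "ball 0 r <= {z. x+axis i z : S}" using open_line[OF S] open_contains_ball by blast
  have "((%z. integral (cbox a b) (f (x+axis i z))) has_field_derivative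
     integral (cbox a b) (%t. pd i (%x. f x t) (x+axis i 0))) (at 0 within ball 0 r)"
  proof (rule leibniz_rule_field_derivative[where fx="%z t. pd i (%x. f x t) (x+axis i z)"])
   fix z :: complex and t assume z: "z : ball 0 r" and t: "t : cbox a b"
   have "((%z. f (x+axis i z) t) has_field_derivative pd i (%x. f x t) (x+axis i z)) (at z)"
    by (rule line_has_derivative[OF S, where f="%x. f x t"])
     (use z t r holo_line[OF f] in \<open>auto simp: subset_iff\<close>)
   thus "((%z. f (x+axis i z) t) has_field_derivative pd i (%x. f x t) (x+axis i z)) (at z within ball 0 r)"
    by (rule has_field_derivative_at_within)
  next
   fix z assume z: "z : ball (0::complex) r"
   have "continuous_on (cbox a b) ((%(x, t). f x t) \<circ> (%t. (x+axis i z, t)))"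
    by (intro continuous_on_compose continuous_intros continuous_on_subset[OF cont])
     (use z r in auto)
   thus "f (x+axis i z) integrable_on cbox a b" by (intro integrable_continuous) (simp add: o_def)
  next
   have "continuous_on (ball 0 r \<times> cbox a b) ((%(x, t). pd i (%x. f x t) x) \<circ> (%(z, t). (x+axis i z, t)))"
    unfolding case_prod_unfold by (intro continuous_on_compose continuous_on_subset[OF pdc[unfolded case_prod_unfold]] continuous_intros)
     (use r in auto)
   thus "continuous_on (ball 0 r \<times> cbox a b) (%(z, t). pd i (%x. f x t) (x+axis i z))" by (simp add: o_def case_prod_unfold)
  qed (use r in auto)
  thus ?thesis using at_within_open[of "0::complex" "ball 0 r"] r(1) by simp
 qed
 show "holo S (%x. integral {a..b} (f x))"
 proof (rule holo_separately[OF S])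
  show "continuous_on S (%x. integral {a..b} (f x))" using integral_continuous_on_param[of S a b f] cont by simp
 qed (use * in \<open>auto simp: field_differentiable_def\<close>)
 show "x : S ==> pd i (%x. integral {a..b} (f x)) x = integral {a..b} (%t. pd i (%x. f x t) x)"
  unfolding pd_def[of i "%x. integral {a..b} (f x)"] using * by (rule DERIV_imp_deriv)
qed

section \<open>Rules of calculus: sums, products, quotients, composition\<close>

lemma holo_const [simp]: "holo S (%x. c) \<longleftrightarrow> open S" using holoI[of S "%x. c" "%_ _. 0"] by (auto simp: holo_open)

lemma pd_const [simp]: "pd i (%x. c) x = 0" unfolding pd_def by simp

lemma coord_has_derivative:
 "((%x::complex ^ 'n::finite. x$k) has_derivative (%h. SUM i. (if i = k then 1 else 0) * h$i)) (at x)"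
 by (simp add: if_mult_left bounded_linear.has_derivative[OF bounded_linear_vec_nth] cong: if_cong)

lemma holo_coord: "open S ==> holo S (%x. x$k)" by (rule holoI[OF _ coord_has_derivative])

lemma pd_coord: "pd i (%x. x$k) x = (if i = k then 1 else 0)" using pd_unique(2)[OF coord_has_derivative] .

lemma holo_add:
 assumes "holo S f" "holo S g"
 shows "holo S (%x. f x+g x)" "x : S ==> pd i (%x. f x+g x) x = pd i f x+pd i g x"
proof -
 have *: "((%x. f x+g x) has_derivative (%h. SUM i. (pd i f x+pd i g x) * h$i)) (at x)" if "x : S" for x
  using has_derivative_add[OF holo_has_derivative[OF assms(1) that] holo_has_derivative[OF assms(2) that]]
  by (simp add: distrib_right sum.distrib)
 show "holo S (%x. f x+g x)" by (rule holoI[OF holo_open[OF assms(1)] *])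
 show "x : S ==> pd i (%x. f x+g x) x = pd i f x+pd i g x" using pd_unique(2)[OF *] .
qed

lemma holo_mult:
 assumes "holo S f" "holo S g"
 shows "holo S (%x. f x * g x)" "x : S ==> pd i (%x. f x * g x) x = f x * pd i g x+g x * pd i f x"
proof -
 have *: "((%x. f x * g x) has_derivative (%h. SUM i. (f x * pd i g x+g x * pd i f x) * h$i)) (at x)" if "x : S" for x
  using has_derivative_mult[OF holo_has_derivative[OF assms(1) that] holo_has_derivative[OF assms(2) that]]
  by (simp add: distrib_left sum.distrib sum_distrib_left mult_ac)
 show "holo S (%x. f x * g x)" by (rule holoI[OF holo_open[OF assms(1)] *])
 show "x : S ==> pd i (%x. f x * g x) x = f x * pd i g x+g x * pd i f x" using pd_unique(2)[OF *] .
qed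

lemma holo_cmult:
 assumes "holo S f"
 shows "holo S (%x. c * f x)" "x : S ==> pd i (%x. c * f x) x = c * pd i f x"
 using holo_mult(1)[of S "%_. c" f] holo_mult(2)[of S "%_. c" f x i] assms by (auto simp: holo_open)

lemma holo_minus:
 assumes "holo S f"
 shows "holo S (%x. - f x)" "x : S ==> pd i (%x. - f x) x = - pd i f x"
 using holo_cmult(1)[OF assms, of "-1"] holo_cmult(2)[OF assms, where c="-1" and x=x and i=i] by auto

lemma holo_diff:
 assumes "holo S f" "holo S g"
 shows "holo S (%x. f x - g x)" "x : S ==> pd i (%x. f x - g x) x = pd i f x - pd i g x"
 using holo_add[OF assms(1) holo_minus(1)[OF assms(2)]]
  holo_minus(2)[OF assms(2), of x i] by auto

lemma holo_sum:
 assumes "!!k. k : I ==> holo S (f k)" "open S"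
 shows "holo S (%x. SUM k:I. f k x) & (x : S --> pd i (%x. SUM k:I. f k x) x = (SUM k:I. pd i (f k) x))" using assms
proof (induction I rule: infinite_finite_induct)
 case (insert k I)
 thus ?case using holo_add[of S "f k" "%x. SUM k:I. f k x"] by simp
qed simp_all

lemmas holo_sumI = holo_sum[THEN conjunct1]
lemmas pd_sum = holo_sum[THEN conjunct2, rule_format]

lemma holo_inverse:
 assumes f: "holo S f" and "!!x. x : S ==> f x ~= 0"
 shows "holo S (%x. inverse (f x))"
proof (rule holoI[OF holo_open[OF f]])
 fix x assume x: "x : S"
 show "((%x. inverse (f x)) has_derivative (%h. SUM i. (- inverse (f x) * inverse (f x) * pd i f x) * h$i)) (at x)"
  using Deriv.has_derivative_inverse[of f x, OF _ holo_has_derivative[OF f x]] assms(2)[OF x]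
  by (simp add: sum_distrib_left sum_distrib_right mult_ac sum_negf)
qed

lemma holo_divide:
 "holo S f ==> holo S g ==> (!!x. x : S ==> g x ~= 0) ==> holo S (%x. f x / g x)" unfolding divide_inverse by (intro holo_mult holo_inverse)

lemma vec_eq_sum_axis: "(y :: complex ^ 'm::finite) = (SUM l. axis l (y$l))"
 by (simp add: vec_eq_iff axis_def if_distrib[of "%x. _$x"] cong: if_cong)

lemma holo_vec_has_derivative:
 fixes F :: "complex ^ 'k::finite => complex ^ 'm::finite"
 assumes "!!l. holo S (%x. F x$l)" "x : S"
 shows "(F has_derivative (%h. \<chi> l. SUM i. pd i (%x. F x$l) x * h$i)) (at x)"
proof -
 have "((%x. SUM l. axis l (F x$l)) has_derivative
   (%h. SUM l. axis l (SUM i. pd i (%x. F x$l) x * h$i))) (at x)"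
  by (intro has_derivative_sum bounded_linear.has_derivative[OF bounded_linear_axis]
    holo_has_derivative[OF assms])
 moreover have "(%h. SUM l. axis l (SUM i. pd i (%x. F x$l) x * h$i)) =
   (%h. \<chi> l. SUM i. pd i (%x. F x$l) x * h$i)" by (subst vec_eq_sum_axis) simp
 ultimately show ?thesis by (simp add: vec_eq_sum_axis[symmetric])
qed

lemma holo_vec_continuous:
 fixes F :: "complex ^ 'k::finite => complex ^ 'm::finite"
 assumes "!!l. holo S (%x. F x$l)"
 shows "continuous_on S F" using holo_vec_has_derivative[OF assms] by (meson has_derivative_continuous continuous_at_imp_continuous_on)

lemma holo_compose:
 fixes F :: "complex ^ 'k::finite => complex ^ 'm::finite"
 assumes F: "!!l. holo S (%x. F x$l)" and g: "holo T g" and sub: "F`S <= T"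
 shows "holo S (%x. g (F x))"
  and "x : S ==> pd i (%x. g (F x)) x = (SUM l. pd l g (F x) * pd i (%x. F x$l) x)"
proof -
 have *: "((%x. g (F x)) has_derivative
   (%h. SUM i. (SUM l. pd l g (F x) * pd i (%x. F x$l) x) * h$i)) (at x)" if x: "x : S" for x
 proof -
  have "((%x. g (F x)) has_derivative
   (%h. SUM l. pd l g (F x) * (\<chi> l. SUM i. pd i (%x. F x$l) x * h$i)$l)) (at x)"
   by (rule has_derivative_compose[OF holo_vec_has_derivative[OF F x] holo_has_derivative[OF g]])
    (use x sub in auto)
  moreover have "(SUM l. pd l g (F x) * (SUM i. pd i (%x. F x$l) x * h$i)) =
   (SUM i. (SUM l. pd l g (F x) * pd i (%x. F x$l) x) * h$i)" for h
   unfolding sum_distrib_left sum_distrib_right by (subst sum.swap) (simp add: mult_ac)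
  ultimately show ?thesis by simp
 qed
 show "holo S (%x. g (F x))" by (rule holoI[OF holo_open[OF F] *])
 show "x : S ==> pd i (%x. g (F x)) x = (SUM l. pd l g (F x) * pd i (%x. F x$l) x)" using pd_unique(2)[OF *] .
qed

lemma open_holo_preimage:
 fixes F :: "complex ^ 'k::finite => complex ^ 'm::finite"
 assumes "!!l. holo S (%x. F x$l)" "open T"
 shows "open {x : S. F x : T}"
proof -
 have "open (S Int F -` T)" by (rule continuous_open_preimage[OF holo_vec_continuous]) (use assms holo_open in auto)
 thus ?thesis by (simp add: vimage_def Int_def)
qed

section \<open>Cauchy integrals for partial derivatives\<close>

lemma circlepath_nz: "r > 0 ==> circlepath 0 r t ~= 0" "r > 0 ==> norm (circlepath 0 r t) = r" by (auto simp: circlepath norm_mult)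

text \<open>In the parametrization of the circle the factor \<open>2 pi i\<close> cancels against
  the derivative of \<open>circlepath\<close>, so Cauchy's formula becomes a mean value over the
  circle.\<close>

lemma pd_cauchy:
 assumes f: "holo S f" and r: "r > 0" and sub: "!!z. norm z <= r ==> x+axis i z : S"
 shows "pd i f x = integral {0..1} (%t. f (x+axis i (circlepath 0 r t)) / circlepath 0 r t)"
proof -
 have hol: "(%z. f (x+axis i z)) holomorphic_on {z. x+axis i z : S}" by (rule line_holomorphic[OF holo_open[OF f] holo_line[OF f]])
 have "((%z. f (x+axis i z)) has_field_derivative
  1 / (2 * of_real pi * \<i>) * contour_integral (circlepath 0 r) (%u. f (x+axis i u) / (u - 0)\<^sup>2)) (at 0)"
  by (rule Cauchy_derivative_integral_circlepath)
   (use r sub in \<open>auto intro!: holomorphic_on_imp_continuous_on holomorphic_on_subset[OF hol]\<close>)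
 hence "pd i f x = 1 / (2 * of_real pi * \<i>) * contour_integral (circlepath 0 r) (%u. f (x+axis i u) / u\<^sup>2)"
  unfolding pd_def using DERIV_imp_deriv by force
 also have "... = 1 / (2 * of_real pi * \<i>) *
   integral {0..1} (%t. (2 * of_real pi * \<i>) * (f (x+axis i (circlepath 0 r t)) / circlepath 0 r t))"
  unfolding contour_integral_integral vector_derivative_circlepath using r by (intro arg_cong[where f="%x. _ * x"] integral_cong)
   (auto simp: circlepath power2_eq_square field_simps)
 also have "... = integral {0..1} (%t. f (x+axis i (circlepath 0 r t)) / circlepath 0 r t)" by (subst integral_mult_right) simp
 finally show ?thesis .
qed

text \<open>The Cauchy integral with one fixed radius serves as \<open>F\<close> for all
  \<open>g\<close>. Since it can be differentiated under the integral sign, the holomorphy of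
  derivatives and the symmetry of second derivatives both follow from this one fact.\<close>

lemma pd_integral:
 fixes x :: "complex ^ 'n::finite"
 assumes S: "open S" and x: "x : S"
 obtains e and F :: "(complex ^ 'n => complex) => complex ^ 'n => complex"
 where "e > 0" "ball x e <= S" 
  "!!g y. holo S g ==> y : ball x e ==> pd i g y = F g y"
  "!!g. holo S g ==> holo (ball x e) (F g)"
  "!!g y j. holo S g ==> y : ball x e ==> pd j (F g) y = F (pd j g) y"
proof -
 obtain R where R: "R > 0" "cball x R <= S" using S x open_contains_cball by blast
 define r where "r = R / 2"
 have r: "r > 0" using R by (simp add: r_def)
 have inS: "y+axis i z : S" if "y : ball x r" "norm z <= r" for y and z :: complex
 proof -
  have "dist x (y+axis i z) <= dist x y+norm (axis i z)" by (metis dist_triangle dist_norm add_diff_cancel_left' norm_minus_commute)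
  hence "y+axis i z : cball x R" using that by (simp add: r_def)
  thus ?thesis using R by auto
 qed
 define F where "F g y t = g (y+axis i (circlepath 0 r t)) / circlepath 0 r t" for g :: "complex^'n => complex" and y t
 have contc: "continuous_on T (circlepath 0 r)" for T unfolding circlepath by (intro continuous_intros)
 have contF: "continuous_on (ball x r \<times> {0..1}) (%(y, t). F g y t)" if g: "holo S g" for g unfolding F_def case_prod_unfold
 proof (rule continuous_on_divide)
  have c: "continuous_on (ball x r \<times> {0..1}) (%p. circlepath 0 r (snd p))"
   by (rule continuous_on_compose2[OF contc[of UNIV]]) (auto intro!: continuous_intros)
  thus "continuous_on (ball x r \<times> {0..1}) (%p. circlepath 0 r (snd p))" .
  show "continuous_on (ball x r \<times> {0..1}) (%p. g (fst p+axis i (circlepath 0 r (snd p))))"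
  proof (rule continuous_on_compose2[OF holo_continuous_on[OF g]])
   show "continuous_on (ball x r \<times> {0..1}) (%p. fst p+axis i (circlepath 0 r (snd p)))" by (intro continuous_intros c)
   show "(%p. fst p+axis i (circlepath 0 r (snd p)))`(ball x r \<times> {0..1}) <= S"
    using inS circlepath_nz(2)[OF r] by (auto simp: image_subset_iff)
  qed
 qed (simp add: circlepath_nz(1)[OF r])
 have holF: "holo (ball x r) (%y. F g y t)" "y : ball x r ==> pd j (%y. F g y t) y = F (pd j g) y t" 
  if g: "holo S g" for g t y j
 proof -
  let ?c = "axis i (circlepath 0 r t)"
  have s: "holo (ball x r) (%y. (y+?c)$l)" for l
   using holo_add(1)[OF holo_coord[of "ball x r" l] holo_const[THEN iffD2, of "ball x r" "?c$l"]] by simp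
  have s2: "pd j (%y. (y+?c)$l) y = (if j = l then 1 else 0)" for l y
   using holo_add(2)[OF holo_coord[of UNIV l] holo_const[THEN iffD2, of UNIV "?c$l"]]  by (simp add: pd_coord)
  have sub: "(%y. y+?c)`ball x r <= S" using inS circlepath_nz(2)[OF r, of t] by (auto simp: image_subset_iff)
  note c = holo_compose[OF s g sub]
  show "holo (ball x r) (%y. F g y t)"
   unfolding F_def divide_inverse using holo_cmult(1)[OF c(1), of "inverse (circlepath 0 r t)"] by (simp add: mult.commute)
  show "y : ball x r ==> pd j (%y. F g y t) y = F (pd j g) y t" unfolding F_def divide_inverse
   using holo_cmult(2)[OF c(1), where x=y and c="inverse (circlepath 0 r t)" and i=j] c(2)[of y j] s2
   by (simp add: mult.commute if_mult_left cong: if_cong)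
 qed
 show ?thesis
 proof (rule that[of r "%g y. integral {0..1} (F g y)"])
  show "ball x r <= S" using R r by (auto simp: r_def)
  show "pd i g y = integral {0..1} (F g y)" if "holo S g" "y : ball x r" for g y
   unfolding F_def by (rule pd_cauchy[OF that(1) r inS[OF that(2)]])
  show "holo (ball x r) (%y. integral {0..1} (F g y))" if "holo S g" for g
   by (rule holo_integral(1)[OF _ contF[OF that] holF(1)[OF that]]) auto
  show "pd j (%y. integral {0..1} (F g y)) y = integral {0..1} (F (pd j g) y)"
   if "holo S g" "y : ball x r" for g y j using holo_integral(2)[OF _ contF[OF that(1)] holF(1)[OF that(1)] that(2)] holF(2)[OF that]
   by simp
 qed (rule r)
qed

lemma holo_pd:
 assumes f: "holo S f"
 shows "holo S (pd i f)"
proof (rule holo_local)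
 fix x assume x: "x : S"
 obtain e and F :: "(complex ^ 'a => complex) => complex ^ 'a => complex"
  where F: "e > 0" "ball x e <= S" 
  "!!g y. holo S g ==> y : ball x e ==> pd i g y = F g y"
  "!!g. holo S g ==> holo (ball x e) (F g)" by (rule pd_integral[OF holo_open[OF f] x, of i]) blast
 have "holo (ball x e) (pd i f)" using holo_cong[of "ball x e" "pd i f" "F f"] F(3,4)[OF f] by blast
 thus "EX T. x : T & T <= S & holo T (pd i f)" using F by (intro exI[of _ "ball x e"]) auto
qed

lemma pd_commute:
 assumes f: "holo S f" and x: "x : S"
 shows "pd j (pd i f) x = pd i (pd j f) x"
proof -
 obtain e and F :: "(complex ^ 'a => complex) => complex ^ 'a => complex"
  where F: "e > 0" "ball x e <= S" 
  "!!g y. holo S g ==> y : ball x e ==> pd i g y = F g y"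
  "!!g y j. holo S g ==> y : ball x e ==> pd j (F g) y = F (pd j g) y" by (rule pd_integral[OF holo_open[OF f] x, of i]) blast
 have x': "x : ball x e" using F(1) by simp
 have "pd j (pd i f) x = pd j (F f) x" by (rule pd_cong[OF open_ball x']) (use F(3)[OF f] in auto)
 also have "... = pd i (pd j f) x" using F(3)[OF holo_pd[OF f] x'] F(4)[OF f x'] by simp
 finally show ?thesis .
qed

text \<open>The fundamental theorem of calculus on the segment from \<open>p\<close> to
  \<open>x\<close> yields the coefficients as integrals of the partial derivatives. It is used to
  compute derivations in coordinates.\<close>

lemma Hadamard:
 fixes f :: "complex ^ 'n::finite => complex"
 assumes f: "holo (ball p e) f"
 obtains g where "!!i. holo (ball p e) (g i)" "!!i. g i p = pd i f p"
  "!!x. x : ball p e ==> f x = f p+(SUM i. (x$i - p$i) * g i x)"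
proof
 note pdh = holo_pd[OF f]
 define G where "G i x t = pd i f (p+t *\<^sub>R (x - p))" for i x t
 have sub: "p+t *\<^sub>R (x - p) : ball p e" if "x : ball p e" "t : {0..1}" for x t
 proof -
  have "t * norm (x - p) <= norm (x - p)" using that by (simp add: mult_left_le_one_le)
  also have "... < e" using that by (simp add: dist_norm norm_minus_commute)
  finally show ?thesis using that by (simp add: dist_norm)
 qed
 show "holo (ball p e) (%x. integral {0..1} (G i x))" for i
 proof (rule holo_integral(1))
  show "continuous_on (ball p e \<times> {0..1}) (%(x, t). G i x t)" unfolding G_def case_prod_unfold
   by (intro continuous_on_compose2[OF holo_continuous_on[OF pdh]] continuous_intros) (use sub in auto)
  show "holo (ball p e) (%x. G i x t)" if t: "t : {0..1}" for t unfolding G_def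
  proof (rule holo_compose(1)[OF _ pdh])
   show "holo (ball p e) (%x. (p+t *\<^sub>R (x - p))$l)" for l
    unfolding vector_add_component vector_scaleR_component vector_minus_component 
    unfolding scaleR_conv_of_real by (intro holo_add holo_cmult holo_diff holo_coord) auto
  qed (use sub t in auto)
 qed auto
 show "integral {0..1} (G i p) = pd i f p" for i by (simp add: G_def[abs_def])
 fix x assume x: "x : ball p e"
 have "((%t. SUM i. (x$i - p$i) * G i x t) has_integral (f (p+1 *\<^sub>R (x - p)) - f (p+0 *\<^sub>R (x - p)))) {0..1}"
 proof (rule fundamental_theorem_of_calculus)
  fix t :: real assume t: "t : {0..1}"
  have 1: "((%t. p+t *\<^sub>R (x - p)) has_derivative (%h. h *\<^sub>R (x - p))) (at t within {0..1})"
   by (auto intro!: derivative_eq_intros)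
  have "((%t. f (p+t *\<^sub>R (x - p))) has_derivative
   (%h. SUM i. pd i f (p+t *\<^sub>R (x - p)) * (h *\<^sub>R (x - p))$i)) (at t within {0..1})"
   by (rule has_derivative_compose[OF 1 holo_has_derivative[OF f sub[OF x t]]])
  thus "((%t. f (p+t *\<^sub>R (x - p))) has_vector_derivative (SUM i. (x$i - p$i) * G i x t)) (at t within {0..1})"
   by (simp add: has_vector_derivative_def G_def scaleR_sum_right mult_ac)
 qed auto
 hence "integral {0..1} (%t. SUM i. (x$i - p$i) * G i x t) = f x - f p" by (simp add: integral_unique)
 moreover have "integral {0..1} (%t. SUM i. (x$i - p$i) * G i x t) =
  (SUM i. integral {0..1} (%t. (x$i - p$i) * G i x t))"
 proof (rule integral_sum)
  fix i
  show "(%t. (x$i - p$i) * G i x t) integrable_on {0..1}" unfolding G_def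
   by (intro integrable_continuous_interval continuous_intros continuous_on_compose2[OF holo_continuous_on[OF pdh]])
    (use sub x in auto)
 qed auto
 ultimately show "f x = f p+(SUM i. (x$i - p$i) * integral {0..1} (G i x))" by simp
qed

section \<open>Uniform limits and estimates for Picard iteration\<close>

lemma holo_uniform_limit:
 fixes f :: "nat => complex ^ 'n::finite => complex"
 assumes f: "!!k. holo S (f k)" and lim: "uniform_limit S f g sequentially"
 shows "holo S g"
proof (rule holo_separately)
 show S: "open S" using f holo_open by blast
 show "continuous_on S g" by (rule uniform_limit_theorem[OF _ lim]) (auto intro!: always_eventually holo_continuous_on f)
 fix x i assume x: "x : S"
 let ?T = "{z. x+axis i z : S}"
 have "(%z. g (x+axis i z)) holomorphic_on ?T"
 proof (rule holomorphic_uniform_sequence[where f="%k z. f k (x+axis i z)"])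
  show T: "open ?T" by (rule open_line[OF S])
  show "(%z. f k (x+axis i z)) holomorphic_on ?T" for k by (rule line_holomorphic[OF S holo_line[OF f]])
  fix w assume "w : ?T"
  then obtain d where d: "d > 0" "cball w d <= ?T" using T open_contains_cball by blast
  have "uniform_limit (cball w d) (%k z. f k (x+axis i z)) (%z. g (x+axis i z)) sequentially" unfolding uniform_limit_iff
  proof (intro allI impI)
   fix e :: real assume "e > 0"
   hence "\<forall>\<^sub>F n in sequentially. ALL x:S. dist (f n x) (g x) < e" using lim by (simp add: uniform_limit_iff)
   thus "\<forall>\<^sub>F n in sequentially. ALL z:cball w d. dist (f n (x+axis i z)) (g (x+axis i z)) < e"
    by (rule eventually_mono) (use d(2) in blast)
  qed
  thus "EX d>0. cball w d <= ?T & uniform_limit (cball w d) (%k z. f k (x+axis i z)) (%z. g (x+axis i z)) sequentially" using d by blast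
 qed
 thus "(%z. g (x+axis i z)) field_differentiable (at 0)"
  using open_line[OF S, of x i] x by (simp add: holomorphic_on_imp_differentiable_at)
qed

lemma continuous_on_compact_bound:
 fixes f :: "'a::topological_space => 'b::real_normed_vector"
 assumes "compact K" "continuous_on K f"
 obtains B where "B >= 0" "!!x. x : K ==> norm (f x) <= B"
proof -
 have "bounded (f`K)" by (intro compact_imp_bounded compact_continuous_image assms)
 then obtain B where "ALL x:K. norm (f x) <= B" by (auto simp: bounded_iff)
 hence "ALL x:K. norm (f x) <= max B 0" by auto
 thus ?thesis using that[of "max B 0"] by auto
qed

text \<open>A single constant \<open>L\<close> serves two purposes in the iteration: the bound keeps
  the iterates in the ball, the Lipschitz estimate makes the step a contraction.\<close>

lemma holo_bounded_lipschitz: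
 fixes g :: "complex ^ 'n::finite => complex"
 assumes g: "holo S g" and sub: "cball c R <= S"
 obtains L where "L >= 0" "!!y. y : cball c R ==> norm (g y) <= L"
  "!!y z. y : cball c R ==> z : cball c R ==> norm (g y - g z) <= L * norm (y - z)"
proof -
 obtain B where B: "B >= 0" "!!y. y : cball c R ==> norm (g y) <= B"
  using continuous_on_compact_bound[OF compact_cball continuous_on_subset[OF holo_continuous_on[OF g] sub]] by blast
 have "EX D>=0. ALL y:cball c R. norm (pd i g y) <= D" for i
  using continuous_on_compact_bound[OF compact_cball continuous_on_subset[OF holo_continuous_on[OF holo_pd[OF g]] sub]] by metis
 then obtain D where D: "!!i. D i >= 0" "!!i y. y : cball c R ==> norm (pd i g y) <= D i" by metis
 define L where "L = B+(SUM i. D i)"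
 have D0: "(SUM i. D i) >= 0" by (intro sum_nonneg D)
 have "norm (g y - g z) <= (SUM i. D i) * norm (y - z)" if "y : cball c R" "z : cball c R" for y z
 proof (rule differentiable_bound[OF convex_cball _ _ that])
  fix x assume x: "x : cball c R"
  show "(g has_derivative (%h. SUM i. pd i g x * h$i)) (at x within cball c R)"
   by (rule has_derivative_at_withinI[OF holo_has_derivative[OF g]]) (use x sub in auto)
  show "onorm (%h. SUM i. pd i g x * h$i) <= (SUM i. D i)"
  proof (rule onorm_le)
   fix h :: "complex ^ 'n"
   have "norm (SUM i. pd i g x * h$i) <= (SUM i. norm (pd i g x * h$i))" by (rule norm_sum)
   also have "... <= (SUM i. D i * norm h)"
    by (intro sum_mono) (auto simp: norm_mult D x Finite_Cartesian_Product.norm_nth_le intro!: mult_mono simp del: mem_cball)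
   finally show "norm (SUM i. pd i g x * h$i) <= (SUM i. D i) * norm h" by (simp add: sum_distrib_right)
  qed
 qed
 also have "(SUM i. D i) * norm (y - z) <= L * norm (y - z)" for y z :: "complex ^ 'n" using B by (intro mult_right_mono) (auto simp: L_def)
 finally have "norm (g y - g z) <= L * norm (y - z)" if "y : cball c R" "z : cball c R" for y z using that by blast
 moreover have "norm (g y) <= L" if "y : cball c R" for y using B(2)[OF that] D0 by (simp add: L_def)
 ultimately show ?thesis using that[of L] B D0 by (simp add: L_def)
qed

lemma norm_le_card_vec:
 fixes v :: "complex ^ 'm::finite"
 assumes "!!l. norm (v$l) <= b"
 shows "norm v <= real CARD('m) * b"
proof -
 have "norm v <= (SUM l. norm (v$l))" unfolding norm_vec_def by (rule L2_set_le_sum) auto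
 also have "... <= real CARD('m) * b" using sum_mono[of UNIV "%l. norm (v$l)" "%_. b"] assms by simp
 finally show ?thesis .
qed

lemma norm_integral_unit_interval:
 fixes f :: "real => 'b::banach"
 assumes "f integrable_on {0..1}" and B: "!!t. t : {0..1} ==> norm (f t) <= B"
 shows "norm (integral {0..1} f) <= B"
proof -
 have "0 <= norm (f 0)" by simp
 also have "... <= B" by (rule B) simp
 finally have "0 <= B" .
 thus ?thesis using has_integral_bound[of B f "integral {0..1} f" 0 1] assms by (simp add: has_integral_integral)
qed

lemma scaleR_in_ball: "x : ball 0 r ==> t : {0..1} ==> t *\<^sub>R x : ball (0::'a::real_normed_vector) r"
 using mult_left_le_one_le[of "norm x" t] by auto

section \<open>Flows of holomorphic vector fields and Frobenius's theorem\<close>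

text \<open>
 Along each ray, \<open>f\<close> follows the flow of \<open>\<Sum>\<^sub>i x\<^sub>i G\<^sub>i\<close>; for a one-dimensional parameter this is
 the existence theorem for holomorphic ordinary differential equations.
\<close>

theorem radial_flow:
 fixes G :: "'k::finite => complex ^ 'm::finite => complex ^ 'm"
 assumes Om: "open Om" "c : Om" and G: "!!i l. holo Om (%y. G i y$l)"
 obtains r and f :: "complex ^ 'k => complex ^ 'm"
 where "r > 0" "!!l. holo (ball 0 r) (%x. f x$l)" "f`ball 0 r <= Om" "f 0 = c"
  "!!x l. x : ball 0 r ==>
   (SUM i. x$i * pd i (%x. f x$l) x) = (SUM i. x$i * G i (f x)$l)"
proof -
 obtain R where R: "R > 0" "cball c R <= Om" using Om open_contains_cball by blast
 define H where "H x y l = (SUM i. x$i * G i y$l)" for x :: "complex ^ 'k" and y l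
 have "EX L>=0. (ALL y:cball c R. norm (G i y$l) <= L) &
  (ALL y:cball c R. ALL z:cball c R. norm (G i y$l - G i z$l) <= L * norm (y - z))" for i l
  using holo_bounded_lipschitz[OF G R(2)] by metis
 then obtain L where L: "!!i l. L i l >= 0"
  "!!i l y. y : cball c R ==> norm (G i y$l) <= L i l"
  "!!i l y z. y : cball c R ==> z : cball c R ==> norm (G i y$l - G i z$l) <= L i l * norm (y - z)" by metis
 define K where "K = (SUM l. SUM i. L i l)"
 have K: "(SUM i. L i l) <= K" for l unfolding K_def using L(1) by (intro member_le_sum) (auto intro!: sum_nonneg)
 have K0: "K >= 0" unfolding K_def by (intro sum_nonneg L)
 have sumK: "(SUM i. norm x * (L i l * b)) <= norm x * (K * b)" if "b >= 0" for x :: "complex^'k" and l b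
 proof -
  have "(SUM i. norm x * (L i l * b)) = norm x * ((SUM i. L i l) * b)" by (simp add: sum_distrib_left sum_distrib_right)
  also have "... <= norm x * (K * b)" using that K[of l] by (intro mult_left_mono mult_right_mono) auto
  finally show ?thesis .
 qed
 have Hb: "norm (H x y l) <= norm x * (K * 1)" if "y : cball c R" for x y l
 proof -
  have "norm (H x y l) <= (SUM i. norm x * (L i l * 1))" unfolding H_def using L(1) L(2)[OF that]
   by (intro sum_norm_le) (auto simp: norm_mult intro!: mult_mono Finite_Cartesian_Product.norm_nth_le)
  also have "... <= norm x * (K * 1)" by (rule sumK) simp
  finally show ?thesis .
 qed
 have Hl: "norm (H x y l - H x z l) <= norm x * (K * norm (y - z))" if "y : cball c R" "z : cball c R" for x y z l
 proof -
  have "norm (H x y l - H x z l) <= (SUM i. norm x * (L i l * norm (y - z)))"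
   unfolding H_def sum_subtractf[symmetric] right_diff_distrib[symmetric] using L(1) L(3)[OF that]
   by (intro sum_norm_le) (auto simp: norm_mult intro!: mult_mono Finite_Cartesian_Product.norm_nth_le)
  also have "... <= norm x * (K * norm (y - z))" by (rule sumK) simp
  finally show ?thesis .
 qed
 define M where "M = real CARD('m)"
 have M: "M >= 1" unfolding M_def by (simp add: Suc_leI)
 \<comment> \<open>\<open>M\<close> converts bounds on components into bounds on the norm, and
   \<open>K+1\<close> in place of \<open>K\<close> keeps \<open>q\<close> positive. Then
   \<open>r * q <= R\<close> keeps the iterates in \<open>cball c R\<close>, and
   \<open>r * q <= 1/2\<close> makes \<open>Ph\<close> contract by one half.\<close>
 define q where "q = M * (K+1)"
 have q: "q > 0" "M * K <= q" using M K0 by (auto simp: q_def)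
 define r where "r = min (R / q) (1 / (2 * q))"
 have r: "r > 0" using R q by (simp add: r_def)
 have rq: "r * (M * K) <= R" "r * (M * K) <= 1/2"
 proof -
  have 1: "r * (M * K) <= r * q" using q r by (intro mult_left_mono) auto
  have "r * q <= (R / q) * q" "r * q <= (1 / (2 * q)) * q" using q(1) by (intro mult_right_mono; simp add: r_def)+
  hence "r * q <= R" "r * q <= 1/2" using q(1) by auto
  with 1 show "r * (M * K) <= R" "r * (M * K) <= 1/2" by auto
 qed
 \<comment> \<open>The integral equation along a ray is rescaled to the fixed interval
   \<open>{0..1}\<close>: the endpoint \<open>x\<close> appears only in \<open>H x\<close> and in
   the argument \<open>t *\<^sub>R x\<close>. This makes \<open>Ph f\<close> holomorphic in
   \<open>x\<close>.\<close>
 define Ph where "Ph f x = (\<chi> l. c$l+integral {0..1} (%t. H x (f (t *\<^sub>R x)) l))"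
  for f :: "complex ^ 'k => complex ^ 'm" and x
 define good where "good f \<longleftrightarrow> (ALL l. holo (ball 0 r) (%x. f x$l)) & (ALL x:ball 0 r. f x : cball c R)"
  for f :: "complex ^ 'k => complex ^ 'm"
 have contH: "continuous_on (ball 0 r \<times> {0..1}) (%(x, t). H x (f (t *\<^sub>R x)) l)" 
  if f: "good f" for f l
 proof -
  have cf: "continuous_on (ball 0 r) f" using f by (intro holo_vec_continuous) (simp add: good_def)
  have cf': "continuous_on (ball 0 r \<times> {0..1}) (%p. f (snd p *\<^sub>R fst p))"
   by (rule continuous_on_compose2[OF cf]) (auto intro!: continuous_intros scaleR_in_ball simp del: mem_ball)
  have cG: "continuous_on (ball 0 r \<times> {0..1}) (%p. G i (f (snd p *\<^sub>R fst p))$l)" for i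
    by (rule continuous_on_compose2[OF holo_continuous_on[OF G] cf'])
     (use f R in \<open>auto simp: good_def image_subset_iff simp del: mem_cball mem_ball intro!: scaleR_in_ball\<close>)
  show ?thesis unfolding H_def case_prod_unfold
   by (intro continuous_on_sum continuous_on_mult cG continuous_on_component continuous_on_fst continuous_on_id)
 qed
 have intH: "(%t. H x (f (t *\<^sub>R x)) l) integrable_on {0..1}" if "good f" "x : ball 0 r" for f x l
 proof -
  have "continuous_on {0..1} ((%p. (%(x, t). H x (f (t *\<^sub>R x)) l) p) \<circ> (%t. (x, t)))"
   by (rule continuous_on_compose) (use that in \<open>auto intro!: continuous_intros continuous_on_subset[OF contH]\<close>)
  thus ?thesis by (intro integrable_continuous_interval) (simp add: o_def)
 qed
 have goodPh: "good (Ph f)" if f: "good f" for f unfolding good_def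
 proof (intro conjI allI ballI)
  fix l
  have holH: "holo (ball 0 r) (%x. H x (f (t *\<^sub>R x)) l)" if t: "t : {0..1}" for t unfolding H_def
  proof (intro holo_sumI holo_mult(1) holo_coord)
   fix i
   have "holo (ball 0 r) (%x. f (t *\<^sub>R x)$l)" for l
   proof (rule holo_compose(1)[of _ "%x. t *\<^sub>R x"])
    show "holo (ball 0 r) (%x::complex^'k. (t *\<^sub>R x)$l)" for l
     unfolding vector_scaleR_component unfolding scaleR_conv_of_real by (intro holo_cmult holo_coord) auto
    show "holo (ball 0 r) (%x. f x$l)" using f by (simp add: good_def)
   qed (use scaleR_in_ball t in blast)
   thus "holo (ball 0 r) (%x. G i (f (t *\<^sub>R x))$l)" by (rule holo_compose(1)[OF _ G])
     (use f R scaleR_in_ball[OF _ t] in \<open>unfold good_def, blast\<close>)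
  qed auto
  have "holo (ball 0 r) (%x. c$l+integral {0..1} (%t. H x (f (t *\<^sub>R x)) l))"
   by (intro holo_add holo_integral(1)[OF _ contH[OF f] holH]) auto
  thus "holo (ball 0 r) (%x. Ph f x$l)" by (simp add: Ph_def)
 next
  fix x :: "complex ^ 'k" assume x: "x : ball 0 r"
  have "norm (Ph f x - c) <= M * (norm x * (K * 1))" unfolding M_def
  proof (rule norm_le_card_vec)
   fix l
   have "norm (integral {0..1} (%t. H x (f (t *\<^sub>R x)) l)) <= norm x * (K * 1)" by (rule norm_integral_unit_interval)
     (use intH[OF f x] f scaleR_in_ball[OF x] in \<open>auto simp: good_def simp del: mem_cball mult_1_right intro!: Hb\<close>)
   thus "norm ((Ph f x - c)$l) <= norm x * (K * 1)" by (simp add: Ph_def)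
  qed
  also have "... <= r * (M * K)" using x M K0 by (simp add: mult.left_commute mult_right_mono)
  finally show "Ph f x : cball c R" using rq by (simp add: dist_norm norm_minus_commute)
 qed
 have contr: "norm (Ph f x - Ph g x) <= 1/2 * b"
  if f: "good f" and g: "good g" and b: "!!x. x : ball 0 r ==> norm (f x - g x) <= b" and x: "x : ball 0 r" for f g b x
 proof -
  have b0: "b >= 0" using b[OF x] norm_ge_zero order_trans by blast
  have "norm (Ph f x - Ph g x) <= M * (norm x * (K * b))" unfolding M_def
  proof (rule norm_le_card_vec)
   fix l
   have "norm (integral {0..1} (%t. H x (f (t *\<^sub>R x)) l - H x (g (t *\<^sub>R x)) l)) <= norm x * (K * b)"
   proof (rule norm_integral_unit_interval)
    fix t :: real assume "t : {0..1}"
    hence t: "t *\<^sub>R x : ball 0 r" by (intro scaleR_in_ball x) auto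
    have "norm (H x (f (t *\<^sub>R x)) l - H x (g (t *\<^sub>R x)) l) <= norm x * (K * norm (f (t *\<^sub>R x) - g (t *\<^sub>R x)))"
     by (rule Hl) (use f g t in \<open>auto simp: good_def simp del: mem_ball mem_cball\<close>)
    also have "... <= norm x * (K * b)" using b[OF t] K0 by (intro mult_left_mono) auto
    finally show "norm (H x (f (t *\<^sub>R x)) l - H x (g (t *\<^sub>R x)) l) <= norm x * (K * b)" .
   qed (use intH[OF f x] intH[OF g x] in \<open>auto intro!: integrable_diff\<close>)
   thus "norm ((Ph f x - Ph g x)$l) <= norm x * (K * b)" by (simp add: Ph_def integral_diff[OF intH[OF f x] intH[OF g x]])
  qed
  also have "... = norm x * (M * K * b)" by simp
  also have "... <= r * (M * K * b)" using x M K0 b0 by (intro mult_right_mono mult_nonneg_nonneg) auto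
  also have "... = (r * (M * K)) * b" by simp
  also have "... <= 1/2 * b" using rq b0 by (intro mult_right_mono) auto
  finally show ?thesis .
 qed
 define F where "F k = (Ph ^^ k) (%_. c)" for k
 have F0: "good (%_. c)" using R by (simp add: good_def)
 have Fgood: "good (F k)" for k unfolding F_def by (induction k) (simp_all add: F0 goodPh)
 have F_Suc: "F (Suc k) = Ph (F k)" for k by (simp add: F_def)
 have diff: "norm (F (Suc k) x - F k x) <= R * (1/2) ^ k" if "x : ball 0 r" for k x using that
 proof (induction k arbitrary: x)
  case 0
  thus ?case using goodPh[OF F0] by (simp add: F_def good_def dist_norm norm_minus_commute)
 next
  case (Suc k)
  have "norm (Ph (F (Suc k)) x - Ph (F k) x) <= 1/2 * (R * (1/2) ^ k)" by (rule contr[OF Fgood Fgood Suc.IH Suc.prems])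
  thus ?case by (simp add: F_Suc)
 qed
 \<comment> \<open>The iterates are the partial sums of a telescoping series with a geometric
   majorant, so they converge uniformly and the limit is again holomorphic.\<close>
 have "uniformly_convergent_on (ball 0 r) (%n x. \<Sum>k<n. F (Suc k) x - F k x)"
  by (rule Weierstrass_m_test'[where M="%k. R * (1/2) ^ k"]) (auto simp: diff simp del: mem_ball intro!: summable_mult summable_geometric)
 then obtain g where g: "uniform_limit (ball 0 r) (%n x. \<Sum>k<n. F (Suc k) x - F k x) g sequentially"
  by (auto simp: uniformly_convergent_on_def)
 define f where "f x = g x+c" for x
 have lim: "uniform_limit (ball 0 r) F f sequentially"
 proof -
  have "uniform_limit (ball 0 r) (%n x. (\<Sum>k<n. F (Suc k) x - F k x)+c) (%x. g x+c) sequentially"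
   by (rule uniform_limit_add[OF g uniform_limit_const])
  moreover have "(\<Sum>k<n. F (Suc k) x - F k x)+c = F n x" for n x using sum_lessThan_telescope[of "%k. F k x" n] by (simp add: F_def)
  ultimately show ?thesis by (simp add: f_def[abs_def])
 qed
 have pt: "(%n. F n x) \<longlonglongrightarrow> f x" if "x : ball 0 r" for x by (rule tendsto_uniform_limitI[OF lim that])
 have good: "good f" unfolding good_def
 proof (intro conjI allI ballI)
  fix l
  have "uniform_limit (ball 0 r) (%n x. F n x$l) (%x. f x$l) sequentially"
   by (rule bounded_linear.uniform_limit[OF bounded_linear_vec_nth lim])
  thus "holo (ball 0 r) (%x. f x$l)" by (rule holo_uniform_limit[rotated]) (use Fgood in \<open>simp add: good_def\<close>)
 next
  fix x :: "complex ^ 'k" assume "x : ball 0 r"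
  thus "f x : cball c R" using closed_sequentially[OF closed_cball _ pt] Fgood by (simp add: good_def)
 qed
 have fix_eq: "Ph f x = f x" if x: "x : ball 0 r" for x
 proof (rule LIMSEQ_unique)
  show "(%n. F (Suc n) x) \<longlonglongrightarrow> f x" using pt[OF x] by (rule LIMSEQ_Suc)
  show "(%n. F (Suc n) x) \<longlonglongrightarrow> Ph f x"
  proof (rule metric_LIMSEQ_I)
   fix e :: real assume e: "e > 0"
   obtain n0 where n0: "!!n y. n >= n0 ==> y : ball 0 r ==> dist (F n y) (f y) < e"
    using lim e unfolding uniform_limit_iff eventually_sequentially by blast
   show "EX n0. ALL n>=n0. dist (F (Suc n) x) (Ph f x) < e"
   proof (intro exI[of _ n0] allI impI)
    fix n assume "n >= n0"
    hence "norm (F n y - f y) <= e" if "y : ball 0 r" for y using n0[of n y] that by (simp add: dist_norm)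
    from contr[OF Fgood good this x] have "norm (Ph (F n) x - Ph f x) <= 1/2 * e" .
    thus "dist (F (Suc n) x) (Ph f x) < e" using e by (simp add: F_Suc dist_norm)
   qed
  qed
 qed
 show ?thesis
 proof (rule that[OF r])
  show "holo (ball 0 r) (%x. f x$l)" for l using good by (simp add: good_def)
  show "f`ball 0 r <= Om" using good R by (auto simp: good_def)
  show "f 0 = c" using fix_eq[of 0] r by (simp add: Ph_def H_def vec_eq_iff)
  fix x :: "complex ^ 'k" and l assume x: "x : ball 0 r"
  define g where "g t = H x (f (t *\<^sub>R x)) l" for t
  have gc: "continuous_on {0..1} g"
  proof -
   have "continuous_on {0..1} ((%p. (%(x, t). H x (f (t *\<^sub>R x)) l) p) \<circ> (%t. (x, t)))"
    by (rule continuous_on_compose) (use x in \<open>auto intro!: continuous_intros continuous_on_subset[OF contH[OF good]]\<close>)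
   thus ?thesis by (simp add: o_def g_def[abs_def])
  qed
  \<comment> \<open>The fixed point equation at \<open>s *\<^sub>R x\<close>, after the substitution
    \<open>t * s\<close>, has \<open>s\<close> as its upper limit of integration; its derivative at
    \<open>s = 1\<close> is the radial derivative of \<open>f\<close>.\<close>
  have ray: "f (s *\<^sub>R x)$l = c$l+integral {0..s} g" if s: "s : {0..1}" for s
  proof -
   have "((%t. s *\<^sub>R g (t * s)) has_integral (integral {0..1 * s} g - integral {0..0 * s} g)) {0..1}"
   proof (rule fundamental_theorem_of_calculus)
    fix t :: real assume t: "t : {0..1}"
    have ts: "t * s : {0..1}" using t s by (auto intro: mult_le_one)
    have 1: "((%t. t * s) has_vector_derivative s) (at t within {0..1})" by (auto intro!: derivative_eq_intros)
    have "((%u. integral {0..u} g) has_vector_derivative g (t * s)) (at (t * s) within (%t. t * s)`{0..1})"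
     by (rule has_vector_derivative_within_subset[OF integral_has_vector_derivative[OF gc ts]])
      (use s in \<open>auto intro: mult_le_one\<close>)
    from vector_diff_chain_within[OF 1 this]
    show "((%t. integral {0..t * s} g) has_vector_derivative s *\<^sub>R g (t * s)) (at t within {0..1})" by (simp add: o_def)
   qed auto
   from integral_unique[OF this]
   have "integral {0..s} g = integral {0..1} (%t. s *\<^sub>R g (t * s))" by simp
   also have "(%t. s *\<^sub>R g (t * s)) = (%t. H (s *\<^sub>R x) (f (t *\<^sub>R (s *\<^sub>R x))) l)"
    by (simp add: g_def H_def scaleR_sum_right)
   finally show ?thesis using fix_eq[OF scaleR_in_ball[OF x s]] by (simp add: Ph_def vec_eq_iff)
  qed
  have "((%s. c$l+integral {0..s} g) has_vector_derivative g 1) (at 1 within {0..1})"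
   using has_vector_derivative_add[OF has_vector_derivative_const integral_has_vector_derivative[OF gc, of 1]] by simp
  hence d1: "((%s. f (s *\<^sub>R x)$l) has_vector_derivative g 1) (at 1 within {0..1})"
   by (rule has_vector_derivative_transform[rotated 2]) (auto simp: ray)
  have "((%t. t *\<^sub>R x) has_derivative (%h. h *\<^sub>R x)) (at 1 within {0..1})" by (auto intro!: derivative_eq_intros)
  hence "((%t. f (t *\<^sub>R x)$l) has_derivative
   (%h. SUM i. pd i (%x. f x$l) (1 *\<^sub>R x) * (h *\<^sub>R x)$i)) (at 1 within {0..1})"
   by (rule has_derivative_compose[where g="%x. f x$l"])
    (use x good holo_has_derivative[of "ball 0 r" "%x. f x$l" x] in \<open>auto simp: good_def\<close>)
  hence d2: "((%t. f (t *\<^sub>R x)$l) has_vector_derivative (SUM i. x$i * pd i (%x. f x$l) x)) (at 1 within {0..1})"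
   by (simp add: has_vector_derivative_def scaleR_sum_right mult_ac)
  show "(SUM i. x$i * pd i (%x. f x$l) x) = (SUM i. x$i * G i (f x)$l)"
   using vector_derivative_unique_within_closed_interval[of 0 1 1, OF _ _ d2[folded cbox_interval] d1[folded cbox_interval]]
   by (simp add: g_def H_def)
 qed
qed

text \<open>Frobenius's theorem. The radial solution satisfies the combination of the equations
  weighted by \<open>x\<close>. By \<open>comm\<close> the errors \<open>E j l\<close> in the single
  equations obey a homogeneous linear radial equation, and on a small ball such errors are bounded
  by half of themselves, so they vanish.\<close>

theorem commuting_flows:
 fixes G :: "'k::finite => complex ^ 'm::finite => complex ^ 'm"
 assumes Om: "open Om" "c : Om" and G: "!!i l. holo Om (%y. G i y$l)"
  and comm: "!!i j l y. y : Om ==> (SUM m. pd m (%y. G i y$l) y * G j y$m) =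
   (SUM m. pd m (%y. G j y$l) y * G i y$m)"
 obtains r and f :: "complex ^ 'k => complex ^ 'm"
 where "r > 0" "!!l. holo (ball 0 r) (%x. f x$l)" "f`ball 0 r <= Om" "f 0 = c"
  "!!x l i. x : ball 0 r ==> pd i (%x. f x$l) x = G i (f x)$l"
proof -
 obtain r and f :: "complex ^ 'k => complex ^ 'm"
  where r: "r > 0" and f: "!!l. holo (ball 0 r) (%x. f x$l)" and fOm: "f`ball 0 r <= Om" and f0: "f 0 = c"
  and rad: "!!x l. x : ball 0 r ==>
   (SUM i. x$i * pd i (%x. f x$l) x) = (SUM i. x$i * G i (f x)$l)" using radial_flow[of Om c G, OF Om G] by blast
 define E where "E j l x = pd j (%x. f x$l) x - G j (f x)$l" for j l x
 have holG: "holo (ball 0 r) (%x. G j (f x)$l)" for j l by (rule holo_compose(1)[OF f G fOm])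
 have holE: "holo (ball 0 r) (E j l)" for j l unfolding E_def by (intro holo_diff(1) holo_pd f holG)
 have pdG: "pd i (%x. G j (f x)$l) x = (SUM m. pd m (%y. G j y$l) (f x) * pd i (%x. f x$m) x)"
  if "x : ball 0 r" for i j l x by (rule holo_compose(2)[OF f G fOm that])
 \<comment> \<open>Differentiating the radial identity in direction \<open>j\<close> isolates
   \<open>E j\<close>; \<open>comm\<close> exchanges \<open>i\<close> and \<open>j\<close> in the
   derivatives of \<open>G\<close>, so that only errors remain on the right.\<close>
 have euler: "E j l x+(SUM i. x$i * pd i (E j l) x) =
  (SUM i. x$i * (SUM m. pd m (%y. G i y$l) (f x) * E j m x))" if x: "x : ball 0 r" for j l x
 proof -
  have prod_rule: "pd j (%x. SUM i. x$i * h i x) x = h j x+(SUM i. x$i * pd j (h i) x)"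
   if h: "!!i. holo (ball 0 r) (h i)" for h
  proof -
   have "pd j (%x. SUM i. x$i * h i x) x = (SUM i. pd j (%x. x$i * h i x) x)"
    by (rule pd_sum[OF _ _ x]) (auto intro!: holo_mult(1) holo_coord h)
   also have "... = (SUM i. x$i * pd j (h i) x+h i x * (if j = i then 1 else 0))"
    by (intro sum.cong refl) (simp add: holo_mult(2)[OF holo_coord h x] pd_coord)
   finally show ?thesis by (simp add: sum.distrib if_mult_right cong: if_cong)
  qed
  have "pd j (%x. SUM i. x$i * pd i (%x. f x$l) x) x = pd j (%x. SUM i. x$i * G i (f x)$l) x"
   by (rule pd_cong[OF open_ball x]) (rule rad)
  hence 1: "pd j (%x. f x$l) x+(SUM i. x$i * pd j (pd i (%x. f x$l)) x) =
    G j (f x)$l+(SUM i. x$i * pd j (%x. G i (f x)$l) x)" by (simp add: prod_rule[OF holo_pd[OF f]] prod_rule[OF holG])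
  have 2: "pd i (E j l) x = pd j (pd i (%x. f x$l)) x - pd i (%x. G j (f x)$l) x" for i
   unfolding E_def using holo_diff(2)[OF holo_pd[OF f] holG x] pd_commute[OF f x] by metis
  have 3: "(SUM i. x$i * pd i (%x. G j (f x)$l) x) =
    (SUM i. x$i * (SUM m. pd m (%y. G i y$l) (f x) * G j (f x)$m))"
  proof -
   have "(SUM i. x$i * pd i (%x. G j (f x)$l) x) =
     (SUM i. SUM m. pd m (%y. G j y$l) (f x) * (x$i * pd i (%x. f x$m) x))" by (simp add: pdG[OF x] sum_distrib_left mult_ac)
   also have "... = (SUM m. pd m (%y. G j y$l) (f x) * (SUM i. x$i * pd i (%x. f x$m) x))"
    by (subst sum.swap) (simp add: sum_distrib_left)
   also have "... = (SUM m. pd m (%y. G j y$l) (f x) * (SUM i. x$i * G i (f x)$m))" by (simp add: rad[OF x])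
   also have "... = (SUM i. x$i * (SUM m. pd m (%y. G j y$l) (f x) * G i (f x)$m))"
    unfolding sum_distrib_left by (subst sum.swap) (simp add: mult_ac)
   also have "... = (SUM i. x$i * (SUM m. pd m (%y. G i y$l) (f x) * G j (f x)$m))"
    using comm[of "f x"] x fOm by (simp add: image_subset_iff)
   finally show ?thesis .
  qed
  have "E j l x+(SUM i. x$i * pd i (E j l) x) =
    (pd j (%x. f x$l) x+(SUM i. x$i * pd j (pd i (%x. f x$l)) x)) - G j (f x)$l
    - (SUM i. x$i * pd i (%x. G j (f x)$l) x)" by (simp add: 2 right_diff_distrib sum_subtractf E_def)
  also have "... = (SUM i. x$i * pd j (%x. G i (f x)$l) x) -
    (SUM i. x$i * (SUM m. pd m (%y. G i y$l) (f x) * G j (f x)$m))" unfolding 1 3 by simp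
  also have "... = (SUM i. x$i * (SUM m. pd m (%y. G i y$l) (f x) * E j m x))"
   by (simp add: pdG[OF x] E_def sum_subtractf right_diff_distrib)
  finally show ?thesis .
 qed
 define rh where "rh = r / 2"
 have rh: "rh > 0" "cball 0 rh <= ball (0::complex^'k) r" using r by (auto simp: rh_def)
 have holD: "holo (ball 0 r) (%x. pd m (%y. G i y$l) (f x))" for m i l by (rule holo_compose(1)[OF f holo_pd[OF G] fOm])
 have ex: "EX B. B >= 0 & (ALL x:cball 0 rh. norm (pd m (%y. G i y$l) (f x)) <= B)" for m i l
  by (rule continuous_on_compact_bound[OF compact_cball continuous_on_subset[OF holo_continuous_on[OF holD] rh(2)], of m i l]) blast
 define B where "B m i l = (SOME B. B >= 0 & (ALL x:cball 0 rh. norm (pd m (%y. G i y$l) (f x)) <= B))" for m i l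
 have B: "B m i l >= 0" "!!x. x : cball 0 rh ==> norm (pd m (%y. G i y$l) (f x)) <= B m i l" for m i l
  using someI_ex[OF ex[of m i l]] unfolding B_def by blast+
 define C where "C = (SUM l. SUM i. SUM m. B m i l)"
 have C: "C >= 0" unfolding C_def by (intro sum_nonneg B)
 \<comment> \<open>Chosen so that \<open>s * C <= 1/2\<close>; the summand 1 avoids a division by
   zero.\<close>
 define s where "s = min rh (1 / (2 * (C+1)))"
 have s: "s > 0" "s <= rh" using rh C by (auto simp: s_def)
 have sC: "s * C <= 1/2"
 proof -
  have "s * C <= (1 / (2 * (C+1))) * (C+1)" using C s by (intro mult_mono) (auto simp: s_def)
  also have "... = 1/2" using C by (simp add: field_simps)
  finally show ?thesis .
 qed
 have zero: "E j l x = 0" if x: "x : cball 0 s" for j l x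
 proof -
  let ?e = "%x. SUM l. norm (E j l x)"
  have cont: "continuous_on (cball 0 s) ?e"
   by (intro continuous_intros continuous_on_subset[OF holo_continuous_on[OF holE]]) (use s rh in auto)
  \<comment> \<open>At the point where the total error is largest, integrating the derivative of
    \<open>t *\<^sub>R E j l (t *\<^sub>R x0)\<close> bounds this error by \<open>s * C\<close>
    times itself.\<close>
  obtain x0 where x0: "x0 : cball 0 s" "!!y. y : cball 0 s ==> ?e y <= ?e x0"
   using continuous_attains_sup[OF compact_cball _ cont] s by auto
  define e where "e = ?e x0"
  have e0: "e >= 0" unfolding e_def by (intro sum_nonneg) auto
  have Ee: "norm (E j m y) <= e" if "y : cball 0 s" for y m
   using member_le_sum[of m UNIV "%l. norm (E j l y)"] x0(2)[OF that] by (simp add: e_def)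
  have bound: "norm (E j l x0) <= s * (SUM i. SUM m. B m i l) * e" for l
  proof -
   have tx: "t *\<^sub>R x0 : cball 0 s" if "t : {0..1}" for t using that x0(1) mult_left_le_one_le[of "norm x0" t] by auto
   have tx': "t *\<^sub>R x0 : ball 0 r" "t *\<^sub>R x0 : cball 0 rh" if "t : {0..1}" for t using tx[OF that] s rh_def r by auto
   let ?u' = "%t. SUM i. (t *\<^sub>R x0)$i * (SUM m. pd m (%y. G i y$l) (f (t *\<^sub>R x0)) * E j m (t *\<^sub>R x0))"
   have "(?u' has_integral 1 *\<^sub>R E j l (1 *\<^sub>R x0) - 0 *\<^sub>R E j l (0 *\<^sub>R x0)) {0..1}"
   proof (rule fundamental_theorem_of_calculus)
    fix t :: real assume t: "t : {0..1}"
    have "((%t. t *\<^sub>R x0) has_derivative (%h. h *\<^sub>R x0)) (at t within {0..1})" by (auto intro!: derivative_eq_intros)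
    from has_derivative_compose[OF this holo_has_derivative[OF holE tx'(1)[OF t]], of j l]
    have "((%t. E j l (t *\<^sub>R x0)) has_vector_derivative (SUM i. x0$i * pd i (E j l) (t *\<^sub>R x0))) (at t within {0..1})"
     by (simp add: has_vector_derivative_def scaleR_sum_right mult_ac)
    from has_vector_derivative_scaleR[OF DERIV_ident this]
    have "((%t. t *\<^sub>R E j l (t *\<^sub>R x0)) has_vector_derivative
      t *\<^sub>R (SUM i. x0$i * pd i (E j l) (t *\<^sub>R x0))+1 *\<^sub>R E j l (t *\<^sub>R x0)) (at t within {0..1})" by simp
    moreover have "t *\<^sub>R (SUM i. x0$i * pd i (E j l) (t *\<^sub>R x0))+1 *\<^sub>R E j l (t *\<^sub>R x0) = ?u' t"
     unfolding euler[OF tx'(1)[OF t], symmetric] by (simp add: scaleR_sum_right)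
    ultimately show "((%t. t *\<^sub>R E j l (t *\<^sub>R x0)) has_vector_derivative ?u' t) (at t within {0..1})" by simp
   qed simp
   hence hi: "(?u' has_integral E j l x0) {0..1}" by simp
   have "norm (integral {0..1} ?u') <= (SUM i. s * (SUM m. B m i l * e))"
   proof (rule norm_integral_unit_interval)
    show "?u' integrable_on {0..1}" using hi by blast
    fix t :: real assume t: "t : {0..1}"
    show "norm (?u' t) <= (SUM i. s * (SUM m. B m i l * e))"
    proof (intro sum_norm_le)
     fix i
     have 1: "norm ((t *\<^sub>R x0)$i) <= s" using Finite_Cartesian_Product.norm_nth_le[of "t *\<^sub>R x0" i] tx[OF t] by simp
     have 2: "norm (SUM m. pd m (%y. G i y$l) (f (t *\<^sub>R x0)) * E j m (t *\<^sub>R x0)) <= (SUM m. B m i l * e)"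
      by (intro sum_norm_le) (simp add: norm_mult mult_mono B(1) B(2)[OF tx'(2)[OF t]] Ee[OF tx[OF t]])
     show "norm ((t *\<^sub>R x0)$i * (SUM m. pd m (%y. G i y$l) (f (t *\<^sub>R x0)) * E j m (t *\<^sub>R x0)))
       <= s * (SUM m. B m i l * e)" unfolding norm_mult by (rule mult_mono[OF 1 2]) (use s in auto)
    qed
   qed
   thus ?thesis using integral_unique[OF hi] by (simp add: sum_distrib_left sum_distrib_right mult.assoc)
  qed
  have "e <= (SUM l. s * (SUM i. SUM m. B m i l) * e)" unfolding e_def by (intro sum_mono bound[unfolded e_def])
  also have "... = s * C * e" by (simp add: C_def sum_distrib_left sum_distrib_right)
  also have "... <= 1/2 * e" by (rule mult_right_mono[OF sC e0])
  finally have "e = 0" using e0 by simp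
  thus ?thesis using Ee[OF x, of l] by simp
 qed
 show ?thesis
 proof (rule that[of s f])
  have sub: "ball 0 s <= ball (0::complex^'k) r" using s rh by (auto simp: rh_def)
  show "holo (ball 0 s) (%x. f x$l)" for l by (rule holo_subset[OF f open_ball sub])
  show "f`ball 0 s <= Om" using fOm sub by blast
  show "pd i (%x. f x$l) x = G i (f x)$l" if "x : ball 0 s" for x l i using zero[of x i l] that by (simp add: E_def)
 qed (use s f0 in auto)
qed

section \<open>The holomorphic inverse function theorem\<close>

lemma complex_linear_sum:
 fixes D :: "complex ^ 'n::finite => complex ^ 'm::finite"
 assumes "linear D" and c: "!!c h. D (c *s h) = c *s D h"
 shows "D h$l = (SUM i. D (axis i 1)$l * h$i)"
proof -
 have "h = (SUM i. h$i *s axis i 1)" by (simp add: vec_eq_iff axis_def if_mult_right cong: if_cong)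
 hence "D h = (SUM i. D (h$i *s axis i 1))" using linear_sum[OF assms(1), of "%i. h$i *s axis i 1" UNIV] by simp
 thus ?thesis by (simp add: c mult.commute)
qed

text \<open>The real inverse function theorem gives a differentiable inverse; its derivative inverts
  a complex linear map, so it is complex linear and the inverse is holomorphic. Injectivity of the
  differential suffices because source and target have equal dimension.\<close>

theorem holo_inverse_function:
 fixes F :: "complex ^ 'n::finite => complex ^ 'n"
 assumes F: "!!l. holo S (%x. F x$l)" and x0: "x0 : S"
  and inj: "!!h. (!!l. (SUM i. pd i (%x. F x$l) x0 * h$i) = 0) ==> h = 0"
 obtains U where "open U" "U <= S" "x0 : U" "inj_on F U" "open (F`U)"
  "!!l. holo (F`U) (%y. inv_into U F y$l)"
proof -
 define D where "D x h = (\<chi> l. SUM i. pd i (%x. F x$l) x * h$i)" for x h :: "complex ^ 'n"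
 have S: "open S" using F holo_open by blast
 have deriv: "(F has_derivative D x) (at x)" if "x : S" for x unfolding D_def by (rule holo_vec_has_derivative[OF F that])
 have bl: "bounded_linear (D x)" if "x : S" for x using deriv[OF that] by (rule has_derivative_bounded_linear)
 have Dlin: "D x (c *s h) = c *s D x h" for x c h by (simp add: D_def vec_eq_iff sum_distrib_left mult_ac)
 define f' where "f' x = Blinfun (D x)" for x
 have f': "blinfun_apply (f' x) = D x" if "x : S" for x unfolding f'_def by (rule bounded_linear_Blinfun_apply[OF bl[OF that]])
 have cont: "continuous_on S f'"
 proof (rule continuous_on_blinfun_componentwise)
  fix b :: "complex ^ 'n"
  have "continuous_on S (%x. D x b)"
   unfolding D_def by (intro continuous_on_vec_lambda continuous_intros holo_continuous_on[OF holo_pd[OF F]])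
  thus "continuous_on S (%x. blinfun_apply (f' x) b)" by (rule continuous_on_eq) (simp add: f')
 qed
 have lin: "linear (D x0)" using bl[OF x0] by (rule bounded_linear.linear)
 have "inj (D x0)" unfolding linear_injective_0[OF lin]
 proof (intro allI impI inj)
  fix h l assume "D x0 h = 0"
  hence "D x0 h$l = 0" by simp
  thus "(SUM i. pd i (%x. F x$l) x0 * h$i) = 0" by (simp add: D_def)
 qed
 then obtain g0 where g0: "linear g0" "g0 \<circ> D x0 = id" using linear_injective_left_inverse[OF lin] by blast
 have "Blinfun g0 o\<^sub>L f' x0 = id_blinfun"
 proof (rule blinfun_eqI)
  fix h
  have "blinfun_apply (Blinfun g0) = g0" by (rule bounded_linear_Blinfun_apply) (use g0 linear_conv_bounded_linear in blast)
  thus "blinfun_apply (Blinfun g0 o\<^sub>L f' x0) h = blinfun_apply id_blinfun h"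
   using g0(2) by (simp add: f'[OF x0] o_def fun_eq_iff id_def)
 qed
 from inverse_function_theorem[OF S _ cont x0 this, of F]
 obtain U V g g' where U: "open U" "U <= S" "x0 : U" "open V" "homeomorphism U V F g"
  and g: "!!y. y : V ==> (g has_derivative (g' y)) (at y)"
  and g': "!!y. y : V ==> g' y = inv (blinfun_apply (f'(g y)))"
  and bij: "!!y. y : V ==> bij (blinfun_apply (f'(g y)))" using deriv f' by metis
 have FU: "F`U = V" and gF: "!!x. x : U ==> g (F x) = x" and gV: "g`V = U" using U(5) by (auto simp: homeomorphism_def)
 have injU: "inj_on F U" using gF by (metis inj_onI)
 have inv: "inv_into U F y = g y" if "y : V" for y using that FU gF injU by (metis inv_into_f_f image_iff)
 have holg: "holo V (%y. g y$l)" for l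
 proof (rule holoI[OF U(4)])
  fix y assume y: "y : V"
  have gy: "g y : S" using y gV U by auto
  have b: "bij (D (g y))" using bij[OF y] f'[OF gy] by simp
  have g'D: "D (g y) (g' y h) = h" for h using g'[OF y] f'[OF gy] b by (simp add: bij_is_surj surj_f_inv_f)
  have sc: "g' y (c *s h) = c *s g' y h" for c h using bij_is_inj[OF b] g'D by (metis Dlin injD)
  have lg: "linear (g' y)" using g[OF y] has_derivative_linear by blast
  have "((%y. g y$l) has_derivative (%h. g' y h$l)) (at y)" by (rule bounded_linear.has_derivative[OF bounded_linear_vec_nth g[OF y]])
  thus "((%y. g y$l) has_derivative (%h. SUM i. g' y (axis i 1)$l * h$i)) (at y)"
   by (simp add: complex_linear_sum[OF lg sc, symmetric])
 qed
 show ?thesis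
 proof (rule that[OF U(1,2,3) injU])
  show "open (F`U)" using FU U by simp
  show "holo (F`U) (%y. inv_into U F y$l)" for l using holg[of l] FU inv holo_cong[of V "%y. inv_into U F y$l" "%y. g y$l"] by simp
 qed
qed

section \<open>Coordinates on complex manifolds\<close>

text \<open>The atlas axioms of \<open>complex_manifold\<close> apart from its topological
  conditions. They are what local arguments use, and what is verified for \<open>det_atlas\<close>,
  \<open>pull_atlas\<close> and \<open>cp_atlas\<close>.\<close>

definition atlas_compat :: "('a, 'n::finite) atlas => bool" where
 "atlas_compat A \<longleftrightarrow> (ALL (U, ph):A. inj_on ph U & open (ph`U)) &
  (ALL (U, ph):A. ALL (V, ps):A. ALL i. holo (ph`(U Int V)) (%x. ps (inv_into U ph x)$i))"

lemma atlas_inj: "atlas_compat A ==> (U, ph) : A ==> inj_on ph U" unfolding atlas_compat_def by fast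

lemma atlas_transition:
 "atlas_compat A ==> (U, ph) : A ==> (V, ps) : A ==>
  holo (ph`(U Int V)) (%x. ps (inv_into U ph x)$i)" unfolding atlas_compat_def by fast

lemma complex_manifold_compat: "complex_manifold A ==> atlas_compat A" by (simp add: complex_manifold_def atlas_compat_def)

lemma mopen_points: "mopen A W ==> W <= points A" by (simp add: mopen_def)

lemma mopenI:
 "W <= points A ==> (!!U ph. (U, ph) : A ==> open (ph`(U Int W))) ==> mopen A W" by (auto simp: mopen_def)

lemma holo_onI:
 "W <= points A ==> (!!U ph. (U, ph) : A ==> holo (ph`(U Int W)) (%x. f (inv_into U ph x))) ==> holo_on A W f"
 unfolding holo_on_def mopen_def using holo_open by fast

lemma mopen_Union: "(!!W. W : F ==> mopen A W) ==> mopen A (\<Union>F)"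
proof (rule mopenI)
 fix U ph assume *: "!!W. W : F ==> mopen A W" "(U, ph) : A"
 have "ph`(U Int \<Union>F) = (UN W:F. ph`(U Int W))" by blast
 moreover have "open (ph`(U Int W))" if "W : F" for W using *(1)[OF that] *(2) by (auto simp: mopen_def)
 ultimately show "open (ph`(U Int \<Union>F))" by auto
qed (use mopen_points in blast)

lemma mopen_empty [simp]: "mopen A {}" by (auto simp: mopen_def)

lemma mopen_Int:
 assumes A: "atlas_compat A" and V: "mopen A V" and W: "mopen A W"
 shows "mopen A (V Int W)"
proof (rule mopenI)
 show "V Int W <= points A" using mopen_points[OF V] by blast
 fix U ph assume u: "(U, ph) : A"
 hence "ph`(U Int (V Int W)) = ph`(U Int V) Int ph`(U Int W)"
  using inj_on_image_Int[of ph U "U Int V" "U Int W"] A by (auto simp: atlas_compat_def Int_ac)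
 thus "open (ph`(U Int (V Int W)))" using u V W by (auto simp: mopen_def)
qed

lemma mopen_chart:
 assumes A: "atlas_compat A" and u: "(U, ph) : A"
 shows "mopen A U"
proof (rule mopenI)
 show "U <= points A" using u by (force simp: points_def)
 show "open (ps`(V Int U))" if "(V, ps) : A" for V ps using holo_open[OF atlas_transition[OF A that u]] .
qed

lemma mopen_all: "atlas_compat A ==> mopen A (points A)" unfolding points_def by (rule mopen_Union) (auto intro: mopen_chart)

lemma istopology_mopen: "atlas_compat A ==> istopology (mopen A)" unfolding istopology_def by (auto intro: mopen_Int mopen_Union)

lemma openin_mtop: "atlas_compat A ==> openin (mtop A) W \<longleftrightarrow> mopen A W"
 by (simp add: mtop_def istopology_mopen topology_inverse')

lemma topspace_mtop: "atlas_compat A ==> topspace (mtop A) = points A" using openin_mtop[of A] mopen_all[of A] mopen_points[of A]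
 by (metis openin_subset openin_topspace subset_antisym)

lemma holo_on_mopen: "holo_on A W f ==> mopen A W" by (simp add: holo_on_def)

lemma holo_on_const [simp]: "holo_on A W (%_. c) \<longleftrightarrow> mopen A W" by (auto simp: holo_on_def mopen_def)

lemma holo_on_cong:
 assumes A: "atlas_compat A" and "!!p. p : W ==> f p = g p"
 shows "holo_on A W f \<longleftrightarrow> holo_on A W g"
proof -
 have "holo (ph`(U Int W)) (%x. f (inv_into U ph x)) \<longleftrightarrow> holo (ph`(U Int W)) (%x. g (inv_into U ph x))"
  if "(U, ph) : A" for U ph by (rule holo_cong) (use atlas_inj[OF A that] assms(2) in auto)
 thus ?thesis unfolding holo_on_def by (auto cong: conj_cong)
qed

lemma holo_on_subset: "holo_on A W f ==> mopen A V ==> V <= W ==> holo_on A V f"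
 unfolding holo_on_def mopen_def by (fastforce elim!: holo_subset)

lemma mopen_local:
 assumes "!!p. p : W ==> EX V. p : V & V <= W & mopen A V"
 shows "mopen A W"
proof -
 have "W = \<Union>{V. V <= W & mopen A V}" using assms by blast
 thus ?thesis using mopen_Union[of "{V. V <= W & mopen A V}" A] by auto
qed

lemma holo_on_local:
 assumes *: "!!p. p : W ==> EX V. p : V & V <= W & holo_on A V f"
 shows "holo_on A W f"
proof (rule holo_onI)
 show "W <= points A" using * holo_on_mopen mopen_points by blast
 fix U ph assume u: "(U, ph) : A"
 show "holo (ph`(U Int W)) (%x. f (inv_into U ph x))"
 proof (rule holo_local)
  fix x assume "x : ph`(U Int W)"
  then obtain p where p: "p : U" "p : W" "x = ph p" by auto
  then obtain V where V: "p : V" "V <= W" "holo_on A V f" using * by blast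
  thus "EX T. x : T & T <= ph`(U Int W) & holo T (%x. f (inv_into U ph x))"
   using u p by (intro exI[of _ "ph`(U Int V)"]) (auto simp: holo_on_def)
 qed
qed

lemma holo_on_add: "holo_on A W f ==> holo_on A W g ==> holo_on A W (%p. f p+g p)" by (auto simp: holo_on_def intro!: holo_add(1))

lemma holo_on_diff: "holo_on A W f ==> holo_on A W g ==> holo_on A W (%p. f p - g p)" by (auto simp: holo_on_def intro!: holo_diff(1))

lemma holo_on_mult: "holo_on A W f ==> holo_on A W g ==> holo_on A W (%p. f p * g p)" by (auto simp: holo_on_def intro!: holo_mult(1))

lemma holo_on_sum:
 "(!!k. k : I ==> holo_on A W (f k)) ==> mopen A W ==> holo_on A W (%p. SUM k:I. f k p)"
 by (induction I rule: infinite_finite_induct) (auto intro: holo_on_add)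

lemma holo_on_prod:
 "(!!k. k : I ==> holo_on A W (f k)) ==> mopen A W ==> holo_on A W (%p. PROD k:I. f k p)"
 by (induction I rule: infinite_finite_induct) (auto intro: holo_on_mult)

lemma holo_on_inverse:
 assumes A: "atlas_compat A" and "holo_on A W f" "!!p. p : W ==> f p ~= 0"
 shows "holo_on A W (%p. inverse (f p))"
proof (rule holo_onI)
 show "W <= points A" by (rule mopen_points[OF holo_on_mopen[OF assms(2)]])
 fix U ph assume u: "(U, ph) : A"
 have "holo (ph`(U Int W)) (%x. f (inv_into U ph x))" using assms(2) u by (auto simp: holo_on_def)
 thus "holo (ph`(U Int W)) (%x. inverse (f (inv_into U ph x)))" by (rule holo_inverse) (use assms(3) atlas_inj[OF A u] in auto)
qed

lemma holo_on_divide: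
 "atlas_compat A ==> holo_on A W f ==> holo_on A W g ==> (!!p. p : W ==> g p ~= 0) ==>
  holo_on A W (%p. f p / g p)" unfolding divide_inverse by (intro holo_on_mult holo_on_inverse)

lemma mopen_nonzero:
 assumes A: "atlas_compat A" and f: "holo_on A W f"
 shows "mopen A {p : W. f p ~= 0}"
proof (rule mopenI)
 show "{p : W. f p ~= 0} <= points A" using mopen_points[OF holo_on_mopen[OF f]] by blast
 fix U ph assume u: "(U, ph) : A"
 have h: "holo (ph`(U Int W)) (%x. f (inv_into U ph x))" using f u by (auto simp: holo_on_def)
 have "open (ph`(U Int W) Int (%x. f (inv_into U ph x)) -` (- {0}))"
  by (rule continuous_open_preimage[OF holo_continuous_on[OF h] holo_open[OF h]]) auto
 moreover have "ph`(U Int W) Int (%x. f (inv_into U ph x)) -` (- {0}) = ph`(U Int {p : W. f p ~= 0})" using atlas_inj[OF A u] by auto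
 ultimately show "open (ph`(U Int {p : W. f p ~= 0}))" by simp
qed

lemma holo_nearI: "p : W ==> holo_on A W f ==> holo_near A p f" by (auto simp: holo_near_def)

lemma holo_near_cong:
 assumes A: "atlas_compat A" and W: "mopen A W" "p : W" "!!x. x : W ==> f x = g x"
 shows "holo_near A p f \<longleftrightarrow> holo_near A p g"
proof -
 have *: "holo_near A p g" if "holo_near A p f" "!!x. x : W ==> f x = g x" for f g
 proof -
  obtain V where V: "p : V" "holo_on A V f" using \<open>holo_near A p f\<close> by (auto simp: holo_near_def)
  have "holo_on A (V Int W) f" by (rule holo_on_subset[OF V(2) mopen_Int[OF A holo_on_mopen[OF V(2)] W(1)]]) auto
  hence "holo_on A (V Int W) g" using holo_on_cong[OF A, of "V Int W" f g] that(2) by auto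
  thus ?thesis using V W by (auto intro: holo_nearI)
 qed
 show ?thesis using *[of f g] *[of g f] W(3) by auto
qed

lemma holo_near_nbhd:
 assumes A: "atlas_compat A" and f: "holo_near A p f" and U: "mopen A U" "p : U"
 obtains W where "p : W" "W <= U" "holo_on A W f"
proof -
 obtain V where V: "p : V" "holo_on A V f" using f by (auto simp: holo_near_def)
 have "holo_on A (V Int U) f" by (rule holo_on_subset[OF V(2) mopen_Int[OF A holo_on_mopen[OF V(2)] U(1)]]) auto
 thus ?thesis using that[of "V Int U"] V U by auto
qed

lemma holo_near2:
 assumes A: "atlas_compat A" and f: "holo_near A p f" and g: "holo_near A p g"
 obtains W where "p : W" "holo_on A W f" "holo_on A W g"
proof -
 obtain V where V: "p : V" "holo_on A V g" using g by (auto simp: holo_near_def)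
 obtain W where W: "p : W" "W <= V" "holo_on A W f" using holo_near_nbhd[OF A f holo_on_mopen[OF V(2)] V(1)] by blast
 thus ?thesis using that[of W] V holo_on_subset[OF V(2) holo_on_mopen[OF W(3)]] by auto
qed

lemma holo_near_const: "p : points A ==> atlas_compat A ==> holo_near A p (%_. c)"
 by (rule holo_nearI[OF _ holo_on_const[THEN iffD2, OF mopen_all]])

lemma holo_near_points: "holo_near A p f ==> p : points A" unfolding holo_near_def using holo_on_mopen mopen_points by blast


subsection \<open>Local isomorphisms\<close>

text \<open>Local biholomorphisms are described by the functions they pull back rather than by
  charts; with \<open>g\<close> constant the equivalence also says that open sets correspond.
  Restriction, inversion and composition become formal.\<close>

definition iso_on :: "('a, 'n::finite) atlas => ('b, 'm::finite) atlas => 'a set => ('a => 'b) => bool" where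
 "iso_on A B W f \<longleftrightarrow> mopen A W & inj_on f W &
  (ALL V g. V <= W --> (holo_on A V (%x. g (f x)) \<longleftrightarrow> holo_on B (f`V) g))"

lemma iso_on_mopen: "iso_on A B W f ==> mopen A W" by (simp add: iso_on_def)

lemma iso_on_inj: "iso_on A B W f ==> inj_on f W" by (simp add: iso_on_def)

lemma iso_on_holo: "iso_on A B W f ==> V <= W ==> holo_on A V (%x. g (f x)) \<longleftrightarrow> holo_on B (f`V) g"
 by (simp add: iso_on_def)

lemma iso_on_mopen_iff: "iso_on A B W f ==> V <= W ==> mopen A V \<longleftrightarrow> mopen B (f`V)"
 using iso_on_holo[of A B W f V "%_. 0"] by simp

lemma iso_on_image_mopen: "iso_on A B W f ==> mopen B (f`W)" using iso_on_mopen_iff[of A B W f W] by (simp add: iso_on_mopen)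

lemma iso_on_subset: "iso_on A B W f ==> mopen A V ==> V <= W ==> iso_on A B V f" unfolding iso_on_def using inj_on_subset by blast

lemma iso_on_holo_inv:
 assumes A: "atlas_compat A" and f: "iso_on A B W f" and V: "V <= W"
 shows "holo_on A V g \<longleftrightarrow> holo_on B (f`V) (%y. g (inv_into W f y))"
proof -
 have "holo_on A V g \<longleftrightarrow> holo_on A V (%x. g (inv_into W f (f x)))"
  by (rule holo_on_cong[OF A]) (use V iso_on_inj[OF f] in \<open>auto simp: subset_iff\<close>)
 thus ?thesis using iso_on_holo[OF f V, of "%y. g (inv_into W f y)"] by simp
qed

lemma iso_on_inv:
 assumes A: "atlas_compat A" and f: "iso_on A B W f"
 shows "iso_on B A (f`W) (inv_into W f)" unfolding iso_on_def
proof (intro conjI allI impI)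
 show "mopen B (f`W)" by (rule iso_on_image_mopen[OF f])
 show "inj_on (inv_into W f) (f`W)" by (rule inj_on_inv_into) simp
 fix V g assume V: "V <= f`W"
 have e: "f`inv_into W f`V = V" by (rule image_inv_into_cancel[OF refl V])
 have "inv_into W f`V <= W" using V by (auto intro: inv_into_into)
 from iso_on_holo_inv[OF A f this, of g]
 show "holo_on B V (%x. g (inv_into W f x)) \<longleftrightarrow> holo_on A (inv_into W f`V) g" by (simp add: e)
qed

lemma iso_on_comp:
 assumes f: "iso_on A B W f" and g: "iso_on B C (f`W) g"
 shows "iso_on A C W (%x. g (f x))" unfolding iso_on_def
proof (intro conjI allI impI)
 show "mopen A W" by (rule iso_on_mopen[OF f])
 show "inj_on (%x. g (f x)) W" using comp_inj_on[OF iso_on_inj[OF f] iso_on_inj[OF g]] by (simp add: o_def)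
 fix V h assume V: "V <= W"
 show "holo_on A V (%x. h (g (f x))) \<longleftrightarrow> holo_on C ((%x. g (f x))`V) h"
  using iso_on_holo[OF f V, of "%x. h (g x)"] iso_on_holo[OF g image_mono[OF V], of h] by (simp add: image_image)
qed

definition affine_atlas :: "(complex ^ 'n::finite, 'n) atlas" where
 "affine_atlas = {(UNIV, %x. x)}"

lemma affine_atlas_compat [simp]: "atlas_compat affine_atlas"
 by (auto simp: affine_atlas_def atlas_compat_def inv_into_def intro!: holo_coord)

lemma holo_on_affine [simp]: "holo_on affine_atlas S f \<longleftrightarrow> holo S f"
 by (auto simp: affine_atlas_def holo_on_def mopen_def points_def inv_into_def holo_open)

lemma mopen_affine [simp]: "mopen affine_atlas S \<longleftrightarrow> open S"
 using holo_on_const[of affine_atlas S 0] holo_on_affine[of S "%_. 0"] by simp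

text \<open>Coordinates are arbitrary isomorphisms onto open sets of coordinate space, not only
  members of the atlas: the proof of flatness works in a chart built from the developing
  map.\<close>

abbreviation coord :: "('a, 'n::finite) atlas => 'a set => ('a => complex ^ 'm::finite) => bool" where
 "coord A U ph \<equiv> iso_on A affine_atlas U ph"

lemma coord_components: "coord A U ph ==> holo_on A U (%p. ph p$i)"
 using iso_on_holo[of A affine_atlas U ph U "%x. x$i"] iso_on_image_mopen[of A affine_atlas U ph] by (simp add: holo_coord)

lemma coord_transition:
 assumes A: "atlas_compat A" and ph: "coord A U ph" and ps: "coord A V ps"
 shows "holo (ph`(U Int V)) (%x. ps (inv_into U ph x)$i)"
proof -
 have "mopen A (U Int V)" by (intro mopen_Int A iso_on_mopen[OF ph] iso_on_mopen[OF ps])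
 hence "holo_on A (U Int V) (%p. ps p$i)" using holo_on_subset[OF coord_components[OF ps]] by blast
 thus ?thesis using iso_on_holo_inv[OF A ph, of "U Int V"] by simp
qed

lemma transition_image:
 assumes "inj_on ph U" "inj_on ps V" "W <= U"
 shows "{x : ph`(U Int V). ps (inv_into U ph x) : ps`(V Int W)} = ph`(W Int V)"
  and "{x : ps`(U Int V). ph (inv_into V ps x) : ph`W} = ps`(V Int W)"
proof -
 have "ps (inv_into U ph (ph p)) : ps`(V Int W) \<longleftrightarrow> p : W" if "p : U Int V" for p
  using that assms by (auto simp: inj_on_image_mem_iff[of ps V])
 thus "{x : ph`(U Int V). ps (inv_into U ph x) : ps`(V Int W)} = ph`(W Int V)" using assms(3) by blast
 have "ph (inv_into V ps (ps p)) : ph`W \<longleftrightarrow> p : W" if "p : U Int V" for p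
  using that assms by (auto simp: inj_on_image_mem_iff[of ph U])
 thus "{x : ps`(U Int V). ph (inv_into V ps x) : ph`W} = ps`(V Int W)" using assms(3) by blast
qed

lemma coordI:
 assumes A: "atlas_compat A" and U: "U <= points A" and inj: "inj_on ph U"
  and tr1: "!!V ps i. (V, ps) : A ==> holo (ph`(U Int V)) (%x. ps (inv_into U ph x)$i)"
  and tr2: "!!V ps i. (V, ps) : A ==> holo (ps`(U Int V)) (%x. ph (inv_into V ps x)$i)"
 shows "coord A U ph"
proof -
 have mU: "mopen A U" using U holo_open[OF tr2] by (auto simp: mopen_def Int_commute)
 have injA: "inj_on ps V" if "(V, ps) : A" for V ps using atlas_inj[OF A that] .
 have "holo_on A W (%x. g (ph x)) \<longleftrightarrow> holo (ph`W) g" if W: "W <= U" for W g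
 proof
  assume h: "holo_on A W (%x. g (ph x))"
  show "holo (ph`W) g"
  proof (rule holo_local)
   fix x assume "x : ph`W"
   then obtain p where p: "p : W" "x = ph p" by blast
   then obtain V ps where v: "(V, ps) : A" "p : V" using W U by (auto simp: points_def)
   have hv: "holo (ps`(V Int W)) (%x. g (ph (inv_into V ps x)))" using h v by (auto simp: holo_on_def)
   let ?T = "{x : ph`(U Int V). ps (inv_into U ph x) : ps`(V Int W)}"
   have T: "?T = ph`(W Int V)" by (rule transition_image(1)[OF inj injA[OF v(1)] W])
   have "open ?T" by (rule open_holo_preimage[OF tr1[OF v(1)] holo_open[OF hv]])
   hence oW: "open (ph`(W Int V))" unfolding T .
   have t1: "holo (ph`(W Int V)) (%x. ps (inv_into U ph x)$i)" for i by (rule holo_subset[OF tr1[OF v(1)] oW]) (use W in blast)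
   have "holo (ph`(W Int V)) (%x. g (ph (inv_into V ps (ps (inv_into U ph x)))))" by (rule holo_compose(1)[OF t1 hv]) (use T in blast)
   moreover have "ph (inv_into V ps (ps (inv_into U ph x))) = x" if "x : ph`(W Int V)" for x
    using that W inj injA[OF v(1)] by (auto simp: subset_iff)
   ultimately have "holo (ph`(W Int V)) g" by (subst holo_cong[of _ g "%x. g (ph (inv_into V ps (ps (inv_into U ph x))))"]) auto
   moreover have "x : ph`(W Int V)" using p v(2) by blast
   moreover have "ph`(W Int V) <= ph`W" by blast
   ultimately show "EX T. x : T & T <= ph`W & holo T g" by metis
  qed
 next
  assume h: "holo (ph`W) g"
  show "holo_on A W (%x. g (ph x))"
  proof (rule holo_onI)
   show "W <= points A" using W U by blast
   fix V ps assume v: "(V, ps) : A"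
   let ?T = "{x : ps`(U Int V). ph (inv_into V ps x) : ph`W}"
   have T: "?T = ps`(V Int W)" by (rule transition_image(2)[OF inj injA[OF v] W])
   have "open ?T" by (rule open_holo_preimage[OF tr2[OF v] holo_open[OF h]])
   hence o: "open (ps`(V Int W))" unfolding T .
   have t2: "holo (ps`(V Int W)) (%x. ph (inv_into V ps x)$i)" for i by (rule holo_subset[OF tr2[OF v] o]) (use W in blast)
   show "holo (ps`(V Int W)) (%x. g (ph (inv_into V ps x)))" by (rule holo_compose(1)[OF t2 h]) (use T in blast)
  qed
 qed
 thus ?thesis unfolding iso_on_def using mU inj by auto
qed

lemma coord_chart: "atlas_compat A ==> (U, ph) : A ==> coord A U ph"
proof (rule coordI)
 assume A: "atlas_compat A" "(U, ph) : A"
 thus "atlas_compat A" "U <= points A" "inj_on ph U" using mopen_points[OF mopen_chart[OF A]] atlas_inj[OF A] by auto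
 show "holo (ph`(U Int V)) (%x. ps (inv_into U ph x)$i)" if "(V, ps) : A" for V ps i using A that by (intro atlas_transition)
 show "holo (ps`(U Int V)) (%x. ph (inv_into V ps x)$i)" if "(V, ps) : A" for V ps i
  using atlas_transition[OF A(1) that A(2)] by (simp add: Int_commute)
qed

lemma coord_at: 
 assumes "atlas_compat A" "p : points A"
 obtains U ph where "(U, ph) : A" "p : U" "coord A U ph"
proof -
 obtain U ph where "(U, ph) : A" "p : U" using assms(2) by (auto simp: points_def)
 with that coord_chart[OF assms(1)] show ?thesis by blast
qed

subsection \<open>Holomorphic maps\<close>

text \<open>Holomorphy of a map at a single point, again in terms of pulled back functions; this is
  the condition under which \<open>tmap\<close> carries tangent vectors to tangent vectors.\<close>

definition smooth_at :: "('a, 'n::finite) atlas => ('b, 'm::finite) atlas => ('a => 'b) => 'a => bool" where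
 "smooth_at A B F p \<longleftrightarrow> (ALL W g. F p : W & holo_on B W g -->
  (EX V. p : V & F`V <= W & holo_on A V (%x. g (F x))))"

lemma smooth_atD:
 "smooth_at A B F p ==> F p : W ==> holo_on B W g ==>
  EX V. p : V & F`V <= W & holo_on A V (%x. g (F x))" by (simp add: smooth_at_def)

lemma smooth_at_near: "smooth_at A B F p ==> holo_near B (F p) g ==> holo_near A p (%x. g (F x))"
 unfolding holo_near_def using smooth_atD by metis

lemma smooth_at_mopen:
 assumes "smooth_at A B F p" "F p : W" "mopen B W"
 obtains V where "p : V" "mopen A V" "F`V <= W" using smooth_atD[OF assms(1,2), of "%_. 0"] assms(3) holo_on_mopen by auto

lemma iso_on_preimage:
 assumes B: "atlas_compat B" and f: "iso_on A B W f" and g: "holo_on B W' g"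
 shows "holo_on A {x : W. f x : W'} (%x. g (f x))"
proof -
 have e: "f`{x : W. f x : W'} = W' Int f`W" by auto
 have "holo_on B (W' Int f`W) g" by (rule holo_on_subset[OF g mopen_Int[OF B holo_on_mopen[OF g] iso_on_image_mopen[OF f]]]) simp
 thus ?thesis using iso_on_holo[OF f, of "{x : W. f x : W'}" g] e by auto
qed

lemma iso_on_smooth:
 assumes B: "atlas_compat B" and f: "iso_on A B W f" and p: "p : W"
 shows "smooth_at A B f p" unfolding smooth_at_def
proof (intro allI impI, elim conjE)
 fix W' g assume "f p : W'" "holo_on B W' g"
 thus "EX V. p : V & f`V <= W' & holo_on A V (%x. g (f x))"
  using iso_on_preimage[OF B f, of W' g] p by (intro exI[of _ "{x : W. f x : W'}"]) auto
qed

lemma holo_map_compose: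
 assumes A: "atlas_compat A" and B: "atlas_compat B"
  and f: "holo_map A B W f" and g: "holo_on B W' g"
 shows "holo_on A {x : W. f x : W'} (%x. g (f x))"
proof (rule holo_on_local)
 fix p assume p: "p : {x : W. f x : W'}"
 have W: "mopen A W" using f by (simp add: holo_map_def)
 obtain U ph where u: "(U, ph) : A" "p : U" "coord A U ph" using coord_at[OF A] p mopen_points[OF W] by blast
 obtain V ps where v: "(V, ps) : B" "f p : V" "coord B V ps" using coord_at[OF B] p mopen_points[OF holo_on_mopen[OF g]] by blast
 let ?S = "ph`(U Int W Int f -` V)"
 let ?F = "%x. ps (f (inv_into U ph x))"
 have F: "holo ?S (%x. ?F x$i)" for i using f u(1) v(1) unfolding holo_map_def by fast
 have g': "holo (ps`(V Int W')) (%y. g (inv_into V ps y))" using g v(1) by (auto simp: holo_on_def)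
 define T where "T = {x : ?S. ?F x : ps`(V Int W')}"
 have T: "open T" unfolding T_def by (rule open_holo_preimage[OF F holo_open[OF g']])
 have FT: "holo T (%x. ?F x$i)" for i by (rule holo_subset[OF F T]) (auto simp: T_def)
 have h: "holo T (%x. g (inv_into V ps (?F x)))" by (rule holo_compose(1)[OF FT g']) (auto simp: T_def)
 let ?N = "U Int W Int f -` (V Int W')"
 have injs: "inj_on ph U" "inj_on ps V" using iso_on_inj[OF u(3)] iso_on_inj[OF v(3)] .
 have TN: "T = ph`?N"
 proof -
  have *: "ps (f q) : ps`(V Int W') \<longleftrightarrow> f q : W'" if "f q : V" for q
   using that inj_on_image_mem_iff[OF injs(2) that, of "V Int W'"] by simp
  show ?thesis
  proof
   show "T <= ph`?N"
   proof
    fix x assume "x : T"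
    then obtain q where q: "q : U" "q : W" "f q : V" "x = ph q" "?F x : ps`(V Int W')" by (auto simp: T_def simp del: image_iff)
    hence "f q : W'" using *[of q] injs(1) by simp
    thus "x : ph`?N" using q by blast
   qed
   show "ph`?N <= T" using injs(1) by (auto simp: T_def)
  qed
 qed
 have "holo (ph`?N) (%x. g (f (inv_into U ph x)))" using h unfolding TN by (rule holo_cong[THEN iffD1, rotated]) (use injs in auto)
 hence "holo_on A ?N (%x. g (f x))" using iso_on_holo_inv[OF A u(3), of ?N "%x. g (f x)"] by (simp add: Int_assoc)
 thus "EX V. p : V & V <= {x : W. f x : W'} & holo_on A V (%x. g (f x))" using p u(2) v(2) by (intro exI[of _ ?N]) auto
qed

lemma holo_map_smooth:
 assumes "atlas_compat A" "atlas_compat B" "holo_map A B W f" "p : W"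
 shows "smooth_at A B f p" unfolding smooth_at_def
proof (intro allI impI, elim conjE)
 fix W' g assume "f p : W'" "holo_on B W' g"
 thus "EX V. p : V & f`V <= W' & holo_on A V (%x. g (f x))"
  using holo_map_compose[OF assms(1-3), of W' g] assms(4) by (intro exI[of _ "{x : W. f x : W'}"]) auto
qed

lemma holo_mapI:
 assumes A: "atlas_compat A" and W: "mopen A W" "f`W <= points B"
  and f: "!!V ps i. (V, ps) : B ==> holo_on A {x : W. f x : V} (%x. ps (f x)$i)"
 shows "holo_map A B W f" unfolding holo_map_def
proof (intro conjI W ballI, safe)
 fix U ph V ps i assume "(U, ph) : A" "(V, ps) : B"
 moreover have "{x : W. f x : V} = W Int f -` V" by auto
 ultimately show "holo (ph`(U Int W Int f -` V)) (%x. ps (f (inv_into U ph x))$i)"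
  using f[of V ps i] by (auto simp: holo_on_def Int_assoc)
qed

lemma iso_on_holo_map:
 assumes A: "atlas_compat A" and B: "atlas_compat B" and f: "iso_on A B W f"
 shows "holo_map A B W f"
proof (rule holo_mapI[OF A iso_on_mopen[OF f] mopen_points[OF iso_on_image_mopen[OF f]]])
 fix V ps i assume "(V, ps) : B"
 hence "holo_on B V (%y. ps y$i)" by (intro coord_components coord_chart B)
 thus "holo_on A {x : W. f x : V} (%x. ps (f x)$i)" by (rule iso_on_preimage[OF B f])
qed

lemma biholo_on_iff_iso_on:
 assumes A: "atlas_compat A" and B: "atlas_compat B"
 shows "biholo_on A B W f \<longleftrightarrow> iso_on A B W f"
proof
 assume f: "iso_on A B W f"
 show "biholo_on A B W f" unfolding biholo_on_def using iso_on_holo_map[OF A B f] iso_on_inj[OF f] iso_on_image_mopen[OF f]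
   iso_on_holo_map[OF B A iso_on_inv[OF A f]] by blast
next
 assume f: "biholo_on A B W f"
 hence fm: "holo_map A B W f" and inj: "inj_on f W" and o: "mopen B (f`W)"
  and im: "holo_map B A (f`W) (inv_into W f)" by (auto simp: biholo_on_def)
 show "iso_on A B W f" unfolding iso_on_def
 proof (intro conjI allI impI)
  show "mopen A W" using fm by (simp add: holo_map_def)
  show "inj_on f W" by (rule inj)
  fix V g assume V: "V <= W"
  have e1: "{x : W. f x : f`V} = V" using V inj by (auto dest: inj_onD)
  have e2: "{y : f`W. inv_into W f y : V} = f`V" using V inj by auto
  show "holo_on A V (%x. g (f x)) \<longleftrightarrow> holo_on B (f`V) g"
  proof
   assume "holo_on B (f`V) g"
   from holo_map_compose[OF A B fm this] show "holo_on A V (%x. g (f x))" unfolding e1 .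
  next
   assume "holo_on A V (%x. g (f x))"
   from holo_map_compose[OF B A im this] have "holo_on B (f`V) (%y. g (f (inv_into W f y)))" unfolding e2 .
   moreover have "f (inv_into W f y) = y" if "y : f`V" for y using that V by (intro f_inv_into_f) blast
   ultimately show "holo_on B (f`V) g" using holo_on_cong[OF B, of "f`V" g "%y. g (f (inv_into W f y))"] by simp
  qed
 qed
qed


subsection \<open>Tangent vectors in coordinates\<close>

lemma tangent_cong:
 "v : tangent A p ==> holo_near A p f ==> mopen A W ==> p : W ==> (!!x. x : W ==> f x = g x) ==> v f = v g" unfolding tangent_def by blast

lemma tangent_add: "v : tangent A p ==> holo_near A p f ==> holo_near A p g ==> v (%x. f x+g x) = v f+v g" by (simp add: tangent_def)

lemma tangent_mult:
 "v : tangent A p ==> holo_near A p f ==> holo_near A p g ==> v (%x. f x * g x) = f p * v g+g p * v f" by (simp add: tangent_def)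

lemma tangent_cmult: "v : tangent A p ==> holo_near A p f ==> v (%x. c * f x) = c * v f" by (simp add: tangent_def)

lemma tangent_not_near: "v : tangent A p ==> \<not> holo_near A p f ==> v f = 0" by (simp add: tangent_def)

lemma tangent_const:
 assumes A: "atlas_compat A" and v: "v : tangent A p"
 shows "v (%_. c) = 0"
proof (cases "p : points A")
 case True
 have 1: "holo_near A p (%_. 1)" by (rule holo_near_const[OF True A])
 have "v (%_. 1) = 0" using tangent_mult[OF v 1 1] by simp
 thus ?thesis using tangent_cmult[OF v 1, of c] by simp
next
 case False
 hence "\<not> holo_near A p (%_. c)" using holo_near_points[of A p "%_. c"] by blast
 thus ?thesis by (rule tangent_not_near[OF v])
qed

lemma holo_near_add: 
 "atlas_compat A ==> holo_near A p f ==> holo_near A p g ==> holo_near A p (%x. f x+g x)"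
 by (erule (2) holo_near2) (auto intro!: holo_nearI holo_on_add)

lemma holo_near_mult: 
 "atlas_compat A ==> holo_near A p f ==> holo_near A p g ==> holo_near A p (%x. f x * g x)"
 by (erule (2) holo_near2) (auto intro!: holo_nearI holo_on_mult)

lemma holo_near_sum:
 assumes A: "atlas_compat A" and "p : points A" "!!i. i : I ==> holo_near A p (f i)"
 shows "holo_near A p (%x. SUM i:I. f i x)" using assms(3)
proof (induction I rule: infinite_finite_induct)
 case (insert i I)
 thus ?case using holo_near_add[OF A, of p "f i"] by simp
qed (simp_all add: holo_near_const[OF assms(2) A])

lemma tangent_sum:
 assumes A: "atlas_compat A" and v: "v : tangent A p" and p: "p : points A"
  and "!!i. i : I ==> holo_near A p (f i)"
 shows "v (%x. SUM i:I. f i x) = (SUM i:I. v (f i))" using assms(4)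
proof (induction I rule: infinite_finite_induct)
 case (insert i I)
 thus ?case using tangent_add[OF v, of "f i"] holo_near_sum[OF A p, of I f] by simp
qed (simp_all add: tangent_const[OF A v])

lemma tangentI:
 assumes "!!f. \<not> holo_near A p f ==> v f = 0"
  and "!!f g W. holo_near A p f ==> mopen A W ==> p : W ==> (!!x. x : W ==> f x = g x) ==> v f = v g"
  and "!!f g. holo_near A p f ==> holo_near A p g ==> v (%x. f x+g x) = v f+v g"
  and "!!f g. holo_near A p f ==> holo_near A p g ==> v (%x. f x * g x) = f p * v g+g p * v f"
  and "!!f c. holo_near A p f ==> v (%x. c * f x) = c * v f"
 shows "v : tangent A p"
proof -
 have *: "ALL f g W. holo_near A p f & mopen A W & p : W & (ALL x:W. f x = g x) --> v f = v g"
 proof (intro allI impI)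
  fix f g W assume "holo_near A p f & mopen A W & p : W & (ALL x:W. f x = g x)"
  thus "v f = v g" by (intro assms(2)[of f W g]) simp_all
 qed
 show ?thesis unfolding tangent_def mem_Collect_eq by (intro conjI[OF _ conjI[OF *]]) (simp_all add: assms(1,3-5))
qed

lemma tmap_tangent:
 assumes A: "atlas_compat A" and B: "atlas_compat B" and F: "smooth_at A B F p" and v: "v : tangent A p"
 shows "tmap B F (F p) v : tangent B (F p)"
proof (rule tangentI)
 fix f g W assume f: "holo_near B (F p) f" and W: "mopen B W" "F p : W" and eq: "!!x. x : W ==> f x = g x"
 have g: "holo_near B (F p) g" using holo_near_cong[OF B W eq] f by simp
 obtain V where V: "p : V" "mopen A V" "F`V <= W" using smooth_at_mopen[OF F W(2,1)] .
 have "v (%x. f (F x)) = v (%x. g (F x))" by (rule tangent_cong[OF v smooth_at_near[OF F f] V(2,1)]) (use V(3) eq in auto)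
 thus "tmap B F (F p) v f = tmap B F (F p) v g" using f g by (simp add: tmap_def)
next
 fix f g assume f: "holo_near B (F p) f" and g: "holo_near B (F p) g"
 note fn = smooth_at_near[OF F f] smooth_at_near[OF F g]
 show "tmap B F (F p) v (%x. f x+g x) = tmap B F (F p) v f+tmap B F (F p) v g"
  using f g holo_near_add[OF B f g] tangent_add[OF v fn] by (simp add: tmap_def)
 show "tmap B F (F p) v (%x. f x * g x) = f (F p) * tmap B F (F p) v g+g (F p) * tmap B F (F p) v f"
  using f g holo_near_mult[OF B f g] tangent_mult[OF v fn] by (simp add: tmap_def)
next
 fix f c assume f: "holo_near B (F p) f"
 have "holo_near B (F p) (%x. c * f x)" by (rule holo_near_mult[OF B holo_near_const[OF holo_near_points[OF f] B] f])
 thus "tmap B F (F p) v (%x. c * f x) = c * tmap B F (F p) v f" using f tangent_cmult[OF v smooth_at_near[OF F f]] by (simp add: tmap_def)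
qed (simp add: tmap_def)

definition cpd :: "'a set => ('a => complex ^ 'n::finite) => 'n => ('a => complex) => 'a => complex" where
 "cpd U ph i f p = pd i (%x. f (inv_into U ph x)) (ph p)"

locale coordinates =
 fixes A :: "('a, 'n::finite) atlas" and U :: "'a set" and ph :: "'a => complex ^ 'm::finite"
 assumes A: "atlas_compat A" and ph: "coord A U ph"
begin

lemma inj: "inj_on ph U" by (rule iso_on_inj[OF ph])

lemma U_mopen: "mopen A U" by (rule iso_on_mopen[OF ph])

lemma U_points: "p : U ==> p : points A" using mopen_points[OF U_mopen] by blast

lemma holo_on_iff: "W <= U ==> holo_on A W f \<longleftrightarrow> holo (ph`W) (%x. f (inv_into U ph x))"
 using iso_on_holo_inv[OF A ph] by simp

lemma mopen_iff: "W <= U ==> mopen A W \<longleftrightarrow> open (ph`W)" using iso_on_mopen_iff[OF ph] by simp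

lemma inv_ph [simp]: "p : U ==> inv_into U ph (ph p) = p" using inj by simp

lemma holo_on_coord: "mopen A W ==> W <= U ==> holo_on A W (%p. ph p$i)" using holo_on_subset[OF coord_components[OF ph]] by blast

lemma coord_near: "p : U ==> holo_near A p (%x. ph x$i)" using holo_nearI[OF _ holo_on_coord[OF U_mopen]] by blast

lemma near: "p : U ==> holo_near A p f ==> EX W. p : W & W <= U & holo_on A W f" using holo_near_nbhd[OF A _ U_mopen] by metis

lemma ball_nbhd:
 assumes W: "mopen A W" "W <= U" and p: "p : W"
 obtains e V where "e > 0" "p : V" "V <= W" "mopen A V" "ph`V = ball (ph p) e"
proof -
 have "open (ph`W)" using W mopen_iff by blast
 then obtain e where e: "e > 0" "ball (ph p) e <= ph`W" using p open_contains_ball by blast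
 let ?V = "{x : W. ph x : ball (ph p) e}"
 have im: "ph`?V = ball (ph p) e" using e by blast
 have "?V <= U" using W by blast
 hence "mopen A ?V" using mopen_iff[of ?V] im by simp
 thus ?thesis using that[of e ?V] e p im by auto
qed

lemma cpd_cong:
 assumes "mopen A W" "p : W" "p : U" "!!x. x : W ==> f x = g x"
 shows "cpd U ph i f p = cpd U ph i g p"
proof -
 have m: "mopen A (W Int U)" by (rule mopen_Int[OF A assms(1) U_mopen])
 hence o: "open (ph`(W Int U))" using mopen_iff[of "W Int U"] by simp
 show ?thesis unfolding cpd_def by (rule pd_cong[OF o]) (use assms in auto)
qed

lemma
 assumes p: "p : U" and f: "holo_near A p f"
 shows cpd_add: "holo_near A p g ==> cpd U ph i (%x. f x+g x) p = cpd U ph i f p+cpd U ph i g p"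
  and cpd_mult: "holo_near A p g ==> cpd U ph i (%x. f x * g x) p = f p * cpd U ph i g p+g p * cpd U ph i f p"
  and cpd_cmult: "cpd U ph i (%x. c * f x) p = c * cpd U ph i f p"
proof -
 have *: "EX S. ph p : S & holo S (%x. f (inv_into U ph x)) & holo S (%x. g (inv_into U ph x))"
  if g: "holo_near A p g" for g
 proof -
  obtain W where W: "p : W" "holo_on A W f" "holo_on A W g" using holo_near2[OF A f g] .
  have m: "mopen A (W Int U)" by (rule mopen_Int[OF A holo_on_mopen[OF W(2)] U_mopen])
  have "holo_on A (W Int U) f" "holo_on A (W Int U) g" using holo_on_subset[OF W(2) m] holo_on_subset[OF W(3) m] by auto
  thus ?thesis using W p holo_on_iff[of "W Int U"] by (intro exI[of _ "ph`(W Int U)"]) auto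
 qed
 show "cpd U ph i (%x. f x+g x) p = cpd U ph i f p+cpd U ph i g p" if g: "holo_near A p g"
 proof -
  obtain S where S: "ph p : S" "holo S (%x. f (inv_into U ph x))" "holo S (%x. g (inv_into U ph x))" using *[OF g] by blast
  show ?thesis unfolding cpd_def by (rule holo_add(2)[OF S(2,3,1)])
 qed
 show "cpd U ph i (%x. f x * g x) p = f p * cpd U ph i g p+g p * cpd U ph i f p" if g: "holo_near A p g"
 proof -
  obtain S where S: "ph p : S" "holo S (%x. f (inv_into U ph x))" "holo S (%x. g (inv_into U ph x))" using *[OF g] by blast
  show ?thesis unfolding cpd_def using holo_mult(2)[OF S(2,3,1)] p by simp
 qed
 show "cpd U ph i (%x. c * f x) p = c * cpd U ph i f p"
 proof -
  obtain S where S: "ph p : S" "holo S (%x. f (inv_into U ph x))" using *[OF f] by blast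
  show ?thesis unfolding cpd_def by (rule holo_cmult(2)[OF S(2,1)])
 qed
qed

lemma cpd_const [simp]: "cpd U ph i (%_. c) p = 0" by (simp add: cpd_def)

lemma cpd_compose:
 assumes p: "p : U" and h: "holo S h" "ph p : S"
 shows "cpd U ph i (%x. h (ph x)) p = pd i h (ph p)"
proof -
 have oU: "open (ph`U)" using mopen_iff[of U] U_mopen by simp
 show ?thesis unfolding cpd_def by (rule pd_cong[OF oU]) (use p in \<open>auto simp: f_inv_into_f\<close>)
qed

lemma cpd_coord:
 assumes p: "p : U"
 shows "cpd U ph i (%x. ph x$k) p = (if i = k then 1 else 0)"
 using cpd_compose[OF p holo_coord[OF open_UNIV], of i k] by (simp add: pd_coord)

lemma holo_on_cpd:
 assumes W: "W <= U" and f: "holo_on A W f"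
 shows "holo_on A W (cpd U ph i f)"
proof -
 have "holo (ph`W) (pd i (%x. f (inv_into U ph x)))" using f holo_on_iff[OF W] by (intro holo_pd) simp
 hence "holo_on A W (%x. pd i (%x. f (inv_into U ph x)) (ph x))" using iso_on_holo[OF ph W] by simp
 thus ?thesis by (simp add: cpd_def[abs_def])
qed

lemma cpd_sum:
 assumes p: "p : U" and "!!k. k : I ==> holo_near A p (f k)"
 shows "cpd U ph i (%x. SUM k:I. f k x) p = (SUM k:I. cpd U ph i (f k) p)" using assms(2)
proof (induction I rule: infinite_finite_induct)
 case (insert k I)
 thus ?case using cpd_add[OF p, of "f k" "%x. SUM k:I. f k x"] holo_near_sum[OF A U_points[OF p], of I f] by simp
qed simp_all

lemma cpd_commute:
 assumes p: "p : U" and f: "holo_near A p f"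
 shows "cpd U ph j (cpd U ph i f) p = cpd U ph i (cpd U ph j f) p"
proof -
 obtain W where W: "p : W" "W <= U" "holo_on A W f" using near[OF p f] by blast
 let ?f = "%x. f (inv_into U ph x)"
 have h: "holo (ph`W) ?f" using W holo_on_iff by blast
 have "cpd U ph j (cpd U ph i f) p = pd j (pd i ?f) (ph p)" for i j unfolding cpd_def[of _ _ j]
  by (rule pd_cong[OF holo_open[OF h]]) (use W inj in \<open>auto simp: cpd_def inj_on_subset\<close>)
 thus ?thesis using pd_commute[OF h, of "ph p"] W by simp
qed

text \<open>In Hadamard's decomposition of \<open>f\<close> a derivation kills the constant term,
  and since the factors \<open>ph x$i - ph p$i\<close> vanish at \<open>p\<close>, the Leibniz rule
  leaves the values of the other factors at \<open>p\<close>, which are the partial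
  derivatives.\<close>

lemma tangent_expand:
 assumes p: "p : U" and v: "v : tangent A p" and f: "holo_near A p f"
 shows "v f = (SUM i. v (%x. ph x$i) * cpd U ph i f p)"
proof -
 obtain W where W: "p : W" "W <= U" "holo_on A W f" using near[OF p f] by blast
 obtain e V where V: "e > 0" "p : V" "V <= W" "mopen A V" "ph`V = ball (ph p) e" using ball_nbhd[OF holo_on_mopen[OF W(3)] W(2,1)] .
 have VU: "V <= U" using V W by blast
 let ?f = "%x. f (inv_into U ph x)"
 have h: "holo (ball (ph p) e) ?f" using holo_on_iff[OF VU, of f] holo_on_subset[OF W(3) V(4,3)] V(5) by simp
 obtain g where g: "!!i. holo (ball (ph p) e) (g i)" "!!i. g i (ph p) = pd i ?f (ph p)"
  "!!x. x : ball (ph p) e ==> ?f x = ?f (ph p)+(SUM i. (x$i - ph p$i) * g i x)" using Hadamard[OF h] by blast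
 have fV: "f x = f p+(SUM i. (ph x$i+- ph p$i) * g i (ph x))" if "x : V" for x
 proof -
  have "ph x : ball (ph p) e" using that V(5) by blast
  from g(3)[OF this] show ?thesis using that VU p by (simp add: subset_iff)
 qed
 have gV: "holo_on A V (%x. g i (ph x))" for i using iso_on_holo[OF ph VU, of "g i"] g(1) V(5) by simp
 have gn: "holo_near A p (%x. g i (ph x))" for i by (rule holo_nearI[OF V(2) gV])
 have pp: "p : points A" by (rule U_points[OF p])
 have cn: "holo_near A p (%x. c)" for c by (rule holo_near_const[OF pp A])
 have dn: "holo_near A p (%x. ph x$i+- ph p$i)" for i by (rule holo_near_add[OF A coord_near[OF p] cn])
 have mn: "holo_near A p (%x. (ph x$i+- ph p$i) * g i (ph x))" for i by (rule holo_near_mult[OF A dn gn])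
 have "v f = v (%x. f p+(SUM i. (ph x$i+- ph p$i) * g i (ph x)))" by (rule tangent_cong[OF v f V(4,2) fV])
 also have "... = v (%x. f p)+(SUM i. v (%x. (ph x$i+- ph p$i) * g i (ph x)))"
  by (subst tangent_add[OF v cn holo_near_sum[OF A pp mn]], subst tangent_sum[OF A v pp mn]) simp
 also have "... = (SUM i. g i (ph p) * v (%x. ph x$i+- ph p$i))" by (simp only: tangent_mult[OF v dn gn] tangent_const[OF A v]) simp
 also have "... = (SUM i. v (%x. ph x$i) * cpd U ph i f p)"
  by (simp only: tangent_add[OF v coord_near[OF p] cn] tangent_const[OF A v]) (simp add: g(2) cpd_def mult.commute)
 finally show ?thesis .
qed

definition tvec :: "'a => ('m => complex) => 'a tvec" where
 "tvec p a = (%f. if holo_near A p f then SUM i. a i * cpd U ph i f p else 0)"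

lemma tvec_tangent:
 assumes p: "p : U"
 shows "tvec p a : tangent A p"
proof (rule tangentI)
 fix f g W assume f: "holo_near A p f" and W: "mopen A W" "p : W" and eq: "!!x. x : W ==> f x = g x"
 have g: "holo_near A p g" using holo_near_cong[OF A W eq] f by simp
 show "tvec p a f = tvec p a g" using f g cpd_cong[OF W p eq] by (simp add: tvec_def)
next
 fix f g assume f: "holo_near A p f" and g: "holo_near A p g"
 show "tvec p a (%x. f x+g x) = tvec p a f+tvec p a g"
  using f g holo_near_add[OF A f g] by (simp add: tvec_def cpd_add[OF p f g] distrib_left sum.distrib)
 show "tvec p a (%x. f x * g x) = f p * tvec p a g+g p * tvec p a f" using f g holo_near_mult[OF A f g]
  by (simp add: tvec_def cpd_mult[OF p f g] distrib_left sum.distrib sum_distrib_left mult_ac)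
next
 fix f c assume f: "holo_near A p f"
 have "holo_near A p (%x. c * f x)" by (rule holo_near_mult[OF A holo_near_const[OF holo_near_points[OF f] A] f])
 thus "tvec p a (%x. c * f x) = c * tvec p a f" using f by (simp add: tvec_def cpd_cmult[OF p f] sum_distrib_left mult_ac)
qed (simp add: tvec_def)

lemma tvec_coord: "p : U ==> tvec p a (%x. ph x$i) = a i" by (simp add: tvec_def coord_near cpd_coord if_mult_right cong: if_cong)

lemma tvec_eq:
 assumes "p : U" "v : tangent A p"
 shows "v = tvec p (%i. v (%x. ph x$i))"
proof
 fix f show "v f = tvec p (%i. v (%x. ph x$i)) f" using tangent_expand[OF assms] tangent_not_near[OF assms(2)] by (simp add: tvec_def)
qed

lemma tangent_eqI:
 assumes "p : U" "v : tangent A p" "w : tangent A p" "!!i. v (%x. ph x$i) = w (%x. ph x$i)"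
 shows "v = w" using tvec_eq[OF assms(1,2)] tvec_eq[OF assms(1,3)] assms(4) by simp

definition vf :: "'a set => ('m => 'a => complex) => 'a vfield" where
 "vf V a = (%p. if p : V then tvec p (%i. a i p) else 0)"

lemma vf_vfields:
 assumes V: "mopen A V" "V <= U" and a: "!!i. holo_on A V (a i)"
 shows "vf V a : vfields A V" unfolding vfields_def
proof (safe)
 show "vf V a p : tangent A p" if "p : V" for p using that V tvec_tangent by (auto simp: vf_def)
 show "vf V a p = 0" if "p ~: V" for p using that by (simp add: vf_def)
 fix V' f assume V': "V' <= V" and f: "holo_on A V' f"
 have "holo_on A V' (%p. SUM i. a i p * cpd U ph i f p)"
  using V' V f by (intro holo_on_sum holo_on_mult holo_on_subset[OF a] holo_on_cpd holo_on_mopen[OF f]) auto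
 thus "holo_on A V' (%p. vf V a p f)"
  by (rule holo_on_cong[OF A, THEN iffD1, rotated]) (use V' holo_nearI[OF _ f] in \<open>auto simp: vf_def tvec_def\<close>)
qed

lemma vfields_comp:
 assumes X: "X : vfields A V" and V: "mopen A V" "V <= U"
 shows "holo_on A V (%p. X p (%x. ph x$i))" "X = vf V (%i p. X p (%x. ph x$i))"
proof -
 show "holo_on A V (%p. X p (%x. ph x$i))"
 proof -
  have "ALL W f. W <= V & holo_on A W f --> holo_on A W (%p. X p f)" using X by (simp add: vfields_def)
  thus ?thesis using holo_on_coord[OF V, of i] by simp
 qed
 show "X = vf V (%i p. X p (%x. ph x$i))"
 proof
  fix p show "X p = vf V (%i p. X p (%x. ph x$i)) p" using X tvec_eq[of p "X p"] V by (auto simp: vf_def vfields_def)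
 qed
qed

end

section \<open>Alternating forms of top degree\<close>

definition lin_closed :: "(complex => 'v => 'v) => 'v::ab_group_add set => bool" where
 "lin_closed sc T \<longleftrightarrow> 0 : T & (ALL x:T. ALL y:T. x+y : T) & (ALL c. ALL x:T. sc c x : T)"

lemma lin_closed_sum:
 "lin_closed sc T ==> (!!k. k : K ==> x k : T) ==> (SUM k:K. sc (a k) (x k)) : T"
 by (induction K rule: infinite_finite_induct) (auto simp: lin_closed_def)

lemma multilinear_add:
 "om : multilinear_forms sc T ==> ALL j. v j : T ==> x : T ==> y : T ==>
  om (v(i := x+y)) = om (v(i := x)) + om (v(i := y))" by (simp add: multilinear_forms_def)

lemma multilinear_scale:
 "om : multilinear_forms sc T ==> ALL j. v j : T ==> x : T ==> om (v(i := sc c x)) = c * om (v(i := x))"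
 by (simp add: multilinear_forms_def)

lemma alternating_multilinear: "om : alternating_forms sc T ==> om : multilinear_forms sc T" by (simp add: alternating_forms_def)

lemma alternating_same: "om : alternating_forms sc T ==> i ~= j ==> v i = v j ==> om v = 0" unfolding alternating_forms_def by blast

lemma multilinear_outside: "om : multilinear_forms sc T ==> v i ~: T ==> om v = 0" unfolding multilinear_forms_def by blast

lemma alternating_formsI:
 assumes "!!v i. v i ~: T ==> om v = 0"
  and "!!v i x y. ALL j. v j : T ==> x : T ==> y : T ==> om (v(i := x+y)) = om (v(i := x)) + om (v(i := y))"
  and "!!v i x c. ALL j. v j : T ==> x : T ==> om (v(i := sc c x)) = c * om (v(i := x))"
  and "!!v i j. i ~= j ==> v i = v j ==> om v = 0"
 shows "om : alternating_forms sc T" unfolding alternating_forms_def multilinear_forms_def mem_Collect_eq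
 by (intro conjI allI impI; (elim conjE exE)?) (rule assms; assumption)+

lemma multilinear_sum:
 assumes om: "om : multilinear_forms sc T" and T: "lin_closed sc T" and v: "ALL j. v j : T"
  and x: "!!k. k : K ==> x k : T"
 shows "om (v(i := SUM k:K. sc (a k) (x k))) = (SUM k:K. a k * om (v(i := x k)))" using x
proof (induction K rule: infinite_finite_induct)
 case (insert k K)
 have "sc (a k) (x k) : T" "(SUM k:K. sc (a k) (x k)) : T"
  using T insert.prems lin_closed_sum[OF T, of K x a] by (auto simp: lin_closed_def)
 thus ?case using insert by (simp add: multilinear_add[OF om v] multilinear_scale[OF om v] del: fun_upd_apply)
next
 case empty
 have "0 : T" using T by (simp add: lin_closed_def)
 from multilinear_add[OF om v this this, of i] show ?case by (simp del: fun_upd_apply)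
next
 case (infinite K)
 have "0 : T" using T by (simp add: lin_closed_def)
 from multilinear_add[OF om v this this, of i] show ?case using infinite by (simp del: fun_upd_apply)
qed

lemma alternating_swap:
 assumes om: "om : alternating_forms sc T" and T: "lin_closed sc T" and v: "ALL j. v j : T" and ij: "i ~= j"
  and x: "x : T" and y: "y : T"
 shows "om (v(i := x, j := y)) = - om (v(i := y, j := x))"
proof -
 note m = multilinear_add[OF alternating_multilinear[OF om]]
 have xy: "x+y : T" using T x y by (simp add: lin_closed_def)
 have up: "ALL k. (v(l := z)) k : T" if "z : T" for z l using that v by auto
 have z: "om (v(i := w, j := w)) = 0" for w by (rule alternating_same[OF om ij]) simp
 have "0 = om (v(i := x+y, j := x+y))" using z by simp
 also have "... = om ((v(j := x))(i := x+y)) + om ((v(j := y))(i := x+y))"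
  using m[OF up[OF xy, of i] x y, where i=j] ij by (simp add: fun_upd_twist del: fun_upd_apply)
 also have "... = om (v(i := x, j := y)) + om (v(i := y, j := x))"
  using m[OF up[OF x, of j] x y, where i=i] m[OF up[OF y, of j] x y, where i=i] z ij by (simp add: fun_upd_twist del: fun_upd_apply)
 finally show ?thesis by (simp add: eq_neg_iff_add_eq_0)
qed

text \<open>Expanding one slot after another in the spanning family reduces to arguments
  \<open>b (f i)\<close>. If \<open>f\<close> is not injective, two arguments agree; otherwise it is
  a permutation, a product of transpositions, each of which only changes the sign.\<close>

lemma alternating_vanishes:
 fixes om :: "('i::finite => 'v::ab_group_add) => complex"
 assumes om: "om : alternating_forms sc T" and T: "lin_closed sc T"
  and b: "!!i. b i : T" and span: "!!x. x : T ==> EX a. x = (SUM i. sc (a i) (b i))"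
  and 0: "om b = 0"
 shows "om v = 0"
proof -
 note omm = alternating_multilinear[OF om]
 have perm: "ALL c. (ALL i. c i : T) --> om c = 0 --> om (c \<circ> p) = 0" if "p permutes UNIV" for p using that finite[of UNIV]
 proof (induction rule: permutes_induct)
  case (swap i j p)
  show ?case
  proof (intro allI impI)
   fix c assume c: "ALL i. c i : T" "om c = 0"
   have "c \<circ> Transposition.transpose i j = c(i := c j, j := c i)" by (auto simp: Transposition.transpose_def)
   moreover have "om (c(i := c j, j := c i)) = - om (c(i := c i, j := c j))" by (rule alternating_swap[OF om T]) (use c swap in auto)
   ultimately have z: "om (c \<circ> Transposition.transpose i j) = 0" using c(2) by simp
   have "om ((c \<circ> Transposition.transpose i j) \<circ> p) = 0" by (rule swap.IH[THEN spec, THEN mp, THEN mp, OF _ z]) (simp add: c(1))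
   thus "om (c \<circ> (Transposition.transpose i j \<circ> p)) = 0" by (simp only: o_assoc)
  qed
 qed simp
 have "ALL v. (ALL j. v j : T) --> (ALL j. j ~: J --> v j : range b) --> om v = 0" for J :: "'i set"
 proof (induction J rule: finite_induct[OF finite])
  case 1
  show ?case
  proof (intro allI impI)
   fix v :: "'i => 'v" assume "ALL j. v j : T" and "ALL j. j ~: {} --> v j : range b"
   hence "ALL j. EX i. v j = b i" by (simp add: image_iff)
   from choice[OF this] obtain f where f: "ALL j. v j = b (f j)" by blast
   show "om v = 0"
   proof (cases "inj f")
    case True
    hence "bij f" by (simp add: bij_def finite_UNIV_inj_surj)
    hence "f permutes UNIV" by (simp add: permutes_def bij_iff)
    have "om (b \<circ> f) = 0" by (rule perm[THEN spec, THEN mp, THEN mp, OF \<open>f permutes UNIV\<close>]) (use 0 b in auto)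
    moreover have "b \<circ> f = v" using f by (simp add: fun_eq_iff)
    ultimately show ?thesis by simp
   next
    case False
    then obtain i j where "i ~= j" "f i = f j" by (auto simp: inj_def)
    thus ?thesis using alternating_same[OF om, of i j v] f by simp
   qed
  qed
 next
  case (2 j J)
  show ?case
  proof (intro allI impI)
   fix v :: "'i => 'v" assume v: "ALL j. v j : T" and r: "ALL i. i ~: insert j J --> v i : range b"
   obtain a where a: "v j = (SUM i. sc (a i) (b i))" using span v by blast
   have "om v = om (v(j := SUM i. sc (a i) (b i)))" using fun_upd_triv[of v j] a by simp
   also have "... = (SUM i. a i * om (v(j := b i)))" by (rule multilinear_sum[OF omm T]) (use v b in auto)
   also have "... = 0"
   proof (rule sum.neutral, safe)
    fix i
    have "om (v(j := b i)) = 0" by (rule 2(3)[rule_format]) (use v b r in auto)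
    thus "a i * om (v(j := b i)) = 0" by simp
   qed
   finally show "om v = 0" .
  qed
 qed
 from this[of UNIV] have "om v = 0" if "ALL j. v j : T" using that by auto
 moreover have "om v = 0" if "\<not> (ALL j. v j : T)" using omm that by (auto simp: multilinear_forms_def)
 ultimately show ?thesis by blast
qed

text \<open>The difference \<open>om - om b * et\<close> vanishes on \<open>b\<close>, hence
  everywhere. So forms of top degree make up a line.\<close>

lemma alternating_proportional:
 fixes om et :: "('i::finite => 'v::ab_group_add) => complex"
 assumes om: "om : alternating_forms sc T" and et: "et : alternating_forms sc T" and T: "lin_closed sc T"
  and b: "!!i. b i : T" and span: "!!x. x : T ==> EX a. x = (SUM i. sc (a i) (b i))"
  and 1: "et b = 1"
 shows "om = (%v. om b * et v)"
proof
 fix v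
 have "(%v. om v - om b * et v) : alternating_forms sc T" using alternating_multilinear[OF om] alternating_multilinear[OF et]
  by (intro alternating_formsI)
   (simp_all add: multilinear_outside multilinear_add multilinear_scale
    alternating_same[OF om] alternating_same[OF et] algebra_simps del: fun_upd_apply)
 hence "(%v. om v - om b * et v) v = 0"
 proof (rule alternating_vanishes[OF _ T])
  show "b i : T" for i by (rule b)
  show "EX a. x = (SUM i. sc (a i) (b i))" if "x : T" for x by (rule span[OF that])
 qed (simp add: 1)
 thus "om v = om b * et v" by simp
qed

lemma tangent_lin_closed:
 assumes A: "atlas_compat A"
 shows "lin_closed vscale (tangent A p)" unfolding lin_closed_def
proof (intro conjI ballI allI)
 show "0 : tangent A p" by (rule tangentI) simp_all
 show "v+w : tangent A p" if v: "v : tangent A p" and w: "w : tangent A p" for v w by (rule tangentI)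
   (simp_all add: tangent_not_near[OF v] tangent_not_near[OF w] tangent_add[OF v] tangent_add[OF w]
    tangent_mult[OF v] tangent_mult[OF w] tangent_cmult[OF v] tangent_cmult[OF w]
    tangent_cong[OF v] tangent_cong[OF w] algebra_simps)
 show "vscale c v : tangent A p" if v: "v : tangent A p" for c v by (rule tangentI)
   (simp_all add: vscale_def tangent_not_near[OF v] tangent_add[OF v]
    tangent_mult[OF v] tangent_cmult[OF v] tangent_cong[OF v] algebra_simps)
qed

lemma sum_fun_apply: "(SUM i:I. f i) x = (SUM i:I. f i x)" by (induction I rule: infinite_finite_induct) auto

context coordinates
begin

definition bvec :: "'m => 'a => 'a tvec" where
 "bvec i p = tvec p (%k. if k = i then 1 else 0)"

lemma bvec_tangent: "p : U ==> bvec i p : tangent A p" unfolding bvec_def by (rule tvec_tangent)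

lemma bvec_coord: "p : U ==> bvec i p (%x. ph x$k) = (if k = i then 1 else 0)" by (simp add: bvec_def tvec_coord)

lemma bvec_apply: "holo_near A p f ==> bvec i p f = cpd U ph i f p" by (simp add: bvec_def tvec_def if_mult_left cong: if_cong)

lemma tvec_sum_bvec: "tvec p a = (SUM i. vscale (a i) (bvec i p))"
 by (rule ext) (simp add: sum_fun_apply vscale_def tvec_def bvec_apply, simp add: bvec_def tvec_def)

lemma tangent_span: "p : U ==> v : tangent A p ==> EX a. v = (SUM i. vscale (a i) (bvec i p))" using tvec_eq tvec_sum_bvec by metis

end

lemma coord_form_alternating:
 fixes A :: "('a, 'b::finite) atlas"
 assumes A: "atlas_compat A"
 shows "coord_form A ph p : nforms_at A p"
proof -
 let ?M = "%v. (\<chi> i. \<chi> j. v j (%x. ph x$i)) :: complex^'b^'b"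
 \<comment> \<open>The arguments are the columns of the matrix; transposing turns them into rows, to
   which \<open>det_row_add\<close> and \<open>det_row_mul\<close> apply.\<close>
 have tr: "det (?M v) = det (\<chi> j. \<chi> i. v j (%x. ph x$i))" for v :: "'b => 'a tvec"
  using det_transpose[of "?M v"] by (simp add: transpose_def)
 have T: "x+y : tangent A p" "vscale c x : tangent A p" if "x : tangent A p" "y : tangent A p" for x y c
  using tangent_lin_closed[OF A, of p] that by (auto simp: lin_closed_def)
 have row: "(\<chi> j. \<chi> i. (v(k := x)) j (%x. ph x$i)) =
  (\<chi> j. if j = k then (\<chi> i. x (%x. ph x$i)) else (\<chi> i. v j (%x. ph x$i)))" for v :: "'b => 'a tvec" and k x
  by (simp add: vec_eq_iff)
 have cfM: "coord_form A ph p w = det (?M w)" if "ALL j. w j : tangent A p" for w using that by (simp add: coord_form_def)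
 have upd: "ALL j. (v(i := x)) j : tangent A p" if "ALL j. v j : tangent A p" "x : tangent A p" for v :: "'b => 'a tvec" and x i
  using that by simp
 show ?thesis unfolding nforms_at_def alternating_forms_def multilinear_forms_def mem_Collect_eq
 proof (intro conjI allI impI; (elim conjE exE)?)
  fix v :: "'b => 'a tvec" and i assume "v i ~: tangent A p"
  thus "coord_form A ph p v = 0" by (auto simp: coord_form_def)
 next
  fix v :: "'b => 'a tvec" and i and x y :: "'a tvec" assume v: "ALL j. v j : tangent A p" "x : tangent A p" "y : tangent A p"
  have "det (?M (v(i := x+y))) = det (?M (v(i := x)))+det (?M (v(i := y)))"
   unfolding tr row by (subst det_row_add[symmetric]) (simp add: vec_eq_iff plus_vec_def cong: if_cong)
  thus "coord_form A ph p (v(i := x+y)) = coord_form A ph p (v(i := x))+coord_form A ph p (v(i := y))"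
   using cfM[OF upd[OF v(1), of "x+y" i]] cfM[OF upd[OF v(1,2), of i]] cfM[OF upd[OF v(1,3), of i]] T(1)[OF v(2,3)] by argo
 next
  fix v :: "'b => 'a tvec" and i and x :: "'a tvec" and c assume v: "ALL j. v j : tangent A p" "x : tangent A p"
  have "det (?M (v(i := vscale c x))) = c * det (?M (v(i := x)))"
   unfolding tr row by (subst det_row_mul[symmetric]) (simp add: vec_eq_iff vscale_def vector_scalar_mult_def cong: if_cong)
  thus "coord_form A ph p (v(i := vscale c x)) = c * coord_form A ph p (v(i := x))"
   using cfM[OF upd[OF v(1), of "vscale c x" i]] cfM[OF upd[OF v(1,2), of i]] T(2)[OF v(2,2), of c] by argo
 next
  fix v :: "'b => 'a tvec" and i j assume "i ~= j" "v i = v j"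
  hence "det (?M v) = 0" by (intro det_identical_columns[of i j]) (simp_all add: column_def)
  thus "coord_form A ph p v = 0" by (simp add: coord_form_def)
 qed
qed

section \<open>Coordinates on the principal bundle\<close>

lemma nforms_at_add: "om : nforms_at A p ==> et : nforms_at A p ==> om+et : nforms_at A p" unfolding nforms_at_def
 by (intro alternating_formsI; drule (1) conjI; elim conjE; (frule alternating_multilinear)?)
  (simp_all add: multilinear_outside[OF alternating_multilinear] multilinear_add[OF alternating_multilinear]
   multilinear_scale[OF alternating_multilinear] alternating_same algebra_simps del: fun_upd_apply)

lemma nforms_at_scale: "om : nforms_at A p ==> (%v. c * om v) : nforms_at A p" unfolding nforms_at_def by (intro alternating_formsI)
  (simp_all add: multilinear_outside[OF alternating_multilinear] multilinear_add[OF alternating_multilinear]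
   multilinear_scale[OF alternating_multilinear] alternating_same algebra_simps del: fun_upd_apply)

lemma holo_on_det:
 fixes M :: "'a => complex ^ 'k::finite ^ 'k"
 assumes W: "mopen A W" and M: "!!i j. holo_on A W (%p. M p$i$j)"
 shows "holo_on A W (%p. det (M p))" unfolding det_def by (intro holo_on_sum holo_on_mult holo_on_prod M W) (simp add: W)

definition dchart :: "('a, 'n::finite) atlas => ('a => complex ^ 'n) => ('a, 'n) dpoint => complex ^ 'n option" where
 "dchart A ph x = (\<chi> k. case k of None => snd x (coord_form A ph (fst x)) | Some i => ph (fst x)$i)"

lemma det_atlas_eq: "det_atlas A = {(det_over A U, dchart A ph) | U ph. (U, ph) : A}" unfolding det_atlas_def dchart_def[abs_def] ..

definition base_part :: "complex ^ ('n::finite option) => complex ^ 'n" where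
 "base_part y = (\<chi> i. y$Some i)"

lemma base_part_nth [simp]: "base_part y$i = y$Some i" by (simp add: base_part_def)

lemma dchart_nth [simp]:
 "dchart A ph x$None = snd x (coord_form A ph (fst x))" "dchart A ph x$Some i = ph (fst x)$i" by (simp_all add: dchart_def)

lemma base_part_dchart [simp]: "base_part (dchart A ph x) = ph (fst x)" by (simp add: vec_eq_iff)

lemma det_over_mono: "V <= W ==> det_over A V <= det_over A W" by (auto simp: det_over_def)

lemma det_over_Int: "det_over A V Int det_over A W = det_over A (V Int W)" by (auto simp: det_over_def)

lemma det_over_fst: "x : det_over A V ==> fst x : V" by (auto simp: det_over_def)

lemma det_over_iff: "x : det_over A W ==> x : det_over A V \<longleftrightarrow> fst x : V" by (auto simp: det_over_def)

locale chart = coordinates A U ph for A :: "('a, 'n::finite) atlas" and U and ph :: "'a => complex ^ 'n"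
begin

abbreviation "cf \<equiv> coord_form A ph"

lemma cf_bvec: "p : U ==> cf p (%i. bvec i p) = 1"
proof -
 assume p: "p : U"
 have "(\<chi> i j. bvec j p (%x. ph x$i)) = (mat 1 :: complex ^ 'n ^ 'n)" by (simp add: vec_eq_iff mat_def bvec_coord[OF p])
 thus ?thesis using bvec_tangent[OF p] by (simp add: coord_form_def)
qed

lemma cf_nform: "cf p : nforms_at A p" by (rule coord_form_alternating[OF A])

lemma nform_eq:
 assumes p: "p : U" and om: "om : nforms_at A p"
 shows "om = (%v. om (%i. bvec i p) * cf p v)"
proof (rule alternating_proportional[OF om[unfolded nforms_at_def] cf_nform[unfolded nforms_at_def] tangent_lin_closed[OF A]])
 show "bvec i p : tangent A p" for i by (rule bvec_tangent[OF p])
 show "EX a. x = (SUM i. vscale (a i) (bvec i p))" if "x : tangent A p" for x by (rule tangent_span[OF p that])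
 show "cf p (%i. bvec i p) = 1" by (rule cf_bvec[OF p])
qed

text \<open>This is \<open>c\<close> times the exterior product of the coordinate fields, in the
  dual description of multivectors; \<open>nv p 1\<close> is the local section of
  \<open>det(TM)\<close> dual to \<open>cf\<close>.\<close>

definition nv :: "'a => complex => ('a, 'n) nvec" where
 "nv p c = (%om. if om : nforms_at A p then c * om (%i. bvec i p) else 0)"

lemma nv_mem: "nv p c : nvecs_at A p" unfolding nvecs_at_def exterior_power_def dual_of_def nforms_at_def[symmetric]
 by (auto simp: nv_def nforms_at_add nforms_at_scale algebra_simps)

lemma nv_cf: "p : U ==> nv p c (cf p) = c" by (simp add: nv_def cf_nform cf_bvec)

lemma nvec_scale: "e : nvecs_at A p ==> om : nforms_at A p ==> e (%v. c * om v) = c * e om"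
 unfolding nvecs_at_def exterior_power_def dual_of_def nforms_at_def by blast

lemma nvec_form:
 assumes p: "p : U" and e: "e : nvecs_at A p" and om: "om : nforms_at A p"
 shows "e om = om (%i. bvec i p) * e (cf p)" using nvec_scale[OF e cf_nform, of "om (%i. bvec i p)"] nform_eq[OF p om] by metis

lemma nvec_eq: "p : U ==> e : nvecs_at A p ==> e = nv p (e (cf p))"
proof
 fix om assume p: "p : U" and e: "e : nvecs_at A p"
 show "e om = nv p (e (cf p)) om"
 proof (cases "om : nforms_at A p")
  case True
  thus ?thesis using nvec_form[OF p e True] by (simp add: nv_def mult.commute)
 next
  case False
  thus ?thesis using e by (simp add: nv_def nvecs_at_def exterior_power_def dual_of_def nforms_at_def)
 qed
qed

lemma nv_nonzero: "p : U ==> nv p c = 0 \<longleftrightarrow> c = 0" using nv_cf[of p c] by (auto simp: nv_def[of p 0] zero_fun_def)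

lemma det_over_nv: "p : U ==> p : V ==> (p, nv p c) : det_over A V \<longleftrightarrow> c ~= 0"
 by (simp add: det_over_def U_points nv_mem nv_nonzero)

lemma det_over_nz: "x : det_over A U ==> snd x (cf (fst x)) ~= 0"
 using nvec_eq[of "fst x" "snd x"] nv_nonzero[of "fst x"] by (auto simp: det_over_def)

lemma det_over_eq: "x : det_over A U ==> x = (fst x, nv (fst x) (snd x (cf (fst x))))"
 using nvec_eq[of "fst x" "snd x"] by (auto simp: det_over_def)

lemma dchart_inj: "inj_on (dchart A ph) (det_over A U)"
proof (rule inj_onI)
 fix x y assume x: "x : det_over A U" and y: "y : det_over A U" and eq: "dchart A ph x = dchart A ph y"
 have "ph (fst x) = ph (fst y)" using eq by (metis base_part_dchart)
 hence 1: "fst x = fst y" using inj det_over_fst[OF x] det_over_fst[OF y] by (auto dest: inj_onD)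
 have 2: "snd x (cf (fst x)) = snd y (cf (fst y))" using eq by (metis dchart_nth(1))
 have "x = (fst x, nv (fst x) (snd x (cf (fst x))))" by (rule det_over_eq[OF x])
 also have "... = (fst y, nv (fst y) (snd y (cf (fst y))))" by (simp only: 1 2[unfolded 1])
 also have "... = y" by (rule det_over_eq[OF y, symmetric])
 finally show "x = y" .
qed

definition dinv :: "complex ^ ('n option) => ('a, 'n) dpoint" where
 "dinv y = (let p = inv_into U ph (base_part y) in (p, nv p (y$None)))"

lemma dchart_image:
 assumes V: "V <= U"
 shows "dchart A ph`det_over A V = {y. base_part y : ph`V & y$None ~= 0}"
proof
 show "dchart A ph`det_over A V <= {y. base_part y : ph`V & y$None ~= 0}"
 proof
  fix y assume "y : dchart A ph`det_over A V"
  then obtain x where x: "x : det_over A V" "y = dchart A ph x" by blast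
  hence "x : det_over A U" using det_over_mono[OF V] by blast
  thus "y : {y. base_part y : ph`V & y$None ~= 0}" using x det_over_nz[of x] det_over_fst[OF x(1)] by simp
 qed
 show "{y. base_part y : ph`V & y$None ~= 0} <= dchart A ph`det_over A V"
 proof
  fix y assume y: "y : {y. base_part y : ph`V & y$None ~= 0}"
  then obtain p where p: "p : V" "base_part y = ph p" by auto
  have pU: "p : U" using p V by blast
  have "dchart A ph (p, nv p (y$None)) = y" unfolding vec_eq_iff
  proof
   fix k show "dchart A ph (p, nv p (y$None))$k = y$k" using p(2) by (cases k) (auto simp: nv_cf[OF pU] vec_eq_iff)
  qed
  moreover have "(p, nv p (y$None)) : det_over A V" using det_over_nv[OF pU p(1)] y by simp
  ultimately show "y : dchart A ph`det_over A V" by force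
 qed
qed

lemma dinv_dchart: "x : det_over A U ==> dinv (dchart A ph x) = x" using det_over_eq[of x] det_over_fst[of x] by (simp add: dinv_def)

lemma inv_dchart: "y : dchart A ph`det_over A U ==> inv_into (det_over A U) (dchart A ph) y = dinv y" using dchart_inj dinv_dchart by auto

lemma holo_base_part: "open S ==> holo S (%y. base_part y$i)" by (simp add: holo_coord)

lemma dchart_image_open:
 assumes V: "mopen A V" "V <= U"
 shows "open (dchart A ph`det_over A V)"
proof -
 have "open (ph`V)" using mopen_iff V by blast
 hence "open {y : UNIV. base_part y : ph`V}" by (rule open_holo_preimage[OF holo_base_part[OF open_UNIV]])
 moreover have "open {y :: complex ^ 'n option. y$None ~= 0}" by (intro open_Collect_neq continuous_intros)
 ultimately show ?thesis unfolding dchart_image[OF V(2)] using open_Int by (auto simp: Collect_conj_eq)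
qed

lemma holo_base_compose:
 assumes V: "V <= U" and g: "holo_on A V g"
 shows "holo (dchart A ph`det_over A V) (%y. g (inv_into U ph (base_part y)))"
 by (rule holo_compose(1)[OF holo_base_part[OF dchart_image_open[OF holo_on_mopen[OF g] V]], of "ph`V" "%x. g (inv_into U ph x)"])
  (use holo_on_iff[OF V] g dchart_image[OF V] in auto)

end

text \<open>Top forms being proportional, a change of chart multiplies the fibre coordinate by the
  Jacobian determinant \<open>J\<close> of the base, a polynomial in holomorphic partial
  derivatives.\<close>

lemma dchart_transition:
 assumes "chart A U ph" "chart A V ps"
 shows "holo (dchart A ph`(det_over A U Int det_over A V))
  (%y. dchart A ps (inv_into (det_over A U) (dchart A ph) y)$k)"
proof -
 interpret a: chart A U ph by fact
 interpret b: chart A V ps by fact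
 let ?S = "dchart A ph`det_over A (U Int V)"
 have UV: "mopen A (U Int V)" by (rule mopen_Int[OF a.A a.U_mopen b.U_mopen])
 define J where "J p = coord_form A ps p (%i. a.bvec i p)" for p
 have J: "holo_on A (U Int V) J"
 proof -
  have "holo_on A (U Int V) (%p. det (\<chi> i j. cpd U ph j (%x. ps x$i) p))"
   by (rule holo_on_det[OF UV]) (use a.holo_on_cpd[OF _ b.holo_on_coord[OF UV]] in simp)
  thus ?thesis by (rule holo_on_cong[OF a.A, THEN iffD1, rotated])
    (simp add: J_def coord_form_def a.bvec_tangent a.bvec_apply b.coord_near)
 qed
 have inv: "dchart A ps (inv_into (det_over A U) (dchart A ph) y)$k =
   (case k of None => J (inv_into U ph (base_part y)) * y$None
    | Some i => ps (inv_into U ph (base_part y))$i)" if y: "y : ?S" for y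
 proof -
  have y': "y : dchart A ph`det_over A U" using y det_over_mono[of "U Int V" U A] by auto
  let ?p = "inv_into U ph (base_part y)"
  have p: "?p : U" using y' unfolding a.dchart_image[OF order_refl] by (auto intro: inv_into_into)
  have "a.nv ?p (y$None) (coord_form A ps ?p) = J ?p * y$None"
   using coord_form_alternating[OF a.A, of ps ?p] by (simp add: a.nv_def J_def)
  thus ?thesis using a.inv_dchart[OF y'] by (simp add: a.dinv_def Let_def split: option.split)
 qed
 have "holo ?S (%y. case k of None => J (inv_into U ph (base_part y)) * y$None
    | Some i => ps (inv_into U ph (base_part y))$i)"
 proof (cases k)
  case None
  thus ?thesis using holo_mult(1)[OF a.holo_base_compose[OF _ J] holo_coord[OF a.dchart_image_open[OF UV]]] by simp
 next
  case (Some i)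
  thus ?thesis using a.holo_base_compose[OF _ b.holo_on_coord[OF UV], of i] by simp
 qed
 hence "holo ?S (%y. dchart A ps (inv_into (det_over A U) (dchart A ph) y)$k)" by (rule holo_cong[THEN iffD1, rotated]) (simp add: inv)
 thus ?thesis by (simp add: det_over_Int)
qed

lemma chartI: "atlas_compat A ==> (U, ph) : A ==> chart A U ph" unfolding chart_def coordinates_def using coord_chart by blast

lemma det_atlas_compat:
 assumes A: "atlas_compat A"
 shows "atlas_compat (det_atlas A)"
proof -
 have *: "inj_on Ph U' & open (Ph`U') &
   (ALL (V', Ps):det_atlas A. ALL i. holo (Ph`(U' Int V')) (%x. Ps (inv_into U' Ph x)$i))"
  if H: "(U', Ph) : det_atlas A" for U' Ph
 proof -
  obtain U ph where u: "(U, ph) : A" "U' = det_over A U" "Ph = dchart A ph" using H by (auto simp: det_atlas_eq)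
  interpret chart A U ph by (rule chartI[OF A u(1)])
  have "holo (Ph`(U' Int V')) (%x. Ps (inv_into U' Ph x)$i)" if H2: "(V', Ps) : det_atlas A" for V' Ps i
  proof -
   obtain V ps where v: "(V, ps) : A" "V' = det_over A V" "Ps = dchart A ps" using H2 by (auto simp: det_atlas_eq)
   show ?thesis unfolding u v by (rule dchart_transition[OF chartI[OF A u(1)] chartI[OF A v(1)]])
  qed
  thus ?thesis using dchart_inj dchart_image_open[OF U_mopen order_refl] u by auto
 qed
 show ?thesis unfolding atlas_compat_def using * by blast
qed

lemma points_det_atlas: "points (det_atlas A) = det_over A (points A)"
proof -
 have "points (det_atlas A) = (UN (U, ph):A. det_over A U)" unfolding points_def det_atlas_eq by fastforce
 also have "... = det_over A (points A)" by (auto simp: det_over_def points_def) 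
 finally show ?thesis .
qed

sublocale chart \<subseteq> det: coordinates "det_atlas A" "det_over A U" "dchart A ph"
proof
 show dA: "atlas_compat (det_atlas A)" by (rule det_atlas_compat[OF A])
 show "coord (det_atlas A) (det_over A U) (dchart A ph)"
 proof (rule coordI[OF dA _ dchart_inj])
  show "det_over A U <= points (det_atlas A)" unfolding points_det_atlas by (rule det_over_mono) (use U_points in blast)
  fix V' Ps i assume "(V', Ps) : det_atlas A"
  then obtain V ps where v: "(V, ps) : A" "V' = det_over A V" "Ps = dchart A ps" by (auto simp: det_atlas_eq)
  note c = chart_axioms chartI[OF A v(1)]
  show "holo (dchart A ph`(det_over A U Int V')) (%x. Ps (inv_into (det_over A U) (dchart A ph) x)$i)"
   unfolding v by (rule dchart_transition[OF c])
  show "holo (Ps`(det_over A U Int V')) (%x. dchart A ph (inv_into V' Ps x)$i)"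
   unfolding v using dchart_transition[OF c(2,1)] by (simp add: Int_commute)
 qed
qed

context chart
begin

lemma det_mopen: "mopen A V ==> V <= U ==> mopen (det_atlas A) (det_over A V)"
 using det.mopen_iff[of "det_over A V"] dchart_image_open det_over_mono[of V U A] by simp

lemma holo_on_fst:
 assumes V: "V <= U" and g: "holo_on A V g"
 shows "holo_on (det_atlas A) (det_over A V) (%x. g (fst x))"
proof -
 have "holo (dchart A ph`det_over A V) (%y. g (fst (inv_into (det_over A U) (dchart A ph) y)))" using holo_base_compose[OF V g]
 proof (rule holo_cong[THEN iffD1, rotated])
  fix y assume "y : dchart A ph`det_over A V"
  hence "y : dchart A ph`det_over A U" using det_over_mono[OF V] by blast
  from inv_dchart[OF this] show "g (inv_into U ph (base_part y)) = g (fst (inv_into (det_over A U) (dchart A ph) y))"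
   by (simp add: dinv_def Let_def)
 qed
 thus ?thesis using det.holo_on_iff[OF det_over_mono[OF V]] by simp
qed

end

section \<open>Sections of \<open>E\<close> in coordinates\<close>

lemma fst_det_scale [simp]: "fst (det_scale c x) = fst x" by (simp add: det_scale_def)

context chart
begin

abbreviation "Ph \<equiv> dchart A ph"
abbreviation "dA \<equiv> det_atlas A"

lemma det_scale_over: "c ~= 0 ==> x : det_over A V ==> V <= U ==> det_scale c x : det_over A V"
proof -
 assume c: "c ~= 0" and x: "x : det_over A V" and V: "V <= U"
 hence "x : det_over A U" using det_over_mono by blast
 from det_over_eq[OF this] det_over_nz[OF this] obtain p d where pd: "x = (p, nv p d)" "d ~= 0" by blast
 have "det_scale c x = (p, nv p (c * d))" by (auto simp: pd(1) det_scale_def nv_def fun_eq_iff)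
 thus ?thesis using x V pd c det_over_nv[of p V "c * d"] det_over_fst[OF x] by auto
qed

lemma dchart_scale: "Ph (det_scale c x)$k = (case k of None => c | Some _ => 1) * Ph x$k" by (cases k) (simp_all add: det_scale_def)

lemma det_scale_smooth:
 assumes c: "c ~= 0" and x: "x : det_over A U"
 shows "smooth_at dA dA (det_scale c) x" unfolding smooth_at_def
proof (intro allI impI, elim conjE)
 fix W g assume W: "det_scale c x : W" and g: "holo_on dA W g"
 let ?O = "det_over A U"
 let ?V = "{y : ?O. det_scale c y : W}"
 have m: "mopen dA (?O Int W)" by (rule mopen_Int[OF det.A det.U_mopen holo_on_mopen[OF g]])
 have g': "holo (Ph`(?O Int W)) (%y. g (inv_into ?O Ph y))" using det.holo_on_iff[of "?O Int W" g] holo_on_subset[OF g m] by simp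
 define sc :: "complex ^ ('n option) => complex ^ ('n option)"
  where "sc y = (\<chi> k. (case k of None => c | Some _ => 1) * y$k)" for y
 have sc: "holo S (%y. sc y$k)" if "open S" for S k unfolding sc_def by (simp add: holo_cmult holo_coord that)
 have scPh: "sc (Ph y) = Ph (det_scale c y)" for y by (simp add: sc_def vec_eq_iff dchart_scale)
 let ?T = "{y : Ph`?O. sc y : Ph`(?O Int W)}"
 have T: "?T = Ph`?V"
 proof -
  have "sc (Ph y) : Ph`(?O Int W) \<longleftrightarrow> det_scale c y : W" if y: "y : ?O" for y
   unfolding scPh using inj_on_image_mem_iff[OF dchart_inj det_scale_over[OF c y order_refl], of "?O Int W"]
    det_scale_over[OF c y order_refl] by simp
  thus ?thesis by blast
 qed
 have oO: "open (Ph`?O)" by (rule dchart_image_open[OF U_mopen order_refl])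
 have oT: "open ?T" by (rule open_holo_preimage[OF sc[OF oO] holo_open[OF g']])
 have "holo ?T (%y. g (inv_into ?O Ph (sc y)))" by (rule holo_compose(1)[OF sc[OF oT] g']) auto
 hence "holo (Ph`?V) (%y. g (det_scale c (inv_into ?O Ph y)))" unfolding T
 proof (rule holo_cong[THEN iffD1, rotated])
  fix y assume "y : Ph`?V"
  then obtain z where z: "z : ?O" "y = Ph z" by auto
  have "inv_into ?O Ph (Ph (det_scale c z)) = det_scale c z" by (rule det.inv_ph[OF det_scale_over[OF c z(1) order_refl]])
  thus "g (inv_into ?O Ph (sc y)) = g (det_scale c (inv_into ?O Ph y))" using z by (simp add: scPh)
 qed
 hence "holo_on dA ?V (%y. g (det_scale c y))" using det.holo_on_iff[of ?V] by simp
 thus "EX V. x : V & det_scale c`V <= W & holo_on dA V (%y. g (det_scale c y))" using x W by (intro exI[of _ ?V]) auto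
qed

lemma det_cpd_fst:
 assumes x: "x : det_over A U" and f: "holo_near A (fst x) f"
 shows "holo_near dA x (%x. f (fst x))"
  and "cpd (det_over A U) Ph k (%x. f (fst x)) x = (case k of None => 0 | Some i => cpd U ph i f (fst x))"
proof -
 obtain W where W: "fst x : W" "W <= U" "holo_on A W f" using near[OF det_over_fst[OF x] f] by blast
 have xW: "x : det_over A W" using W(1) x det_over_iff by blast
 show "holo_near dA x (%x. f (fst x))" by (rule holo_nearI[OF xW holo_on_fst[OF W(2,3)]])
 let ?f = "%y. f (inv_into U ph y)"
 let ?S = "Ph`det_over A W"
 have S: "open ?S" by (rule dchart_image_open[OF holo_on_mopen[OF W(3)] W(2)])
 have xS: "Ph x : ?S" using xW by blast
 have f': "holo (ph`W) ?f" using holo_on_iff[OF W(2)] W(3) by blast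
 have sub: "base_part`?S <= ph`W" unfolding dchart_image[OF W(2)] by auto
 have "cpd (det_over A U) Ph k (%x. f (fst x)) x = pd k (%y. ?f (base_part y)) (Ph x)" unfolding cpd_def
 proof (rule pd_cong[OF S xS])
  fix y assume "y : ?S"
  hence "y : Ph`det_over A U" using det_over_mono[OF W(2)] by blast
  from inv_dchart[OF this] show "f (fst (inv_into (det_over A U) Ph y)) = ?f (base_part y)" by (simp add: dinv_def Let_def)
 qed
 also have "... = (SUM l. pd l ?f (base_part (Ph x)) * pd k (%y. base_part y$l) (Ph x))"
  by (rule holo_compose(2)[OF holo_base_part[OF S] f' sub xS])
 also have "... = (case k of None => 0 | Some i => cpd U ph i f (fst x))"
  by (cases k) (simp_all add: pd_coord cpd_def if_mult_right cong: if_cong)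
 finally show "cpd (det_over A U) Ph k (%x. f (fst x)) x = (case k of None => 0 | Some i => cpd U ph i f (fst x))" .
qed

text \<open>With fibre coordinate \<open>w\<close> (index \<open>None\<close>), the invariant vector
  fields are the combinations of \<open>w d/dw\<close> and the \<open>d/dz i\<close> with
  coefficients from the base; \<open>mult\<close> is the factor \<open>w\<close> or 1 in front of
  the coordinate derivation.\<close>

definition mult :: "'n option => ('a, 'n) dpoint => complex" where
 "mult k x = (case k of None => Ph x$None | Some _ => 1)"

lemma holo_on_mult_coord: "mopen dA W ==> W <= det_over A U ==> holo_on dA W (mult k)"
proof (cases k)
 case None
 hence "mult k = (%x. Ph x$None)" by (simp add: mult_def fun_eq_iff)
 thus "mopen dA W ==> W <= det_over A U ==> holo_on dA W (mult k)" using det.holo_on_coord[of W None] by simp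
next
 case (Some i)
 hence "mult k = (%x. 1)" by (simp add: mult_def fun_eq_iff)
 thus "mopen dA W ==> W <= det_over A U ==> holo_on dA W (mult k)" by simp
qed

text \<open>The section with components \<open>a\<close> in the frame of the Euler field and the coordinate fields.\<close>

definition sec :: "'a set => ('n option => 'a => complex) => ('a, 'n) esec" where
 "sec V a = (%x. if x : det_over A V then det.tvec x (%k. a k (fst x) * mult k x) else 0)"

text \<open>Read off at the point of the fibre where \<open>w = 1\<close>, so that the factor
  \<open>mult\<close> is 1; invariance determines the section along the rest of the fibre.\<close>

definition comp :: "'n option => ('a, 'n) esec => 'a => complex" where
 "comp k s p = s (p, nv p 1) (%x. Ph x$k)"

lemma unit_over: "p : V ==> V <= U ==> (p, nv p 1) : det_over A V" using det_over_nv[of p V 1] by auto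

lemma det_over_U: "x : det_over A V ==> V <= U ==> x : det_over A U" using det_over_mono[of V U A] by blast

lemma sec_coord: "x : det_over A V ==> V <= U ==> sec V a x (%x. Ph x$k) = a k (fst x) * mult k x"
 by (simp add: sec_def det.tvec_coord det_over_U)

lemma comp_sec: "p : V ==> V <= U ==> comp k (sec V a) p = a k p" using sec_coord[OF unit_over, of p V a k]
 by (cases k) (auto simp: comp_def mult_def nv_cf subset_iff)

lemma sec_cong: "(!!k p. p : V ==> a k p = b k p) ==> sec V a = sec V b"
 unfolding sec_def by (intro ext if_cong arg_cong[where f="%a. det.tvec _ a _"] refl) (simp add: det_over_fst)

lemma sec_eqD: "sec V a = sec V b ==> p : V ==> V <= U ==> a k p = b k p" using comp_sec by metis

lemma sec_apply:
 assumes "x : det_over A V" "V <= U" "holo_near dA x f"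
 shows "sec V a x f = (SUM k. a k (fst x) * mult k x * cpd (det_over A U) Ph k f x)" using assms(1,3) by (simp add: sec_def det.tvec_def)

lemma sec_tangent: "x : det_over A V ==> V <= U ==> sec V a x : tangent dA x" using det.tvec_tangent[OF det_over_U] by (simp add: sec_def)

lemma invariant_iff:
 assumes V: "V <= U" and s: "ALL x:det_over A V. s x : tangent dA x"
 shows "invariant_over A V s \<longleftrightarrow> (ALL x:det_over A V. ALL c k. c ~= 0 -->
  s (det_scale c x) (%x. Ph x$k) = (case k of None => c | Some _ => 1) * s x (%x. Ph x$k))"
proof -
 have *: "s (det_scale c x) = tmap dA (det_scale c) (det_scale c x) (s x) \<longleftrightarrow>
  (ALL k. s (det_scale c x) (%x. Ph x$k) = (case k of None => c | Some _ => 1) * s x (%x. Ph x$k))"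
  if x: "x : det_over A V" and c: "c ~= 0" for x c
 proof -
  have xU: "x : det_over A U" using x V det_over_mono by blast
  have cx: "det_scale c x : det_over A V" by (rule det_scale_over[OF c x V])
  have cxU: "det_scale c x : det_over A U" using cx V det_over_mono by blast
  have t: "tmap dA (det_scale c) (det_scale c x) (s x) : tangent dA (det_scale c x)"
   by (rule tmap_tangent[OF det.A det.A det_scale_smooth[OF c xU] s[THEN bspec, OF x]])
  have v: "tmap dA (det_scale c) (det_scale c x) (s x) (%x. Ph x$k) =
    (case k of None => c | Some _ => 1) * s x (%x. Ph x$k)" for k
   using det.coord_near[OF cxU, of k] tangent_cmult[OF s[THEN bspec, OF x] det.coord_near[OF xU, of k]] by (simp add: tmap_def dchart_scale)
  show ?thesis using v det.tangent_eqI[OF cxU s[THEN bspec, OF cx] t] by metis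
 qed
 show ?thesis unfolding invariant_over_def using * by blast
qed

lemma mult_scale: "mult k (det_scale c x) = (case k of None => c | Some _ => 1) * mult k x"
 by (cases k) (simp_all add: mult_def det_scale_def)

lemma sec_invariant:
 assumes V: "V <= U"
 shows "invariant_over A V (sec V a)"
proof (subst invariant_iff[OF V]; (intro ballI allI impI)?)
 show "sec V a x : tangent dA x" if "x : det_over A V" for x by (rule sec_tangent[OF that V])
next
 fix x c k assume x: "x : det_over A V" and c: "(c::complex) ~= 0"
 show "sec V a (det_scale c x) (%x. Ph x$k) =
   (case k of None => c | Some _ => 1) * sec V a x (%x. Ph x$k)"
  using sec_coord[OF det_scale_over[OF c x V] V, of a k] sec_coord[OF x V, of a k] by (simp only: fst_det_scale mult_scale mult_ac)
qed

lemma sec_unique: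
 assumes V: "V <= U" and s: "ALL x:det_over A V. s x : tangent dA x"
  and z: "!!x. x ~: det_over A V ==> s x = 0" and inv: "invariant_over A V s"
 shows "s = sec V (%k. comp k s)"
proof
 fix x show "s x = sec V (%k. comp k s) x"
 proof (cases "x : det_over A V")
  case True
  have xU: "x : det_over A U" using True V det_over_mono by blast
  have p: "fst x : V" by (rule det_over_fst[OF True])
  let ?c = "snd x (cf (fst x))" and ?u = "(fst x, nv (fst x) 1)"
  have c: "?c ~= 0" by (rule det_over_nz[OF xU])
  have "x = det_scale ?c ?u" by (subst det_over_eq[OF xU]) (auto simp: det_scale_def nv_def fun_eq_iff)
  moreover have "?u : det_over A V" by (rule unit_over[OF p V])
  ultimately have "s x (%x. Ph x$k) = (case k of None => ?c | Some _ => 1) * comp k s (fst x)" for k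
   using inv[unfolded invariant_iff[OF V s], THEN bspec, of ?u, THEN spec, of ?c, THEN spec, of k] c by (simp add: comp_def)
  hence "s x (%x. Ph x$k) = comp k s (fst x) * mult k x" for k by (simp add: mult_def split: option.split)
  thus ?thesis using det.tvec_eq[OF xU s[THEN bspec, OF True]] True by (simp add: sec_def)
 next
  case False
  thus ?thesis using z by (simp add: sec_def)
 qed
qed

text \<open>Pull-back along the holomorphic section \<open>w = 1\<close> of \<open>det(TM)\<close>;
  this is how \<open>comp\<close> becomes holomorphic on the base.\<close>

lemma unit_section:
 assumes V: "mopen A V" "V <= U" and g: "holo_on dA (det_over A V) g"
 shows "holo_on A V (%p. g (p, nv p 1))"
proof -
 let ?u = "%y :: complex ^ 'n. (\<chi> k. case k of None => 1 | Some i => y$i) :: complex ^ ('n option)"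
 have oV: "open (ph`V)" using V mopen_iff by blast
 have u: "holo (ph`V) (%y. ?u y$k)" for k using oV by (cases k) (auto intro: holo_coord)
 have bu: "base_part (?u y) = y" for y by (simp add: vec_eq_iff)
 have sub: "?u`ph`V <= Ph`det_over A V" unfolding dchart_image[OF V(2)] by (auto simp: bu)
 have g': "holo (Ph`det_over A V) (%y. g (inv_into (det_over A U) Ph y))" using det.holo_on_iff[OF det_over_mono[OF V(2)]] g by blast
 have "holo (ph`V) (%y. g (inv_into (det_over A U) Ph (?u y)))" by (rule holo_compose(1)[OF u g' sub])
 hence "holo (ph`V) (%y. (%p. g (p, nv p 1)) (inv_into U ph y))"
 proof (rule holo_cong[THEN iffD1, rotated])
  fix y assume "y : ph`V"
  hence "?u y : Ph`det_over A V" using sub by blast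
  hence "?u y : Ph`det_over A U" using det_over_mono[OF V(2)] by blast
  from inv_dchart[OF this]
  show "g (inv_into (det_over A U) Ph (?u y)) = g (inv_into U ph y, nv (inv_into U ph y) 1)" by (simp add: dinv_def Let_def bu)
 qed
 thus ?thesis using holo_on_iff[OF V(2)] by simp
qed

lemma sec_Esec:
 assumes V: "mopen A V" "V <= U" and a: "!!k. holo_on A V (a k)"
 shows "sec V a : Esec A V"
proof -
 have m: "mopen dA (det_over A V)" by (rule det_mopen[OF V])
 have "det.vf (det_over A V) (%k x. a k (fst x) * mult k x) : vfields dA (det_over A V)"
  by (rule det.vf_vfields[OF m det_over_mono[OF V(2)]])
   (intro holo_on_mult holo_on_fst V a holo_on_mult_coord m det_over_mono)
 moreover have "det.vf (det_over A V) (%k x. a k (fst x) * mult k x) = sec V a" by (simp add: det.vf_def sec_def fun_eq_iff)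
 ultimately show ?thesis unfolding Esec_def using sec_invariant[OF V(2)] by simp
qed

lemma Esec_comp:
 assumes V: "mopen A V" "V <= U" and s: "s : Esec A V"
 shows "holo_on A V (comp k s)" and "s = sec V (%k. comp k s)"
proof -
 have sv: "s : vfields dA (det_over A V)" and inv: "invariant_over A V s" using s by (auto simp: Esec_def)
 have m: "mopen dA (det_over A V)" by (rule det_mopen[OF V])
 have "holo_on dA (det_over A V) (%x. s x (%x. Ph x$k))" by (rule det.vfields_comp(1)[OF sv m det_over_mono[OF V(2)]])
 from unit_section[OF V this] show "holo_on A V (comp k s)" by (simp add: comp_def[abs_def])
 show "s = sec V (%k. comp k s)" by (rule sec_unique[OF V(2) _ _ inv]) (use sv in \<open>auto simp: vfields_def\<close>)
qed

lemma sec_Efibre: "p : U ==> sec {p} a : Efibre A p" unfolding Efibre_def mem_Collect_eq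
proof (intro conjI ballI allI impI)
 assume p: "p : U"
 show "sec {p} a x : tangent dA x" if "x : det_over A {p}" for x using sec_tangent[OF that] p by simp
 show "sec {p} a x = 0" if "x ~: det_over A {p}" for x using that by (simp add: sec_def)
 show "invariant_over A {p} (sec {p} a)" using sec_invariant[of "{p}"] p by simp
qed

lemma Efibre_comp: "p : U ==> v : Efibre A p ==> v = sec {p} (%k _. comp k v p)"
proof -
 assume p: "p : U" and v: "v : Efibre A p"
 have "v = sec {p} (%k. comp k v)"
 proof (rule sec_unique)
  show "{p} <= U" using p by simp
  show "ALL x:det_over A {p}. v x : tangent dA x" using v by (simp add: Efibre_def)
  show "v x = 0" if "x ~: det_over A {p}" for x using v that unfolding Efibre_def by blast
  show "invariant_over A {p} v" using v by (simp add: Efibre_def)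
 qed
 also have "... = sec {p} (%k _. comp k v p)" by (rule sec_cong) simp
 finally show ?thesis .
qed

lemma eres_sec: "V' <= V ==> eres V' (sec V a) = sec V' a" by (auto simp: eres_def sec_def fun_eq_iff det_over_def)

lemma sec_add: "sec V a+sec V b = sec V (%k p. a k p+b k p)" by (rule ext)+ (simp add: sec_def det.tvec_def algebra_simps sum.distrib)

lemma sec_emul: "emul g (sec V a) = sec V (%k p. g p * a k p)"
 by (rule ext)+ (simp add: emul_def vmul_def vscale_def sec_def det.tvec_def sum_distrib_left mult_ac)

lemma sec_escale: "escale c (sec V a) = sec V (%k p. c * a k p)" unfolding escale_def by (rule sec_emul)

lemma sec_zero: "sec V (%k p. 0) = 0" by (rule ext)+ (simp add: sec_def det.tvec_def)

lemma sec_sum: "(SUM i:I. sec V (a i)) = sec V (%k p. SUM i:I. a i k p)"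
 by (induction I rule: infinite_finite_induct) (simp_all add: sec_zero sec_add)

lemma sec_diff: "sec V a - sec V b = sec V (%k p. a k p - b k p)" using sec_add[of V "%k p. a k p - b k p" b] by (simp add: algebra_simps)

definition fr :: "'a set => 'n option => ('a, 'n) esec" where
 "fr V k = sec V (%j _. if j = k then 1 else 0)"

lemma fr_Esec: "mopen A V ==> V <= U ==> fr V k : Esec A V" unfolding fr_def by (rule sec_Esec) auto

lemma sec_fr: "sec V a = (SUM k. emul (a k) (fr V k))" by (simp add: fr_def sec_emul sec_sum if_mult_right cong: if_cong)

lemma eres_fr: "V' <= V ==> eres V' (fr V k) = fr V' k" unfolding fr_def by (rule eres_sec)

text \<open>Scaling by \<open>c\<close> shifts the fibre coordinate \<open>w\<close> by
  \<open>(c - 1) * w\<close>, so the derivative at \<open>c = 1\<close> is that of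
  \<open>w d/dw\<close>, the frame element with index \<open>None\<close>.\<close>

lemma euler_fr:
 assumes V: "V <= U"
 shows "euler A V = fr V None"
proof (rule ext)+
 fix x f
 show "euler A V x f = fr V None x f"
 proof (cases "x : det_over A V & holo_near dA x f")
  case True
  have xU: "x : det_over A U" using True V det_over_mono by blast
  have f: "holo_near dA x f" using True by simp
  let ?O = "det_over A U"
  let ?F = "%y. f (inv_into ?O Ph y)" and ?w = "Ph x$None"
  obtain W where W: "x : W" "W <= ?O" "holo_on dA W f" using det.near[OF xU f] by blast
  have hF: "holo (Ph`W) ?F" using det.holo_on_iff[OF W(2)] W(3) by blast
  have xS: "Ph x : Ph`W" using W by blast
  have "((%z. ?F (Ph x+axis None z)) has_field_derivative pd None ?F (Ph x)) (at ((1 - 1) * ?w))"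
   using pd_unique(1)[OF holo_has_derivative[OF hF xS], of None] by simp
  moreover have "((%c. (c - 1) * ?w) has_field_derivative ?w) (at 1)" by (auto intro!: derivative_eq_intros)
  ultimately have "((%c. ?F (Ph x+axis None ((c - 1) * ?w))) has_field_derivative pd None ?F (Ph x) * ?w) (at 1)"
   using DERIV_chain[of "%z. ?F (Ph x+axis None z)" _ "%c. (c - 1) * ?w" 1] by (simp add: o_def)
  hence "((%c. f (det_scale c x)) has_field_derivative pd None ?F (Ph x) * ?w) (at 1)"
  proof (rule has_field_derivative_transform_within_open[of _ _ _ "- {0}"])
   fix c :: complex assume "c : - {0}"
   hence c: "c ~= 0" by simp
   have "Ph x+axis None ((c - 1) * ?w) = Ph (det_scale c x)" unfolding vec_eq_iff
   proof
    fix k show "(Ph x+axis None ((c - 1) * ?w))$k = Ph (det_scale c x)$k"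
     unfolding dchart_scale by (cases k) (simp_all add: axis_def algebra_simps)
   qed
   thus "?F (Ph x+axis None ((c - 1) * ?w)) = f (det_scale c x)" using det.inv_ph[OF det_scale_over[OF c xU order_refl]] by simp
  qed auto
  hence "deriv (%c. f (det_scale c x)) 1 = pd None ?F (Ph x) * ?w" by (rule DERIV_imp_deriv)
  moreover have "fr V None x f = ?w * pd None ?F (Ph x)" unfolding fr_def using sec_apply[of x V f "%j _. if j = None then 1 else 0"] True V
   by (simp add: mult_def cpd_def if_mult_left cong: if_cong)
  ultimately show ?thesis using True by (simp add: euler_def)
 next
  case False
  thus ?thesis by (auto simp: euler_def fr_def sec_def det.tvec_def)
 qed
qed

lemma rho_sec:
 assumes p: "p : V" and V: "V <= U"
 shows "rho A (sec V a) p = tvec p (%i. a (Some i) p)"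
proof
 fix f
 let ?x = "SOME x. x : det_over A {p}"
 have "(p, nv p 1) : det_over A {p}" by (rule unit_over) (use p V in auto)
 hence x: "?x : det_over A {p}" by (rule someI)
 have fx: "fst ?x = p" using det_over_fst[OF x] by simp
 have xV: "?x : det_over A V" using x p by (auto simp: det_over_def)
 have xU: "?x : det_over A U" using xV V det_over_mono by blast
 show "rho A (sec V a) p f = tvec p (%i. a (Some i) p) f"
 proof (cases "holo_near A p f")
  case True
  have f: "holo_near A (fst ?x) f" using True fx by simp
  have "sec V a ?x (%x. f (fst x)) = (SUM k. a k p * mult k ?x * (case k of None => 0 | Some i => cpd U ph i f p))"
   unfolding sec_apply[OF xV V det_cpd_fst(1)[OF xU f]] det_cpd_fst(2)[OF xU f] fx ..
  also have "... = (SUM i. a (Some i) p * cpd U ph i f p)" by (simp add: UNIV_option_conv sum.reindex mult_def)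
  finally show ?thesis using True by (simp add: rho_def tmap_def tvec_def)
 qed (simp add: rho_def tmap_def tvec_def)
qed

text \<open>The frame consists of \<open>w d/dw\<close> and the \<open>d/dz i\<close>. The factor
  \<open>mult k\<close> is constant in each direction other than \<open>k\<close> (fact
  \<open>cm\<close>), so the bracket reduces to a difference of mixed second derivatives.\<close>

lemma ebracket_fr:
 assumes V: "mopen A V" "V <= U"
 shows "ebracket A V (fr V j) (fr V k) = 0"
proof (rule ext)+
 fix x f
 show "ebracket A V (fr V j) (fr V k) x f = 0 x f"
 proof (cases "x : det_over A V & holo_near dA x f & j ~= k")
  case True
  have xV: "x : det_over A V" and jk: "j ~= k" and f: "holo_near dA x f" using True by auto
  have xU: "x : det_over A U" using xV V det_over_mono by blast
  let ?c = "cpd (det_over A U) Ph"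
  have frf: "fr V k y f = mult k y * ?c k f y" if "y : det_over A V" "holo_near dA y f" for k y f
   unfolding fr_def using sec_apply[OF that(1) V(2) that(2)] by (simp add: if_mult_left cong: if_cong)
  obtain W where W: "x : W" "W <= det_over A V" "holo_on dA W f" using holo_near_nbhd[OF det.A f det_mopen[OF V] xV] by blast
  have mW: "mopen dA W" by (rule holo_on_mopen[OF W(3)])
  have WU: "W <= det_over A U" using W(2) det_over_mono[OF V(2)] by blast
  have mk: "holo_near dA x (mult k)" for k by (rule holo_nearI[OF W(1) holo_on_mult_coord[OF mW WU]])
  have ck: "holo_near dA x (?c k f)" for k by (rule holo_nearI[OF W(1) det.holo_on_cpd[OF WU W(3)]])
  have va: "vapply (fr V k) f y = mult k y * ?c k f y" if "y : W" for y k
   using frf[of y f k] that W holo_nearI[OF that W(3)] by (auto simp: vapply_def)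
  have cm: "?c j (mult k) x = 0" if "j ~= k" for j k
  proof (cases k)
   case None
   hence "mult k = (%x. Ph x$None)" by (simp add: mult_def fun_eq_iff)
   thus ?thesis using det.cpd_coord[OF xU, of j None] that None by simp
  next
   case (Some i)
   hence "mult k = (%x. 1)" by (simp add: mult_def fun_eq_iff)
   thus ?thesis by simp
  qed
  have nm: "holo_near dA x (%y. mult k y * ?c k f y)" for k by (rule holo_near_mult[OF det.A mk ck])
  have e: "fr V j x (vapply (fr V k) f) = mult j x * (mult k x * ?c j (?c k f) x)" if "j ~= k" for j k
  proof -
   have "fr V j x (vapply (fr V k) f) = fr V j x (%y. mult k y * ?c k f y)"
    by (rule tangent_cong[OF sec_tangent[OF xV V(2), of "%ja _. if ja = j then 1 else 0", folded fr_def] _ mW W(1) va])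
     (use holo_near_cong[OF det.A mW W(1) va[of _ k]] nm in auto)
   also have "... = mult j x * ?c j (%y. mult k y * ?c k f y) x" by (rule frf[OF xV nm])
   also have "?c j (%y. mult k y * ?c k f y) x = mult k x * ?c j (?c k f) x" using det.cpd_mult[OF xU mk ck, of j k k] cm[OF that] by simp
   finally show ?thesis .
  qed
  show ?thesis using xV f e[OF jk] e[of k j] jk det.cpd_commute[OF xU f, of j k] by (simp add: ebracket_def lie_bracket_def)
 next
  case False
  thus ?thesis by (auto simp: ebracket_def lie_bracket_def)
 qed
qed

lemma is_frame_fr:
 assumes V: "mopen A V" "V <= U"
 shows "is_frame A V (fr V)" unfolding is_frame_def
proof (intro conjI allI ballI V fr_Esec)
 fix p v assume p: "p : V" and v: "v : Efibre A p"
 have pU: "p : U" using p V by blast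
 have *: "(SUM i. escale (a i) (eres {p} (fr V i))) = sec {p} (%k _. a k)" for a
  using p by (simp add: eres_fr) (simp add: fr_def sec_escale sec_sum if_mult_right cong: if_cong)
 show "EX! a. v = (SUM i. escale (a i) (eres {p} (fr V i)))" unfolding *
 proof
  show "v = sec {p} (%k _. comp k v p)" by (rule Efibre_comp[OF pU v])
  fix a assume "v = sec {p} (%k _. a k)"
  moreover have "comp k (sec {p} (%k _. a k)) p = a k" for k by (rule comp_sec) (use pU in auto)
  ultimately show "a = (%k. comp k v p)" by simp
 qed
qed

lemma frame_coords_fr:
 assumes V: "V <= U" and p: "p : V"
 shows "frame_coords (fr V) p (sec V a) = (%k. a k p)" unfolding frame_coords_def
proof (rule the_equality)
 have *: "(SUM i. escale (a i) (eres {p} (fr V i))) = sec {p} (%k _. a k)" for a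
  using p by (simp add: eres_fr) (simp add: fr_def sec_escale sec_sum if_mult_right cong: if_cong)
 show "eres {p} (sec V a) = (SUM i. escale (a i p) (eres {p} (fr V i)))" unfolding * using p by (simp add: eres_sec) (rule sec_cong, simp)
 fix b assume "eres {p} (sec V a) = (SUM i. escale (b i) (eres {p} (fr V i)))"
 hence "sec {p} a = sec {p} (%k _. b k)" unfolding * using p by (simp add: eres_sec)
 from sec_eqD[OF this, of p] show "b = (%k. a k p)" using p V by (auto simp: fun_eq_iff)
qed

end

section \<open>Connections in coordinates\<close>

lemma chart_at:
 assumes A: "atlas_compat A" and p: "p : points A"
 obtains U ph where "chart A U ph" "p : U"
proof -
 obtain U ph where "(U, ph) : A" "p : U" "coord A U ph" using coord_at[OF A p] .
 thus ?thesis using that chartI[OF A] by blast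
qed

lemma det_over_mopen:
 assumes A: "atlas_compat A" and W: "mopen A W"
 shows "mopen (det_atlas A) (det_over A W)"
proof (rule mopen_local)
 fix x assume x: "x : det_over A W"
 have p: "fst x : W" by (rule det_over_fst[OF x])
 obtain U ph where u: "chart A U ph" "fst x : U" using chart_at[OF A] mopen_points[OF W] p by blast
 interpret chart A U ph by (rule u(1))
 have "mopen (det_atlas A) (det_over A (W Int U))" by (rule det_mopen[OF mopen_Int[OF A W U_mopen]]) simp
 thus "EX V. x : V & V <= det_over A W & mopen (det_atlas A) V"
  using x u(2) det_over_iff[OF x, of "W Int U"] p det_over_mono[of "W Int U" W A] by blast
qed

lemma EsecD:
 assumes "s : Esec A U"
 shows "!!x. x : det_over A U ==> s x : tangent (det_atlas A) x" "!!x. x ~: det_over A U ==> s x = 0"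
  "!!W f. W <= det_over A U ==> holo_on (det_atlas A) W f ==> holo_on (det_atlas A) W (%x. s x f)"
  "invariant_over A U s" using assms unfolding Esec_def vfields_def by blast+

lemma EsecI:
 assumes "!!x. x : det_over A U ==> s x : tangent (det_atlas A) x" "!!x. x ~: det_over A U ==> s x = 0"
  "!!W f. W <= det_over A U ==> holo_on (det_atlas A) W f ==> holo_on (det_atlas A) W (%x. s x f)"
  "invariant_over A U s"
 shows "s : Esec A U" unfolding Esec_def vfields_def mem_Collect_eq
proof (intro CollectI conjI ballI allI impI assms(1,2,4); assumption?)
 fix W f assume "W <= det_over A U & holo_on (det_atlas A) W f"
 thus "holo_on (det_atlas A) W (%x. s x f)" by (intro assms(3)) auto
qed

lemma Esec_eres:
 assumes A: "atlas_compat A" and s: "s : Esec A U" and V: "V <= U"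
 shows "eres V s : Esec A V"
proof (rule EsecI)
 have VU: "det_over A V <= det_over A U" by (rule det_over_mono[OF V])
 have e: "eres V s x = s x" if "x : det_over A V" for x using det_over_fst[OF that] by (simp add: eres_def)
 show "eres V s x : tangent (det_atlas A) x" if "x : det_over A V" for x using e[OF that] EsecD(1)[OF s, of x] that VU by auto
 show "eres V s x = 0" if "x ~: det_over A V" for x using that EsecD(2)[OF s, of x] det_over_iff[of x A U V] by (auto simp: eres_def)
 show "holo_on (det_atlas A) W (%x. eres V s x f)" if W: "W <= det_over A V" "holo_on (det_atlas A) W f" for W f
  by (rule holo_on_cong[OF det_atlas_compat[OF A], THEN iffD1, rotated, OF EsecD(3)[OF s _ W(2)]])
   (use W VU e in auto)
 show "invariant_over A V (eres V s)" unfolding invariant_over_def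
 proof (intro ballI allI impI)
  fix x c assume x: "x : det_over A V" and c: "(c::complex) ~= 0"
  have "s (det_scale c x) = tmap (det_atlas A) (det_scale c) (det_scale c x) (s x)"
   using EsecD(4)[OF s] x VU c by (auto simp: invariant_over_def)
  thus "eres V s (det_scale c x) = tmap (det_atlas A) (det_scale c) (det_scale c x) (eres V s x)"
   using det_over_fst[OF x] by (simp add: eres_def)
 qed
qed

lemma Esec_local:
 assumes A: "atlas_compat A" and z: "!!x. x ~: det_over A U ==> s x = 0"
  and loc: "!!p. p : U ==> EX V. p : V & V <= U & mopen A V & eres V s : Esec A V"
 shows "s : Esec A U"
proof (rule EsecI)
 note dA = det_atlas_compat[OF A]
 have loc': "EX V. x : det_over A V & V <= U & mopen A V & eres V s : Esec A V" if x: "x : det_over A U" for x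
  using loc[OF det_over_fst[OF x]] det_over_iff[OF x] by blast
 have e: "eres V s x = s x" if "x : det_over A V" for x V using det_over_fst[OF that] by (simp add: eres_def)
 show "s x : tangent (det_atlas A) x" if x: "x : det_over A U" for x
 proof -
  obtain V where "x : det_over A V" "eres V s : Esec A V" using loc'[OF x] by blast
  thus ?thesis using EsecD(1)[of "eres V s" A V x] e by simp
 qed
 show "s x = 0" if "x ~: det_over A U" for x by (rule z[OF that])
 show "holo_on (det_atlas A) W (%x. s x f)" if W: "W <= det_over A U" "holo_on (det_atlas A) W f" for W f
 proof (rule holo_on_local)
  fix x assume x: "x : W"
  obtain V where V: "x : det_over A V" "mopen A V" "eres V s : Esec A V" using loc' x W(1) by blast
  let ?W = "W Int det_over A V"
  have m: "mopen (det_atlas A) ?W" by (rule mopen_Int[OF dA holo_on_mopen[OF W(2)] det_over_mopen[OF A V(2)]])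
  have f: "holo_on (det_atlas A) ?W f" by (rule holo_on_subset[OF W(2) m]) simp
  have "holo_on (det_atlas A) ?W (%x. s x f)" by (rule holo_on_cong[OF dA, THEN iffD1, rotated, OF EsecD(3)[OF V(3) _ f]]) (use e in auto)
  thus "EX V. x : V & V <= W & holo_on (det_atlas A) V (%x. s x f)" using x V(1) by (intro exI[of _ ?W]) auto
 qed
 show "invariant_over A U s" unfolding invariant_over_def
 proof (intro ballI allI impI)
  fix x c assume x: "x : det_over A U" and c: "(c::complex) ~= 0"
  obtain V where V: "x : det_over A V" "eres V s : Esec A V" using loc'[OF x] by blast
  have "eres V s (det_scale c x) = tmap (det_atlas A) (det_scale c) (det_scale c x) (eres V s x)"
   using EsecD(4)[OF V(2)] V(1) c by (simp add: invariant_over_def)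
  thus "s (det_scale c x) = tmap (det_atlas A) (det_scale c) (det_scale c x) (s x)" using det_over_fst[OF V(1)] by (simp add: eres_def)
 qed
qed

lemma eres_diff: "eres V (s - t) = eres V s - eres V t" by (auto simp: eres_def fun_eq_iff)

lemma mopen_chart_nbhd:
 assumes A: "atlas_compat A" and U: "mopen A U" "p : U"
 obtains O' ph V where "chart A O' ph" "p : V" "V <= U" "V <= O'" "mopen A V"
proof -
 obtain O' ph where u: "chart A O' ph" "p : O'" using chart_at[OF A] mopen_points[OF U(1)] U(2) by blast
 interpret chart A O' ph by (rule u(1))
 show ?thesis using that[OF u(1), of "U Int O'"] u U mopen_Int[OF A U(1) U_mopen] by blast
qed

lemma Esec_diff:
 assumes A: "atlas_compat A" and U: "mopen A U" and s: "s : Esec A U" and t: "t : Esec A U"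
 shows "s - t : Esec A U"
proof (rule Esec_local[OF A])
 show "(s - t) x = 0" if "x ~: det_over A U" for x using EsecD(2)[OF s that] EsecD(2)[OF t that] by simp
 fix p assume p: "p : U"
 obtain O' ph V where V: "chart A O' ph" "p : V" "V <= U" "V <= O'" "mopen A V" using mopen_chart_nbhd[OF A U p] .
 interpret chart A O' ph by (rule V(1))
 note c = Esec_comp[OF V(5,4) Esec_eres[OF A s V(3)]] Esec_comp[OF V(5,4) Esec_eres[OF A t V(3)]]
 have "eres V (s - t) = sec V (%k. comp k (eres V s)) - sec V (%k. comp k (eres V t))" unfolding eres_diff using c(2,4) by simp
 also have "... = sec V (%k p. comp k (eres V s) p - comp k (eres V t) p)" by (rule sec_diff)
 also have "... : Esec A V" by (intro sec_Esec V holo_on_diff c(1,3))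
 finally show "EX V. p : V & V <= U & mopen A V & eres V (s - t) : Esec A V" using V by blast
qed

locale rho_conn =
 fixes A :: "('a, 'n::finite) atlas" and N :: "('a, 'n) econn"
 assumes cA: "atlas_compat A" and N: "rho_connection A N" and tf: "rho_torsion_free A N" and ec: "euler_condition A N"
begin

lemma
 assumes "mopen A U" "s : Esec A U" "t : Esec A U"
 shows N_Esec: "N U s t : Esec A U"
  and N_eres: "mopen A V ==> V <= U ==> N V (eres V s) (eres V t) = eres V (N U s t)"
  and N_add1: "s' : Esec A U ==> N U (s+s') t = N U s t+N U s' t"
  and N_add2: "t' : Esec A U ==> N U s (t+t') = N U s t+N U s t'"
  and N_mul1: "holo_on A U g ==> N U (emul g s) t = emul g (N U s t)"
  and N_mul2: "holo_on A U g ==> N U s (emul g t) = emul (vapply (rho A s) g) t+emul g (N U s t)"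
 using N[unfolded rho_connection_def, THEN spec, THEN mp, OF assms(1), THEN bspec, OF assms(2), THEN bspec, OF assms(3)] by blast+

lemma bracket_N: "mopen A U ==> s : Esec A U ==> t : Esec A U ==> ebracket A U s t = N U s t - N U t s"
 using tf unfolding rho_torsion_free_def by (metis eq_iff_diff_eq_0)

lemma ebracket_Esec: "mopen A U ==> s : Esec A U ==> t : Esec A U ==> ebracket A U s t : Esec A U"
 using bracket_N Esec_diff[OF cA] N_Esec by simp

lemma eres_curvature:
 assumes U: "mopen A U" and s: "s1 : Esec A U" "s2 : Esec A U" "t : Esec A U" and V: "mopen A V" "V <= U"
 shows "eres V (rho_curvature A N U s1 s2 t) = rho_curvature A N V (eres V s1) (eres V s2) (eres V t)"
proof -
 note e = Esec_eres[OF cA _ V(2)]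
 have b: "eres V (ebracket A U s1 s2) = ebracket A V (eres V s1) (eres V s2)" using s e V U by (simp add: bracket_N eres_diff N_eres)
 show ?thesis unfolding rho_curvature_def eres_diff b[symmetric] using s e V U by (simp add: N_eres[symmetric] N_Esec ebracket_Esec)
qed

text \<open>Curvature commutes with restriction and a section that vanishes locally vanishes, so the
  check can be made on open sets inside charts.\<close>

lemma flat_local:
 assumes "!!p. p : points A ==> EX U. p : U & mopen A U &
  (ALL V s1 s2 t. mopen A V --> V <= U --> s1 : Esec A V --> s2 : Esec A V --> t : Esec A V -->
    rho_curvature A N V s1 s2 t = 0)"
 shows "rho_flat A N" unfolding rho_flat_def
proof (intro allI impI ballI ext)
 fix O' s1 s2 t x f
 assume O': "mopen A O'" and s: "s1 : Esec A O'" "s2 : Esec A O'" "t : Esec A O'"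
 have R: "rho_curvature A N O' s1 s2 t : Esec A O'" unfolding rho_curvature_def using O' s by (intro Esec_diff[OF cA] N_Esec ebracket_Esec)
 show "rho_curvature A N O' s1 s2 t x f = 0 x f"
 proof (cases "x : det_over A O'")
  case True
  hence p: "fst x : O'" by (rule det_over_fst)
  then obtain U where U: "fst x : U" "mopen A U" 
   "ALL V s1 s2 t. mopen A V --> V <= U --> s1 : Esec A V --> s2 : Esec A V --> t : Esec A V -->
    rho_curvature A N V s1 s2 t = 0" using assms[of "fst x"] mopen_points[OF O'] by blast
  let ?V = "O' Int U"
  have V: "mopen A ?V" "?V <= O'" "?V <= U" using mopen_Int[OF cA O' U(2)] by auto
  have "eres ?V (rho_curvature A N O' s1 s2 t) = 0"
   using eres_curvature[OF O' s V(1,2)] U(3) V Esec_eres[OF cA s(1) V(2)] Esec_eres[OF cA s(2) V(2)]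
    Esec_eres[OF cA s(3) V(2)] by simp
  hence "eres ?V (rho_curvature A N O' s1 s2 t) x f = 0" by simp
  thus ?thesis using p U(1) by (simp add: eres_def)
 next
  case False
  thus ?thesis using EsecD(2)[OF R] by simp
 qed
qed

end

locale rho_chart = rho_conn A N+chart A U ph
 for A :: "('a, 'n::finite) atlas" and N :: "('a, 'n) econn" and U and ph :: "'a => complex ^ 'n"
begin

text \<open>Christoffel symbols in the commuting frame, upper index first. The index
  \<open>None\<close> is the Euler direction, where the Euler condition and symmetry leave only the
  constant \<open>kp\<close>; see \<open>Gm_None\<close>.\<close>

definition Gm :: "'n option => 'n option => 'n option => 'a => complex" where
 "Gm l j k = comp l (N U (fr U j) (fr U k))"

definition kp :: complex where "kp = - 1 / (of_nat CARD('n)+1)"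

lemma frU: "fr U k : Esec A U" by (rule fr_Esec[OF U_mopen order_refl])

lemma Gm_holo: "holo_on A U (Gm l j k)" unfolding Gm_def by (rule Esec_comp(1)[OF U_mopen order_refl N_Esec[OF U_mopen frU frU]])

lemma N_fr: "mopen A V ==> V <= U ==> N V (fr V j) (fr V k) = sec V (%l. Gm l j k)"
proof -
 assume V: "mopen A V" "V <= U"
 have "N V (fr V j) (fr V k) = eres V (N U (fr U j) (fr U k))" using N_eres[OF U_mopen frU frU V] V by (simp add: eres_fr)
 also have "N U (fr U j) (fr U k) = sec U (%l. Gm l j k)"
  unfolding Gm_def by (rule Esec_comp(2)[OF U_mopen order_refl N_Esec[OF U_mopen frU frU]])
 finally show ?thesis by (simp add: eres_sec V)
qed

lemma Gm_sym: "p : U ==> Gm l j k p = Gm l k j p"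
proof -
 assume p: "p : U"
 have "N U (fr U j) (fr U k) - N U (fr U k) (fr U j) = 0" using bracket_N[OF U_mopen frU frU] ebracket_fr[OF U_mopen order_refl] by simp
 hence "sec U (%l. Gm l j k) = sec U (%l. Gm l k j)" using N_fr[OF U_mopen order_refl] by simp
 from sec_eqD[OF this p order_refl] show ?thesis .
qed

lemma Gm_None: "p : U ==> Gm l None k p = (if l = k then kp else 0)" "p : U ==> Gm l k None p = (if l = k then kp else 0)"
proof -
 have "N U (fr U None) (fr U k) = escale kp (fr U k)"
  using ec[unfolded euler_condition_def, THEN spec, THEN mp, OF U_mopen, THEN bspec, OF frU] by (simp add: euler_fr kp_def)
 hence *: "sec U (%l. Gm l None k) = sec U (%j p. kp * (if j = k then 1 else 0))"
  unfolding N_fr[OF U_mopen order_refl] by (simp add: fr_def sec_escale)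
 show "Gm l None k p = (if l = k then kp else 0)" if p: "p : U" using sec_eqD[OF * p order_refl, of l] by simp
 thus "p : U ==> Gm l k None p = (if l = k then kp else 0)" using Gm_sym by simp
qed

abbreviation Dv :: "('n option => 'a => complex) => ('a => complex) => 'a => complex" where
 "Dv a g p \<equiv> (SUM i. a (Some i) p * cpd U ph i g p)"

lemma rho_apply: "p : V ==> V <= U ==> holo_on A V g ==> rho A (sec V a) p g = Dv a g p" by (simp add: rho_sec tvec_def holo_nearI)

lemma zero_Esec: "mopen A V ==> V <= U ==> 0 : Esec A V" using sec_Esec[of V "%_ _. 0"] by (simp add: sec_zero)

lemma emul_0: "emul (%_. 0) s = 0" by (simp add: emul_def vmul_def vscale_def fun_eq_iff)

lemma N_sum1:
 assumes V: "mopen A V" "V <= U" and s: "!!j. s j : Esec A V" and t: "t : Esec A V"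
 shows "finite J ==> (SUM j:J. s j) : Esec A V & N V (SUM j:J. s j) t = (SUM j:J. N V (s j) t)"
proof (induction J rule: finite_induct)
 case empty
 have "N V 0 t = 0" using N_mul1[OF V(1) zero_Esec[OF V] t, of "%_. 0"] V by (simp add: emul_0)
 thus ?case using zero_Esec[OF V] unfolding sum.empty by blast
next
 case (insert j J)
 have "s j+(SUM j:J. s j) : Esec A V" using Esec_comp[OF V s[of j]] Esec_comp[OF V insert(3)[THEN conjunct1]] sec_add
   sec_Esec[OF V, of "%k p. comp k (s j) p+comp k (SUM j:J. s j) p"] holo_on_add by metis
 thus ?case unfolding sum.insert[OF insert(1,2)] using insert(3) N_add1[OF V(1) s t insert(3)[THEN conjunct1], of j] by (simp only:)
qed

lemma N_sum2:
 assumes V: "mopen A V" "V <= U" and s: "!!j. s j : Esec A V" and t: "t : Esec A V"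
 shows "finite J ==> N V t (SUM j:J. s j) = (SUM j:J. N V t (s j))"
proof (induction J rule: finite_induct)
 case empty
 have "N V t 0 = 0" using N_mul2[OF V(1) t zero_Esec[OF V], of "%_. 0"] V
  by (simp add: emul_0) (simp add: emul_def vmul_def vscale_def fun_eq_iff)
 thus ?case unfolding sum.empty .
next
 case (insert j J)
 thus ?case unfolding sum.insert[OF insert(1,2)]
  using N_add2[OF V(1) t s N_sum1[OF V s t insert(1), THEN conjunct1], of j] insert(3) by (simp only:)
qed

lemma N_sec:
 assumes V: "mopen A V" "V <= U" and a: "!!k. holo_on A V (a k)" and b: "!!k. holo_on A V (b k)"
 shows "N V (sec V a) (sec V b) = sec V (%l p. Dv a (b l) p+(SUM j. SUM k. a j p * b k p * Gm l j k p))"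
proof -
 note fV = fr_Esec[OF V]
 have E: "emul g (fr V k) : Esec A V" if "holo_on A V g" for g k
  unfolding fr_def sec_emul by (intro sec_Esec[OF V] holo_on_mult that) (use V in simp)
 have bE: "sec V b : Esec A V" by (rule sec_Esec[OF V b])
 have 1: "N V (fr V j) (emul (b k) (fr V k)) =
  sec V (%l p. (if l = k then Dv (%i _. if i = j then 1 else 0) (b k) p else 0)+b k p * Gm l j k p)" for j k
 proof -
  have "N V (fr V j) (emul (b k) (fr V k)) =
    emul (vapply (rho A (fr V j)) (b k)) (fr V k)+emul (b k) (N V (fr V j) (fr V k))" by (rule N_mul2[OF V(1) fV fV b])
  also have "emul (vapply (rho A (fr V j)) (b k)) (fr V k) =
    sec V (%l p. if l = k then Dv (%i _. if i = j then 1 else 0) (b k) p else 0)" unfolding fr_def sec_emul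
   by (rule sec_cong) (simp add: vapply_def rho_apply[OF _ V(2) b])
  also have "emul (b k) (N V (fr V j) (fr V k)) = sec V (%l p. b k p * Gm l j k p)" by (simp add: N_fr[OF V] sec_emul)
  finally show ?thesis by (simp add: sec_add)
 qed
 have 2: "N V (fr V j) (sec V b) = sec V (%l p. Dv (%i _. if i = j then 1 else 0) (b l) p+(SUM k. b k p * Gm l j k p))" for j
 proof -
  have "N V (fr V j) (sec V b) = (SUM k. N V (fr V j) (emul (b k) (fr V k)))"
   unfolding sec_fr[of V b] by (rule N_sum2[OF V E[OF b] fV finite])
  also have "... = sec V (%l p. Dv (%i _. if i = j then 1 else 0) (b l) p+(SUM k. b k p * Gm l j k p))"
   unfolding 1 sec_sum by (rule sec_cong) (simp add: sum.distrib)
  finally show ?thesis .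
 qed
 have "N V (sec V a) (sec V b) = (SUM j. N V (emul (a j) (fr V j)) (sec V b))"
  unfolding sec_fr[of V a] by (rule N_sum1[OF V E[OF a] bE finite, THEN conjunct2])
 also have "... = (SUM j. emul (a j) (N V (fr V j) (sec V b)))" by (intro sum.cong refl N_mul1[OF V(1) fV bE a])
 also have "... = sec V (%l p. Dv a (b l) p+(SUM j. SUM k. a j p * b k p * Gm l j k p))" unfolding 2 sec_emul sec_sum
 proof (rule sec_cong)
  fix l p
  have "(SUM j. a j p * (SUM i. (if Some i = j then 1 else 0) * cpd U ph i (b l) p)) =
   (SUM i. SUM j. a j p * ((if Some i = j then 1 else 0) * cpd U ph i (b l) p))" unfolding sum_distrib_left by (rule sum.swap)
  also have "... = Dv a (b l) p" by (intro sum.cong refl) (simp add: if_mult_left if_mult_right cong: if_cong)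
  finally show "(SUM j. a j p * ((SUM i. (if Some i = j then 1 else 0) * cpd U ph i (b l) p)+(SUM k. b k p * Gm l j k p))) =
   Dv a (b l) p+(SUM j. SUM k. a j p * b k p * Gm l j k p)" by (simp add: distrib_left sum.distrib sum_distrib_left mult_ac)
 qed
 finally show ?thesis .
qed

end

lemma sum_UNIV_option: "(SUM k. f k) = f None+(SUM i:(UNIV::'n::finite set). f (Some i))" by (simp add: UNIV_option_conv sum.reindex)

context chart
begin

lemma Efibre_sec: "p : U ==> v : Efibre A p ==> EX a. v = sec {p} (%k _. a k)" by (rule exI[of _ "%k. comp k v p"], rule Efibre_comp)

lemma Efibre_lin_closed: "p : U ==> lin_closed escale (Efibre A p)" unfolding lin_closed_def
proof (intro conjI ballI allI)
 assume p: "p : U"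
 show "0 : Efibre A p" using sec_Efibre[OF p, of "%_ _. 0"] by (simp add: sec_zero)
 fix v assume "v : Efibre A p"
 then obtain a where a: "v = sec {p} (%k _. a k)" using Efibre_sec[OF p] by blast
 show "escale c v : Efibre A p" for c unfolding a sec_escale by (rule sec_Efibre[OF p])
 fix w assume "w : Efibre A p"
 then obtain b where b: "w = sec {p} (%k _. b k)" using Efibre_sec[OF p] by blast
 show "v+w : Efibre A p" unfolding a b sec_add by (rule sec_Efibre[OF p])
qed

lemma comp_add: "comp k (v+w) p = comp k v p+comp k w p" by (simp add: comp_def)

lemma comp_escale: "comp k (escale c v) p = c * comp k v p" by (simp add: comp_def escale_def emul_def vmul_def vscale_def)

lemma comp_fr: "p : V ==> V <= U ==> comp k (fr V j) p = (if k = j then 1 else 0)" unfolding fr_def by (rule comp_sec)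

lemma rho_fr: "p : V ==> V <= U ==> rho A (fr V (Some j)) p = bvec j p"
 unfolding fr_def bvec_def rho_sec by (intro arg_cong[where f = "tvec p"] ext) simp

end

section \<open>Curvature in coordinates\<close>

lemma (in coordinates) vf_outside: "p ~: V ==> vf V a p = 0" by (simp add: vf_def)

context rho_chart
begin

text \<open>The classical formula for curvature. There is no bracket term because the frame
  commutes, and the Euler direction annihilates functions of the base, hence the value 0 for
  \<open>None\<close>.\<close>

definition Rm :: "'n option => 'n option => 'n option => 'n option => 'a => complex" where
 "Rm l i j k p = (case i of None => 0 | Some i => cpd U ph i (Gm l j k) p) - (case j of None => 0 | Some j => cpd U ph j (Gm l i k) p) +
  (SUM m. Gm m j k p * Gm l i m p - Gm m i k p * Gm l j m p)"

lemma kp_nonzero: "kp ~= 0"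
proof -
 have "(of_nat (CARD('n)+1) :: complex) ~= 0" unfolding of_nat_eq_0_iff by simp
 thus ?thesis by (simp add: kp_def add.commute)
qed

lemma Dv_option: "Dv a g p = (SUM i. a i p * (case i of None => 0 | Some i => cpd U ph i g p))" by (simp add: sum_UNIV_option)

lemma Dv_holo:
 assumes V: "mopen A V" "V <= U" and a: "!!k. holo_on A V (a k)" and f: "holo_on A V f"
 shows "holo_on A V (Dv a f)"
proof -
 have "holo_on A V (%p. a (Some i) p * cpd U ph i f p)" for i by (rule holo_on_mult[OF a[of "Some i"] holo_on_cpd[OF V(2) f]])
 thus ?thesis by (rule holo_on_sum[OF _ V(1)])
qed

lemma Dv_rules:
 assumes V: "mopen A V" "V <= U" "p : V" and f: "holo_on A V f" "holo_on A V g"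
 shows "Dv a (%x. f x+g x) p = Dv a f p+Dv a g p" "Dv a (%x. f x * g x) p = f p * Dv a g p+g p * Dv a f p"
  "(!!i. holo_on A V (h i)) ==> Dv a (%x. SUM i. h i x) p = (SUM i. Dv a (h i) p)"
proof -
 have p: "p : U" using V by blast
 have n: "holo_near A p f" "holo_near A p g" using holo_nearI[OF V(3)] f by auto
 show "Dv a (%x. f x+g x) p = Dv a f p+Dv a g p" "Dv a (%x. f x * g x) p = f p * Dv a g p+g p * Dv a f p"
  by (simp_all add: cpd_add[OF p n] cpd_mult[OF p n] distrib_left sum.distrib sum_distrib_left mult_ac)
 assume h: "!!i. holo_on A V (h i)"
 show "Dv a (%x. SUM i. h i x) p = (SUM i. Dv a (h i) p)" unfolding cpd_sum[OF p holo_nearI[OF V(3) h]] sum_distrib_left by (rule sum.swap)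
qed

lemma Dv_commutator:
 assumes V: "mopen A V" "V <= U" "p : V" and a: "!!k. holo_on A V (a k)" and b: "!!k. holo_on A V (b k)"
  and f: "holo_on A V f"
 shows "Dv a (Dv b f) p - Dv b (Dv a f) p = Dv (%k p. Dv a (b k) p - Dv b (a k) p) f p"
proof -
 have pU: "p : U" using V by blast
 have *: "Dv a (Dv b f) p = (SUM i. SUM j. a (Some i) p * b (Some j) p * cpd U ph i (cpd U ph j f) p)+Dv (%k. Dv a (b k)) f p"
  if b: "!!k. holo_on A V (b k)" for a b
 proof -
  have c: "holo_on A V (cpd U ph j f)" for j by (rule holo_on_cpd[OF V(2) f])
  have "Dv a (Dv b f) p = (SUM j. b (Some j) p * Dv a (cpd U ph j f) p+cpd U ph j f p * Dv a (b (Some j)) p)"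
   unfolding Dv_rules(3)[OF V f f holo_on_mult[OF b c], of a] Dv_rules(2)[OF V b c] ..
  also have "... = (SUM j. SUM i. a (Some i) p * b (Some j) p * cpd U ph i (cpd U ph j f) p)+Dv (%k. Dv a (b k)) f p"
   by (simp add: sum.distrib sum_distrib_left mult_ac)
  finally show ?thesis by (subst (asm) sum.swap)
 qed
 have "(SUM i. SUM j. a (Some i) p * b (Some j) p * cpd U ph i (cpd U ph j f) p) =
  (SUM i. SUM j. b (Some i) p * a (Some j) p * cpd U ph i (cpd U ph j f) p)"
  by (subst sum.swap) (simp add: cpd_commute[OF pU holo_nearI[OF V(3) f]] mult_ac)
 thus ?thesis using *[of b a, OF b] *[of a b, OF a] by (simp add: sum_subtractf left_diff_distrib)
qed

text \<open>Tensoriality: when the two orders of differentiation are subtracted, the terms with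
  derivatives of the coefficients are symmetric or are cancelled by the bracket \<open>B\<close>,
  and the values \<open>Rm\<close> on the frame remain.\<close>

lemma curvature_sec:
 assumes V: "mopen A V" "V <= U" and a: "!!k. holo_on A V (a k)" and b: "!!k. holo_on A V (b k)" and c: "!!k. holo_on A V (c k)"
 shows "rho_curvature A N V (sec V a) (sec V b) (sec V c) =
  sec V (%l p. SUM i. SUM j. SUM k. a i p * b j p * c k p * Rm l i j k p)"
proof -
 define M where "M a b l p = Dv a (b l) p+(SUM j. SUM k. a j p * b k p * Gm l j k p)" for a b l p
 define B where "B l p = Dv a (b l) p - Dv b (a l) p" for l p
 have G: "holo_on A V (Gm l j k)" for l j k by (rule holo_on_subset[OF Gm_holo V])
 have Mh: "holo_on A V (M a b l)" if "!!k. holo_on A V (a k)" "!!k. holo_on A V (b k)" for a b l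
  unfolding M_def[abs_def] by (intro holo_on_add holo_on_sum holo_on_mult Dv_holo[OF V] that G V)
 have Bh: "holo_on A V (B l)" for l unfolding B_def[abs_def] by (intro holo_on_diff Dv_holo V a b)
 have NM: "N V (sec V a) (sec V b) = sec V (M a b)" if "!!k. holo_on A V (a k)" "!!k. holo_on A V (b k)" for a b
  unfolding N_sec[OF V that] M_def[abs_def] ..
 have MB: "M a b l p - M b a l p = B l p" if p: "p : V" for l p
 proof -
  have "p : U" using p V by blast
  hence "(SUM j. SUM k. a j p * b k p * Gm l j k p) = (SUM j. SUM k. b j p * a k p * Gm l j k p)"
   by (subst sum.swap) (simp add: Gm_sym mult_ac)
  thus ?thesis by (simp add: M_def B_def)
 qed
 have "ebracket A V (sec V a) (sec V b) = sec V B"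
  unfolding bracket_N[OF V(1) sec_Esec[OF V a] sec_Esec[OF V b]] NM[of a b, OF a b] NM[of b a, OF b a] sec_diff by (rule sec_cong) (rule MB)
 hence "rho_curvature A N V (sec V a) (sec V b) (sec V c) = sec V (%l p. M a (M b c) l p - M b (M a c) l p - M B c l p)"
  unfolding rho_curvature_def by (simp add: NM a b c Bh Mh sec_diff)
 also have "... = sec V (%l p. SUM i. SUM j. SUM k. a i p * b j p * c k p * Rm l i j k p)"
 proof (rule sec_cong)
  fix l p assume p: "p : V"
  note R = Dv_rules[OF V p]
  define \<D> where "\<D> i g = (case i of None => 0 | Some i => cpd U ph i g p)" for i :: "'n option" and g
  \<comment> \<open>\<open>S\<close> collects the terms in which no coefficient is differentiated,
    \<open>X\<close> those with one derivative of \<open>c\<close>; the sum of \<open>X a b\<close>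
    and \<open>X b a\<close> is symmetric and drops out.\<close>
  define S where "S a b = (SUM i. SUM j. SUM k. a i p * b j p * c k p * (\<D> i (Gm l j k)+(SUM m. Gm m j k p * Gm l i m p)))"
   for a b :: "'n option => 'a => complex"
  define X where "X a b = (SUM j. SUM k. b j p * Dv a (c k) p * Gm l j k p)" for a b :: "'n option => 'a => complex"
  have D: "Dv a (M b c l) p = Dv a (Dv b (c l)) p+(SUM j. SUM k. Dv a (b j) p * c k p * Gm l j k p)+X a b +
    (SUM j. SUM k. b j p * c k p * Dv a (Gm l j k) p)" if b: "!!k. holo_on A V (b k)" for a b
  proof -
   define w where "w j k p = b j p * c k p * Gm l j k p" for j k p
   have h: "holo_on A V (w j k)" for j k unfolding w_def[abs_def] by (rule holo_on_mult[OF holo_on_mult[OF b c] G])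
   have h': "holo_on A V (%p. SUM k. w j k p)" for j by (rule holo_on_sum[OF h V(1)])
   have "M b c l = (%p. Dv b (c l) p+(SUM j. SUM k. w j k p))" by (simp add: M_def fun_eq_iff w_def)
   hence 1: "Dv a (M b c l) p = Dv a (%p. Dv b (c l) p+(SUM j. SUM k. w j k p)) p" by simp
   have 2: "... = Dv a (Dv b (c l)) p+Dv a (%p. SUM j. SUM k. w j k p) p"
    by (rule R(1)[OF Dv_holo[of V b "c l", OF V b c] holo_on_sum[OF h' V(1)]])
   have 3: "Dv a (%p. SUM j. SUM k. w j k p) p = (SUM j. Dv a (%p. SUM k. w j k p) p)" by (rule R(3)[OF c c]) (rule h')
   have 4: "Dv a (%p. SUM k. w j k p) p = (SUM k. Dv a (w j k) p)" for j by (rule R(3)[OF c c]) (rule h)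
   have 5: "Dv a (w j k) p = Dv a (b j) p * c k p * Gm l j k p+b j p * Dv a (c k) p * Gm l j k p+b j p * c k p * Dv a (Gm l j k) p" for j k
    unfolding w_def[abs_def] R(2)[OF holo_on_mult[OF b c] G] R(2)[OF b c] by (simp add: algebra_simps)
   show ?thesis unfolding 1 2 3 4 5 X_def sum.distrib by (simp only: add.assoc)
  qed
  have M: "M a (M b c) l p = Dv a (Dv b (c l)) p+(SUM j. SUM k. Dv a (b j) p * c k p * Gm l j k p)+X a b+X b a+S a b"
   if b: "!!k. holo_on A V (b k)" for a b
  proof -
   have 1: "(SUM j. SUM k. b j p * c k p * Dv a (Gm l j k) p) = (SUM i. SUM j. SUM k. a i p * b j p * c k p * \<D> i (Gm l j k))"
    unfolding Dv_option \<D>_def[symmetric] sum_distrib_left by (subst (2) sum.swap, subst sum.swap) (simp add: mult_ac)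
   have 2: "(SUM i. SUM m. a i p * (SUM j. SUM k. b j p * c k p * Gm m j k p) * Gm l i m p) =
     (SUM i. SUM j. SUM k. a i p * b j p * c k p * (SUM m. Gm m j k p * Gm l i m p))"
   proof (rule sum.cong[OF refl])
    fix i
    have "(SUM m. a i p * (SUM j. SUM k. b j p * c k p * Gm m j k p) * Gm l i m p) =
     (SUM m. SUM j. SUM k. a i p * b j p * c k p * (Gm m j k p * Gm l i m p))" by (simp add: sum_distrib_left sum_distrib_right mult_ac)
    also have "... = (SUM j. SUM m. SUM k. a i p * b j p * c k p * (Gm m j k p * Gm l i m p))" by (rule sum.swap)
    also have "... = (SUM j. SUM k. SUM m. a i p * b j p * c k p * (Gm m j k p * Gm l i m p))" by (rule sum.cong[OF refl sum.swap])
    also have "... = (SUM j. SUM k. a i p * b j p * c k p * (SUM m. Gm m j k p * Gm l i m p))" by (simp only: sum_distrib_left)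
    finally show "(SUM m. a i p * (SUM j. SUM k. b j p * c k p * Gm m j k p) * Gm l i m p) =
     (SUM j. SUM k. a i p * b j p * c k p * (SUM m. Gm m j k p * Gm l i m p))" .
   qed
   have 3: "M a (M b c) l p = Dv a (M b c l) p+X b a +
     (SUM i. SUM m. a i p * (SUM j. SUM k. b j p * c k p * Gm m j k p) * Gm l i m p)"
    unfolding M_def[of a "M b c"] M_def[of b c _ p] X_def by (simp only: distrib_left distrib_right sum.distrib add.assoc)
   show ?thesis unfolding 3 D[where a = a, OF b] S_def distrib_left sum.distrib 1 2 by (simp only: add_ac)
  qed
  have "S b a = (SUM i. SUM j. SUM k. a i p * b j p * c k p * (\<D> j (Gm l i k)+(SUM m. Gm m i k p * Gm l j m p)))"
   unfolding S_def by (subst sum.swap) (simp add: mult_ac)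
  moreover have Rm: "Rm l i j k p = (\<D> i (Gm l j k)+(SUM m. Gm m j k p * Gm l i m p)) - (\<D> j (Gm l i k)+(SUM m. Gm m i k p * Gm l j m p))" for i j k
   by (simp add: Rm_def \<D>_def sum_subtractf)
  ultimately have S: "S a b - S b a = (SUM i. SUM j. SUM k. a i p * b j p * c k p * Rm l i j k p)"
   unfolding S_def[of a b] Rm by (simp only: right_diff_distrib sum_subtractf)
  have C: "Dv a (Dv b (c l)) p = Dv b (Dv a (c l)) p+Dv B (c l) p"
   using Dv_commutator[OF V p, of a b "c l", OF a b c] unfolding B_def[abs_def] by (simp add: algebra_simps)
  have "M B c l p = Dv B (c l) p+(SUM j. SUM k. Dv a (b j) p * c k p * Gm l j k p) - (SUM j. SUM k. Dv b (a j) p * c k p * Gm l j k p)"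
   unfolding M_def[of B c l p] by (simp only: B_def left_diff_distrib sum_subtractf add_diff_eq)
  thus "M a (M b c) l p - M b (M a c) l p - M B c l p = (SUM i. SUM j. SUM k. a i p * b j p * c k p * Rm l i j k p)"
   unfolding M[where a = a and b = b, OF b] M[where a = b and b = a, OF a] C by (simp add: S[symmetric])
 qed
 finally show ?thesis .
qed

lemma curvature_fr: "rho_curvature A N U (fr U i) (fr U j) (fr U k) = sec U (%l. Rm l i j k)"
proof -
 have d: "(SUM j. (if j = i then 1 else 0) * f j) = f i" for f :: "'n option => complex" and i by (simp add: if_mult_left cong: if_cong)
 have 1: "holo_on A U (%_. if l = k then 1 else 0)" for l k :: "'n option" using U_mopen by simp
 show ?thesis unfolding fr_def curvature_sec[OF U_mopen order_refl 1 1 1] by (simp only: mult.assoc sum_distrib_left[symmetric] d)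
qed

lemma Rm_zero_flat:
 assumes z: "!!l i j k p. p : U ==> Rm l i j k p = 0"
  and V: "mopen A V" "V <= U" and s: "s1 : Esec A V" "s2 : Esec A V" "t : Esec A V"
 shows "rho_curvature A N V s1 s2 t = 0"
proof -
 note c = Esec_comp[OF V s(1)] Esec_comp[OF V s(2)] Esec_comp[OF V s(3)]
 have "rho_curvature A N V s1 s2 t = sec V (%l p. 0)"
  apply (subst c(2), subst c(4), subst c(6), subst curvature_sec[OF V c(1,3,5)])
  apply (rule sec_cong) using z V(2) by (simp add: subset_iff)
 thus ?thesis by (simp add: sec_zero)
qed

lemma Ricci_Rm:
 assumes rf: "Ricci_flat A N" and p: "p : U"
 shows "(SUM i. Rm i i j k p) = 0"
proof -
 have "rho_Ricci A N U (fr U) (fr U k) (fr U j) p = 0"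
  using rf[unfolded Ricci_flat_def, THEN spec, THEN spec, THEN mp, OF is_frame_fr[OF U_mopen order_refl],
   THEN bspec, OF frU, THEN bspec, OF frU] p by blast
 thus ?thesis unfolding rho_Ricci_def curvature_fr frame_coords_fr[OF order_refl p] .
qed

end

section \<open>Holomorphic curves\<close>

definition cv :: "complex => complex ^ 1" where "cv z = (\<chi> i. z)"

lemma cv_nth1 [simp]: "cv z$i = z" by (simp add: cv_def)

lemma cv_nth: "cv (x$1) = x" by (simp add: vec_eq_iff forall_1)

lemma cv_eq [simp]: "cv z = cv w \<longleftrightarrow> z = w" by (auto simp: vec_eq_iff)

lemma bounded_linear_cv: "bounded_linear cv"
proof -
 have "cv = axis 1" by (auto simp: fun_eq_iff vec_eq_iff axis_def forall_1)
 thus ?thesis using bounded_linear_axis[of "1::1"] by simp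
qed

lemma bounded_linear_nth1: "bounded_linear (%x :: complex ^ 1. x$1)" by (rule bounded_linear_vec_nth)

lemma holo1_iff:
 fixes T :: "(complex ^ 1) set"
 shows "holo T f \<longleftrightarrow> open {z. cv z : T} & (%z. f (cv z)) holomorphic_on {z. cv z : T}" (is "?L \<longleftrightarrow> open ?O & _")
proof
 assume L: ?L
 have o: "open ?O" using open_vimage[OF holo_open[OF L] linear_continuous_on[OF bounded_linear_cv]] by (simp add: vimage_def)
 have "((%z. f (cv z)) has_field_derivative pd 1 f (cv z)) (at z)" if z: "cv z : T" for z
 proof -
  have "(f has_derivative (%h. SUM i. (\<chi> i. pd i f (cv z))$i * h$i)) (at (cv z))" using holo_has_derivative[OF L z] by simp
  from has_derivative_compose[OF bounded_linear_imp_has_derivative[OF bounded_linear_cv] this]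
  show ?thesis by (simp add: has_field_derivative_def sum_1)
 qed
 hence "(%z. f (cv z)) holomorphic_on ?O" by (auto simp: holomorphic_on_open[OF o])
 thus "open ?O & (%z. f (cv z)) holomorphic_on ?O" using o by blast
next
 assume R: "open ?O & (%z. f (cv z)) holomorphic_on ?O"
 have T: "T = (%x. x$1) -` ?O" by (auto simp: cv_nth)
 have "open T" by (subst T, rule open_vimage[OF R[THEN conjunct1] linear_continuous_on[OF bounded_linear_nth1]])
 moreover have "EX a :: complex ^ 1. (f has_derivative (%h. SUM i. a$i * h$i)) (at x)" if x: "x : T" for x
 proof -
  have "x$1 : ?O" using x by (simp add: cv_nth)
  then obtain d where "((%z. f (cv z)) has_derivative (*) d) (at (x$1))"
   using R holomorphic_on_open[OF R[THEN conjunct1]] by (auto simp: has_field_derivative_def)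
  from has_derivative_compose[OF bounded_linear_imp_has_derivative[OF bounded_linear_nth1] this]
  have "(f has_derivative (%h. d * h$1)) (at x)" by (simp add: cv_nth)
  thus ?thesis by (intro exI[of _ "\<chi> i. d"]) (simp add: sum_1)
 qed
 ultimately show ?L unfolding holo_def by blast
qed

text \<open>An open set of the plane as a Riemann surface; discs of this kind serve as domains when
  a parametrized geodesic has to be regarded as an unparametrized curve.\<close>

definition plane_atlas :: "complex set => (complex, 1) atlas" where
 "plane_atlas S = {(S, cv)}"

lemma std_atlas_eq: "std_atlas = plane_atlas UNIV" by (simp add: std_atlas_def plane_atlas_def cv_def[abs_def])

lemma inv_cv [simp]: "z : S ==> inv_into S cv (cv z) = z" by (rule inv_into_f_f) (auto simp: inj_on_def)

lemma cv_image [simp]: "{z. cv z : cv`W} = W" by auto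

lemma mopen_plane: "mopen (plane_atlas S) W \<longleftrightarrow> W <= S & open W"
proof -
 have "open (cv`W) \<longleftrightarrow> open W" using holo1_iff[of "cv`W" "%_. 0"] by simp
 thus ?thesis by (auto simp: mopen_def plane_atlas_def points_def Int_absorb1)
qed

lemma holo_on_plane: "holo_on (plane_atlas S) W f \<longleftrightarrow> W <= S & open W & f holomorphic_on W"
proof (cases "W <= S & open W")
 case True
 have "holo (cv`W) (%x. f (inv_into S cv x)) \<longleftrightarrow> (%z. f (inv_into S cv (cv z))) holomorphic_on W"
  using holo1_iff[of "cv`W"] True by simp
 also have "... \<longleftrightarrow> f holomorphic_on W" by (rule holomorphic_cong) (use True in auto)
 finally show ?thesis using True by (simp add: holo_on_def mopen_plane) (simp add: plane_atlas_def Int_absorb1)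
qed (auto simp: holo_on_def mopen_plane)

lemma points_plane [simp]: "points (plane_atlas S) = S" by (simp add: points_def plane_atlas_def)

lemma plane_compat: "open S ==> atlas_compat (plane_atlas S)"
proof -
 assume S: "open S"
 have o: "open (cv`S)" using holo1_iff[of "cv`S" "%_. 0"] S by simp
 have "holo (cv`S) (%x. cv (inv_into S cv x)$i)" for i by (rule holo_cong[THEN iffD1, rotated, OF holo_coord[OF o, of i]]) auto
 thus ?thesis using o by (auto simp: atlas_compat_def plane_atlas_def inj_on_def)
qed

lemma std_compat [simp]: "atlas_compat std_atlas" unfolding std_atlas_eq by (rule plane_compat) simp

lemma mopen_std [simp]: "mopen std_atlas W \<longleftrightarrow> open W" by (simp add: std_atlas_eq mopen_plane)

lemma holo_on_std [simp]: "holo_on std_atlas W f \<longleftrightarrow> open W & f holomorphic_on W"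
 by (simp add: std_atlas_eq holo_on_plane)

lemma mtop_plane: "open S ==> mtop (plane_atlas S) = subtopology euclidean S" unfolding topology_eq openin_mtop[OF plane_compat] mopen_plane
 by (auto simp: openin_subtopology)

lemma complex_manifold_plane: "open S ==> complex_manifold (plane_atlas S)"
proof -
 assume S: "open S"
 have "second_countable (euclidean :: complex topology)"
 proof -
  obtain B :: "complex set set" where "countable B" "topological_basis B" using ex_countable_basis by blast
  thus ?thesis unfolding second_countable_def using topological_basis_open topological_basisE by (metis open_openin)
 qed
 hence "second_countable (mtop (plane_atlas S))" using second_countable_subtopology mtop_plane[OF S] by metis
 moreover have "Hausdorff_space (mtop (plane_atlas S))"
  using Hausdorff_space_subtopology[OF Hausdorff_space_euclidean] mtop_plane[OF S] by metis
 ultimately show ?thesis using plane_compat[OF S] unfolding complex_manifold_def atlas_compat_def by blast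
qed

lemma connected_plane: "open S ==> connected S ==> connected_space (mtop (plane_atlas S))"
 by (simp add: mtop_plane connectedin_iff_connected[symmetric] connectedin_def)

lemma plane_iso: 
 assumes S: "open S" and W: "open W" "W <= S"
 shows "iso_on std_atlas (plane_atlas S) W (%z. z)" unfolding iso_on_def using W by (auto simp: holo_on_plane)

definition cderiv :: "complex => complex tvec" where
 "cderiv z = (%f. if holo_near std_atlas z f then deriv f z else 0)"

lemma holo_near_std: "holo_near std_atlas z f ==> f field_differentiable (at z)"
 unfolding holo_near_def by (auto intro: holomorphic_on_imp_differentiable_at)

lemma cderiv_tangent: "cderiv z : tangent std_atlas z"
proof (rule tangentI)
 note a = holo_near_add[OF std_compat] note m = holo_near_mult[OF std_compat]
 show "cderiv z f = 0" if "\<not> holo_near std_atlas z f" for f using that by (simp add: cderiv_def)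
 show "cderiv z f = cderiv z g" if f: "holo_near std_atlas z f" and W: "mopen std_atlas W" "z : W" and e: "!!x. x : W ==> f x = g x" for f g W
 proof -
  have "holo_near std_atlas z g" using holo_near_cong[OF std_compat W, of f g] e f by blast
  moreover have "deriv f z = deriv g z" by (rule deriv_cong_ev) (use e W in \<open>auto simp: eventually_nhds\<close>)
  ultimately show ?thesis using f by (simp add: cderiv_def)
 qed
 fix f g assume f: "holo_near std_atlas z f" and g: "holo_near std_atlas z g"
 note d = holo_near_std[OF f] holo_near_std[OF g]
 show "cderiv z (%x. f x+g x) = cderiv z f+cderiv z g" using f g a[OF f g] d by (simp add: cderiv_def)
 show "cderiv z (%x. f x * g x) = f z * cderiv z g+g z * cderiv z f" using f g m[OF f g] d by (simp add: cderiv_def mult_ac)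
next
 fix f and c :: complex assume f: "holo_near std_atlas z f"
 have "holo_near std_atlas z (%x. c * f x)"
  by (rule holo_near_mult[OF std_compat holo_near_const f]) (use std_compat in \<open>simp_all add: std_atlas_eq\<close>)
 thus "cderiv z (%x. c * f x) = c * cderiv z f" using f holo_near_std[OF f] by (simp add: cderiv_def)
qed

lemma curve_holomorphic:
 assumes A: "atlas_compat A" and gm: "holo_map std_atlas A W gm" and f: "holo_on A V f"
 shows "open {w : W. gm w : V}" "(%w. f (gm w)) holomorphic_on {w : W. gm w : V}" using holo_map_compose[OF std_compat A gm f] by simp_all

lemma velocity_tmap:
 assumes A: "atlas_compat A" and gm: "holo_map std_atlas A W gm" and z: "z : W"
 shows "velocity A gm z = tmap A gm (gm z) (cderiv z)" "velocity A gm z : tangent A (gm z)"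
proof -
 have s: "smooth_at std_atlas A gm z" by (rule holo_map_smooth[OF std_compat A gm z])
 show "velocity A gm z = tmap A gm (gm z) (cderiv z)" using smooth_at_near[OF s] by (simp add: velocity_def tmap_def cderiv_def fun_eq_iff)
 thus "velocity A gm z : tangent A (gm z)" using tmap_tangent[OF std_compat A s cderiv_tangent] by simp
qed

lemma holo_map_std_subset:
 assumes A: "atlas_compat A" and gm: "holo_map std_atlas A W gm" and W': "open W'" "W' <= W"
 shows "holo_map std_atlas A W' gm"
proof (rule holo_mapI[OF std_compat])
 show "mopen std_atlas W'" "gm`W' <= points A" using W' gm by (auto simp: holo_map_def)
 fix V ps i assume V: "(V, ps) : A"
 have "holo_on A V (%p. ps p$i)" by (rule coord_components[OF coord_chart[OF A V]])
 from curve_holomorphic[OF A gm this]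
 have "open {w : W. gm w : V}" "(%w. ps (gm w)$i) holomorphic_on {w : W. gm w : V}" .
 moreover have "{w : W'. gm w : V} = W' Int {w : W. gm w : V}" using W' by auto
 ultimately show "holo_on std_atlas {w : W'. gm w : V} (%x. ps (gm x)$i)" using W' by (auto intro: holomorphic_on_subset)
qed

context coordinates
begin

abbreviation "ccoord gm i w \<equiv> ph (gm w)$i"

lemma ccoord_holomorphic:
 assumes gm: "holo_map std_atlas A W gm" and "gm`W <= U"
 shows "ccoord gm i holomorphic_on W"
proof -
 have "{w : W. gm w : U} = W" using assms(2) by auto
 thus ?thesis using curve_holomorphic(2)[OF A gm coord_components[OF ph], of i] by simp
qed

lemma velocity_coord:
 assumes "gm z : U"
 shows "velocity A gm z (%x. ph x$i) = deriv (ccoord gm i) z" using coord_near[of "gm z" i, OF assms] by (simp add: velocity_def)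

lemma curve_chain:
 assumes gm: "holo_map std_atlas A W gm" and z: "z : W" "gm z : U" and f: "holo_near A (gm z) f"
 shows "deriv (%w. f (gm w)) z = (SUM i. deriv (ccoord gm i) z * cpd U ph i f (gm z))"
 using tangent_expand[OF z(2) velocity_tmap(2)[OF A gm z(1)] f] f by (simp add: velocity_coord[of gm z, OF z(2)]) (simp add: velocity_def)

lemma velocity_zero_iff:
 assumes gm: "holo_map std_atlas A W gm" and z: "z : W" "gm z : U"
 shows "velocity A gm z = 0 \<longleftrightarrow> (ALL i. deriv (ccoord gm i) z = 0)"
proof
 assume "velocity A gm z = 0"
 thus "ALL i. deriv (ccoord gm i) z = 0" using velocity_coord[of gm z, OF z(2)] by (metis zero_fun_apply)
next
 assume *: "ALL i. deriv (ccoord gm i) z = 0"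
 show "velocity A gm z = 0" using tvec_eq[OF z(2) velocity_tmap(2)[OF A gm z(1)]] unfolding velocity_coord[of gm z, OF z(2)] tvec_def
  by (simp add: * fun_eq_iff)
qed

lemma holo_mapI_std:
 assumes W: "open W" and f: "!!i. (%w. f w$i) holomorphic_on W" and fU: "f`W <= ph`U"
 shows "holo_map std_atlas A W (%w. inv_into U ph (f w))"
proof (rule holo_mapI[OF std_compat])
 show "mopen std_atlas W" using W by simp
 have inU: "inv_into U ph (f w) : U" if "w : W" for w using fU that by (auto intro: inv_into_into)
 show "(%w. inv_into U ph (f w))`W <= points A" using inU U_points by blast
 fix V ps i assume V: "(V, ps) : A"
 have t: "holo (ph`(U Int V)) (%x. ps (inv_into U ph x)$i)" by (rule coord_transition[OF A ph coord_chart[OF A V]])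
 let ?O = "{w : W. inv_into U ph (f w) : V}"
 have e: "inv_into U ph (f w) : V \<longleftrightarrow> f w : ph`(U Int V)" if w: "w : W" for w
 proof
  assume "inv_into U ph (f w) : V"
  hence "inv_into U ph (f w) : U Int V" using inU[OF w] by blast
  moreover have "ph (inv_into U ph (f w)) = f w" using fU w by (auto intro: f_inv_into_f)
  ultimately show "f w : ph`(U Int V)" by force
 qed auto
 have h: "holo (cv`W) (%x. f (x$1)$k)" for k using holo1_iff[of "cv`W" "%x. f (x$1)$k"] W f[of k] by simp
 have p: "{x : cv`W. f (x$1) : ph`(U Int V)} = cv`?O" using e by auto
 have "open (cv`?O)" unfolding p[symmetric] by (rule open_holo_preimage[OF h holo_open[OF t]])
 hence "holo (cv`?O) (%x. ps (inv_into U ph (f (x$1)))$i)" by (intro holo_compose(1)[OF holo_subset[OF h] t]) (use e in auto)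
 thus "holo_on std_atlas ?O (%x. ps (inv_into U ph (f x))$i)"
  using holo1_iff[of "cv`?O" "%x. ps (inv_into U ph (f (x$1)))$i"] by simp
qed

end

section \<open>Geodesics in coordinates\<close>

context rho_chart
begin

lemma rho_sec_outside: "V <= U ==> p ~: V ==> rho A (sec V a) p = 0"
proof -
 assume V: "V <= U" and p: "p ~: V"
 show ?thesis
 proof (cases "det_over A {p} = {}")
  case False
  hence "(SOME x. x : det_over A {p}) : det_over A {p}" by (simp add: some_in_eq)
  from det_over_fst[OF this] have "(SOME x. x : det_over A {p}) ~: det_over A V"
   using p det_over_fst[of "SOME x. x : det_over A {p}" A V] by auto
  thus ?thesis by (simp add: rho_def sec_def tmap_def fun_eq_iff)
 next
  case True
  have "p ~: points A"
  proof
   assume q: "p : points A"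
   obtain O' ps where c: "chart A O' ps" "p : O'" using chart_at[OF A q] .
   interpret c: chart A O' ps by (rule c(1))
   have "(p, c.nv p 1) : det_over A {p}" by (rule c.unit_over) (use c(2) in auto)
   thus False using True by blast
  qed
  hence "\<not> holo_near A p f" for f using holo_near_points[of A p f] by blast
  thus ?thesis by (simp add: rho_def tmap_def fun_eq_iff)
 qed
qed

definition hlift :: "('n => 'b) => 'n option => 'b::zero" where
 "hlift a k = (case k of None => 0 | Some i => a i)"

lemma hlift_simps [simp]: "hlift a None = 0" "hlift a (Some i) = a i" by (simp_all add: hlift_def)

text \<open>The splitting of \<open>rho\<close> that belongs to the chart: coordinate fields of the
  base are lifted to coordinate fields of \<open>det(TM)\<close>, with no Euler component. Its
  connection \<open>conn\<close> has as Christoffel symbols the \<open>Gm\<close> with all indices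
  of the form \<open>Some i\<close>.\<close>

definition hsec :: "'a => 'a tvec => ('a, 'n) esec" where
 "hsec p v = sec {p} (%k _. hlift (%i. v (%x. ph x$i)) k)"

lemma hsec_bundle:
 "V <= U ==> apply_bundle_map hsec V X = sec V (%k p. hlift (%i. X p (%x. ph x$i)) k)"
 by (rule ext)+ (auto simp: apply_bundle_map_def hsec_def sec_def det_over_def)

lemma hsec_vf:
 "V <= U ==> apply_bundle_map hsec V (vf V a) = sec V (%k p. hlift (%i. a i p) k)"
 unfolding hsec_bundle by (rule sec_cong) (auto simp: vf_def tvec_coord subset_iff)

lemma hlift_holo: "mopen A V ==> (!!i. holo_on A V (a i)) ==> holo_on A V (%p. hlift (%i. a i p) k)" by (cases k) simp_all

lemma rho_section_hsec: "rho_section A U hsec" unfolding rho_section_def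
proof (intro conjI ballI allI impI)
 fix p v assume p: "p : U" and v: "v : tangent A p"
 have pp: "p : {p}" "{p} <= U" using p by auto
 show "hsec p v : Efibre A p" unfolding hsec_def by (rule sec_Efibre[OF p])
 show "rho A (hsec p v) p = v" unfolding hsec_def rho_sec[OF pp] using tvec_eq[OF p v] by simp
 show "hsec p (vscale c v) = escale c (hsec p v)" for c
  unfolding hsec_def sec_escale by (rule sec_cong) (simp add: hlift_def vscale_def split: option.split)
 show "hsec p (v+w) = hsec p v+hsec p w" for w unfolding hsec_def sec_add by (rule sec_cong) (simp add: hlift_def split: option.split)
next
 fix V X assume V: "mopen A V & V <= U & X : vfields A V"
 have "holo_on A V (%p. X p (%x. ph x$i))" for i by (rule vfields_comp(1)) (use V in auto)
 thus "apply_bundle_map hsec V X : Esec A V" using V by (simp add: hsec_bundle sec_Esec hlift_holo)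
qed

abbreviation "conn \<equiv> induced_conn A N hsec"

lemma conn_vf:
 assumes V: "mopen A V" "V <= U" and a: "!!i. holo_on A V (a i)" and b: "!!i. holo_on A V (b i)"
 shows "conn V (vf V a) (vf V b) = vf V (%l p. (SUM i. a i p * cpd U ph i (b l) p) +
  (SUM i. SUM j. a i p * b j p * Gm (Some l) (Some i) (Some j) p))" (is "_ = vf V ?c")
proof
 fix p
 have *: "conn V (vf V a) (vf V b) =
  rho A (sec V (%l p. Dv (%k p. hlift (%i. a i p) k) (%p. hlift (%i. b i p) l) p +
   (SUM j. SUM k. hlift (%i. a i p) j * hlift (%i. b i p) k * Gm l j k p)))" unfolding induced_conn_def hsec_vf[OF V(2)]
  by (subst N_sec[OF V]) (simp_all add: hlift_holo[OF V(1)] a b)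
 show "conn V (vf V a) (vf V b) p = vf V ?c p"
 proof (cases "p : V")
  case True
  show ?thesis unfolding * rho_sec[OF True V(2)] using True by (simp add: vf_def sum_UNIV_option)
 next
  case False
  show ?thesis unfolding * rho_sec_outside[OF V(2) False] by (simp add: vf_outside[OF False])
 qed
qed

lemma geodesic_equation:
 assumes g: "param_geodesic A U conn W gm" and z: "z : W"
 shows "deriv (deriv (ccoord gm l)) z +
  (SUM i. SUM j. deriv (ccoord gm i) z * deriv (ccoord gm j) z * Gm (Some l) (Some i) (Some j) (gm z)) = 0"
proof -
 have gm: "holo_map std_atlas A W gm" "gm`W <= U" using g by (auto simp: param_geodesic_def)
 obtain W' V X where W': "open W'" "z : W'" "W' <= W" and V: "mopen A V" "V <= U" "gm`W' <= V"
  and X: "X : vfields A V" "ALL w:W'. X (gm w) = velocity A gm w & conn V X X (gm w) = 0" using g z unfolding param_geodesic_def by blast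
 define a where "a l p = X p (%x. ph x$l)" for l p
 have a: "holo_on A V (a l)" for l unfolding a_def[abs_def] by (rule vfields_comp(1)[OF X(1) V(1,2)])
 have Xa: "X = vf V a" unfolding a_def[abs_def] by (rule vfields_comp(2)[OF X(1) V(1,2)])
 have av: "a l (gm w) = deriv (ccoord gm l) w" if w: "w : W'" for l w
 proof -
  have "gm w : U" using gm(2) W'(3) w by blast
  from velocity_coord[of gm w, OF this] X(2) w show ?thesis by (simp add: a_def)
 qed
 have zV: "gm z : V" and zU: "gm z : U" using V W' by auto
 have "deriv (deriv (ccoord gm l)) z = deriv (%w. a l (gm w)) z"
  by (rule deriv_cong_ev) (use av W' in \<open>auto simp: eventually_nhds intro!: exI[of _ W']\<close>)
 also have "... = (SUM i. deriv (ccoord gm i) z * cpd U ph i (a l) (gm z))" by (rule curve_chain[OF gm(1) z zU holo_nearI[OF zV a]])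
 finally have 1: "deriv (deriv (ccoord gm l)) z = (SUM i. deriv (ccoord gm i) z * cpd U ph i (a l) (gm z))" .
 have "conn V X X (gm z) (%x. ph x$l) = 0" using X(2) W'(2) by simp
 thus ?thesis unfolding Xa conn_vf[OF V(1,2) a a] 1 using zV by (simp add: vf_def tvec_coord[OF zU] av[OF W'(2)])
qed

text \<open>The geodesic equation is a first order system for positions (\<open>Inl\<close>) and
  velocities (\<open>Inr\<close>), solved by \<open>commuting_flows\<close> with a single parameter,
  for which commutation is trivial. As \<open>param_geodesic\<close> asks for a vector field
  extending the velocity, the curve is shrunk until its coordinate \<open>m\<close>, of nonzero
  derivative \<open>a m\<close> at the start, is injective.\<close>

lemma geodesic_exists:
 assumes p: "p : U" and m: "a m ~= 0"
 obtains r gm where "r > 0" "param_geodesic A U conn (ball 0 r) gm" "gm 0 = p" "!!i. deriv (ccoord gm i) 0 = a i"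
proof -
 define px :: "complex ^ ('n+'n) => complex ^ 'n" where "px y = (\<chi> i. y$Inl i)" for y
 have pxh: "holo S (%y. px y$i)" if "open S" for S i using holo_coord[OF that] by (simp add: px_def)
 define Om where "Om = {y : UNIV. px y : ph`U}"
 have oU: "open (ph`U)" using mopen_iff[of U] U_mopen by simp
 have Om: "open Om" unfolding Om_def by (rule open_holo_preimage[OF pxh oU]) simp
 have Gmh: "holo Om (%y. Gm (Some l) (Some i) (Some j) (inv_into U ph (px y)))" for l i j
  by (rule holo_compose(1)[OF pxh[OF Om]]) (use Gm_holo holo_on_iff[of U] in \<open>auto simp: Om_def\<close>)
 define G :: "1 => complex ^ ('n+'n) => complex ^ ('n+'n)" where
  "G t y = (\<chi> k. case k of Inl i => y$Inr i
   | Inr l => - (SUM i. SUM j. y$Inr i * y$Inr j * Gm (Some l) (Some i) (Some j) (inv_into U ph (px y))))" for t y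
 have Gh: "holo Om (%y. G t y$k)" for t k
 proof (cases k)
  case (Inl i) thus ?thesis using holo_coord[OF Om] by (simp add: G_def)
 next
  case (Inr l)
  have "holo Om (%y. - (SUM i. SUM j. y$Inr i * y$Inr j * Gm (Some l) (Some i) (Some j) (inv_into U ph (px y))))"
   by (intro holo_minus(1) holo_sumI finite holo_mult(1) holo_coord Om Gmh ballI)
  thus ?thesis using Inr by (simp add: G_def)
 qed
 define c :: "complex ^ ('n+'n)" where "c = (\<chi> k. case k of Inl i => ph p$i | Inr i => a i)"
 have cOm: "c : Om"
 proof -
  have "px c = ph p" by (simp add: px_def c_def vec_eq_iff)
  thus ?thesis using p by (simp add: Om_def)
 qed
 have comm: "(SUM m. pd m (%y. G i y$l) y * G j y$m) = (SUM m. pd m (%y. G j y$l) y * G i y$m)" for i j l y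
  using num1_eq_iff[of i j] by simp
 obtain r and F :: "complex ^ 1 => complex ^ ('n+'n)" where r: "r > 0"
  and Fh: "!!l. holo (ball 0 r) (%x. F x$l)" and FOm: "F`ball 0 r <= Om" and F0: "F 0 = c"
  and pdF: "!!x l i. x : ball 0 r ==> pd i (%x. F x$l) x = G i (F x)$l"
  using commuting_flows[where G=G and Om=Om and c=c, OF Om cOm Gh comm] by blast
 have cvb: "cv w : ball 0 r \<longleftrightarrow> w : ball 0 r" for w r by (simp add: norm_vec_def L2_set_def sum_1)
 define f where "f i w = F (cv w)$Inl i" for i w
 define g where "g i w = F (cv w)$Inr i" for i w
 have dF: "((%w. F (cv w)$k) has_field_derivative G 1 (F (cv w))$k) (at w)" if w: "w : ball 0 r" for k w
 proof -
  have wr: "cv w : ball 0 r" using cvb w by blast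
  have "((%z. F (cv w+axis 1 z)$k) has_field_derivative pd 1 (%x. F x$k) (cv w)) (at 0)"
   by (rule pd_unique(1)[OF holo_has_derivative[OF Fh wr], of 1])
  moreover have "((%v. v - w) has_field_derivative 1) (at w)" by (auto intro!: derivative_eq_intros)
  ultimately have "((%v. F (cv w+axis 1 (v - w))$k) has_field_derivative pd 1 (%x. F x$k) (cv w) * 1) (at w)"
   using DERIV_chain[of "%z. F (cv w+axis 1 z)$k" _ "%v. v - w" w 1 UNIV] by (simp add: o_def)
  moreover have "cv w+axis 1 (v - w) = cv v" for v by (simp add: vec_eq_iff axis_def forall_1)
  ultimately show ?thesis by (simp add: pdF[OF wr])
 qed
 have df: "(f i has_field_derivative g i w) (at w)" if "w : ball 0 r" for i w
  using dF[OF that, of "Inl i"] by (simp add: f_def[abs_def] g_def G_def)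
 have dg: "(g l has_field_derivative - (SUM i. SUM j. g i w * g j w * Gm (Some l) (Some i) (Some j) (inv_into U ph (\<chi> i. f i w)))) (at w)"
  if "w : ball 0 r" for l w using dF[OF that, of "Inr l"] by (simp add: f_def g_def[abs_def] G_def px_def)
 have fhol: "f i holomorphic_on ball 0 r" and ghol: "g i holomorphic_on ball 0 r" for i
  unfolding holomorphic_on_open[OF open_ball] using df dg by blast+
 have fU: "(\<chi> i. f i w) : ph`U" if "w : ball 0 r" for w
 proof -
  have "F (cv w) : Om" using FOm cvb[of w r] that by blast
  thus ?thesis by (simp add: Om_def px_def f_def)
 qed
 have cv0: "cv 0 = 0" by (simp add: vec_eq_iff)
 have f'0: "deriv (f m) 0 ~= 0" using DERIV_imp_deriv[OF df[of 0 m]] r m by (simp add: g_def cv0 F0 c_def)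
 have r0: "0 : ball (0::complex) r" using r by simp
 obtain s where s: "s > 0" "ball 0 s <= ball (0::complex) r" "inj_on (f m) (ball 0 s)"
  by (rule has_complex_derivative_locally_injective[OF fhol[of m] r0 open_ball f'0])
 have fs: "f m holomorphic_on ball 0 s" using fhol s(2) holomorphic_on_subset by blast
 obtain ta where ta: "ta holomorphic_on f m`ball 0 s"
  "!!z. z : ball 0 s ==> deriv (f m) z * deriv ta (f m z) = 1" "!!z. z : ball 0 s ==> ta (f m z) = z"
  using holomorphic_has_inverse[OF fs open_ball s(3)] by blast
 have ofs: "open (f m`ball 0 s)" by (rule open_mapping_thm3[OF fs open_ball s(3)])
 define gm where "gm w = inv_into U ph (\<chi> i. f i w)" for w
 have phgm: "ph (gm w) = (\<chi> i. f i w)" "gm w : U" if "w : ball 0 r" for w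
  unfolding gm_def using fU[OF that] by (auto intro: f_inv_into_f inv_into_into)
 have gmh: "holo_map std_atlas A (ball 0 s) gm" unfolding gm_def[abs_def]
 proof (rule holo_mapI_std)
  show "(%w. (\<chi> i. f i w)$i) holomorphic_on ball 0 s" for i using holomorphic_on_subset[OF fhol[of i] s(2)] by simp
  show "(%w. \<chi> i. f i w)`ball 0 s <= ph`U" using fU s(2) by blast
 qed simp
 have cc: "deriv (ccoord gm i) w = g i w" if w: "w : ball 0 r" for i w
 proof -
  have "deriv (ccoord gm i) w = deriv (f i) w"
   by (rule deriv_cong_ev) (use phgm(1) w in \<open>auto simp: eventually_nhds intro!: exI[of _ "ball 0 r"]\<close>)
  thus ?thesis using DERIV_imp_deriv[OF df[OF w]] by simp
 qed
 define V where "V = {p : U. ph p$m : f m`ball 0 s}"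
 have Vph: "ph`V = {x : ph`U. cv (x$m) : cv`f m`ball 0 s}" by (auto simp: V_def)
 have holo_cv: "holo (cv`f m`ball 0 s) (%y. h (y$1))" if "h holomorphic_on f m`ball 0 s" for h
  using holo1_iff[of "cv`f m`ball 0 s" "%y. h (y$1)"] ofs that by simp
 have oV: "open (ph`V)" unfolding Vph by (rule open_holo_preimage) (use holo_cv[of "%_. 0"] holo_open holo_coord[OF oU] in auto)
 have V: "mopen A V" "V <= U" using oV mopen_iff[of V] by (auto simp: V_def)
 \<comment> \<open>\<open>ta\<close> recovers the time from the coordinate \<open>m\<close>. The
   components are the velocity at that time, hence constant on the slices where this coordinate is
   fixed, and they agree with the velocity along the curve.\<close>
 define b where "b l q = g l (ta (ph q$m))" for l q
 have bh: "holo_on A V (b l)" for l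
 proof -
  have ht: "(%z. g l (ta z)) holomorphic_on f m`ball 0 s"
  proof -
   have "(g l \<circ> ta) holomorphic_on f m`ball 0 s" by (rule holomorphic_on_compose_gen[OF ta(1) ghol]) (use ta(3) s(2) in auto)
   thus ?thesis by (simp add: o_def)
  qed
  have "holo (ph`V) (%x. (%y. g l (ta (y$1))) (cv (x$m)))"
   by (rule holo_compose(1)[OF _ holo_cv[OF ht]]) (use oV holo_coord in \<open>auto simp: Vph\<close>)
  hence "holo (ph`V) (%x. b l (inv_into U ph x))"
   by (rule holo_cong[THEN iffD1, rotated]) (use V in \<open>auto simp: b_def subset_iff\<close>)
  thus ?thesis using holo_on_iff[OF V(2)] by simp
 qed
 have bgm: "b l (gm w) = g l w" if "w : ball 0 s" for l w using phgm(1)[of w] that s(2) ta(3) by (auto simp: b_def)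
 have gmV: "gm w : V" if w: "w : ball 0 s" for w using phgm[of w] that s(2) by (auto simp: V_def)
 have vel: "velocity A gm w = tvec (gm w) (%i. g i w)" if w: "w : ball 0 s" for w
 proof -
  have wr: "w : ball 0 r" using w s(2) by blast
  show ?thesis
   using tvec_eq[OF phgm(2)[OF wr] velocity_tmap(2)[OF A gmh w]] by (simp add: velocity_coord[of gm w, OF phgm(2)[OF wr]] cc[OF wr])
 qed
 have "param_geodesic A U conn (ball 0 s) gm" unfolding param_geodesic_def
 proof (intro conjI ballI)
  show "holo_map std_atlas A (ball 0 s) gm" by (rule gmh)
  show "gm`ball 0 s <= U" using gmV V by blast
  fix z :: complex assume z: "z : ball 0 s"
  have zr: "z : ball 0 r" using z s(2) by blast
  have "g m z ~= 0" using ta(2)[OF z] DERIV_imp_deriv[OF df[OF zr, of m]] by auto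
  thus "velocity A gm z ~= 0" using velocity_zero_iff[OF gmh z phgm(2)[OF zr]] cc[OF zr] by metis
  show "EX W' V X. open W' & z : W' & W' <= ball 0 s & mopen A V & V <= U & gm`W' <= V & X : vfields A V &
    (ALL w:W'. X (gm w) = velocity A gm w & conn V X X (gm w) = 0)"
  proof (intro exI conjI ballI)
   show "vf V b : vfields A V" by (rule vf_vfields[OF V bh])
   show "gm`ball 0 s <= V" using gmV by blast
   fix w :: complex assume w: "w : ball 0 s"
   have wr: "w : ball 0 r" using w s(2) by blast
   show "vf V b (gm w) = velocity A gm w" using gmV[OF w] by (simp add: vf_def vel[OF w] bgm[OF w])
   have "(SUM i. g i w * cpd U ph i (b l) (gm w)) = deriv (g l) w" for l
   proof -
    have "deriv (%w. b l (gm w)) w = (SUM i. g i w * cpd U ph i (b l) (gm w))"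
     using curve_chain[OF gmh w phgm(2)[OF wr] holo_nearI[OF gmV[OF w] bh], of l] by (simp add: cc[OF wr])
    moreover have "deriv (%w. b l (gm w)) w = deriv (g l) w"
     by (rule deriv_cong_ev) (use bgm w in \<open>auto simp: eventually_nhds intro!: exI[of _ "ball 0 s"]\<close>)
    ultimately show ?thesis by simp
   qed
   hence "(SUM i. b i (gm w) * cpd U ph i (b l) (gm w))+(SUM i. SUM j. b i (gm w) * b j (gm w) * Gm (Some l) (Some i) (Some j) (gm w)) = 0" for l
    using DERIV_imp_deriv[OF dg[OF wr, of l]] by (simp add: bgm[OF w]) (simp add: gm_def)
   thus "conn V (vf V b) (vf V b) (gm w) = 0" unfolding conn_vf[OF V bh bh] using gmV[OF w] by (simp add: vf_def tvec_def fun_eq_iff)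
  qed (use V z in auto)
 qed
 moreover have "gm 0 = p" using p by (simp add: gm_def f_def cv0 F0 c_def)
 moreover have "deriv (ccoord gm i) 0 = a i" for i using cc[of 0 i] r by (simp add: g_def cv0 F0 c_def)
 ultimately show ?thesis by (rule that[OF s(1)])
qed

end

section \<open>Transport by local isomorphisms\<close>

lemma torsion_free_subset:
 "torsion_free_connection A U D ==> U' <= U ==> torsion_free_connection A U' D" unfolding torsion_free_connection_def
 apply (intro allI impI)
 subgoal for V
  apply (drule spec[of _ V])
  apply (drule mp)
  apply blast
  apply assumption
  done
 done

locale iso_pair =
 fixes A :: "('a, 'n::finite) atlas" and B :: "('b, 'n) atlas" and V :: "'a set" and f :: "'a => 'b"
 assumes cA: "atlas_compat A" and cB: "atlas_compat B" and iso: "iso_on A B V f"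
begin

abbreviation "f' \<equiv> inv_into V f"

lemma f'_f [simp]: "y : V ==> f' (f y) = y" by (rule inv_into_f_f[OF iso_on_inj[OF iso]])

lemma V_mopen: "mopen A V" and fV_mopen: "mopen B (f`V)" using iso_on_mopen[OF iso] iso_on_image_mopen[OF iso] .

lemma near_f: "y : V ==> holo_near B (f y) h ==> holo_near A y (%x. h (f x))" by (rule smooth_at_near[OF iso_on_smooth[OF cB iso]])

lemma inverse_pair: "iso_pair B A (f`V) f'" unfolding iso_pair_def using cA cB iso_on_inv[OF cA iso] by blast

lemma near_f': "y : V ==> holo_near A y g ==> holo_near B (f y) (%x. g (f' x))" using iso_pair.near_f[OF inverse_pair, of "f y" g] by simp

lemma inv_f': "y : V ==> inv_into (f`V) f' y = f y" using iso_pair.f'_f[OF inverse_pair, of "f y"] by simp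

lemma image_f': "W <= V ==> f'`f`W = W" by force

lemma image_of_inverse:
 assumes "W <= V" "W' <= f`W"
 shows "f`f'`W' = W'" "f'`W' <= W"
proof -
 show "f`f'`W' = W'" by (rule image_inv_into_cancel[OF refl]) (use assms in blast)
 show "f'`W' <= W"
 proof
  fix x assume "x : f'`W'"
  then obtain z where "z : W" "x = f' (f z)" using assms(2) by blast
  thus "x : W" using assms(1) f'_f[of z] by auto
 qed
qed

lemma tangent_f'f: "y : V ==> v : tangent A y ==> holo_near A y g ==> v (%x. g (f' (f x))) = v g"
 by (rule sym, rule tangent_cong[OF _ _ V_mopen]) simp_all

lemma tmap_f:
 assumes y: "y : V" and v: "v : tangent A y"
 shows "tmap B f (f y) v : tangent B (f y)" "tmap A f' y (tmap B f (f y) v) = v"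
proof -
 show "tmap B f (f y) v : tangent B (f y)" by (rule tmap_tangent[OF cA cB iso_on_smooth[OF cB iso y] v])
 show "tmap A f' y (tmap B f (f y) v) = v"
 proof
  fix g show "tmap A f' y (tmap B f (f y) v) g = v g"
   using near_f'[OF y, of g] tangent_f'f[OF y v, of g] tangent_not_near[OF v, of g] by (simp add: tmap_def)
 qed
qed

lemma tmap_zero [simp]: "tmap B f p 0 = 0" by (simp add: tmap_def fun_eq_iff)

lemma tmap_f_zero: "y : V ==> v : tangent A y ==> tmap B f (f y) v = 0 \<longleftrightarrow> v = 0"
 using tmap_f(2) iso_pair.tmap_zero[OF inverse_pair] tmap_zero by metis

definition push :: "'a vfield => 'b vfield" where
 "push X = push_vfield B f V X"

definition pull :: "'b vfield => 'a vfield" where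
 "pull Z = pull_vfield A f V Z"

lemma push_apply: "y : V ==> push X (f y) = tmap B f (f y) (X y)" by (simp add: push_def push_vfield_def)

lemma push_outside: "p ~: f`V ==> push X p = 0" by (simp add: push_def push_vfield_def)

lemma pull_apply: "y : V ==> pull Z y = tmap A f' y (Z (f y))" by (simp add: pull_def pull_vfield_def)

lemma pull_outside: "y ~: V ==> pull Z y = 0" by (simp add: pull_def pull_vfield_def)

text \<open>Makes the facts about \<open>push\<close> available for \<open>pull\<close> through
  \<open>inverse_pair\<close>.\<close>

lemma pull_eq_push: "pull = iso_pair.push A (f`V) f'"
proof (intro ext)
 interpret i: iso_pair B A "f`V" f' by (rule inverse_pair)
 have im: "f'`f`V = V" by (rule image_f'[OF order_refl])
 fix Z y g
 show "pull Z y g = i.push Z y g"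
 proof (cases "y : V")
  case True
  thus ?thesis using i.push_apply[of "f y" Z] by (simp add: pull_apply)
 next
  case False
  thus ?thesis using i.push_outside[of y Z] im by (simp add: pull_outside)
 qed
qed

lemma push_eqI:
 assumes "!!y. y : V ==> tmap B f (f y) (X y) = Z (f y)" "!!p. p ~: f`V ==> Z p = 0"
 shows "push X = Z"
proof
 fix p show "push X p = Z p"
 proof (cases "p : f`V")
  case True
  then obtain y where y: "y : V" "p = f y" by blast
  show ?thesis unfolding y(2) push_apply[OF y(1)] by (rule assms(1)[OF y(1)])
 qed (simp add: push_outside assms(2))
qed

lemma vfieldsD: "X : vfields A W ==> y : W ==> X y : tangent A y" "X : vfields A W ==> y ~: W ==> X y = 0"
 "X : vfields A W ==> W' <= W ==> holo_on A W' g ==> holo_on A W' (%p. X p g)" by (simp_all add: vfields_def)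

lemma vres_vfields:
 assumes X: "X : vfields A W" and W': "W' <= W"
 shows "vres W' X : vfields A W'" unfolding vfields_def mem_Collect_eq
proof (intro conjI ballI allI impI)
 show "vres W' X p : tangent A p" if "p : W'" for p using vfieldsD(1)[OF X, of p] that W' by (auto simp: vres_def)
 show "vres W' X p = 0" if "p ~: W'" for p using that by (simp add: vres_def)
 fix O' g assume a: "O' <= W' & holo_on A O' g"
 have "holo_on A O' (%p. X p g)" by (rule vfieldsD(3)[OF X]) (use a W' in auto)
 thus "holo_on A O' (%p. vres W' X p g)" by (rule holo_on_cong[OF cA, THEN iffD1, rotated]) (use a in \<open>auto simp: vres_def\<close>)
qed

lemma vfield_near:
 assumes X: "X : vfields A W" and W: "mopen A W" "y : W" and g: "holo_near A y g"
 shows "holo_near A y (vapply X g)"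
proof -
 obtain W' where W': "y : W'" "W' <= W" "holo_on A W' g" using holo_near_nbhd[OF cA g W] by blast
 show ?thesis unfolding vapply_def by (rule holo_nearI[OF W'(1) vfieldsD(3)[OF X W'(2,3)]])
qed

lemma pull_push:
 assumes X: "!!y. y : V ==> X y : tangent A y" "!!y. y ~: V ==> X y = 0"
 shows "pull (push X) = X"
proof
 fix y show "pull (push X) y = X y" using tmap_f(2)[OF _ X(1)] X(2) by (cases "y : V") (simp_all add: pull_apply push_apply pull_outside)
qed

lemma push_pull:
 assumes Z: "Z : vfields B (f`V)"
 shows "push (pull Z) = Z"
proof (rule push_eqI)
 interpret i: iso_pair B A "f`V" f' by (rule inverse_pair)
 fix y assume y: "y : V"
 hence "f y : f`V" by blast
 note v = i.vfieldsD(1)[OF Z this]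
 have "tmap A f' (f' (f y)) (Z (f y)) = pull Z y" using y by (simp add: pull_apply)
 hence "tmap B i.f' (f y) (pull Z y) = Z (f y)" using i.tmap_f(2)[OF _ v] y by simp
 \<comment> \<open>The inverse of the inverse equals \<open>f\<close> only on \<open>V\<close>; the
   two differentials agree because tangent vectors depend only on germs.\<close>
 moreover have "tmap B i.f' (f y) (pull Z y) = tmap B f (f y) (pull Z y)"
 proof
  fix h
  have t: "pull Z y : tangent A y" using i.tmap_f(1)[OF _ v] y by (simp add: pull_apply)
  have "pull Z y (%x. h (f x)) = pull Z y (%x. h (i.f' x))" if h: "holo_near B (f y) h"
   by (rule tangent_cong[OF t near_f[OF y h] V_mopen y]) (simp add: inv_f')
  thus "tmap B i.f' (f y) (pull Z y) h = tmap B f (f y) (pull Z y) h" by (simp add: tmap_def)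
 qed
 ultimately show "tmap B f (f y) (pull Z y) = Z (f y)" by simp
qed (rule iso_pair.vfieldsD(2)[OF inverse_pair Z])

lemma push_vfields:
 assumes X: "X : vfields A V"
 shows "push X : vfields B (f`V)" unfolding vfields_def mem_Collect_eq
proof (intro conjI ballI allI impI)
 fix p assume "p : f`V"
 then obtain y where y: "y : V" "p = f y" by blast
 show "push X p : tangent B p" unfolding y(2) push_apply[OF y(1)] by (rule tmap_f(1)[OF y(1) vfieldsD(1)[OF X y(1)]])
next
 fix W' h assume a: "W' <= f`V & holo_on B W' h"
 let ?W = "f'`W'"
 have fW: "f`?W = W'" and sub: "?W <= V" using image_of_inverse[OF order_refl] a by auto
 have hh: "holo_on A ?W (%x. h (f x))" using iso_on_holo[OF iso sub, of h] a fW by simp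
 have "holo_on A ?W (%y. push X (f y) h)"
 proof (rule holo_on_cong[OF cA, THEN iffD1, rotated, OF vfieldsD(3)[OF X sub hh]])
  fix y assume y: "y : ?W"
  have "holo_near B (f y) h" by (rule holo_nearI[of _ W']) (use y fW a in auto)
  thus "X y (%x. h (f x)) = push X (f y) h" using push_apply[of y X] y sub by (auto simp: tmap_def)
 qed
 thus "holo_on B W' (%p. push X p h)" using iso_on_holo[OF iso sub, of "%p. push X p h"] fW by simp
qed (simp add: push_outside)

lemma pull_vfields: "Z : vfields B (f`V) ==> pull Z : vfields A V"
 using iso_pair.push_vfields[OF inverse_pair, of Z] by (simp add: pull_eq_push image_f')

lemma push_add: "push (X+Y) = push X+push Y" by (rule push_eqI) (simp_all add: push_outside push_apply tmap_def fun_eq_iff)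

lemma push_vmul: "push (vmul g X) = vmul (%p. g (f' p)) (push X)"
 by (rule push_eqI) (simp_all add: vmul_def push_apply push_outside vscale_def tmap_def fun_eq_iff)

lemma push_vapply:
 assumes X: "X : vfields A V" and g: "holo_on A V g"
 shows "push (vmul (vapply X g) Y) = vmul (vapply (push X) (%p. g (f' p))) (push Y)"
proof (rule push_eqI)
 fix y assume y: "y : V"
 have n: "holo_near A y g" by (rule holo_nearI[OF y g])
 have "push X (f y) (%p. g (f' p)) = X y g"
  using near_f'[OF y n] tangent_f'f[OF y vfieldsD(1)[OF X y] n] by (simp add: push_apply[OF y] tmap_def)
 thus "tmap B f (f y) (vmul (vapply X g) Y y) = vmul (vapply (push X) (%p. g (f' p))) (push Y) (f y)"
  by (simp add: vmul_def vapply_def push_apply[OF y] vscale_def tmap_def fun_eq_iff)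
qed (simp add: vmul_def push_outside vscale_def fun_eq_iff)

lemma push_bracket:
 assumes X: "X : vfields A V" and Y: "Y : vfields A V"
 shows "push (lie_bracket A V X Y) = lie_bracket B (f`V) (push X) (push Y)"
proof (rule push_eqI, rule ext)
 fix y h assume y: "y : V"
 have *: "push X (f y) (vapply (push Y) h) = X y (vapply Y (%x. h (f x)))"
  if h: "holo_near B (f y) h" and X: "X : vfields A V" and Y: "Y : vfields A V" for X Y
 proof -
  have n: "holo_near B (f y) (vapply (push Y) h)"
   by (rule iso_pair.vfield_near[OF inverse_pair push_vfields[OF Y] fV_mopen _ h]) (use y in blast)
  obtain O' where O': "f y : O'" "O' <= f`V" "holo_on B O' h" using holo_near_nbhd[OF cB h fV_mopen] y by blast
  let ?O = "f'`O'"
  have fO: "f`?O = O'" and sub: "?O <= V" using image_of_inverse[OF order_refl O'(2)] .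
  have mO: "mopen A ?O" using iso_on_mopen_iff[OF iso sub] fO holo_on_mopen[OF O'(3)] by simp
  have yO: "y : ?O" using O'(1) y f'_f by (metis image_eqI)
  have "X y (%x. vapply (push Y) h (f x)) = X y (vapply Y (%x. h (f x)))"
  proof (rule sym[OF tangent_cong[OF vfieldsD(1)[OF X y] vfield_near[OF Y V_mopen y near_f[OF y h]] mO yO]])
   fix x assume x: "x : ?O"
   have "f x : O'" using imageI[OF x, of f] unfolding fO .
   hence "holo_near B (f x) h" by (rule holo_nearI[OF _ O'(3)])
   thus "vapply Y (%x. h (f x)) x = vapply (push Y) h (f x)" using x sub by (simp add: vapply_def push_apply subset_iff tmap_def)
  qed
  thus ?thesis using n by (simp add: push_apply[OF y] tmap_def)
 qed
 show "tmap B f (f y) (lie_bracket A V X Y y) h = lie_bracket B (f`V) (push X) (push Y) (f y) h"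
  using y near_f[OF y, of h] *[OF _ X Y] *[OF _ Y X] by (auto simp: tmap_def lie_bracket_def)
qed (auto simp: lie_bracket_def fun_eq_iff)

lemma pull_bracket:
 assumes X: "X : vfields A V" and Y: "Y : vfields A V"
 shows "pull (lie_bracket B (f`V) (push X) (push Y)) = lie_bracket A V X Y"
proof -
 have "pull (push X) = X" "pull (push Y) = Y" using pull_push vfieldsD(1,2) X Y by blast+
 thus ?thesis using iso_pair.push_bracket[OF inverse_pair push_vfields[OF X] push_vfields[OF Y]]
  unfolding pull_eq_push[symmetric] image_f'[OF order_refl] by simp
qed

lemma restrict: "mopen A W ==> W <= V ==> iso_pair A B W f" unfolding iso_pair_def using cA cB iso_on_subset[OF iso] by blast

lemma push_vres:
 assumes "mopen A W" "W <= V"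
 shows "push_vfield B f W (vres W X) = vres (f`W) (push X)" unfolding iso_pair.push_def[OF restrict[OF assms], symmetric]
 by (rule iso_pair.push_eqI[OF restrict[OF assms]]) (use assms in \<open>auto simp: vres_def push_apply subset_iff\<close>)

text \<open>The axioms are transported for the whole of \<open>V\<close> first; smaller open sets
  follow by restricting the pair itself.\<close>

lemma pull_torsion_free_all:
 assumes D: "torsion_free_connection B (f`V) D" and X: "X : vfields A V" and Y: "Y : vfields A V"
 defines "D' \<equiv> pull_conn B A f D"
 shows "D' V X Y : vfields A V &
  (ALL V'. mopen A V' & V' <= V --> D' V' (vres V' X) (vres V' Y) = vres V' (D' V X Y)) &
  (ALL X':vfields A V. D' V (X+X') Y = D' V X Y+D' V X' Y) &
  (ALL Y':vfields A V. D' V X (Y+Y') = D' V X Y+D' V X Y') &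
  (ALL g. holo_on A V g --> D' V (vmul g X) Y = vmul g (D' V X Y) & D' V X (vmul g Y) = vmul (vapply X g) Y+vmul g (D' V X Y)) &
  D' V X Y - D' V Y X = lie_bracket A V X Y"
proof (intro conjI allI ballI impI)
 note P = push_vfields
 have pc: "D' V X Y = pull (D (f`V) (push X) (push Y))" for X Y by (simp add: D'_def pull_conn_def pull_def push_def)
 note ax = D[unfolded torsion_free_connection_def, THEN spec, THEN mp, OF conjI[OF fV_mopen order_refl], THEN bspec, OF P[OF X], THEN bspec, OF P[OF Y]]
 note DD = ax[THEN conjunct1]
 have comb: "pull (Z+Z') = pull Z+pull Z'" "pull (Z - Z') = pull Z - pull Z'" for Z Z'
  by (auto simp: pull_def pull_vfield_def fun_eq_iff tmap_def)
 have Pmul: "pull (vmul (%p. g (f' p)) Z) = vmul g (pull Z)" for g Z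
  by (auto simp: pull_def pull_vfield_def fun_eq_iff tmap_def vmul_def vscale_def)
 show v: "D' V X Y : vfields A V" unfolding pc by (rule pull_vfields[OF DD])
 show "D' V' (vres V' X) (vres V' Y) = vres V' (D' V X Y)" if V': "mopen A V' & V' <= V" for V'
 proof -
  have m: "mopen A V'" "V' <= V" using V' by auto
  interpret w: iso_pair A B V' f by (rule restrict[OF m])
  have "D (f`V') (vres (f`V') (push X)) (vres (f`V') (push Y)) = vres (f`V') (D (f`V) (push X) (push Y))"
   using ax w.fV_mopen m(2) by blast
  also have "... = w.push (vres V' (D' V X Y))" unfolding w.push_def push_vres[OF m] pc push_pull[OF DD] ..
  finally have "D' V' (vres V' X) (vres V' Y) = w.pull (w.push (vres V' (D' V X Y)))"
   by (simp add: D'_def pull_conn_def push_vres[OF m] w.pull_def)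
  also have "... = vres V' (D' V X Y)" by (rule w.pull_push) (use vfieldsD(1)[OF v] m in \<open>auto simp: vres_def\<close>)
  finally show ?thesis .
 qed
 show "D' V (X+X') Y = D' V X Y+D' V X' Y" if "X' : vfields A V" for X' using ax P[OF that] by (simp add: pc push_add comb)
 show "D' V X (Y+Y') = D' V X Y+D' V X Y'" if "Y' : vfields A V" for Y' using ax P[OF that] by (simp add: pc push_add comb)
 fix g assume g: "holo_on A V g"
 have g': "holo_on B (f`V) (%p. g (f' p))" using iso_on_holo_inv[OF cA iso order_refl] g by blast
 show "D' V (vmul g X) Y = vmul g (D' V X Y)" using ax g' by (simp add: pc push_vmul Pmul)
 have "pull (push (vmul (vapply X g) Y)) = vmul (vapply X g) Y"
 proof (rule pull_push)
  show "vmul (vapply X g) Y p : tangent A p" if "p : V" for p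
   using tangent_lin_closed[OF cA, of p] vfieldsD(1)[OF Y that] by (auto simp: lin_closed_def vmul_def)
  show "vmul (vapply X g) Y p = 0" if "p ~: V" for p using vfieldsD(2)[OF Y that] by (simp add: vmul_def vscale_def fun_eq_iff)
 qed
 note e = this[unfolded push_vapply[OF X g]]
 show "D' V X (vmul g Y) = vmul (vapply X g) Y+vmul g (D' V X Y)" using ax g' by (simp add: pc push_vmul comb e) (simp add: Pmul)
next
 have ax: "D (f`V) (push X) (push Y) - D (f`V) (push Y) (push X) = lie_bracket B (f`V) (push X) (push Y)"
  using D[unfolded torsion_free_connection_def, THEN spec, THEN mp, OF conjI[OF fV_mopen order_refl], THEN bspec, OF push_vfields[OF X], THEN bspec, OF push_vfields[OF Y]] by blast
 have "D' V X Y - D' V Y X = pull (D (f`V) (push X) (push Y) - D (f`V) (push Y) (push X))"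
  by (auto simp: D'_def pull_conn_def push_def pull_def pull_vfield_def fun_eq_iff tmap_def)
 thus "D' V X Y - D' V Y X = lie_bracket A V X Y" unfolding ax pull_bracket[OF X Y] .
qed

lemma pull_torsion_free:
 assumes D: "torsion_free_connection B (f`V) D"
 shows "torsion_free_connection A V (pull_conn B A f D)" unfolding torsion_free_connection_def
proof (intro allI impI ballI)
 fix W X Y assume "mopen A W & W <= V" and XY: "X : vfields A W" "Y : vfields A W"
 hence W: "mopen A W" "W <= V" by auto
 have "torsion_free_connection B (f`W) D" by (rule torsion_free_subset[OF D image_mono[OF W(2)]])
 from iso_pair.pull_torsion_free_all[OF restrict[OF W] this XY]
 show "pull_conn B A f D W X Y : vfields A W &
  (ALL V'. mopen A V' & V' <= W --> pull_conn B A f D V' (vres V' X) (vres V' Y) = vres V' (pull_conn B A f D W X Y)) &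
  (ALL X':vfields A W. pull_conn B A f D W (X+X') Y = pull_conn B A f D W X Y+pull_conn B A f D W X' Y) &
  (ALL Y':vfields A W. pull_conn B A f D W X (Y+Y') = pull_conn B A f D W X Y+pull_conn B A f D W X Y') &
  (ALL g. holo_on A W g -->
   pull_conn B A f D W (vmul g X) Y = vmul g (pull_conn B A f D W X Y) &
   pull_conn B A f D W X (vmul g Y) = vmul (vapply X g) Y+vmul g (pull_conn B A f D W X Y)) &
  pull_conn B A f D W X Y - pull_conn B A f D W Y X = lie_bracket A W X Y" .
qed

end

section \<open>Covering spaces\<close>

locale covering =
 fixes A :: "('a, 'n::finite) atlas" and Y :: "'b topology" and q :: "'b => 'a"
 assumes cA: "atlas_compat A" and cov: "covering_map Y (mtop A) q"
begin

abbreviation "B \<equiv> pull_atlas A Y q"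

lemma q_cont: "mopen A W ==> openin Y {y : topspace Y. q y : W}"
 using openin_continuous_map_preimage[of Y "mtop A" q W] cov openin_mtop[OF cA, of W] by (simp add: covering_map_def)

lemma q_image: "q`topspace Y = points A" using cov topspace_mtop[OF cA] unfolding covering_map_def by simp

lemma sheet:
 assumes y: "y : topspace Y"
 shows "EX V. openin Y V & y : V & inj_on q V & (ALL V'. V' <= V & openin Y V' --> mopen A (q`V'))"
proof -
 have "q y : topspace (mtop A)" using q_image y topspace_mtop[OF cA] by blast
 then obtain U \<V> where U: "openin (mtop A) U" "q y : U" and \<V>: "ALL V:\<V>. openin Y V" "\<Union>\<V> = {y : topspace Y. q y : U}"
  and h: "ALL V:\<V>. homeomorphic_map (subtopology Y V) (subtopology (mtop A) U) q" using cov unfolding covering_map_def by meson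
 have "y : \<Union>\<V>" unfolding \<V>(2) using y U(2) by simp
 then obtain V where V: "V : \<V>" "y : V" by blast
 have hV: "homeomorphic_map (subtopology Y V) (subtopology (mtop A) U) q" and oV: "openin Y V" using h \<V>(1) V(1) by blast+
 have t: "topspace (subtopology Y V) = V" using openin_subset[OF oV] by auto
 have "inj_on q V" using homeomorphic_imp_injective_map[OF hV] unfolding t .
 moreover have "mopen A (q`V')" if V': "V' <= V" "openin Y V'" for V'
 proof -
  have "openin (subtopology Y V) V'" using V' openin_open_subtopology[OF oV] by blast
  hence "openin (subtopology (mtop A) U) (q`V')" using homeomorphic_imp_open_map[OF hV] by (simp add: open_map_def)
  hence "openin (mtop A) (q`V')" using openin_open_subtopology[OF U(1)] by blast
  thus ?thesis unfolding openin_mtop[OF cA] .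
 qed
 ultimately show ?thesis using oV V(2) by blast
qed

lemma q_open: "openin Y V ==> mopen A (q`V)"
proof (rule mopen_local)
 fix p assume V: "openin Y V" and "p : q`V"
 then obtain y where y: "y : V" "p = q y" by blast
 have "y : topspace Y" using openin_subset[OF V] y by blast
 from sheet[OF this] obtain V' where V': "openin Y V'" "y : V'" "ALL W. W <= V' & openin Y W --> mopen A (q`W)" by blast
 have "mopen A (q`(V Int V'))" using V' openin_Int[OF V V'(1)] by blast
 thus "EX W. p : W & W <= q`V & mopen A W" using y V'(2) by (intro exI[of _ "q`(V Int V')"]) blast
qed

lemma mem_B: "(W, ps) : B \<longleftrightarrow> (EX U ph. ps = (%y. ph (q y)) & (U, ph) : A & openin Y W & inj_on q W & q`W <= U)"
 by (auto simp: pull_atlas_def)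

lemma chart_B:
 assumes y: "y : topspace Y"
 obtains W U ph where "(W, %y. ph (q y)) : B" "(U, ph) : A" "openin Y W" "inj_on q W" "q`W <= U" "y : W"
proof -
 obtain V where V: "openin Y V" "y : V" "inj_on q V" using sheet[OF y] by blast
 have "q y : points A" using q_image y by blast
 from coord_at[OF cA this] obtain U ph where U: "(U, ph) : A" "q y : U" by blast
 let ?W = "V Int {y : topspace Y. q y : U}"
 have W: "openin Y ?W" by (rule openin_Int[OF V(1) q_cont[OF mopen_chart[OF cA U(1)]]])
 have i: "inj_on q ?W" using V(3) by (rule inj_on_subset) blast
 have "(?W, %y. ph (q y)) : B" unfolding mem_B using U W i by blast
 thus ?thesis using that[OF _ U(1) W i] y U(2) V(2) by blast
qed

lemma points_B: "points B = topspace Y"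
proof (rule set_eqI, rule iffI)
 fix y assume "y : points B"
 then obtain W ps where "(W, ps) : B" "y : W" by (auto simp: points_def)
 thus "y : topspace Y" using openin_subset[of Y W] unfolding mem_B by blast
next
 fix y assume "y : topspace Y"
 then obtain W U ph where w: "(W, %y. ph (q y)) : B" "y : W" by (rule chart_B)
 have "W : fst`B" using imageI[OF w(1), of fst] by simp
 thus "y : points B" unfolding points_def using w(2) by blast
qed

lemma chart_cases:
 assumes "(W, ps) : B"
 obtains U ph where "ps = (%y. ph (q y))" "chart A U ph" "openin Y W" "inj_on q W" "q`W <= U"
proof -
 obtain U ph where u: "ps = (%y. ph (q y))" "(U, ph) : A" "openin Y W" "inj_on q W" "q`W <= U" using assms unfolding mem_B by blast
 show ?thesis by (rule that[OF u(1) chartI[OF cA u(2)] u(3,4,5)])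
qed

lemma chart_inv:
 assumes "chart A U ph" "inj_on q W" "q`W <= U" "W' <= W" "x : ph`q`W'"
 shows "q (inv_into W (%y. ph (q y)) x) = inv_into U ph x" "inv_into W (%y. ph (q y)) x : W'"
proof -
 interpret chart A U ph by (rule assms(1))
 obtain y where y: "y : W'" "x = ph (q y)" using assms(5) by blast
 have i: "inj_on (%y. ph (q y)) W" using comp_inj_on[OF assms(2) inj_on_subset[OF inj assms(3)]] by (simp add: o_def)
 have "inv_into W (%y. ph (q y)) (ph (q y)) = y" using inv_into_f_f[OF i, of y] y assms(4) by blast
 thus "q (inv_into W (%y. ph (q y)) x) = inv_into U ph x" "inv_into W (%y. ph (q y)) x : W'"
  using y inv_ph[of "q y"] subsetD[OF assms(3) imageI[OF subsetD[OF assms(4) y(1)]]] by auto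
qed

text \<open>\<open>q\<close> is locally a homeomorphism and the charts in \<open>B\<close> are
  charts of the base composed with it, so the topology defined by this atlas is the given topology
  \<open>Y\<close>.\<close>

lemma mopen_B: "mopen B T \<longleftrightarrow> openin Y T"
proof
 assume T: "openin Y T"
 show "mopen B T" unfolding mopen_def
 proof (intro conjI ballI)
  show "T <= points B" using openin_subset[OF T] points_B by simp
  fix c assume c: "c : B"
  obtain W ps where e: "c = (W, ps)" by (cases c)
  obtain U ph where u: "ps = (%y. ph (q y))" "chart A U ph" "openin Y W" "inj_on q W" "q`W <= U" by (rule chart_cases[OF c[unfolded e]])
  interpret chart A U ph by (rule u(2))
  have "mopen A (q`(W Int T))" by (rule q_open[OF openin_Int[OF u(3) T]])
  hence "open (ph`q`(W Int T))" using mopen_iff[of "q`(W Int T)"] u(5) by blast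
  thus "case c of (W, ps) => open (ps`(W Int T))" by (simp add: e u(1) image_image)
 qed
next
 assume T: "mopen B T"
 show "openin Y T" unfolding openin_subopen[of Y T]
 proof
  fix y assume y: "y : T"
  hence "y : topspace Y" using mopen_points[OF T] points_B by blast
  then obtain W U ph where w: "(W, %y. ph (q y)) : B" "(U, ph) : A" "openin Y W" "inj_on q W" "q`W <= U" "y : W" by (rule chart_B)
  interpret chart A U ph by (rule chartI[OF cA w(2)])
  have "open ((%y. ph (q y))`(W Int T))" using T w(1) unfolding mopen_def by blast
  moreover have "q`(W Int T) <= U" using w(5) by blast
  ultimately have "mopen A (q`(W Int T))" using mopen_iff[of "q`(W Int T)"] by (simp add: image_image)
  from openin_Int[OF w(3) q_cont[OF this]]
  have "openin Y (W Int {y : topspace Y. q y : q`(W Int T)})" .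
  moreover have "W Int {y : topspace Y. q y : q`(W Int T)} = W Int T" using openin_subset[OF w(3)] w(4) by (auto dest: inj_onD)
  ultimately show "EX T'. openin Y T' & y : T' & T' <= T" using y w(6) by (intro exI[of _ "W Int T"]) auto
 qed
qed

lemma holo_on_lift:
 assumes V: "openin Y V" "inj_on q V" and g: "holo_on A (q`V) g"
 shows "holo_on B V (%y. g (q y))"
proof (rule holo_onI)
 show "V <= points B" using openin_subset[OF V(1)] points_B by simp
 fix W ps assume "(W, ps) : B"
 then obtain U ph where u: "ps = (%y. ph (q y))" "chart A U ph" "openin Y W" "inj_on q W" "q`W <= U" by (rule chart_cases)
 interpret chart A U ph by (rule u(2))
 have WV: "q`(W Int V) <= U" using u(5) by blast
 have "holo_on A (q`(W Int V)) g" by (rule holo_on_subset[OF g q_open[OF openin_Int[OF u(3) V(1)]]]) blast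
 hence "holo (ph`q`(W Int V)) (%x. g (inv_into U ph x))" using holo_on_iff[OF WV] by simp
 hence "holo (ph`q`(W Int V)) (%x. g (q (inv_into W ps x)))"
  by (rule holo_cong[THEN iffD1, rotated]) (use chart_inv(1)[OF u(2,4,5), of "W Int V"] u(1) in simp)
 thus "holo (ps`(W Int V)) (%x. g (q (inv_into W ps x)))" by (simp add: u(1) image_image)
qed

lemma iso_q:
 assumes V: "openin Y V" "inj_on q V"
 shows "iso_on B A V q" unfolding iso_on_def
proof (intro conjI allI impI)
 show "mopen B V" using V(1) mopen_B by simp
 show "inj_on q V" by (rule V(2))
 fix T g assume T: "T <= V"
 show "holo_on B T (%y. g (q y)) \<longleftrightarrow> holo_on A (q`T) g"
 proof
  assume g: "holo_on A (q`T) g"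
  have "V Int {y : topspace Y. q y : q`T} = T" using openin_subset[OF V(1)] V(2) T by (auto dest: inj_onD)
  hence "openin Y T" using openin_Int[OF V(1) q_cont[OF holo_on_mopen[OF g]]] by simp
  from holo_on_lift[OF this inj_on_subset[OF V(2) T] g] show "holo_on B T (%y. g (q y))" .
 next
  assume h: "holo_on B T (%y. g (q y))"
  have oT: "openin Y T" using holo_on_mopen[OF h] mopen_B by simp
  show "holo_on A (q`T) g"
  proof (rule holo_on_local)
   fix p assume "p : q`T"
   then obtain y where y: "y : T" "p = q y" by blast
   hence "y : topspace Y" using openin_subset[OF oT] by blast
   then obtain W U ph where w: "(W, %y. ph (q y)) : B" "(U, ph) : A" "openin Y W" "inj_on q W" "q`W <= U" "y : W" by (rule chart_B)
   interpret chart A U ph by (rule chartI[OF cA w(2)])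
   have WT: "q`(W Int T) <= U" using w(5) by blast
   have "holo ((%y. ph (q y))`(W Int T)) (%x. g (q (inv_into W (%y. ph (q y)) x)))" using h w(1) unfolding holo_on_def by blast
   hence "holo (ph`q`(W Int T)) (%x. g (q (inv_into W (%y. ph (q y)) x)))" by (simp add: image_image)
   hence "holo (ph`q`(W Int T)) (%x. g (inv_into U ph x))"
    by (rule holo_cong[THEN iffD1, rotated]) (use chart_inv(1)[OF chart_axioms w(4,5), of "W Int T"] in simp)
   hence "holo_on A (q`(W Int T)) g" using holo_on_iff[OF WT] by simp
   thus "EX V. p : V & V <= q`T & holo_on A V g" using y w(6) by (intro exI[of _ "q`(W Int T)"]) blast
  qed
 qed
qed

lemma cB: "atlas_compat B" unfolding atlas_compat_def
proof (intro conjI)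
 show "ALL (W, ps):B. inj_on ps W & open (ps`W)"
 proof (rule ballI)
  fix c assume c: "c : B"
  obtain W ps where e: "c = (W, ps)" by (cases c)
  obtain U ph where u: "ps = (%y. ph (q y))" "chart A U ph" "openin Y W" "inj_on q W" "q`W <= U" by (rule chart_cases[OF c[unfolded e]])
  interpret chart A U ph by (rule u(2))
  have "inj_on (%y. ph (q y)) W" using comp_inj_on[OF u(4) inj_on_subset[OF inj u(5)]] by (simp add: o_def)
  moreover have "open (ph`q`W)" using mopen_iff[OF u(5)] q_open[OF u(3)] by simp
  ultimately show "case c of (W, ps) => inj_on ps W & open (ps`W)" by (simp add: e u(1) image_image)
 qed
 show "ALL (W, ps):B. ALL (W', ps'):B. ALL i. holo (ps`(W Int W')) (%x. ps' (inv_into W ps x)$i)"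
 proof (rule ballI)
  fix c assume c: "c : B"
  obtain W ps where e: "c = (W, ps)" by (cases c)
  show "case c of (W, ps) => ALL (W', ps'):B. ALL i. holo (ps`(W Int W')) (%x. ps' (inv_into W ps x)$i)" unfolding e prod.case
  proof (rule ballI)
  fix c' assume c': "c' : B"
  obtain W' ps' where e': "c' = (W', ps')" by (cases c')
  obtain U ph where u: "ps = (%y. ph (q y))" "chart A U ph" "openin Y W" "inj_on q W" "q`W <= U" by (rule chart_cases[OF c[unfolded e]])
  obtain U' ph' where u': "ps' = (%y. ph' (q y))" "chart A U' ph'" "openin Y W'" "inj_on q W'" "q`W' <= U'"
   by (rule chart_cases[OF c'[unfolded e']])
  interpret chart A U ph by (rule u(2))
  interpret u': chart A U' ph' by (rule u'(2))
  have m: "mopen A (q`(W Int W'))" by (rule q_open[OF openin_Int[OF u(3) u'(3)]])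
  have sub: "q`(W Int W') <= U" "q`(W Int W') <= U'" using u(5) u'(5) by auto
  have "holo (ps`(W Int W')) (%x. ps' (inv_into W ps x)$i)" for i
  proof -
   have "holo_on A (q`(W Int W')) (%p. ph' p$i)" by (rule u'.holo_on_coord[OF m sub(2)])
   hence "holo (ph`q`(W Int W')) (%x. ph' (inv_into U ph x)$i)" using holo_on_iff[OF sub(1)] by simp
   hence "holo (ph`q`(W Int W')) (%x. ph' (q (inv_into W ps x))$i)"
    by (rule holo_cong[THEN iffD1, rotated]) (use chart_inv(1)[OF u(2,4,5), of "W Int W'"] u(1) in simp)
   thus ?thesis by (simp add: u(1) u'(1) image_image)
  qed
  thus "case c' of (W', ps') => ALL i. holo (ps`(W Int W')) (%x. ps' (inv_into W ps x)$i)" by (simp add: e')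
  qed
 qed
qed

lemma pair_q: "openin Y V ==> inj_on q V ==> iso_pair B A V q" unfolding iso_pair_def using cA cB iso_q by blast

end

subsection \<open>Transport of geodesics\<close>

lemma param_geodesic_mono:
 assumes g: "param_geodesic A U' D W gm" and U: "U' <= U"
 shows "param_geodesic A U D W gm" unfolding param_geodesic_def
proof (intro conjI ballI)
 show "holo_map std_atlas A W gm" "gm`W <= U" "!!z. z : W ==> velocity A gm z ~= 0" using g U by (auto simp: param_geodesic_def)
 fix z assume "z : W"
 then obtain W' V X where "open W'" "z : W'" "W' <= W" "mopen A V" "V <= U'" "gm`W' <= V" "X : vfields A V"
  "ALL w:W'. X (gm w) = velocity A gm w & D V X X (gm w) = 0" using g unfolding param_geodesic_def by blast
 moreover have "V <= U" using \<open>V <= U'\<close> U by blast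
 ultimately show "EX W' V X. open W' & z : W' & W' <= W & mopen A V & V <= U & gm`W' <= V & X : vfields A V &
   (ALL w:W'. X (gm w) = velocity A gm w & D V X X (gm w) = 0)" by blast
qed

lemmas param_geodesic_field = param_geodesic_def[THEN iffD1, THEN conjunct2, THEN conjunct2, THEN conjunct2, THEN bspec]

lemma param_geodesic_velocity:
 "param_geodesic A U D W gm ==> holo_map std_atlas A W gm & gm`W <= U & (ALL z:W. velocity A gm z ~= 0)"
 unfolding param_geodesic_def by (elim conjE, intro conjI; assumption)

text \<open>The field extending the velocity has to live inside the smaller set, so it is
  restricted; a connection commutes with restriction by the axioms in \<open>D\<close>.\<close>

lemma param_geodesic_shrink:
 assumes A: "atlas_compat A" and g: "param_geodesic A U D W gm" and D: "torsion_free_connection A U D"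
  and U': "mopen A U'" "gm`W' <= U'" and W': "open W'" "W' <= W"
 shows "param_geodesic A (U Int U') D W' gm" unfolding param_geodesic_def
proof (intro conjI ballI)
 note v = param_geodesic_velocity[OF g]
 show gm: "holo_map std_atlas A W' gm" by (rule holo_map_std_subset[OF A _ W']) (use v in blast)
 show "gm`W' <= U Int U'" using v W'(2) U'(2) by blast
 show "velocity A gm z ~= 0" if "z : W'" for z using v W'(2) that by blast
 fix z assume z: "z : W'"
 obtain O' V X where O': "open O'" "z : O'" "O' <= W" "mopen A V" "V <= U" "gm`O' <= V" "X : vfields A V"
  and X: "ALL w:O'. X (gm w) = velocity A gm w & D V X X (gm w) = 0" using param_geodesic_field[OF g subsetD[OF W'(2) z]] by blast
 let ?V = "V Int U'"
 have m: "mopen A ?V" by (rule mopen_Int[OF A O'(4) U'(1)])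
 interpret i: iso_pair A A ?V "%x. x"
 proof
  show "iso_on A A ?V (%x. x)" using m by (simp add: iso_on_def inj_on_def)
 qed (fact A)+
 have e: "D ?V (vres ?V X) (vres ?V X) = vres ?V (D V X X)"
  using D[unfolded torsion_free_connection_def, THEN spec, THEN mp, OF conjI[OF O'(4,5)], THEN bspec, OF O'(7), THEN bspec, OF O'(7)]
   m by blast
 show "EX W'' V X. open W'' & z : W'' & W'' <= W' & mopen A V & V <= U Int U' & gm`W'' <= V & X : vfields A V &
   (ALL w:W''. X (gm w) = velocity A gm w & D V X X (gm w) = 0)"
 proof (intro exI conjI ballI)
  show "open (O' Int W')" using O'(1) W'(1) by blast
  show im: "gm`(O' Int W') <= ?V" using O'(6) U'(2) by blast
  show "vres ?V X : vfields A ?V" by (rule i.vres_vfields[OF O'(7)]) blast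
  fix w assume w: "w : O' Int W'"
  hence "gm w : ?V" using im by blast
  thus "vres ?V X (gm w) = velocity A gm w" "D ?V (vres ?V X) (vres ?V X) (gm w) = 0" unfolding e using X w by (auto simp: vres_def)
 qed (use m O' z in auto)
qed

context iso_pair
begin

lemma holo_map_push:
 assumes S: "atlas_compat S" and c: "holo_map S A W c" and "c`W <= V"
 shows "holo_map S B W (%x. f (c x))"
proof (rule holo_mapI[OF S])
 show "mopen S W" using c by (simp add: holo_map_def)
 show "(%x. f (c x))`W <= points B" using assms(3) mopen_points[OF fV_mopen] by blast
 fix O' ps i assume O': "(O', ps) : B"
 have "holo_on B O' (%y. ps y$i)" by (rule coord_components[OF coord_chart[OF cB O']])
 from holo_map_compose[OF S cA c iso_on_preimage[OF cB iso this]]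
 have "holo_on S {x : W. c x : {x : V. f x : O'}} (%x. ps (f (c x))$i)" .
 moreover have "{x : W. c x : {x : V. f x : O'}} = {x : W. f (c x) : O'}" using assms(3) by auto
 ultimately show "holo_on S {x : W. f (c x) : O'} (%x. ps (f (c x))$i)" by simp
qed

lemma tmap_comp:
 assumes "c x : V"
 shows "tmap B (%x. f (c x)) (f (c x)) v = tmap B f (f (c x)) (tmap A c (c x) v)" using near_f[OF assms] by (simp add: tmap_def fun_eq_iff)

lemma velocity_push:
 assumes "gm z : V"
 shows "velocity B (%w. f (gm w)) z = tmap B f (f (gm z)) (velocity A gm z)"
 using near_f[OF assms] by (simp add: tmap_def velocity_def fun_eq_iff)

lemma immersed_curve_push:
 assumes c: "immersed_curve A U S c" and U: "U <= V"
 shows "immersed_curve B (f`U) S (%x. f (c x))"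
proof -
 have S: "complex_manifold S" "connected_space (mtop S)" and cm: "holo_map S A (points S) c" "c`points S <= U"
  and im: "ALL x:points S. ALL v:tangent S x. tmap A c (c x) v = 0 --> v = 0" using c by (auto simp: immersed_curve_def)
 have sc: "atlas_compat S" by (rule complex_manifold_compat[OF S(1)])
 have cV: "c`points S <= V" using cm(2) U by blast
 have "v = 0" if x: "x : points S" and v: "v : tangent S x" and z: "tmap B (%x. f (c x)) (f (c x)) v = 0" for x v
 proof -
  have cx: "c x : V" using cV x by blast
  have "tmap A c (c x) v : tangent A (c x)" by (rule tmap_tangent[OF sc cA holo_map_smooth[OF sc cA cm(1) x] v])
  hence "tmap A c (c x) v = 0" using z tmap_f_zero[OF cx] by (simp add: tmap_comp[of c x, OF cx])
  thus ?thesis using im x v by blast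
 qed
 moreover have "(%x. f (c x))`points S <= f`U" using cm(2) by blast
 ultimately show ?thesis unfolding immersed_curve_def using S holo_map_push[OF sc cm(1) cV] by simp
qed

text \<open>The vector field extending the velocity is pushed forward along with the curve; by the
  definition of \<open>pull_conn\<close>, its covariant derivative is the push-forward of the one
  upstairs.\<close>

lemma param_geodesic_push:
 assumes g: "param_geodesic A V (pull_conn B A f D) W gm" and D: "torsion_free_connection B (f`V) D"
 shows "param_geodesic B (f`V) D W (%z. f (gm z))" unfolding param_geodesic_def
proof (intro conjI ballI)
 note v = param_geodesic_velocity[OF g]
 have gmV: "gm z : V" if "z : W" for z using v that by blast
 show "holo_map std_atlas B W (%z. f (gm z))" by (rule holo_map_push[OF std_compat]) (use v in auto)
 show "(%z. f (gm z))`W <= f`V" using gmV by blast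
 fix z assume z: "z : W"
 show "velocity B (%z. f (gm z)) z ~= 0"
  unfolding velocity_push[of gm z, OF gmV[OF z]] tmap_f_zero[OF gmV[OF z] velocity_tmap(2)[OF cA v[THEN conjunct1] z]] using v z by blast
 obtain O' U X where O': "open O'" "z : O'" "O' <= W" "mopen A U" "U <= V" "gm`O' <= U" "X : vfields A U"
  and X: "ALL w:O'. X (gm w) = velocity A gm w & pull_conn B A f D U X X (gm w) = 0" using param_geodesic_field[OF g z] by blast
 interpret u: iso_pair A B U f by (rule restrict[OF O'(4,5)])
 have fU: "mopen B (f`U)" "f`U <= f`V" using u.fV_mopen O'(5) by auto
 note pX = u.push_vfields[OF O'(7)]
 have DX: "D (f`U) (u.push X) (u.push X) : vfields B (f`U)"
  using D[unfolded torsion_free_connection_def, THEN spec, THEN mp, OF conjI[OF fU], THEN bspec, OF pX, THEN bspec, OF pX] by blast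
 show "EX W' V' X. open W' & z : W' & W' <= W & mopen B V' & V' <= f`V & (%z. f (gm z))`W' <= V' & X : vfields B V' &
   (ALL w:W'. X (f (gm w)) = velocity B (%z. f (gm z)) w & D V' X X (f (gm w)) = 0)"
 proof (intro exI conjI ballI)
  show "(%z. f (gm z))`O' <= f`U" using O'(6) by blast
  fix w assume w: "w : O'"
  have gmU: "gm w : U" using w O'(6) by blast
  have wV: "gm w : V" using gmU O'(5) by blast
  show "u.push X (f (gm w)) = velocity B (%z. f (gm z)) w" unfolding u.push_apply[OF gmU] velocity_push[of gm w, OF wV] using X w by simp
  have "u.push (pull_conn B A f D U X X) (f (gm w)) = 0" unfolding u.push_apply[OF gmU] using X w by simp
  thus "D (f`U) (u.push X) (u.push X) (f (gm w)) = 0"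
   unfolding pull_conn_def u.push_def[symmetric] u.pull_def[symmetric] u.push_pull[OF DX] .
 qed (use O' fU pX in auto)
qed

lemma param_geodesic_pull:
 assumes g: "param_geodesic B (f`V) D W (%z. f (gm z))" and gm: "holo_map std_atlas A W gm" "gm`W <= V"
 shows "param_geodesic A V (pull_conn B A f D) W gm" unfolding param_geodesic_def
proof (intro conjI ballI gm)
 note v = param_geodesic_velocity[OF g]
 have gmV: "gm z : V" if "z : W" for z using gm(2) that by blast
 interpret i: iso_pair B A "f`V" f' by (rule inverse_pair)
 fix z assume z: "z : W"
 have "velocity B (%z. f (gm z)) z ~= 0" using v z by blast
 thus "velocity A gm z ~= 0"
  using tmap_f_zero[OF gmV[OF z] velocity_tmap(2)[OF cA gm(1) z]] by (simp add: velocity_push[of gm z, OF gmV[OF z]])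
 obtain O' T X where O': "open O'" "z : O'" "O' <= W" "mopen B T" "T <= f`V" "(%z. f (gm z))`O' <= T" "X : vfields B T"
  and X: "ALL w:O'. X (f (gm w)) = velocity B (%z. f (gm z)) w & D T X X (f (gm w)) = 0" using param_geodesic_field[OF g z] by blast
 let ?U = "f'`T"
 have fU: "f`?U = T" and U: "?U <= V" using image_of_inverse[OF order_refl O'(5)] .
 have mU: "mopen A ?U" using iso_on_mopen_iff[OF iso U] fU O'(4) by simp
 have X': "X : vfields B (f`?U)" using O'(7) by (simp only: fU)
 interpret u: iso_pair A B ?U f by (rule restrict[OF mU U])
 let ?X = "u.pull X"
 note pp = u.push_pull[OF X'] and pv = u.pull_vfields[OF X']
 show "EX W' V' X. open W' & z : W' & W' <= W & mopen A V' & V' <= V & gm`W' <= V' & X : vfields A V' &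
   (ALL w:W'. X (gm w) = velocity A gm w & pull_conn B A f D V' X X (gm w) = 0)"
 proof (intro exI conjI ballI)
  have gU: "gm w : ?U" if "w : O'" for w
  proof -
   have "f (gm w) : T" using O'(6) that by blast
   moreover have "f' (f (gm w)) = gm w" using gmV O'(3) that by (intro f'_f) blast
   ultimately show ?thesis by (metis image_eqI)
  qed
  thus "gm`O' <= ?U" by blast
  fix w assume w: "w : O'"
  have wV: "gm w : V" using gU[OF w] U by blast
  have wW: "w : W" using w O'(3) by blast
  have "tmap B f (f (gm w)) (?X (gm w)) = tmap B f (f (gm w)) (velocity A gm w)"
   using u.push_apply[OF gU[OF w], of ?X] X w velocity_push[of gm w, OF wV] unfolding pp by simp
  hence "tmap A f' (gm w) (tmap B f (f (gm w)) (?X (gm w))) = tmap A f' (gm w) (tmap B f (f (gm w)) (velocity A gm w))" by (rule arg_cong)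
  thus "?X (gm w) = velocity A gm w"
   unfolding tmap_f(2)[OF wV vfieldsD(1)[OF pv gU[OF w]]] tmap_f(2)[OF wV velocity_tmap(2)[OF cA gm(1) wW]] .
  have "D (f`?U) (u.push ?X) (u.push ?X) (f (gm w)) = 0" unfolding pp unfolding fU by (rule X[THEN bspec, OF w, THEN conjunct2])
  thus "pull_conn B A f D ?U ?X ?X (gm w) = 0" unfolding pull_conn_def pull_vfield_def u.push_def by (simp add: tmap_def fun_eq_iff)
 qed (use O' mU U pv in auto)
qed

lemma geodesic_near_pull:
 assumes S: "atlas_compat S" and c: "holo_map S A (points S) c" "c`points S <= V" and D: "torsion_free_connection B (f`V) D"
 shows "geodesic_near A V (pull_conn B A f D) S c x \<longleftrightarrow> geodesic_near B (f`V) D S (%x. f (c x)) x"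
 unfolding geodesic_near_def
proof (intro iffI; elim exE conjE)
 fix W g assume g: "biholo_on std_atlas S W g" "x : g`W"
 show "EX W g. biholo_on std_atlas S W g & x : g`W & param_geodesic B (f`V) D W (%z. f (c (g z)))"
  if "param_geodesic A V (pull_conn B A f D) W (%z. c (g z))" using param_geodesic_push[OF that D] g by blast
 have gi: "iso_on std_atlas S W g" using g biholo_on_iff_iso_on[OF std_compat S] by blast
 have gS: "g`W <= points S" by (rule mopen_points[OF iso_on_image_mopen[OF gi]])
 have cg: "holo_map std_atlas A W (%z. c (g z))"
 proof (rule holo_mapI[OF std_compat])
  show "mopen std_atlas W" by (rule iso_on_mopen[OF gi])
  show "(%z. c (g z))`W <= points A" using c(2) gS mopen_points[OF V_mopen] by blast
  fix O' ps i assume O': "(O', ps) : A"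
  have "holo_on A O' (%y. ps y$i)" by (rule coord_components[OF coord_chart[OF cA O']])
  from iso_on_preimage[OF S gi holo_map_compose[OF S cA c(1) this]]
  have "holo_on std_atlas {z : W. g z : {x : points S. c x : O'}} (%x. ps (c (g x))$i)" .
  moreover have "{z : W. g z : {x : points S. c x : O'}} = {z : W. c (g z) : O'}" using gS by auto
  ultimately show "holo_on std_atlas {z : W. c (g z) : O'} (%x. ps (c (g x))$i)" by simp
 qed
 show "EX W g. biholo_on std_atlas S W g & x : g`W & param_geodesic A V (pull_conn B A f D) W (%z. c (g z))"
  if "param_geodesic B (f`V) D W (%z. f (c (g z)))" using param_geodesic_pull[OF that cg] c(2) gS g by blast
qed

end

section \<open>Projective space\<close>

definition sig :: "'n option => 'n => 'n option" where
 "sig i j = (if i = Some j then None else Some j)"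

definition sig_inv :: "'n option => 'n option => 'n" where
 "sig_inv i k = (case k of None => the i | Some j => j)"

lemma sig_neq [simp]: "sig i j ~= i" by (cases i) (auto simp: sig_def)

lemma sig_inv_sig [simp]: "sig_inv i (sig i j) = j" by (auto simp: sig_def sig_inv_def)

lemma sig_sig_inv [simp]: "k ~= i ==> sig i (sig_inv i k) = k" by (cases k; cases i) (auto simp: sig_def sig_inv_def)

text \<open>Inverse of the affine chart at \<open>i\<close>: it gives the representative vector
  whose coordinate \<open>i\<close> is 1.\<close>

definition cp_ins :: "'n option => complex ^ 'n => complex ^ ('n::finite option)" where
 "cp_ins i x = (\<chi> k. if k = i then 1 else x$sig_inv i k)"

definition cp_dom :: "'n option => (complex ^ ('n::finite option)) set set" where
 "cp_dom i = {l : cp_points. EX v:l. v$i ~= 0}"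

definition cp_coord :: "'n option => (complex ^ ('n::finite option)) set => complex ^ 'n" where
 "cp_coord i l = (\<chi> j. (THE v. v : l & v$i = 1)$sig i j)"

lemma cp_atlas_eq: "cp_atlas = {(cp_dom i, cp_coord i) | i. True}" by (simp add: cp_atlas_def cp_dom_def cp_coord_def[abs_def] sig_def)

lemma span_line: "vec.span {v :: complex ^ 'k::finite} = range (%c. c *s v)" by (simp add: vec.span_singleton)

lemma cp_points_span: "v ~= 0 ==> vec.span {v} : cp_points" by (auto simp: cp_points_def)

lemma span_scale: "c ~= 0 ==> vec.span {c *s (v :: complex ^ 'k::finite)} = vec.span {v}"
proof -
 assume c: "c ~= 0"
 have 1: "d *s v = (d / c) *s (c *s v)" for d using c by (simp add: vec_eq_iff)
 have 2: "d *s (c *s v) = (d * c) *s v" for d by (simp add: vec_eq_iff)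
 show ?thesis unfolding span_line
 proof (rule set_eqI, rule iffI)
  show "x : range (%d. d *s v)" if "x : range (%d. d *s (c *s v))" for x using that 2 by blast
  show "x : range (%d. d *s (c *s v))" if "x : range (%d. d *s v)" for x using that 1 by blast
 qed
qed

lemma cp_dom_span: "v ~= 0 ==> vec.span {v} : cp_dom i \<longleftrightarrow> v$i ~= 0"
proof -
 assume v: "v ~= 0"
 have "v : vec.span {v}" by (rule vec.span_base) simp
 thus ?thesis using cp_points_span[OF v] by (auto simp: cp_dom_def span_line)
qed

lemma cp_domE:
 assumes "l : cp_dom i"
 obtains v where "l = vec.span {v}" "v$i = 1"
proof -
 obtain v where v: "l = vec.span {v}" "v ~= 0" using assms by (auto simp: cp_dom_def cp_points_def)
 hence nz: "v$i ~= 0" using assms cp_dom_span[OF v(2), of i] by simp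
 have "l = vec.span {inverse (v$i) *s v}" using span_scale[of "inverse (v$i)" v] nz v(1) by simp
 thus ?thesis by (rule that) (use nz in simp)
qed

lemma cp_rep:
 fixes v :: "complex ^ 'k::finite"
 assumes v: "v$i = 1"
 shows "(THE w. w : vec.span {v} & w$i = 1) = v"
proof (rule the_equality)
 show "v : vec.span {v} & v$i = 1" using v vec.span_base[of v "{v}"] by simp
 fix w assume w: "w : vec.span {v} & w$i = 1"
 then obtain c where "w = c *s v" using span_line[of v] by blast
 thus "w = v" using v w by simp
qed

lemma cp_coord_unit: "v$i = 1 ==> cp_coord i (vec.span {v}) = (\<chi> j. v$sig i j)" by (simp add: cp_coord_def cp_rep)

lemma cp_coord_span: "v$i ~= 0 ==> cp_coord i (vec.span {v}) = (\<chi> j. v$sig i j / v$i)"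
proof -
 assume v: "v$i ~= 0"
 have "vec.span {v} = vec.span {inverse (v$i) *s v}" using span_scale[of "inverse (v$i)" v] v by simp
 thus ?thesis using cp_coord_unit[of "inverse (v$i) *s v" i] v by (simp add: divide_inverse mult.commute)
qed

lemma cp_ins_nth [simp]: "cp_ins i x$i = 1" "cp_ins i x$sig i j = x$j" by (simp_all add: cp_ins_def)

lemma cp_ins_nonzero [simp]: "cp_ins i x ~= 0" using cp_ins_nth(1)[of i x] by (metis zero_index zero_neq_one)

lemma cp_coord_ins [simp]: "cp_coord i (vec.span {cp_ins i x}) = x" by (simp add: cp_coord_unit vec_eq_iff)

lemma cp_ins_dom: "vec.span {cp_ins i x} : cp_dom k \<longleftrightarrow> cp_ins i x$k ~= 0" by (rule cp_dom_span) simp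

lemma cp_ins_coord: "l : cp_dom i ==> vec.span {cp_ins i (cp_coord i l)} = l"
proof -
 assume "l : cp_dom i"
 then obtain v where v: "l = vec.span {v}" "v$i = 1" by (rule cp_domE)
 have "cp_ins i (cp_coord i l) = v" using v by (simp add: vec_eq_iff cp_ins_def cp_coord_unit)
 thus ?thesis using v by simp
qed

lemma cp_coord_inj: "inj_on (cp_coord i) (cp_dom i)" by (rule inj_on_inverseI[of _ "%x. vec.span {cp_ins i x}"]) (rule cp_ins_coord)

lemma cp_coord_image: "cp_coord i`(cp_dom i Int cp_dom k) = {x. cp_ins i x$k ~= 0}"
proof (rule set_eqI, rule iffI)
 fix x assume "x : cp_coord i`(cp_dom i Int cp_dom k)"
 then obtain l where "l : cp_dom i" "l : cp_dom k" "x = cp_coord i l" by blast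
 thus "x : {x. cp_ins i x$k ~= 0}" using cp_ins_dom[of i x k] cp_ins_coord[of l i] by simp
next
 fix x assume "x : {x. cp_ins i x$k ~= 0}"
 hence "vec.span {cp_ins i x} : cp_dom i Int cp_dom k" by (simp add: cp_ins_dom)
 thus "x : cp_coord i`(cp_dom i Int cp_dom k)" by (rule rev_image_eqI) simp
qed

lemma cp_inv: "inv_into (cp_dom i) (cp_coord i) x = vec.span {cp_ins i x}"
 using inv_into_f_f[OF cp_coord_inj, of "vec.span {cp_ins i x}" i] by (simp add: cp_ins_dom)

lemma holo_cp_ins: "open S ==> holo S (%x. cp_ins i x$k)" by (cases "k = i") (simp_all add: cp_ins_def holo_coord)

lemma open_cp_ins: "open {x. cp_ins i x$k ~= 0}"
proof -
 have "open {x : UNIV. (\<chi> j. cp_ins i x$k) : {y :: complex ^ 1. y$1 ~= 0}}"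
 proof (rule open_holo_preimage)
  show "holo UNIV (%x. (\<chi> j. cp_ins i x$k)$l)" for l :: 1 using holo_cp_ins[of UNIV] by simp
  have "{y :: complex ^ 1. y$1 ~= 0} = (%y. y$1) -` (- {0})" by auto
  thus "open {y :: complex ^ 1. y$1 ~= 0}"
   using open_vimage[OF _ linear_continuous_on[OF bounded_linear_nth1], of "- {0}"] by (simp add: open_Compl)
 qed
 thus ?thesis by simp
qed

lemma cp_compat: "atlas_compat cp_atlas" unfolding atlas_compat_def
proof (intro conjI)
 have im: "cp_coord i`cp_dom i = UNIV" for i :: "'n::finite option" using cp_coord_image[of i i] by simp
 show "ALL (U, ph):cp_atlas. inj_on ph U & open (ph`U)" by (auto simp: cp_atlas_eq cp_coord_inj im)
 have "holo {x. cp_ins i x$k ~= 0} (%x. cp_coord k (vec.span {cp_ins i x})$j)" for i k :: "'n::finite option" and j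
 proof -
  have "holo {x. cp_ins i x$k ~= 0} (%x. cp_ins i x$sig k j / cp_ins i x$k)"
   by (rule holo_divide) (use holo_cp_ins[OF open_cp_ins] in auto)
  thus ?thesis by (rule holo_cong[THEN iffD1, rotated]) (simp add: cp_coord_span)
 qed
 thus "ALL (U, ph):cp_atlas. ALL (V, ps):cp_atlas. ALL i. holo (ph`(U Int V)) (%x. ps (inv_into U ph x)$i)"
  by (auto simp: cp_atlas_eq cp_coord_image cp_inv)
qed

lemma cp_coord_iso: "coord cp_atlas (cp_dom i) (cp_coord i)" by (rule coord_chart[OF cp_compat]) (auto simp: cp_atlas_eq)

lemma dim_2_basis:
 fixes Q :: "(complex ^ 'k::finite) set"
 assumes Q: "vec.subspace Q" "vec.dim Q = 2"
 obtains b c where "b ~= c" "vec.independent {b, c}" "Q = vec.span {b, c}"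
proof -
 obtain T where T: "T <= Q" "vec.independent T" "Q <= vec.span T" "card T = vec.dim Q" using vec.basis_exists by blast
 then obtain b c where bc: "T = {b, c}" "b ~= c" using Q(2) by (auto simp: card_2_iff)
 have "vec.span T <= Q" using vec.span_minimal[OF T(1) Q(1)] .
 thus ?thesis using that[of b c] bc T by auto
qed

lemma span_pair: "x : vec.span {b, c :: complex ^ 'k::finite} ==> EX al be. x = al *s b+be *s c"
 by (auto simp: vec.span_breakdown_eq) (metis add.commute diff_add_cancel)

text \<open>The coordinate \<open>i\<close> is a nonzero functional on the plane because of
  \<open>u\<close>, so its kernel in \<open>Q\<close> is a line and \<open>x\<close>,
  \<open>y\<close> are proportional. In an affine chart this says that projective lines are
  straight.\<close>

lemma plane_proportional:
 fixes Q :: "(complex ^ 'k::finite) set"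
 assumes Q: "vec.subspace Q" "vec.dim Q = 2" and u: "u : Q" "u$i ~= 0"
  and x: "x : Q" "x$i = 0" and y: "y : Q" "y$i = 0"
 shows "x$k * y$m = x$m * y$k"
proof -
 obtain b c where Q': "Q = vec.span {b, c}" using dim_2_basis[OF Q] by metis
 obtain al be where x': "x = al *s b+be *s c" using span_pair x(1) Q' by blast
 obtain al' be' where y': "y = al' *s b+be' *s c" using span_pair y(1) Q' by blast
 obtain \<mu> \<nu> where u': "u = \<mu> *s b+\<nu> *s c" using span_pair u(1) Q' by blast
 have e: "al * b$i+be * c$i = 0" "al' * b$i+be' * c$i = 0" using x(2) y(2) x' y' by auto
 have nz: "b$i ~= 0 \<or> c$i ~= 0" using u(2) u' by auto
 have "b$i * (al * be' - al' * be) = 0" "c$i * (al * be' - al' * be) = 0" using e by algebra+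
 hence "al * be' - al' * be = 0" using nz by auto
 thus ?thesis unfolding x' y' by simp algebra
qed

section \<open>Projective structures on covering spaces\<close>

lemma holo_map_cong:
 assumes S: "atlas_compat S" and A: "atlas_compat A" and c: "holo_map S A W c" and e: "!!x. x : W ==> c x = c' x"
 shows "holo_map S A W c'"
proof (rule holo_mapI[OF S])
 show "mopen S W" "c'`W <= points A" using c e by (auto simp: holo_map_def)
 fix V ps i assume V: "(V, ps) : A"
 have "holo_on S {x : W. c x : V} (%x. ps (c x)$i)" by (rule holo_map_compose[OF S A c coord_components[OF coord_chart[OF A V]]])
 moreover have "{x : W. c x : V} = {x : W. c' x : V}" using e by auto
 ultimately show "holo_on S {x : W. c' x : V} (%x. ps (c' x)$i)"
  using holo_on_cong[OF S, of "{x : W. c' x : V}" "%x. ps (c' x)$i" "%x. ps (c x)$i"] e by simp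
qed

lemma velocity_cong:
 assumes "open W" "z : W" "!!x. x : W ==> gm x = gm' x"
 shows "velocity A gm z = velocity A gm' z"
proof
 fix f
 have "deriv (%w. f (gm w)) z = deriv (%w. f (gm' w)) z"
 proof (rule deriv_cong_ev)
  show "\<forall>\<^sub>F w in nhds z. f (gm w) = f (gm' w)" unfolding eventually_nhds using assms by (intro exI[of _ W]) simp
 qed simp
 thus "velocity A gm z f = velocity A gm' z f" using assms(3)[OF assms(2)] by (simp add: velocity_def)
qed

lemma param_geodesic_cong:
 assumes A: "atlas_compat A" and W: "open W" and g: "param_geodesic A U D W gm" and e: "!!x. x : W ==> gm x = gm' x"
 shows "param_geodesic A U D W gm'" unfolding param_geodesic_def
proof (intro conjI ballI)
 note v = param_geodesic_velocity[OF g]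
 show "holo_map std_atlas A W gm'" using holo_map_cong[OF std_compat A v[THEN conjunct1] e] .
 show "gm'`W <= U" using v e by auto
 fix z assume z: "z : W"
 show "velocity A gm' z ~= 0" using v z velocity_cong[OF W z e, where A = A] by auto
 obtain O' V X where O': "open O'" "z : O'" "O' <= W" "mopen A V" "V <= U" "gm`O' <= V" "X : vfields A V"
  and X: "ALL w:O'. X (gm w) = velocity A gm w & D V X X (gm w) = 0" using param_geodesic_field[OF g z] by blast
 have e': "gm' w = gm w" if "w : O'" for w using e[of w] that O'(3) by auto
 show "EX W' V X. open W' & z : W' & W' <= W & mopen A V & V <= U & gm'`W' <= V & X : vfields A V &
   (ALL w:W'. X (gm' w) = velocity A gm' w & D V X X (gm' w) = 0)"
 proof (intro exI conjI ballI)
  show "gm'`O' <= V" using O'(6) e' by auto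
  fix w assume w: "w : O'"
  show "X (gm' w) = velocity A gm' w" "D V X X (gm' w) = 0" using X w velocity_cong[OF O'(1) w e'[symmetric], where A = A] e'[OF w] by auto
 qed (use O' in auto)
qed

lemma geodesic_near_subset:
 assumes A: "atlas_compat A" and S: "atlas_compat S" and c: "c`points S <= U'" and U': "mopen A U'" "U' <= U"
  and D: "torsion_free_connection A U D"
 shows "geodesic_near A U D S c x \<longleftrightarrow> geodesic_near A U' D S c x" unfolding geodesic_near_def
proof (intro iffI; elim exE conjE)
 fix W g assume g: "biholo_on std_atlas S W g" "x : g`W"
 show "EX W g. biholo_on std_atlas S W g & x : g`W & param_geodesic A U D W (%z. c (g z))"
  if "param_geodesic A U' D W (%z. c (g z))" using param_geodesic_mono[OF that U'(2)] g by blast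
 have gi: "iso_on std_atlas S W g" using g biholo_on_iff_iso_on[OF std_compat S] by blast
 have gS: "g`W <= points S" by (rule mopen_points[OF iso_on_image_mopen[OF gi]])
 have oW: "open W" using iso_on_mopen[OF gi] by simp
 show "EX W g. biholo_on std_atlas S W g & x : g`W & param_geodesic A U' D W (%z. c (g z))"
  if p: "param_geodesic A U D W (%z. c (g z))"
 proof -
  have "(%z. c (g z))`W <= U'" using gS c by blast
  from param_geodesic_shrink[OF A p D U'(1) this oW order_refl] have "param_geodesic A U' D W (%z. c (g z))"
   using U'(2) by (simp add: Int_absorb1)
  thus ?thesis using g by blast
 qed
qed

lemma immersed_curve_mono: "immersed_curve A U' S c ==> U' <= U ==> immersed_curve A U S c"
 unfolding immersed_curve_def by (elim conjE, intro conjI; (assumption | erule (1) order_trans))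

lemma coord_plane: "open S ==> coord (plane_atlas S) S cv" by (rule coord_chart[OF plane_compat]) (simp_all add: plane_atlas_def)

text \<open>The tangent space of the disc is spanned by the coordinate field, so the differential is
  injective as soon as the velocity does not vanish.\<close>

lemma immersed_disc:
 assumes A: "atlas_compat A" and S: "open S" "connected S" and gm: "holo_map std_atlas A S gm" "gm`S <= U"
  and v: "!!z. z : S ==> velocity A gm z ~= 0"
 shows "immersed_curve A U (plane_atlas S) gm" unfolding immersed_curve_def points_plane
proof (intro conjI ballI impI complex_manifold_plane connected_plane S gm(2))
 note c = plane_compat[OF S(1)]
 show h: "holo_map (plane_atlas S) A S gm"
 proof (rule holo_mapI[OF c])
  show "mopen (plane_atlas S) S" using S by (simp add: mopen_plane)
  show "gm`S <= points A" using gm by (auto simp: holo_map_def)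
  fix V ps i assume V: "(V, ps) : A"
  have "holo_on std_atlas {x : S. gm x : V} (%x. ps (gm x)$i)"
   by (rule holo_map_compose[OF std_compat A gm(1) coord_components[OF coord_chart[OF A V]]])
  thus "holo_on (plane_atlas S) {x : S. gm x : V} (%x. ps (gm x)$i)" by (auto simp: holo_on_plane)
 qed
 fix x u assume x: "x : S" and u: "u : tangent (plane_atlas S) x" and z: "tmap A gm (gm x) u = 0"
 interpret p: coordinates "plane_atlas S" S cv by standard (rule c, rule coord_plane[OF S(1)])
 obtain f where f: "velocity A gm x f ~= 0" using v[OF x] by (auto simp: fun_eq_iff)
 hence nf: "holo_near A (gm x) f" and df: "deriv (%w. f (gm w)) x ~= 0" by (auto simp: velocity_def split: if_splits)
 have ng: "holo_near (plane_atlas S) x (%w. f (gm w))" by (rule smooth_at_near[OF holo_map_smooth[OF c A h x] nf])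
 have d: "cpd S cv 1 g x = deriv g x" if g: "holo_near (plane_atlas S) x g" for g
 proof -
  have "holo_near std_atlas x g" using g unfolding holo_near_def by (auto simp: holo_on_plane)
  from holo_near_std[OF this] have "(g has_field_derivative deriv g x) (at x)" by (simp add: field_differentiable_derivI)
  moreover have "((%z. x+z) has_field_derivative 1) (at 0)" by (auto intro!: derivative_eq_intros)
  ultimately have "((%z. g (x+z)) has_field_derivative deriv g x) (at 0)"
   using DERIV_chain2[of g "deriv g x" "%z. x+z" 0 1 UNIV] by simp
  hence "((%z. g (inv_into S cv (cv x+axis 1 z))) has_field_derivative deriv g x) (at 0)"
  proof (rule has_field_derivative_transform_within_open[of _ _ _ "(%z. x+z) -` S"])
   show "open ((%z. x+z) -` S)" by (rule open_vimage[OF S(1)]) (intro continuous_intros)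
   fix z assume "z : (%z. x+z) -` S"
   moreover have "cv x+axis 1 z = cv (x+z)" by (simp add: vec_eq_iff axis_def forall_1)
   ultimately show "g (x+z) = g (inv_into S cv (cv x+axis 1 z))" by simp
  qed (use x in simp)
  thus ?thesis unfolding cpd_def pd_def by (simp add: DERIV_imp_deriv)
 qed
 have "u (%w. f (gm w)) = 0" using z nf by (auto simp: tmap_def fun_eq_iff dest: spec[of _ f])
 hence "u (%x. cv x$1) = 0" using p.tangent_expand[OF x u ng] d[OF ng] df by (simp add: sum_1)
 thus "u = 0" using p.tvec_eq[OF x u] by (simp add: p.tvec_def fun_eq_iff sum_1)
qed

lemma geodesic_near_plane:
 assumes S: "open S" and W: "open W" "W <= S" and g: "param_geodesic A U D W gm" and z: "z : W"
 shows "geodesic_near A U D (plane_atlas S) gm z" unfolding geodesic_near_def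
proof (intro exI conjI)
 show "biholo_on std_atlas (plane_atlas S) W (%z. z)"
  using plane_iso[OF S W] biholo_on_iff_iso_on[OF std_compat plane_compat[OF S]] by blast
qed (use g z in auto)

lemma projective_coveringD:
 assumes C: "projective_covering A C"
 shows "\<Union> (fst`C) = points A" "(U, D) : C ==> mopen A U" "(U, D) : C ==> U ~= {} ==> torsion_free_connection A U D"
  "(U, D) : C ==> (V, D') : C ==> U Int V ~= {} ==> projectively_equivalent A (U Int V) D D'"
proof -
 note c0 = C[unfolded projective_covering_def]
 note c = c0[THEN conjunct1] c0[THEN conjunct2, THEN conjunct1] c0[THEN conjunct2, THEN conjunct2]
 show "\<Union> (fst`C) = points A" by (rule c(1))
 show "(U, D) : C ==> mopen A U" "(U, D) : C ==> U ~= {} ==> torsion_free_connection A U D" using c(2)[THEN bspec, of "(U, D)"] by simp_all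
 assume UD: "(U, D) : C" and VD: "(V, D') : C" and ne: "U Int V ~= {}"
 have "ALL (V, D'):C. U Int V ~= {} --> projectively_equivalent A (U Int V) D D'" using c(3)[THEN bspec, OF UD] unfolding prod.case .
 from this[THEN bspec, OF VD] show "projectively_equivalent A (U Int V) D D'" using ne unfolding prod.case by blast
qed

context covering
begin

text \<open>A curve in an overlap upstairs is pushed down by \<open>q\<close>, which is injective
  there, to a curve in the overlap of the base sets, where the two connections have the same
  geodesics.\<close>

lemma pull_covering_projective:
 assumes C: "projective_covering A C"
 shows "projective_covering B (pull_covering A B q C)" unfolding projective_covering_def
proof (intro conjI)
 note Cu = projective_coveringD(1)[OF C] and Cm = projective_coveringD(2)[OF C] and Ct = projective_coveringD(3)[OF C]
  and Ce = projective_coveringD(4)[OF C]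
 have cases: "EX V U D. c = (V, pull_conn A B q D) & (U, D) : C & openin Y V & inj_on q V & q`V <= U"
  if "c : pull_covering A B q C" for c using that mopen_B unfolding pull_covering_def by blast
 show "\<Union> (fst`pull_covering A B q C) = points B"
 proof (rule set_eqI, rule iffI)
  fix y assume "y : \<Union> (fst`pull_covering A B q C)"
  then obtain c where c: "c : pull_covering A B q C" "y : fst c" by blast
  obtain V U D where "c = (V, pull_conn A B q D)" "openin Y V" using cases[OF c(1)] by blast
  thus "y : points B" using c(2) openin_subset[of Y V] points_B by auto
 next
  fix y assume "y : points B"
  hence y: "y : topspace Y" using points_B by simp
  hence "q y : \<Union> (fst`C)" using q_image Cu by blast
  then obtain U D where U: "(U, D) : C" "q y : U" by auto
  obtain V where V: "openin Y V" "y : V" "inj_on q V" using sheet[OF y] by blast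
  let ?V = "V Int {y : topspace Y. q y : U}"
  have o: "openin Y ?V" by (rule openin_Int[OF V(1) q_cont[OF Cm[OF U(1)]]])
  have "(?V, pull_conn A B q D) : pull_covering A B q C"
   unfolding pull_covering_def using U(1) o mopen_B inj_on_subset[OF V(3), of ?V] by blast
  thus "y : \<Union> (fst`pull_covering A B q C)" using y V(2) U(2) by force
 qed
 show "ALL (V, D):pull_covering A B q C. mopen B V & (V ~= {} --> torsion_free_connection B V D)"
 proof
  fix c assume "c : pull_covering A B q C"
  from cases[OF this] obtain V U D where c: "c = (V, pull_conn A B q D)" "(U, D) : C" "openin Y V" "inj_on q V" "q`V <= U" by blast
  interpret i: iso_pair B A V q by (rule pair_q[OF c(3,4)])
  have "torsion_free_connection B V (pull_conn A B q D)" if "V ~= {}"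
  proof (rule i.pull_torsion_free[OF torsion_free_subset[OF Ct(1)[OF c(2)] c(5)]])
   show "U ~= {}" using that c(5) by blast
  qed
  thus "case c of (V, D) => mopen B V & (V ~= {} --> torsion_free_connection B V D)" using c(1,3) mopen_B by simp
 qed
 have main: "projectively_equivalent B (V Int V') (pull_conn A B q D) (pull_conn A B q D')"
  if V: "openin Y V" "inj_on q V" "q`V <= U" "(U, D) : C" and V': "openin Y V'" "inj_on q V'" "q`V' <= U'" "(U', D') : C"
   and ne: "V Int V' ~= {}" for V U D V' U' D' unfolding projectively_equivalent_def
 proof (intro allI impI)
  let ?T = "V Int V'"
  fix S c assume c: "immersed_curve B ?T S c"
  have oT: "openin Y ?T" by (rule openin_Int[OF V(1) V'(1)])
  interpret i: iso_pair B A ?T q by (rule pair_q[OF oT inj_on_subset[OF V(2)]]) blast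
  have qT: "q`?T <= U Int U'" using V(3) V'(3) by blast
  have Une: "U ~= {}" "U' ~= {}" "U Int U' ~= {}" using qT ne by blast+
  have S: "atlas_compat S" and cm: "holo_map S B (points S) c" "c`points S <= ?T"
   using c complex_manifold_compat by (auto simp: immersed_curve_def)
  have ic: "immersed_curve A (U Int U') S (%x. q (c x))" by (rule immersed_curve_mono[OF i.immersed_curve_push[OF c order_refl] qT])
  have t: "torsion_free_connection A (U Int U') D" "torsion_free_connection A (U Int U') D'"
   using torsion_free_subset[OF Ct(1)[OF V(4) Une(1)], of "U Int U'"] torsion_free_subset[OF Ct(1)[OF V'(4) Une(2)], of "U Int U'"] by auto
  have near: "geodesic_near B ?T (pull_conn A B q D) S c x \<longleftrightarrow> geodesic_near A (U Int U') D S (%x. q (c x)) x"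
   if t: "torsion_free_connection A (U Int U') D" for D x unfolding i.geodesic_near_pull[OF S cm torsion_free_subset[OF t qT]]
   by (rule geodesic_near_subset[OF cA S _ i.fV_mopen qT t, symmetric]) (use cm(2) in blast)
  show "(ALL x:points S. geodesic_near B ?T (pull_conn A B q D) S c x) \<longleftrightarrow>
    (ALL x:points S. geodesic_near B ?T (pull_conn A B q D') S c x)" unfolding near[OF t(1)] near[OF t(2)]
   using Ce[OF V(4) V'(4) Une(3)] ic unfolding projectively_equivalent_def by blast
 qed
 show "ALL (V, D):pull_covering A B q C. ALL (V', D'):pull_covering A B q C. V Int V' ~= {} -->
   projectively_equivalent B (V Int V') D D'"
 proof
  fix c assume "c : pull_covering A B q C"
  from cases[OF this] obtain V U D where c: "c = (V, pull_conn A B q D)" "(U, D) : C" "openin Y V" "inj_on q V" "q`V <= U" by blast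
  show "case c of (V, D) => ALL (V', D'):pull_covering A B q C. V Int V' ~= {} --> projectively_equivalent B (V Int V') D D'"
   unfolding c(1) prod.case
  proof
   fix c' assume "c' : pull_covering A B q C"
   from cases[OF this] obtain V' U' D' where c': "c' = (V', pull_conn A B q D')" "(U', D') : C" "openin Y V'" "inj_on q V'" "q`V' <= U'" by blast
   show "case c' of (V', D') => V Int V' ~= {} --> projectively_equivalent B (V Int V') (pull_conn A B q D) D'"
    unfolding c'(1) prod.case using main[OF c(3,4,5,2) c'(3,4,5,2)] by blast
  qed
 qed
qed

end

section \<open>A developing map forces flatness\<close>

lemma deriv_eq_on:
 assumes W: "open W" "z : W" and f: "f holomorphic_on W" and g: "g holomorphic_on W"
  and e: "!!w. w : W ==> al * f w+c = be * g w+d"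
 shows "al * deriv f z = be * deriv g z"
proof -
 have df: "f field_differentiable (at z)" "g field_differentiable (at z)"
  using holomorphic_on_imp_differentiable_at[OF f W] holomorphic_on_imp_differentiable_at[OF g W] by auto
 have "al * deriv f z = deriv (%w. al * f w+c) z"
  using df(1) by (auto intro!: DERIV_imp_deriv[symmetric] derivative_eq_intros DERIV_deriv_iff_field_differentiable[THEN iffD2])
 also have "... = deriv (%w. be * g w+d) z"
 proof (rule deriv_cong_ev)
  show "\<forall>\<^sub>F w in nhds z. al * f w+c = be * g w+d" unfolding eventually_nhds using W e by (intro exI[of _ W]) simp
 qed simp
 also have "... = be * deriv g z"
  using df(2) by (auto intro!: DERIV_imp_deriv derivative_eq_intros DERIV_deriv_iff_field_differentiable[THEN iffD2])
 finally show ?thesis .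
qed

text \<open>\<open>par\<close> says that the quadratic vector \<open>G(a, a)\<close> is proportional
  to \<open>a\<close>. Testing it on \<open>e i + t * e k\<close> with \<open>t = 0\<close>, 1 and
  -1 kills the symbols whose upper index differs from both lower ones and expresses the others
  through \<open>G i i i\<close>.\<close>

lemma bilinear_proportional:
 fixes G :: "'n::finite => 'n => 'n => complex"
 assumes sym: "!!l i j. G l i j = G l j i"
  and par: "!!a k m. a k * (SUM i. SUM j. a i * a j * G m i j) = a m * (SUM i. SUM j. a i * a j * G k i j)"
 shows "G l i j = (if l = i then G j j j / 2 else 0)+(if l = j then G i i i / 2 else 0)"
proof -
 have quad: "(SUM x. SUM y. ((if x = i then 1 else 0)+(if x = k then t else 0)) * ((if y = i then 1 else 0)+(if y = k then t else 0)) * G l x y)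
   = G l i i+2 * t * G l i k+t * t * G l k k" for i k t l
  by (simp add: distrib_right distrib_left sum.distrib if_mult_left if_mult_right sym[of l k i] cong: if_cong)
 have diag: "G l i i = 0" if "l ~= i" for l i
  using par[of "%x. (if x = i then 1 else 0)+(if x = i then 0 else 0)" i l] quad[of i i 0] that by simp
 have par2: "((if r = i then 1 else 0)+(if r = k then t else 0)) * (G m i i+2 * t * G m i k+t * t * G m k k) =
   ((if m = i then 1 else 0)+(if m = k then t else 0)) * (G r i i+2 * t * G r i k+t * t * G r k k)" for i k t m r
  using par[of "%x. (if x = i then 1 else 0)+(if x = k then t else 0)" r m] unfolding quad .
 have off: "G m i k = 0" if "i ~= k" "m ~= i" "m ~= k" for i k m using par2[of i i k 1 m] that diag[of m i] diag[of m k] by simp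
 have half: "2 * G k i k = G i i i" if "i ~= k" for i k
 proof -
  have "G k k k+2 * G k i k = G i i i+2 * G i i k" "G i i i+G k k k = 2 * G i i k+2 * G k i k"
   using par2[of i i k 1 k] par2[of i i k "-1" k] that diag[of k i] diag[of i k] by (simp_all add: algebra_simps)
  thus ?thesis by algebra
 qed
 show ?thesis
  using diag[of l i] off[of i j l] half[of i j] half[of j i] sym[of i i j] by (cases "i = j"; cases "l = i"; cases "l = j") (auto simp: field_simps)
qed

text \<open>
 If \<open>\<nabla>\<^sub>v v\<close> is proportional to \<open>v\<close>, then \<open>Gm\<^sup>l\<^sub>j\<^sub>k = de\<^sup>l\<^sub>j a\<^sub>k+de\<^sup>l\<^sub>k a\<^sub>j\<close>.  The curvature is then determined by
 \<open>Q\<^sub>j\<^sub>k = kp Gm\<^sup>0\<^sub>j\<^sub>k+a\<^sub>j a\<^sub>k - \<partial>\<^sub>j a\<^sub>k\<close>, where \<open>0\<close> stands for the index \<open>None\<close>, and \<open>Ric = 0\<close> means \<open>n Q\<^sub>j\<^sub>k = Q\<^sub>k\<^sub>j\<close>.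
\<close>

lemma (in rho_chart) flat_on_chart:
 assumes n: "CARD('n) >= 2" and rf: "Ricci_flat A N"
  and lin: "!!p a k m. p : U ==> a k * (SUM i. SUM j. a i * a j * Gm (Some m) (Some i) (Some j) p) =
   a m * (SUM i. SUM j. a i * a j * Gm (Some k) (Some i) (Some j) p)"
  and V: "mopen A V" "V <= U" "s1 : Esec A V" "s2 : Esec A V" "t : Esec A V"
 shows "rho_curvature A N V s1 s2 t = 0"
proof (rule Rm_zero_flat[OF _ V])
 define a where "a k p = Gm (Some k) (Some k) (Some k) p / 2" for k p
 define P where "P j k = Gm None (Some j) (Some k)" for j k
 define Q where "Q j k p = kp * P j k p+a j p * a k p - cpd U ph j (a k) p" for j k p
 have ah: "holo_on A U (a k)" for k unfolding a_def[abs_def] divide_inverse by (rule holo_on_mult[OF Gm_holo]) (simp add: U_mopen)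
 have Ph: "holo_on A U (P j k)" for j k unfolding P_def by (rule Gm_holo)
 have z: "Gm (Some l) (Some j) (Some k) p = (if l = j then a k p else 0)+(if l = k then a j p else 0)" if p: "p : U" for l j k p
  unfolding a_def by (rule bilinear_proportional[of "%l j k. Gm (Some l) (Some j) (Some k) p"]) (rule Gm_sym[OF p], rule lin[OF p])
 have c0: "cpd U ph i g p = 0" if "p : U" "!!q. q : U ==> g q = c" for i g p c
  using cpd_cong[OF U_mopen that(1) that(1), where f=g and g="%_. c" and i=i] that(2) by simp
 have dN: "cpd U ph i (Gm l None k) p = 0" "cpd U ph i (Gm l k None) p = 0" if p: "p : U" for i l k p
  using c0[OF p Gm_None(1)] c0[OF p Gm_None(2)] by simp_all
 have dz: "cpd U ph i (Gm (Some l) (Some j) (Some k)) p = (if l = j then cpd U ph i (a k) p else 0)+(if l = k then cpd U ph i (a j) p else 0)"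
  if p: "p : U" for i l j k p by (subst cpd_cong[OF U_mopen p p z], assumption)
   (cases "l = j"; cases "l = k"; simp only: cpd_add[OF p holo_nearI[OF p ah] holo_nearI[OF p ah]] simp_thms if_True if_False cpd_const add_0_left add_0_right)
 have Psym: "P j k p = P k j p" if "p : U" for j k p unfolding P_def by (rule Gm_sym[OF that])
 have RN: "Rm l i j k p = 0" if p: "p : U" and N: "i = None \<or> j = None \<or> k = None" for l i j k p
  using N Gm_sym[OF p, of l] by (auto simp: Rm_def dN[OF p] Gm_None[OF p] if_mult_left if_mult_right sum_subtractf split: option.split cong: if_cong)
 have RS: "Rm (Some l) (Some i) (Some j) (Some k) p = (if l = i then Q j k p else 0) - (if l = j then Q i k p else 0)+(if l = k then Q j i p - Q i j p else 0)"
  if p: "p : U" for l i j k p using Psym[OF p, of i j] by (simp add: Rm_def sum_UNIV_option dz[OF p] z[OF p] Gm_None[OF p] flip: P_def)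
   (simp add: Q_def sum_subtractf sum_negf sum.distrib distrib_left distrib_right if_mult_left if_mult_right mult_ac cong: if_cong)
 have Q0: "Q j k p = 0" if p: "p : U" for j k p
 proof -
  have "of_nat CARD('n) * Q j k p = Q k j p" for j k
  proof -
   have "(SUM i. Rm (Some i) (Some i) (Some j) (Some k) p) = 0"
    using Ricci_Rm[OF rf p, of "Some j" "Some k"] RN[OF p] by (simp add: sum_UNIV_option)
   thus ?thesis unfolding RS[OF p] by (simp add: sum.distrib sum_subtractf)
  qed
  hence e: "of_nat CARD('n) * Q j k p = Q k j p" "of_nat CARD('n) * Q k j p = Q j k p" by blast+
  \<comment> \<open>Applying the relation twice gives \<open>n * n * Q = Q\<close>; for
    \<open>n >= 2\<close> this forces \<open>Q = 0\<close>.\<close>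
  have "(of_nat CARD('n) - 1) * (of_nat CARD('n)+1) * Q j k p = 0" using e(2)[folded e(1)] by (simp add: algebra_simps)
  moreover have "(of_nat CARD('n) :: complex) ~= 1" using n by (metis Suc_1 Suc_n_not_le_n of_nat_eq_1_iff)
  moreover have "(of_nat CARD('n)+1 :: complex) ~= 0" by (metis of_nat_Suc of_nat_neq_0 add.commute)
  ultimately show ?thesis by simp
 qed
 fix l i j k p assume p: "p : U"
 show "Rm l i j k p = 0"
 proof (cases "i = None \<or> j = None \<or> k = None")
  case True
  thus ?thesis by (rule RN[OF p])
 next
  case False
  then obtain i' j' k' where ijk: "i = Some i'" "j = Some j'" "k = Some k'" by auto
  show ?thesis
  proof (cases l)
   case (Some l')
   thus ?thesis unfolding ijk by (simp add: RS[OF p] Q0[OF p])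
  next
   \<comment> \<open>The Euler component is not a combination of values of \<open>Q\<close>. But
     \<open>Q = 0\<close> expresses the first derivatives of \<open>a\<close> through
     \<open>P\<close> and \<open>a\<close>; differentiated once more it gives \<open>kp\<close>
     times the derivatives of \<open>P\<close> in terms of second derivatives of \<open>a\<close>,
     whose symmetry makes everything cancel.\<close>
   case None
   note na = holo_nearI[OF p ah]
   have d: "cpd U ph j (a k) q = kp * P j k q+a j q * a k q" if "q : U" for j k q using Q0[OF that, of j k] by (simp add: Q_def)
   have dP: "kp * cpd U ph i (P j k) p = cpd U ph i (cpd U ph j (a k)) p - (a j p * cpd U ph i (a k) p+a k p * cpd U ph i (a j) p)" for i j k
   proof -
    have "cpd U ph i (cpd U ph j (a k)) p = cpd U ph i (%q. kp * P j k q+a j q * a k q) p" by (rule cpd_cong[OF U_mopen p p d])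
    thus ?thesis
     unfolding cpd_add[OF p holo_nearI[OF p holo_on_mult[OF _ Ph]] holo_nearI[OF p holo_on_mult[OF ah ah]], of "%_. kp", simplified, OF U_mopen]
      cpd_cmult[OF p holo_nearI[OF p Ph]] cpd_mult[OF p na na] by simp
   qed
   have "kp * Rm l i j k p = kp * cpd U ph i' (P j' k') p - kp * cpd U ph j' (P i' k') p +
     (a k' p * (kp * P i' j' p)+a j' p * (kp * P i' k' p) - a k' p * (kp * P j' i' p) - a i' p * (kp * P j' k' p))" unfolding None ijk
    by (simp add: Rm_def sum_UNIV_option z[OF p] Gm_None[OF p] flip: P_def)
     (simp add: sum_subtractf sum_negf sum.distrib distrib_left distrib_right right_diff_distrib if_mult_left if_mult_right mult_ac cong: if_cong)
   also have "... = 0" unfolding dP cpd_commute[OF p na, of i' j'] d[OF p] Psym[OF p, of j' i'] by (simp add: algebra_simps)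
   finally show ?thesis using kp_nonzero by simp
  qed
 qed
qed

text \<open>Flatness is local, so it is checked in the chart composed of a local inverse of
  \<open>q\<close>, the map \<open>de\<close> and an affine chart of projective space. In this chart
  the geodesics of \<open>conn\<close> are straight in every direction, which gives the hypothesis
  \<open>lin\<close> of \<open>flat_on_chart\<close>.\<close>

lemma (in covering) developing_flat:
 assumes rc: "rho_conn A N" and n: "CARD('n) >= 2" and rf: "Ricci_flat A N"
  and gs: "gives_structure A N P" and ps: "projective_structure A P" and dm: "developing_map A P Y q de"
 shows "rho_flat A N"
proof (rule rho_conn.flat_local[OF rc])
 note dm' = dm[unfolded developing_map_def, THEN conjunct2]
 fix p assume "p : points A"
 hence "p : q`topspace Y" unfolding q_image .
 then obtain y where y: "y : topspace Y" "q y = p" by blast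
 have "y : points B" using y(1) unfolding points_B .
 from dm'[THEN conjunct1, unfolded local_biholo_def, THEN bspec, OF this]
 obtain W where W: "y : W" "iso_on B cp_atlas W de" unfolding biholo_on_iff_iso_on[OF cB cp_compat] by (elim exE conjE)
 have "de y : points cp_atlas" by (rule subsetD[OF mopen_points[OF iso_on_image_mopen[OF W(2)]] imageI[OF W(1)]])
 then obtain i where i: "de y : cp_dom i" by (auto simp: points_def cp_atlas_eq)
 obtain V where V: "openin Y V" "y : V" "inj_on q V" using sheet[OF y(1)] by blast
 have "holo_on cp_atlas (cp_dom i) (%_. 0)" using iso_on_mopen[OF cp_coord_iso[of i]] by simp
 from iso_on_preimage[OF cp_compat W(2) this] have "openin Y {x : W. de x : cp_dom i}" by (simp add: mopen_B)
 from openin_Int[OF V(1) this] obtain T where T: "openin Y T" "T <= V" "T <= W" "de`T <= cp_dom i" "y : T"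
  using V(2) W(1) i by (intro that[of "V Int {x : W. de x : cp_dom i}"]) auto
 have injT: "inj_on q T" by (rule inj_on_subset[OF V(3) T(2)])
 define U where "U = q`T"
 define ph where "ph p = cp_coord i (de (inv_into T q p))" for p
 have isoT: "iso_on B A T q" by (rule iso_q[OF T(1) injT])
 have inv_im: "inv_into T q`U = T" unfolding U_def using injT by (force simp: image_iff)
 have d: "iso_on B cp_atlas T de" by (rule iso_on_subset[OF W(2) _ T(3)]) (use T(1) mopen_B in simp)
 have cc: "iso_on cp_atlas affine_atlas (de`T) (cp_coord i)" by (rule iso_on_subset[OF cp_coord_iso iso_on_image_mopen[OF d] T(4)])
 have "iso_on A cp_atlas U (%p. de (inv_into T q p))" by (rule iso_on_comp[OF iso_on_inv[OF cB isoT, folded U_def]]) (simp add: inv_im d)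
 from iso_on_comp[OF this, of affine_atlas "cp_coord i"]
 have co: "coord A U ph" unfolding ph_def[abs_def] using cc inv_im by (simp add: image_comp[symmetric, unfolded o_def] image_image[symmetric])
 have "rho_chart A N U ph" unfolding rho_chart_def chart_def coordinates_def using rc cA co by blast
 then interpret rho_chart A N U ph .
 have pU: "p : U" using y T(5) U_def by blast
 interpret qp: iso_pair B A T q by (rule pair_q[OF T(1) injT])
 interpret qi: iso_pair A B U qp.f' unfolding U_def by (rule qp.inverse_pair)
 obtain C0 where C0: "C0 : P" using ps unfolding projective_structure_def covering_class_def by fastforce
 \<comment> \<open>Adding \<open>conn\<close> to a covering of the class makes its geodesics, lifted
   by the local inverse of \<open>q\<close>, geodesics of the pulled back structure, to which the
   assumption on \<open>de\<close> applies.\<close>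
 let ?C = "insert (U, conn) C0"
 have CP: "?C : P" using gs U_mopen pU rho_section_hsec C0 unfolding gives_structure_def by blast
 have Cp: "projective_covering A ?C" using CP ps unfolding projective_structure_def covering_class_def by blast
 have tf: "torsion_free_connection A U conn" by (rule projective_coveringD(3)[OF Cp]) (use pU in auto)
 let ?PC = "pull_covering A B q ?C"
 have PC: "?PC : pull_structure A B q P"
  unfolding pull_structure_def by (rule UN_I[OF CP]) (simp add: covering_class_def pull_covering_projective[OF Cp])
 have inPC: "(T, pull_conn A B q conn) : ?PC" unfolding pull_covering_def using T(1) mopen_B injT U_def by blast
 have lin: "a k * (SUM i. SUM j. a i * a j * Gm (Some m) (Some i) (Some j) p) =
   a m * (SUM i. SUM j. a i * a j * Gm (Some k) (Some i) (Some j) p)" if p: "p : U" for p a k m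
 proof (cases "ALL j. a j = 0")
  case False
  then obtain j0 where "a j0 ~= 0" by blast
  from geodesic_exists[where a = a, OF p this]
  obtain r gm where r: "r > 0" and g: "param_geodesic A U conn (ball 0 r) gm" and gm0: "gm 0 = p" and d0: "!!i. deriv (ccoord gm i) 0 = a i"
   by blast
  let ?D = "ball (0::complex) r"
  let ?S = "plane_atlas ?D"
  define c where "c z = qp.f' (gm z)" for z
  have v: "holo_map std_atlas A ?D gm" "gm`?D <= U" "!!z. z : ?D ==> velocity A gm z ~= 0" using param_geodesic_velocity[OF g] by auto
  have im: "immersed_curve A U ?S gm" by (rule immersed_disc[OF cA _ _ v]) auto
  have "immersed_curve B (qp.f'`U) ?S c" unfolding c_def[abs_def] by (rule qi.immersed_curve_push[OF im order_refl])
  hence imB: "immersed_curve B (points B) ?S c" by (rule immersed_curve_mono) (use inv_im openin_subset[OF T(1)] points_B in auto)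
  have ch: "holo_map std_atlas B ?D c" unfolding c_def[abs_def] by (rule qi.holo_map_push[OF std_compat v(1,2)])
  have cT: "c z : T" if z: "z : ?D" for z unfolding c_def using imageI[OF subsetD[OF v(2) imageI[OF z]], of qp.f'] unfolding inv_im .
  have qc: "q (c z) = gm z" if "z : ?D" for z
  proof -
   have "gm z : q`T" using v(2) that U_def by blast
   thus ?thesis unfolding c_def by (rule f_inv_into_f)
  qed
  have "param_geodesic A U conn ?D (%z. q (c z))" by (rule param_geodesic_cong[OF cA open_ball g]) (simp add: qc)
  hence gB: "param_geodesic B T (pull_conn A B q conn) ?D c" by (rule qp.param_geodesic_pull[folded U_def, OF _ ch]) (use cT in blast)
  have "geodesic B (pull_structure A B q P) ?S c" unfolding geodesic_def
  proof (intro conjI ballI imB)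
   fix x assume "x : points ?S"
   hence "geodesic_near B T (pull_conn A B q conn) ?S c x" by (intro geodesic_near_plane[OF open_ball open_ball order_refl gB]) simp
   thus "EX C:pull_structure A B q P. EX (U, D):C. geodesic_near B U D ?S c x" by (intro bexI[OF _ PC] bexI[OF _ inPC]) simp
  qed
  then obtain l where l: "l : projective_lines" "de`c`points ?S <= l" using dm'[THEN conjunct2, THEN spec, THEN spec, THEN mp] by blast
  obtain Q where Q: "l = {l : cp_points. l <= Q}" "vec.subspace Q" "vec.dim Q = 2" using l(1) unfolding projective_lines_def by blast
  define u where "u z = cp_ins i (ph (gm z))" for z
  have uQ: "u z : Q" if z: "z : ?D" for z
  proof -
   have "de (c z) : cp_dom i" using T(4) cT[OF z] by blast
   from cp_ins_coord[OF this] have "vec.span {u z} = de (c z)" by (simp add: u_def ph_def c_def)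
   moreover have "de (c z) : l" using l(2) imageI[OF imageI[OF z], of de c] unfolding points_plane by (rule subsetD)
   hence "de (c z) <= Q" unfolding Q(1) by simp
   ultimately show ?thesis using vec.span_base[of "u z" "{u z}"] by auto
  qed
  have r0: "0 : ?D" using r by simp
  have diff: "u z - u 0 : Q" "(u z - u 0)$i = 0" if "z : ?D" for z
   using vec.subspace_diff[OF Q(2) uQ[OF that] uQ[OF r0]] by (simp_all add: u_def)
  \<comment> \<open>Differences of points of the curve lie in \<open>Q\<close> and have coordinate
    \<open>i\<close> equal to 0, so they are proportional. The constants are split off in the form
    that \<open>deriv_eq_on\<close> expects; the identity is differentiated once in \<open>z\<close>
    and then twice in \<open>w\<close>.\<close>
  have cross: "(ccoord gm m w - ccoord gm m 0) * ccoord gm k z+(- (ccoord gm m w - ccoord gm m 0) * ccoord gm k 0) =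
   (ccoord gm k w - ccoord gm k 0) * ccoord gm m z+(- (ccoord gm k w - ccoord gm k 0) * ccoord gm m 0)"
   if z: "z : ?D" and w: "w : ?D" for z w k m
  proof -
   have "(u z - u 0)$sig i k * (u w - u 0)$sig i m = (u z - u 0)$sig i m * (u w - u 0)$sig i k"
    by (rule plane_proportional[OF Q(2,3) uQ[OF r0] _ diff[OF z] diff[OF w]]) (simp add: u_def)
   thus ?thesis by (simp add: u_def algebra_simps)
  qed
  note h = ccoord_holomorphic[OF v(1,2)]
  have 1: "(ccoord gm m w - ccoord gm m 0) * a k = (ccoord gm k w - ccoord gm k 0) * a m" if w: "w : ?D" for w
   using deriv_eq_on[OF open_ball r0 h h cross[OF _ w]] by (simp add: d0)
  have 2: "a k * deriv (ccoord gm m) w = a m * deriv (ccoord gm k) w" if w: "w : ?D" for w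
  proof (rule deriv_eq_on[OF open_ball w h h])
   fix w assume "w : ?D"
   from 1[OF this] show "a k * ccoord gm m w+(- a k * ccoord gm m 0) = a m * ccoord gm k w+(- a m * ccoord gm k 0)"
    by (simp add: algebra_simps)
  qed
  have "a k * deriv (deriv (ccoord gm m)) 0 = a m * deriv (deriv (ccoord gm k)) 0"
   by (rule deriv_eq_on[OF open_ball r0 holomorphic_deriv[OF h open_ball] holomorphic_deriv[OF h open_ball], where c = 0 and d = 0])
    (use 2 in simp)
  moreover have "deriv (deriv (ccoord gm l)) 0 = - (SUM i. SUM j. a i * a j * Gm (Some l) (Some i) (Some j) p)" for l
   using geodesic_equation[OF g r0, of l] by (simp add: d0 gm0 eq_neg_iff_add_eq_0)
  ultimately show ?thesis by simp
 qed simp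
 show "EX U. p : U & mopen A U &
  (ALL V s1 s2 t. mopen A V --> V <= U --> s1 : Esec A V --> s2 : Esec A V --> t : Esec A V -->
    rho_curvature A N V s1 s2 t = 0)" by (intro exI[of _ U] conjI pU U_mopen allI impI) (rule flat_on_chart[OF n rf lin])
qed

section \<open>Flat projective frames\<close>

lemma holo_zero_constant:
 assumes f: "holo (ball c r) f" and z: "!!x i. x : ball c r ==> pd i f x = 0" and x: "x : ball c r" and y: "y : ball c r"
 shows "f x = f y"
proof -
 have "(f has_derivative (%h. 0)) (at x within ball c r)" if "x : ball c r" for x
  using holo_has_derivative[OF f that] z[OF that] by (auto intro: has_derivative_at_withinI)
 from has_derivative_zero_constant[OF convex_ball this] x y show ?thesis by metis
qed

text \<open>The functions \<open>f k\<close> and \<open>g\<close> have the same logarithmic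
  derivative \<open>et\<close>, so the quotients have derivative zero and are constant on a ball
  around \<open>p\<close>.\<close>

lemma (in coordinates) log_derivative_unique:
 assumes V: "mopen A V" "V <= U" and p: "p : V" and f: "!!k. holo_on A V (f k)" and g: "holo_on A V g" and gp: "g p ~= 0"
  and df: "!!k i q. q : V ==> cpd U ph i (f k) q = et i q * f k q" and dg: "!!i q. q : V ==> cpd U ph i g q = et i q * g q"
 shows "EX W. mopen A W & p : W & W <= V & (ALL q:W. g q ~= 0 & (ALL k. f k q = f k p / g p * g q))"
proof -
 have m: "mopen A {q : V. g q ~= 0}" by (rule mopen_nonzero[OF A g])
 have "EX r>0. ball (ph p) r <= ph`{q : V. g q ~= 0}"
 proof -
  have "open (ph`{q : V. g q ~= 0})" using mopen_iff[of "{q : V. g q ~= 0}"] m V(2) by blast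
  moreover have "ph p : ph`{q : V. g q ~= 0}" using p gp by blast
  ultimately show ?thesis using open_contains_ball by blast
 qed
 then obtain r where r: "r > 0" "ball (ph p) r <= ph`{q : V. g q ~= 0}" by blast
 define W where "W = {q : V. g q ~= 0 & ph q : ball (ph p) r}"
 have im: "ph`W = ball (ph p) r" unfolding W_def using r(2) by auto
 have WU: "W <= U" using V(2) by (auto simp: W_def)
 have mW: "mopen A W" using mopen_iff[OF WU] im by simp
 have WV: "W <= V" by (auto simp: W_def)
 have gW: "holo_on A W g" and fW: "holo_on A W (f k)" for k by (rule holo_on_subset[OF _ mW WV], rule g f)+
 have nz: "g q ~= 0" if "q : W" for q using that by (simp add: W_def)
 have eq: "f k q = f k p / g p * g q" if q: "q : W" for k q
 proof -
  let ?h = "%q. f k q / g q"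
  have h: "holo_on A W ?h" by (rule holo_on_divide[OF A fW gW nz])
  have pW: "p : W" using p gp r(1) by (simp add: W_def)
  have hz: "cpd U ph i ?h x = 0" if x: "x : W" for i x
  proof -
   have xU: "x : U" and xV: "x : V" using x WU WV by auto
   have "cpd U ph i (f k) x = cpd U ph i (%q. ?h q * g q) x" by (rule cpd_cong[OF mW x xU]) (use nz in simp)
   also have "... = ?h x * cpd U ph i g x+g x * cpd U ph i ?h x" by (rule cpd_mult[OF xU holo_nearI[OF x h] holo_nearI[OF x gW]])
   finally show ?thesis using nz[OF x] by (simp add: df[OF xV] dg[OF xV])
  qed
  have "holo (ball (ph p) r) (%x. ?h (inv_into U ph x))" using holo_on_iff[OF WU, of ?h] h im by simp
  moreover have "pd i (%x. ?h (inv_into U ph x)) y = 0" if y: "y : ball (ph p) r" for i y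
  proof -
   have "y : ph`W" unfolding im by (rule y)
   then obtain x where x: "x : W" "y = ph x" by blast
   thus ?thesis using hz[OF x(1), of i] by (simp add: cpd_def)
  qed
  moreover have "ph q : ball (ph p) r" "ph p : ball (ph p) r" using q pW im by blast+
  ultimately have "?h (inv_into U ph (ph q)) = ?h (inv_into U ph (ph p))" by (rule holo_zero_constant)
  hence "?h q = ?h p" using q pW WU by (simp add: subset_iff)
  thus ?thesis using nz[OF q] by (simp add: field_simps)
 qed
 have pW: "p : W" using p gp r(1) by (simp add: W_def)
 show ?thesis by (intro exI[of _ W] conjI ballI allI mW WV pW) ((rule nz | rule eq), assumption)+
qed

context rho_chart
begin

text \<open>The vanishing of \<open>Rm\<close>, arranged as the integrability condition that
  \<open>commuting_flows\<close> asks for.\<close>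

lemma flat_Gm:
 assumes fl: "rho_flat A N" and p: "p : U"
 shows "(SUM m. Gm m (Some i) k p * Gm l (Some j) m p)+cpd U ph j (Gm l (Some i) k) p =
  (SUM m. Gm m (Some j) k p * Gm l (Some i) m p)+cpd U ph i (Gm l (Some j) k) p"
proof -
 have "rho_curvature A N U (fr U (Some i)) (fr U (Some j)) (fr U k) = 0" using fl U_mopen frU unfolding rho_flat_def by blast
 hence "sec U (%l. Rm l (Some i) (Some j) k) = sec U (%_ _. 0)" unfolding curvature_fr sec_zero .
 from sec_eqD[OF this p order_refl, of l] show ?thesis by (simp add: Rm_def sum_subtractf algebra_simps)
qed

text \<open>For each \<open>b\<close>, the functions \<open>E k b\<close> are the values on the
  frame of a linear form on the bundle that is parallel along the coordinate fields. Carrying the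
  base point as further unknowns (\<open>Inl\<close>) makes the linear system autonomous, so
  \<open>commuting_flows\<close> applies, with commutation from \<open>flat_Gm\<close>.\<close>

lemma flat_frame_exists:
 fixes e0 :: "'n option => 'n option => complex"
 assumes fl: "rho_flat A N" and p0: "p0 : U"
 obtains V E where "mopen A V" "p0 : V" "V <= U" "!!k b. holo_on A V (E k b)" "!!k b. E k b p0 = e0 k b"
  "!!p i k b. p : V ==> cpd U ph i (E k b) p = (SUM l. Gm l (Some i) k p * E l b p)"
proof -
 define px :: "complex ^ ('n+('n option \<times> 'n option)) => complex ^ 'n" where "px y = (\<chi> i. y$Inl i)" for y
 have pxh: "holo S (%y. px y$i)" if "open S" for S i using holo_coord[OF that] by (simp add: px_def)
 define Om where "Om = {y : UNIV. px y : ph`U}"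
 have oU: "open (ph`U)" using mopen_iff[of U] U_mopen by simp
 have Om: "open Om" unfolding Om_def by (rule open_holo_preimage[OF pxh oU]) simp
 have GmU: "holo (ph`U) (%x. Gm l i k (inv_into U ph x))" for l i k using Gm_holo holo_on_iff[of U] by blast
 have pxOm: "px`Om <= ph`U" by (auto simp: Om_def)
 define gm where "gm l i k y = Gm l (Some i) k (inv_into U ph (px y))" for l i k y
 have gmh: "holo Om (gm l i k)" for l i k unfolding gm_def[abs_def] by (rule holo_compose(1)[OF pxh[OF Om] GmU pxOm])
 define G :: "'n => complex ^ ('n+('n option \<times> 'n option)) => complex ^ ('n+('n option \<times> 'n option))" where
  "G i y = (\<chi> u. case u of Inl j => if j = i then 1 else 0 | Inr (k, b) => (SUM l. gm l i k y * y$Inr (l, b)))" for i y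
 have G1: "G i y$Inl j = (if j = i then 1 else 0)" and G2: "G i y$Inr (k, b) = (SUM l. gm l i k y * y$Inr (l, b))" for i j k b y
  by (simp_all add: G_def)
 have G2h: "holo Om (%y. gm l i k y * y$Inr (l, b))" for l i k b by (rule holo_mult(1)[OF gmh holo_coord[OF Om]])
 have Gh: "holo Om (%y. G t y$u)" for t u
 proof (cases u)
  case (Inl j)
  show ?thesis unfolding Inl G1 using Om by simp
 next
  case (Inr kb)
  obtain k b where kb: "kb = (k, b)" by (cases kb)
  show ?thesis unfolding Inr kb G2 by (rule holo_sumI) (use G2h Om in auto)
 qed
 have comm: "(SUM m. pd m (%y. G i y$u) y * G j y$m) = (SUM m. pd m (%y. G j y$u) y * G i y$m)"
  if y: "y : Om" for i j u y
 proof (cases u)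
  case (Inl l)
  show ?thesis unfolding Inl G1 by simp
 next
  case (Inr kb)
  obtain k b where kb: "kb = (k, b)" by (cases kb)
  let ?p = "inv_into U ph (px y)"
  have yU: "px y : ph`U" using y pxOm by blast
  have pU: "?p : U" and php: "ph ?p = px y" using yU by (auto intro: inv_into_into f_inv_into_f)
  have pdgm: "pd m (gm l i k) y = (SUM a. cpd U ph a (Gm l (Some i) k) ?p * (if m = Inl a then 1 else 0))" for m l i k
  proof -
   have "pd m (gm l i k) y = (SUM a. pd a (%x. Gm l (Some i) k (inv_into U ph x)) (px y) * pd m (%y. px y$a) y)"
    unfolding gm_def[abs_def] by (rule holo_compose(2)[OF pxh[OF Om] GmU pxOm y])
   thus ?thesis unfolding cpd_def php by (simp add: px_def pd_coord)
  qed
  have pdG: "pd m (%y. G i y$Inr (k, b)) y =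
    (SUM l. gm l i k y * (if m = Inr (l, b) then 1 else 0)+y$Inr (l, b) * pd m (gm l i k) y)" for m i
   unfolding G2 pd_sum[of UNIV Om "%l y. gm l i k y * y$Inr (l, b)", OF G2h Om y]
   by (intro sum.cong refl) (simp add: holo_mult(2)[OF gmh holo_coord[OF Om] y] pd_coord)
  have *: "(SUM m. pd m (%y. G i y$Inr (k, b)) y * G j y$m) =
   (SUM l. y$Inr (l, b) * ((SUM m. Gm m (Some i) k ?p * Gm l (Some j) m ?p)+cpd U ph j (Gm l (Some i) k) ?p))" for i j
  proof -
   have "(SUM m. pd m (%y. G i y$Inr (k, b)) y * G j y$m) =
    (SUM m. SUM l. gm l i k y * (if m = Inr (l, b) then G j y$m else 0)) +
    (SUM m. SUM l. y$Inr (l, b) * (SUM a. cpd U ph a (Gm l (Some i) k) ?p * (if m = Inl a then G j y$m else 0)))"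
    unfolding pdG pdgm sum.distrib[symmetric] sum_distrib_right
    by (intro sum.cong refl) (simp add: distrib_right sum_distrib_right sum_distrib_left mult_ac if_mult_left if_mult_right cong: if_cong)
   also have "(SUM m. SUM l. gm l i k y * (if m = Inr (l, b) then G j y$m else 0)) = (SUM l. gm l i k y * G j y$Inr (l, b))"
    by (subst sum.swap) (simp add: sum_distrib_left[symmetric])
   also have "... = (SUM l. y$Inr (l, b) * (SUM m. Gm m (Some i) k ?p * Gm l (Some j) m ?p))"
    unfolding G2 sum_distrib_left by (subst sum.swap) (simp add: gm_def mult_ac)
   also have "(SUM m. SUM l. y$Inr (l, b) * (SUM a. cpd U ph a (Gm l (Some i) k) ?p * (if m = Inl a then G j y$m else 0))) =
    (SUM l. y$Inr (l, b) * (SUM a. cpd U ph a (Gm l (Some i) k) ?p * G j y$Inl a))"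
    by (subst sum.swap, simp add: sum_distrib_left[symmetric], subst sum.swap) (simp add: sum_distrib_left[symmetric])
   finally show ?thesis by (simp add: G1 sum.distrib distrib_left if_mult_right cong: if_cong)
  qed
  show ?thesis unfolding Inr kb * flat_Gm[OF fl pU, of i k _ j] ..
 qed
 define c :: "complex ^ ('n+('n option \<times> 'n option))" where "c = (\<chi> u. case u of Inl i => ph p0$i | Inr (k, b) => e0 k b)"
 have "px c = ph p0" by (simp add: px_def c_def vec_eq_iff)
 hence cOm: "c : Om" using p0 by (simp add: Om_def)
 obtain r and F :: "complex ^ 'n => complex ^ ('n+('n option \<times> 'n option))" where r: "r > 0"
  and Fh: "!!l. holo (ball 0 r) (%x. F x$l)" and FOm: "F`ball 0 r <= Om" and F0: "F 0 = c"
  and pdF: "!!x l i. x : ball 0 r ==> pd i (%x. F x$l) x = G i (F x)$l"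
  using commuting_flows[where G=G and Om=Om and c=c, OF Om cOm Gh comm] by blast
 \<comment> \<open>The position part has constant unit speed in each direction, so the flow
   parameter is the coordinate itself, shifted by \<open>ph p0\<close>.\<close>
 have base: "px (F x) = ph p0+x" if x: "x : ball 0 r" for x unfolding vec_eq_iff
 proof
  fix j
  have h: "holo (ball 0 r) (%x. F x$Inl j - x$j)" by (rule holo_diff(1)[OF Fh holo_coord[OF open_ball]])
  have "F x$Inl j - x$j = F 0$Inl j - 0$j"
  proof (rule holo_zero_constant[OF h _ x])
   show "pd i (%x. F x$Inl j - x$j) x = 0" if "x : ball 0 r" for x i
    by (simp add: holo_diff(2)[OF Fh holo_coord[OF open_ball] that] pdF[OF that] G1 pd_coord)
  qed (use r in simp)
  thus "px (F x)$j = (ph p0+x)$j" by (simp add: px_def F0 c_def algebra_simps)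
 qed
 define V where "V = {p : U. ph p - ph p0 : ball 0 r}"
 have trans: "holo S (%x. (x - ph p0)$i)" "x : S ==> pd j (%x. (x - ph p0)$i) x = (if j = i then 1 else 0)" if "open S" for S i j x
 proof -
  have c: "holo S (%x. x$i - ph p0$i)" by (rule holo_diff(1)[OF holo_coord]) (use that in auto)
  thus "holo S (%x. (x - ph p0)$i)" by simp
  show "x : S ==> pd j (%x. (x - ph p0)$i) x = (if j = i then 1 else 0)"
   using holo_diff(2)[OF holo_coord[OF that], of "%_. ph p0$i" x j i] that by (simp add: pd_coord)
 qed
 have phV: "ph`V = {x : ph`U. x - ph p0 : ball 0 r}" by (auto simp: V_def)
 have oV: "open (ph`V)" unfolding phV by (rule open_holo_preimage[OF trans(1)[OF oU] open_ball])
 have V: "V <= U" "mopen A V" using oV mopen_iff[of V] by (auto simp: V_def)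
 have Vsub: "(%x. x - ph p0)`ph`V <= ball 0 r" by (auto simp: phV)
 define E where "E k b p = F (ph p - ph p0)$Inr (k, b)" for k b p
 note Fcomp = holo_compose[OF trans(1)[OF oV] Fh Vsub]
 show ?thesis
 proof (rule that[OF V(2) _ V(1)])
  show "p0 : V" using p0 r by (simp add: V_def)
  show "holo_on A V (E k b)" for k b unfolding holo_on_iff[OF V(1)]
   by (rule holo_cong[THEN iffD1, rotated, OF Fcomp(1)[of "Inr (k, b)"]]) (use V(1) in \<open>auto simp: E_def subset_iff\<close>)
  show "E k b p0 = e0 k b" for k b by (simp add: E_def F0 c_def)
  fix p i k b assume p: "p : V"
  have pU: "p : U" using p V by blast
  have php: "ph p : ph`V" using p by blast
  have b: "ph p - ph p0 : ball 0 r" using p by (simp add: V_def)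
  have "cpd U ph i (E k b) p = pd i (%x. F (x - ph p0)$Inr (k, b)) (ph p)"
   unfolding E_def[abs_def] by (rule cpd_compose[OF pU Fcomp(1) php])
  also have "... = G i (F (ph p - ph p0))$Inr (k, b)"
   unfolding Fcomp(2)[OF php] trans(2)[OF oV php] by (simp add: pdF[OF b] if_mult_right cong: if_cong)
  also have "... = (SUM l. Gm l (Some i) k p * E l b p)" unfolding G2 by (simp add: gm_def base[OF b] inv_ph[OF pU] E_def)
  finally show "cpd U ph i (E k b) p = (SUM l. Gm l (Some i) k p * E l b p)" .
 qed
qed

end

section \<open>Projective trivializations of \<open>E\<close>\<close>

text \<open>Linear isomorphisms of the fibre onto the space of \<open>n+1\<close> complex
  coordinates: injectivity is enough since the dimensions agree (compare \<open>Eisos_det\<close>),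
  and the value 0 off the fibre makes equality of functions the right notion.\<close>

definition Eisos :: "('a, 'n::finite) atlas => 'a => (('a, 'n) esec => complex ^ ('n option)) set" where
 "Eisos A p = {h. (ALL v. v ~: Efibre A p --> h v = 0) &
  (ALL v:Efibre A p. ALL w:Efibre A p. h (v+w) = h v+h w) &
  (ALL v:Efibre A p. ALL c. h (escale c v) = c *s h v) & (ALL v:Efibre A p. h v = 0 --> v = 0)}"

text \<open>
 A trivialization \<open>H\<close> of \<open>E\<close> over \<open>W\<close> in which \<open>\<nabla>\<close> is the trivial \<open>rh\<close>-connection up to the
 addition of a scalar form \<open>th\<close>.
\<close>

definition ptriv ::
  "('a, 'n::finite) atlas => ('a, 'n) econn => 'a set => ('a => ('a, 'n) esec => complex ^ ('n option)) => bool" where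
 "ptriv A N W H \<longleftrightarrow> mopen A W & (ALL p:W. H p : Eisos A p) &
  (ALL V s b. mopen A V & V <= W & s : Esec A V --> holo_on A V (%p. H p (eres {p} s)$b)) &
  (EX th. ALL V s t. mopen A V & V <= W & s : Esec A V & t : Esec A V --> (ALL p:V. ALL b.
    rho A s p (%q. H q (eres {q} t)$b) =
     H p (eres {p} (N V s t))$b+th p (eres {p} s) * H p (eres {p} t)$b))"

lemma ptriv_subset:
 assumes T: "ptriv A N W H" and V: "mopen A V" "V <= W"
 shows "ptriv A N V H" unfolding ptriv_def
proof (intro conjI)
 note T' = T[unfolded ptriv_def, THEN conjunct2]
 show "mopen A V" by (rule V(1))
 show "ALL p:V. H p : Eisos A p" using T'[THEN conjunct1] V(2) by blast
 show "ALL V' s b. mopen A V' & V' <= V & s : Esec A V' --> holo_on A V' (%p. H p (eres {p} s)$b)"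
 proof (intro allI impI)
  fix V' s b assume "mopen A V' & V' <= V & s : Esec A V'"
  thus "holo_on A V' (%p. H p (eres {p} s)$b)"
   using T'[THEN conjunct2, THEN conjunct1, THEN spec, THEN spec, THEN spec, THEN mp, of V' s b] V(2) by auto
 qed
 from T'[THEN conjunct2, THEN conjunct2] obtain th where th: "ALL V s t. mopen A V & V <= W & s : Esec A V & t : Esec A V --> (ALL p:V. ALL b.
    rho A s p (%q. H q (eres {q} t)$b) =
     H p (eres {p} (N V s t))$b+th p (eres {p} s) * H p (eres {p} t)$b)" by (elim exE)
 show "EX th. ALL V' s t. mopen A V' & V' <= V & s : Esec A V' & t : Esec A V' --> (ALL p:V'. ALL b.
    rho A s p (%q. H q (eres {q} t)$b) =
     H p (eres {p} (N V' s t))$b+th p (eres {p} s) * H p (eres {p} t)$b)"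
 proof (intro exI[of _ th] allI impI)
  fix V' s t assume "mopen A V' & V' <= V & s : Esec A V' & t : Esec A V'"
  hence "mopen A V' & V' <= W & s : Esec A V' & t : Esec A V'" using V(2) by blast
  from th[THEN spec, THEN spec, THEN spec, THEN mp, OF this]
  show "ALL p:V'. ALL b. rho A s p (%q. H q (eres {q} t)$b) =
     H p (eres {p} (N V' s t))$b+th p (eres {p} s) * H p (eres {p} t)$b" .
 qed
qed

lemma EisosD:
 assumes "h : Eisos A p"
 shows "v ~: Efibre A p ==> h v = 0" "v : Efibre A p ==> w : Efibre A p ==> h (v+w) = h v+h w"
  "v : Efibre A p ==> h (escale c v) = c *s h v" "v : Efibre A p ==> h v = 0 ==> v = 0"
proof -
 note a = assms[unfolded Eisos_def mem_Collect_eq]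
 show "v ~: Efibre A p ==> h v = 0" by (rule a[THEN conjunct1, THEN spec, THEN mp])
 show "v : Efibre A p ==> w : Efibre A p ==> h (v+w) = h v+h w" by (rule a[THEN conjunct2, THEN conjunct1, THEN bspec, THEN bspec])
 show "v : Efibre A p ==> h (escale c v) = c *s h v" by (rule a[THEN conjunct2, THEN conjunct2, THEN conjunct1, THEN bspec, THEN spec])
 show "v : Efibre A p ==> h v = 0 ==> v = 0" by (rule a[THEN conjunct2, THEN conjunct2, THEN conjunct2, THEN bspec, THEN mp])
qed

context chart
begin

lemma fr_Efibre: "p : U ==> fr {p} k : Efibre A p" unfolding fr_def by (rule sec_Efibre)

lemma Efibre_fr: "p : U ==> v : Efibre A p ==> v = (SUM k. escale (comp k v p) (fr {p} k))"
proof -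
 assume p: "p : U" and v: "v : Efibre A p"
 have "(SUM k. escale (comp k v p) (fr {p} k)) = sec {p} (%k _. comp k v p)"
  by (simp add: fr_def sec_escale sec_sum if_mult_right cong: if_cong)
 thus ?thesis using Efibre_comp[OF p v] by simp
qed

lemma Eisos_sum:
 assumes p: "p : U" and h: "h : Eisos A p"
 shows "h (SUM k:K. escale (a k) (fr {p} k)) = (SUM k:K. a k *s h (fr {p} k))"
proof (induction K rule: infinite_finite_induct)
 case (insert k K)
 have "(SUM k:K. escale (a k) (fr {p} k)) : Efibre A p" by (rule lin_closed_sum[OF Efibre_lin_closed[OF p]]) (rule fr_Efibre[OF p])
 moreover have "escale (a k) (fr {p} k) : Efibre A p" using Efibre_lin_closed[OF p] fr_Efibre[OF p] unfolding lin_closed_def by blast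
 ultimately have "h (escale (a k) (fr {p} k)+(SUM k:K. escale (a k) (fr {p} k))) =
   h (escale (a k) (fr {p} k))+h (SUM k:K. escale (a k) (fr {p} k))" by (intro EisosD(2)[OF h])
 thus ?case unfolding sum.insert[OF insert(1,2)] by (simp only: insert(3) EisosD(3)[OF h fr_Efibre[OF p]])
next
 case empty
 have "h (escale 0 (fr {p} None)) = 0 *s h (fr {p} None)" by (rule EisosD(3)[OF h fr_Efibre[OF p]])
 moreover have "escale 0 (fr {p} None) = 0" by (simp add: escale_def emul_def vmul_def vscale_def fun_eq_iff)
 ultimately have "h 0 = 0" by simp
 thus ?case unfolding sum.empty .
next
 case (infinite K)
 thus ?case by simp
qed

lemma Eisos_apply:
 assumes p: "p : U" and h: "h : Eisos A p" and v: "v : Efibre A p"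
 shows "h v = (SUM k. comp k v p *s h (fr {p} k))" using Eisos_sum[OF p h, of "%k. comp k v p" UNIV] Efibre_fr[OF p v] by simp

lemma Eisos_det:
 assumes p: "p : U" and h: "h : Eisos A p"
 shows "det (\<chi> b k. h (fr {p} k)$b) ~= 0"
proof -
 let ?M = "\<chi> b k. h (fr {p} k)$b"
 have "x = 0" if x: "?M *v x = 0" for x
 proof -
  let ?v = "sec {p} (%k _. x$k)"
  have v: "?v : Efibre A p" by (rule sec_Efibre[OF p])
  have c: "comp k ?v p = x$k" for k by (rule comp_sec) (use p in auto)
  have "h ?v = ?M *v x" unfolding Eisos_apply[OF p h v] c by (simp add: vec_eq_iff matrix_vector_mult_def mult.commute)
  hence "?v = 0" using EisosD(4)[OF h v] x by simp
  thus "x = 0" using c by (simp add: vec_eq_iff comp_def)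
 qed
 thus ?thesis unfolding invertible_det_nz[symmetric] invertible_left_inverse matrix_left_invertible_ker by blast
qed

lemma Eisos_eqI:
 assumes p: "p : U" and h: "h : Eisos A p" and g: "g : Eisos A p" and e: "!!k. g (fr {p} k) = c *s h (fr {p} k)"
 shows "g = (%v. c *s h v)"
proof
 fix v show "g v = c *s h v"
 proof (cases "v : Efibre A p")
  case True
  show ?thesis unfolding Eisos_apply[OF p h True] Eisos_apply[OF p g True] e by (simp add: vec_eq_iff sum_distrib_left mult_ac)
 next
  case False
  thus ?thesis using EisosD(1)[OF h] EisosD(1)[OF g] by simp
 qed
qed

definition mk_iso :: "'a => ('n option => 'n option => complex) => ('a, 'n) esec => complex ^ ('n option)" where
 "mk_iso p e v = (if v : Efibre A p then \<chi> b. SUM k. comp k v p * e k b else 0)"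

lemma mk_iso_Eisos:
 assumes p: "p : U" and d: "det (\<chi> b k. e k b) ~= 0"
 shows "mk_iso p e : Eisos A p" unfolding Eisos_def mem_Collect_eq
proof (intro conjI allI ballI impI)
 note cl = Efibre_lin_closed[OF p, unfolded lin_closed_def]
 show "mk_iso p e v = 0" if "v ~: Efibre A p" for v using that by (simp add: mk_iso_def)
 fix v assume v: "v : Efibre A p"
 show "mk_iso p e (v+w) = mk_iso p e v+mk_iso p e w" if w: "w : Efibre A p" for w
 proof -
  have "v+w : Efibre A p" using cl v w by blast
  thus ?thesis using v w by (simp add: mk_iso_def vec_eq_iff comp_add distrib_right sum.distrib)
 qed
 show "mk_iso p e (escale c v) = c *s mk_iso p e v" for c
 proof -
  have "escale c v : Efibre A p" using cl v by blast
  thus ?thesis using v by (simp add: mk_iso_def vec_eq_iff comp_escale sum_distrib_left mult_ac)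
 qed
 assume z: "mk_iso p e v = 0"
 have "(\<chi> b k. e k b) *v (\<chi> k. comp k v p) = mk_iso p e v"
  using v by (simp add: mk_iso_def vec_eq_iff matrix_vector_mult_def mult.commute)
 hence "(\<chi> k. comp k v p) = 0"
  using z d unfolding invertible_det_nz[symmetric] invertible_left_inverse matrix_left_invertible_ker by metis
 hence "comp k v p = 0" for k by (simp add: vec_eq_iff)
 thus "v = 0" using Efibre_comp[OF p v] sec_zero[of "{p}"] by simp
qed

lemma mk_iso_fr: "p : U ==> mk_iso p e (fr {p} k)$b = e k b"
proof -
 assume p: "p : U"
 have "comp j (fr {p} k) p = (if j = k then 1 else 0)" for j by (rule comp_fr) (use p in auto)
 thus ?thesis using fr_Efibre[OF p] by (simp add: mk_iso_def if_mult_left cong: if_cong)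
qed

end

context rho_chart
begin

lemma ptriv_coords:
 assumes T: "ptriv A N W H" and W: "W <= U"
 shows "holo_on A W (%p. H p (fr {p} k)$b)"
  and "EX et. ALL p:W. ALL i k b. cpd U ph i (%p. H p (fr {p} k)$b) p =
   (SUM l. Gm l (Some i) k p * H p (fr {p} l)$b)+et i p * H p (fr {p} k)$b"
proof -
 have m: "mopen A W" and iso: "!!p. p : W ==> H p : Eisos A p"
  and hol: "!!V s b. mopen A V & V <= W & s : Esec A V ==> holo_on A V (%p. H p (eres {p} s)$b)"
  using T unfolding ptriv_def by (elim conjE; blast)+
 obtain th where th: "ALL V s t. mopen A V & V <= W & s : Esec A V & t : Esec A V --> (ALL p:V. ALL b.
    rho A s p (%q. H q (eres {q} t)$b) =
     H p (eres {p} (N V s t))$b+th p (eres {p} s) * H p (eres {p} t)$b)" using T unfolding ptriv_def by (elim conjE exE)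
 note frW = fr_Esec[OF m W]
 have er: "eres {p} (fr W k) = fr {p} k" if "p : W" for p k by (rule eres_fr) (use that in simp)
 have h: "holo_on A W (%p. H p (fr {p} k)$b)" for k b
  by (rule holo_on_cong[OF A, THEN iffD1, rotated, OF hol[of W "fr W k" b]]) (use m frW er in simp_all)
 thus "holo_on A W (%p. H p (fr {p} k)$b)" .
 have "cpd U ph i (%p. H p (fr {p} k)$b) p =
   (SUM l. Gm l (Some i) k p * H p (fr {p} l)$b)+th p (fr {p} (Some i)) * H p (fr {p} k)$b"
  if p: "p : W" for p i k b
 proof -
  have pU: "p : U" using p W by blast
  have "cpd U ph i (%p. H p (fr {p} k)$b) p = rho A (fr W (Some i)) p (%q. H q (fr {q} k)$b)"
   unfolding rho_fr[OF p W] by (rule bvec_apply[OF holo_nearI[OF p h], symmetric])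
  also have "... = rho A (fr W (Some i)) p (%q. H q (eres {q} (fr W k))$b)"
   unfolding rho_fr[OF p W] by (rule tangent_cong[OF bvec_tangent[OF pU] holo_nearI[OF p h] m p]) (simp add: er)
  also have "... = H p (eres {p} (N W (fr W (Some i)) (fr W k)))$b+th p (fr {p} (Some i)) * H p (fr {p} k)$b"
   using th[THEN spec, THEN spec, THEN spec, THEN mp, OF conjI[OF m conjI[OF order_refl conjI[OF frW frW]]], THEN bspec, OF p]
   by (simp add: er[OF p])
  also have "eres {p} (N W (fr W (Some i)) (fr W k)) = (SUM l. escale (Gm l (Some i) k p) (fr {p} l))"
  proof -
   have "eres {p} (N W (fr W (Some i)) (fr W k)) = sec {p} (%l. Gm l (Some i) k)" unfolding N_fr[OF m W] by (rule eres_sec) (use p in simp)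
   also have "... = (SUM l. escale (Gm l (Some i) k p) (fr {p} l))"
    by (simp add: fr_def sec_escale sec_sum if_mult_right cong: if_cong) (rule sec_cong, simp)
   finally show ?thesis .
  qed
  finally show ?thesis by (simp add: Eisos_sum[OF pU iso[OF p]])
 qed
 thus "EX et. ALL p:W. ALL i k b. cpd U ph i (%p. H p (fr {p} k)$b) p =
   (SUM l. Gm l (Some i) k p * H p (fr {p} l)$b)+et i p * H p (fr {p} k)$b"
  by (intro exI[of _ "%i p. th p (fr {p} (Some i))"] ballI allI)
qed

text \<open>A section differs from the lift of its image under \<open>rho\<close> by a multiple of
  the Euler field, which annihilates functions but acts on sections as \<open>kp\<close>. This
  discrepancy is the scalar form: \<open>- kp\<close> times the Euler component.\<close>

lemma coords_ptriv:
 assumes V: "mopen A V" "V <= U" and E: "!!k b. holo_on A V (E k b)"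
  and dE: "!!p i k b. p : V ==> cpd U ph i (E k b) p = (SUM l. Gm l (Some i) k p * E l b p)"
  and d: "!!p. p : V ==> det (\<chi> b k. E k b p) ~= 0"
 shows "ptriv A N V (%p. mk_iso p (%k b. E k b p))" unfolding ptriv_def
proof (intro conjI ballI exI allI impI)
 let ?H = "%p. mk_iso p (%k b. E k b p)"
 show "mopen A V" by (rule V(1))
 show "?H p : Eisos A p" if "p : V" for p by (rule mk_iso_Eisos[OF _ d[OF that]]) (use that V in blast)
 have eE: "eres {p} (sec V' a) : Efibre A p" "comp k (eres {p} (sec V' a)) p = a k p" if "p : V'" "V' <= U" for p V' a k
  using that sec_Efibre[of p a] comp_sec[of p "{p}" k a] by (auto simp: eres_sec)
 have H: "?H p (eres {p} (sec V' a))$b = (SUM k. a k p * E k b p)" if "p : V'" "V' <= U" for p V' a b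
  using eE[OF that] by (simp add: mk_iso_def)
 show "holo_on A V' (%p. ?H p (eres {p} s)$b)" if a: "mopen A V' & V' <= V & s : Esec A V'" for V' s b
 proof -
  have V': "mopen A V'" "V' <= U" and s: "s : Esec A V'" using a V by auto
  note c = Esec_comp[OF V' s]
  have "holo_on A V' (%p. SUM k. comp k s p * E k b p)"
   by (rule holo_on_sum[OF holo_on_mult[OF c(1) holo_on_subset[OF E]] V'(1)]) (use a in auto)
  thus ?thesis by (rule holo_on_cong[OF A, THEN iffD1, rotated]) (use H[OF _ V'(2), of _ "%k. comp k s"] c(2) in simp)
 qed
 fix V' s t p b assume a: "mopen A V' & V' <= V & s : Esec A V' & t : Esec A V'" and p: "p : V'"
 have V': "mopen A V'" "V' <= U" and V'V: "V' <= V" and s: "s : Esec A V'" and t: "t : Esec A V'" using a V by auto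
 define x where "x k = comp k s" for k
 define y where "y k = comp k t" for k
 have x: "holo_on A V' (x k)" "s = sec V' x" for k unfolding x_def[abs_def] by (rule Esec_comp[OF V' s])+
 have y: "holo_on A V' (y k)" "t = sec V' y" for k unfolding y_def[abs_def] by (rule Esec_comp[OF V' t])+
 have pU: "p : U" and pV: "p : V" using p V' V'V by auto
 have EV': "holo_on A V' (E k b)" for k b by (rule holo_on_subset[OF E V'(1) V'V])
 note n = holo_nearI[OF p x(1)] holo_nearI[OF p y(1)] holo_nearI[OF p EV']
 have yE: "holo_on A V' (%q. y k q * E k b q)" for k by (rule holo_on_mult[OF y(1) EV'])
 have 1: "rho A s p (%q. ?H q (eres {q} t)$b) = Dv x (%q. SUM k. y k q * E k b q) p"
 proof -
  have "rho A s p : tangent A p" unfolding x(2) rho_sec[OF p V'(2)] by (rule tvec_tangent[OF pU])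
  hence "rho A s p (%q. SUM k. y k q * E k b q) = rho A s p (%q. ?H q (eres {q} t)$b)"
   by (rule tangent_cong[OF _ holo_nearI[OF p holo_on_sum[OF yE V'(1)]] V'(1) p]) (simp add: y(2) H[OF _ V'(2)])
  moreover have "rho A s p (%q. SUM k. y k q * E k b q) = Dv x (%q. SUM k. y k q * E k b q) p"
   unfolding x(2) by (rule rho_apply[OF p V'(2) holo_on_sum[OF yE V'(1)]])
  ultimately show ?thesis by simp
 qed
 have 2: "Dv x (%q. SUM k. y k q * E k b q) p = (SUM k. Dv x (%q. y k q * E k b q) p)" by (rule Dv_rules(3)[OF V' p EV' EV']) (rule yE)
 have 3: "Dv x (%q. y k q * E k b q) p = y k p * Dv x (E k b) p+E k b p * Dv x (y k) p" for k by (rule Dv_rules(2)[OF V' p y(1) EV'])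
 \<comment> \<open>The equation \<open>dE\<close> covers only the indices \<open>Some j\<close>; the
   summand \<open>j = None\<close> on the right equals \<open>kp * x None p * E k b p\<close> and is
   subtracted.\<close>
 have 4: "Dv x (E k b) p = (SUM l. (SUM j. x j p * Gm l j k p) * E l b p) - kp * x None p * E k b p" for k
 proof -
  have "(SUM l. (SUM j. x j p * Gm l j k p) * E l b p) = (SUM j. x j p * (SUM l. Gm l j k p * E l b p))"
   unfolding sum_distrib_left sum_distrib_right by (subst sum.swap) (simp add: mult.assoc)
  thus ?thesis
   by (simp add: sum_UNIV_option[of "%j. x j p * (SUM l. Gm l j k p * E l b p)"] dE[OF pV] Gm_None[OF pU] if_mult_left cong: if_cong)
 qed
 have 5: "(SUM k. y k p * (SUM l. (SUM j. x j p * Gm l j k p) * E l b p)) =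
   (SUM l. (SUM j. SUM k. x j p * y k p * Gm l j k p) * E l b p)"
 proof -
  have "(SUM k. y k p * (SUM l. (SUM j. x j p * Gm l j k p) * E l b p)) =
    (SUM l. SUM k. y k p * ((SUM j. x j p * Gm l j k p) * E l b p))" unfolding sum_distrib_left by (rule sum.swap)
  also have "... = (SUM l. (SUM k. SUM j. x j p * y k p * Gm l j k p) * E l b p)" by (simp add: sum_distrib_left sum_distrib_right mult_ac)
  finally show ?thesis unfolding sum.swap[of "%k j. x j p * y k p * Gm _ j k p"] .
 qed
 show "rho A s p (%q. ?H q (eres {q} t)$b) =
   ?H p (eres {p} (N V' s t))$b+- kp * comp None (eres {p} s) p * ?H p (eres {p} t)$b"
  unfolding x(2) y(2) N_sec[of V' x y, OF V' x(1) y(1)] H[OF p V'(2)] eE(2)[OF p V'(2)]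
  unfolding x(2)[symmetric] y(2)[symmetric] 1 2 3 4 right_diff_distrib sum.distrib sum_subtractf 5
  by (simp add: sum.distrib sum_negf distrib_right distrib_left sum_distrib_left mult_ac)
qed

end

section \<open>Local developing maps\<close>

context rho_chart
begin

text \<open>The transition matrix \<open>L\<close> between the trivializations satisfies the scalar
  equation \<open>dL = (et' - et) L\<close>, so its entries keep constant ratios near
  \<open>p\<close>. At \<open>p\<close> it is \<open>c\<close> times the identity, hence it stays a
  multiple of the identity.\<close>

lemma ptriv_unique:
 assumes T: "ptriv A N W H" "ptriv A N W' H'" and WU: "W <= U" "W' <= U" and p: "p : W" "p : W'"
  and c: "c ~= 0" "H' p = (%v. c *s H p v)"
 obtains V where "mopen A V" "p : V" "V <= W" "V <= W'" "!!q. q : V ==> EX d. d ~= 0 & H' q = (%v. d *s H q v)"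
proof -
 let ?V = "W Int W'"
 have W: "mopen A W" "mopen A W'" using T by (auto simp: ptriv_def)
 have V: "mopen A ?V" "?V <= U" "p : ?V" using mopen_Int[OF A W] WU p by auto
 define E where "E k b p = H p (fr {p} k)$b" for k b p
 define E' where "E' k b p = H' p (fr {p} k)$b" for k b p
 have T1: "ptriv A N ?V H" "ptriv A N ?V H'" using ptriv_subset[OF T(1) V(1)] ptriv_subset[OF T(2) V(1)] by auto
 have Eh: "holo_on A ?V (E k b)" "holo_on A ?V (E' k b)" for k b
  unfolding E_def[abs_def] E'_def[abs_def] using ptriv_coords(1)[OF T1(1) V(2)] ptriv_coords(1)[OF T1(2) V(2)] by blast+
 obtain et where et: "ALL p:?V. ALL i k b. cpd U ph i (E k b) p = (SUM l. Gm l (Some i) k p * E l b p)+et i p * E k b p"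
  using ptriv_coords(2)[OF T1(1) V(2)] unfolding E_def[abs_def] by (elim exE)
 obtain et' where et': "ALL p:?V. ALL i k b. cpd U ph i (E' k b) p = (SUM l. Gm l (Some i) k p * E' l b p)+et' i p * E' k b p"
  using ptriv_coords(2)[OF T1(2) V(2)] unfolding E'_def[abs_def] by (elim exE)
 have iso: "H q : Eisos A q" "H' q : Eisos A q" if "q : ?V" for q using T1 that by (auto simp: ptriv_def)
 define M where "M q = (\<chi> k a. E k a q)" for q
 have dM: "det (M q) ~= 0" if q: "q : ?V" for q
 proof -
  have qU: "q : U" using q V by blast
  have "M q = transpose (\<chi> b k. H q (fr {q} k)$b)" by (simp add: M_def E_def transpose_def)
  thus ?thesis using Eisos_det[OF qU iso(1)[OF q]] by simp
 qed
 have ker: "x = 0" if q: "q : ?V" and x: "!!k. (SUM a. E k a q * x$a) = 0" for q x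
 proof -
  have "M q *v x = 0" using x by (simp add: M_def vec_eq_iff matrix_vector_mult_def)
  thus ?thesis using dM[OF q] unfolding invertible_det_nz[symmetric] invertible_left_inverse matrix_left_invertible_ker by blast
 qed
 \<comment> \<open>Cramer's rule, which shows that the entries are holomorphic.\<close>
 define L where "L b a q = det (\<chi> k a'. if a' = a then E' k b q else E k a' q) / det (M q)" for b a q
 have Lh: "holo_on A ?V (L b a)" for b a unfolding L_def[abs_def]
 proof (rule holo_on_divide[OF A])
  show "holo_on A ?V (%q. det (\<chi> k a'. if a' = a then E' k b q else E k a' q))"
  proof (rule holo_on_det[OF V(1)])
   show "holo_on A ?V (%q. (\<chi> k a'. if a' = a then E' k b q else E k a' q)$i$j)" for i j by (cases "j = a") (simp_all add: Eh)
  qed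
  show "holo_on A ?V (%q. det (M q))" by (rule holo_on_det[OF V(1)]) (simp add: M_def Eh)
 qed (rule dM)
 have LE: "(SUM a. E k a q * L b a q) = E' k b q" if q: "q : ?V" for k b q
 proof -
  have "M q *v (\<chi> a. L b a q) = (\<chi> k. E' k b q)"
  proof -
   have "(\<chi> k j. if j = a then (\<chi> k. E' k b q)$k else M q$k$j) = (\<chi> k a'. if a' = a then E' k b q else E k a' q)" for a
    by (simp add: vec_eq_iff M_def)
   thus ?thesis unfolding cramer[OF dM[OF q]] by (simp add: L_def)
  qed
  thus ?thesis by (simp add: M_def vec_eq_iff matrix_vector_mult_def)
 qed
 have L_unique: "L b a q = x a" if q: "q : ?V" and x: "!!k. (SUM a. E k a q * x a) = E' k b q" for b a q x
 proof -
  have "(\<chi> a. L b a q - x a) = 0" by (rule ker[OF q]) (simp add: right_diff_distrib sum_subtractf LE[OF q] x)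
  thus ?thesis by (simp add: vec_eq_iff)
 qed
 have Lp: "L b a p = (if a = b then c else 0)" for a b by (rule L_unique[OF V(3)]) (simp add: E_def E'_def c(2) if_mult_right cong: if_cong)
 have dL: "cpd U ph i (L b a) q = (et' i q - et i q) * L b a q" if q: "q : ?V" for i b a q
 proof -
  have qU: "q : U" using q V by blast
  note n = holo_nearI[OF q Eh(1)] holo_nearI[OF q Lh]
  have "(\<chi> a. cpd U ph i (L b a) q - (et' i q - et i q) * L b a q) = 0"
  proof (rule ker[OF q])
   fix k
   have "cpd U ph i (E' k b) q = cpd U ph i (%q. SUM a. E k a q * L b a q) q" by (rule cpd_cong[OF V(1) q qU]) (simp add: LE)
   also have "... = (SUM a. E k a q * cpd U ph i (L b a) q+L b a q * cpd U ph i (E k a) q)"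
    unfolding cpd_sum[OF qU holo_nearI[OF q holo_on_mult[OF Eh(1) Lh]]] by (intro sum.cong refl cpd_mult[OF qU n])
   also have "... = (SUM a. E k a q * cpd U ph i (L b a) q)+et i q * E' k b q+(SUM a. SUM l. Gm l (Some i) k q * (E l a q * L b a q))"
    using et[THEN bspec, OF q] by (simp add: sum.distrib distrib_left LE[OF q, symmetric] sum_distrib_left mult_ac)
   also have "(SUM a. SUM l. Gm l (Some i) k q * (E l a q * L b a q)) = (SUM l. Gm l (Some i) k q * E' l b q)"
    by (subst sum.swap) (simp add: sum_distrib_left[symmetric] LE[OF q])
   finally have "(SUM a. E k a q * cpd U ph i (L b a) q) = (et' i q - et i q) * E' k b q"
    using et'[THEN bspec, OF q] by (simp add: algebra_simps)
   moreover have "(SUM a. E k a q * ((et' i q - et i q) * L b a q)) = (et' i q - et i q) * E' k b q"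
    unfolding LE[OF q, symmetric] by (simp add: sum_distrib_left mult_ac)
   ultimately show "(SUM a. E k a q * (\<chi> a. cpd U ph i (L b a) q - (et' i q - et i q) * L b a q)$a) = 0"
    by (simp add: right_diff_distrib[of "E k _ q"] sum_subtractf)
  qed
  thus ?thesis by (simp add: vec_eq_iff)
 qed
 \<comment> \<open>The family is indexed by pairs of matrix indices; the diagonal entry at
   \<open>None\<close> is the reference function, nonzero at \<open>p\<close> with value
   \<open>c\<close>.\<close>
 have "EX W. mopen A W & p : W & W <= ?V & (ALL q:W. L None None q ~= 0 & (ALL k. L (fst k) (snd k) q = L (fst k) (snd k) p / L None None p * L None None q))"
  by (rule log_derivative_unique[OF V Lh Lh _ dL dL]) (simp add: Lp c(1))
 then obtain W0 where W0: "mopen A W0" "p : W0" "W0 <= ?V"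
  and L0: "ALL q:W0. L None None q ~= 0 & (ALL k. L (fst k) (snd k) q = L (fst k) (snd k) p / L None None p * L None None q)" by blast
 show ?thesis
 proof (rule that[OF W0(1,2)])
  show "W0 <= W" "W0 <= W'" using W0(3) by auto
  fix q assume q: "q : W0"
  have qV: "q : ?V" using q W0(3) by blast
  have qU: "q : U" using qV V by blast
  have Lq: "L b a q = (if a = b then L None None q else 0)" for a b
   using L0[THEN bspec, OF q, THEN conjunct2, THEN spec, of "(b, a)"] c(1) by (simp add: Lp)
  have "H' q = (%v. L None None q *s H q v)"
  proof (rule Eisos_eqI[OF qU iso[OF qV]])
   fix k
   have "E' k b q = L None None q * E k b q" for b
    unfolding LE[OF qV, symmetric] by (subst Lq) (simp add: if_mult_right mult.commute cong: if_cong)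
   thus "H' q (fr {q} k) = L None None q *s H q (fr {q} k)" by (simp add: vec_eq_iff E_def E'_def)
  qed
  thus "EX d. d ~= 0 & H' q = (%v. d *s H q v)" using L0 q by blast
 qed
qed

end

lemma iso_on_cong:
 assumes A: "atlas_compat A" and f: "iso_on A B W f" and e: "!!x. x : W ==> f x = g x"
 shows "iso_on A B W g" unfolding iso_on_def
proof (intro conjI allI impI)
 show "mopen A W" by (rule iso_on_mopen[OF f])
 show "inj_on g W" using iso_on_inj[OF f] inj_on_cong[of W f g] e by blast
 fix V h assume V: "V <= W"
 have "g`V = f`V" using e V by (intro image_cong) auto
 moreover have "holo_on A V (%x. h (g x)) \<longleftrightarrow> holo_on A V (%x. h (f x))" by (rule holo_on_cong[OF A]) (use e V in auto)
 ultimately show "holo_on A V (%x. h (g x)) \<longleftrightarrow> holo_on B (g`V) h" using iso_on_holo[OF f V, of h] by simp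
qed

lemma iso_on_affine:
 fixes F :: "complex ^ 'n::finite => complex ^ 'm::finite"
 assumes S: "open S" "inj_on F S" and F: "!!l. holo S (%x. F x$l)" and G: "!!l. holo (F`S) (%y. inv_into S F y$l)"
 shows "iso_on affine_atlas affine_atlas S F" unfolding iso_on_def
proof (intro conjI allI impI)
 show "mopen affine_atlas S" "inj_on F S" using S by auto
 fix T g assume T: "T <= S"
 have Teq: "T = {x : S. F x : F`T}" using T S(2) by (auto dest: inj_onD)
 have inv: "inv_into S F (F x) = x" if "x : T" for x using inv_into_f_f[OF S(2)] that T by blast
 have FTeq: "F`T = {y : F`S. inv_into S F y : T}"
 proof (rule set_eqI, rule iffI)
  fix y assume "y : F`T"
  thus "y : {y : F`S. inv_into S F y : T}" using T inv by auto
 next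
  fix y assume y: "y : {y : F`S. inv_into S F y : T}"
  hence "F (inv_into S F y) = y" by (intro f_inv_into_f) simp
  thus "y : F`T" using y by (metis (mono_tags, lifting) image_eqI mem_Collect_eq)
 qed
 have "holo T (%x. g (F x)) \<longleftrightarrow> holo (F`T) g"
 proof
  assume g: "holo (F`T) g"
  have oT: "open T" by (subst Teq, rule open_holo_preimage[OF F holo_open[OF g]])
  show "holo T (%x. g (F x))" by (rule holo_compose(1)[OF holo_subset[OF F oT T] g order_refl])
 next
  assume h: "holo T (%x. g (F x))"
  have oT: "open (F`T)" by (subst FTeq, rule open_holo_preimage[OF G holo_open[OF h]])
  have "holo (F`T) (%y. g (F (inv_into S F y)))" by (rule holo_compose(1)[OF holo_subset[OF G oT] h]) (use T inv in auto)
  thus "holo (F`T) g" by (rule holo_cong[THEN iffD1, rotated]) (use inv in auto)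
 qed
 thus "holo_on affine_atlas T (%x. g (F x)) \<longleftrightarrow> holo_on affine_atlas (F`T) g" by simp
qed

context rho_chart
begin

section \<open>The developing map of a frame: immersion and straight geodesics\<close>

lemma frame_kernel:
 fixes e :: "'n option => 'n option => complex"
 assumes d: "det (\<chi> b k. e k b) ~= 0" and x: "!!b. (SUM k. x k * e k b) = 0"
 shows "x k = 0"
proof -
 have "(\<chi> b k. e k b) *v (\<chi> k. x k) = 0" using x by (simp add: vec_eq_iff matrix_vector_mult_def mult.commute)
 hence "(\<chi> k. x k) = 0" using d unfolding invertible_det_nz[symmetric] invertible_left_inverse matrix_left_invertible_ker by blast
 thus ?thesis by (simp add: vec_eq_iff)
qed

lemma frame_Some_kernel:
 fixes e :: "'n option => 'n option => complex"
 assumes d: "det (\<chi> b k. e k b) ~= 0" and x: "!!b. (SUM i. h i * e (Some i) b) = c * e None b"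
 shows "h i = 0" using frame_kernel[OF d, of "%k. case k of None => - c | Some i => h i" "Some i"] x by (simp add: sum_UNIV_option)

lemma frame_None_nonzero:
 fixes e :: "'n option => 'n option => complex"
 assumes d: "det (\<chi> b k. e k b) ~= 0"
 shows "EX b. e None b ~= 0"
proof (rule ccontr)
 assume "\<nexists>b. e None b ~= 0"
 thus False using frame_kernel[OF d, of "%k. if k = None then 1 else 0" None] by (simp add: sum_UNIV_option)
qed

text \<open>The covariant derivative of the Euler section in direction \<open>i\<close> is
  \<open>kp\<close> times the frame element \<open>Some i\<close>; so the derivatives of the
  developing vector \<open>E None\<close> are multiples of the remaining frame vectors.\<close>

lemma cpd_None:
 assumes p: "p : U" and dE: "!!i k b. cpd U ph i (E k b) p = (SUM l. Gm l (Some i) k p * E l b p)"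
 shows "cpd U ph i (E None b) p = kp * E (Some i) b p" unfolding dE by (simp add: Gm_None(2)[OF p] if_mult_left cong: if_cong)

text \<open>By \<open>cpd_None\<close> the vector \<open>E None\<close> and its derivatives span the
  whole space, as \<open>kp\<close> is nonzero and the frame independent. Hence the affine
  coordinates of its line have injective differential and \<open>holo_inverse_function\<close>
  applies.\<close>

lemma frame_developing:
 fixes E :: "'n option => 'n option => 'a => complex"
 assumes V: "mopen A V" "V <= U" and E: "!!k b. holo_on A V (E k b)"
  and dE: "!!p i k b. p : V ==> cpd U ph i (E k b) p = (SUM l. Gm l (Some i) k p * E l b p)"
  and d: "!!p. p : V ==> det (\<chi> b k. E k b p) ~= 0" and p0: "p0 : V"
 shows "EX W. p0 : W & W <= V & iso_on A cp_atlas W (%p. vec.span {\<chi> b. E None b p})"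
proof -
 obtain i0 where i0: "E None i0 p0 ~= 0" using frame_None_nonzero[of "%k b. E k b p0", OF d[OF p0]] by blast
 define V1 where "V1 = {p : V. E None i0 p ~= 0}"
 have V1: "mopen A V1" unfolding V1_def by (rule mopen_nonzero[OF A E])
 have V1V: "V1 <= V" and V1U: "V1 <= U" using V by (auto simp: V1_def)
 have pV1: "p0 : V1" using p0 i0 by (simp add: V1_def)
 have pU: "p0 : U" using p0 V by blast
 have EV1: "holo_on A V1 (E k b)" for k b by (rule holo_on_subset[OF E V1 V1V])
 define f where "f j p = E None (sig i0 j) p / E None i0 p" for j p
 have fh: "holo_on A V1 (f j)" for j unfolding f_def[abs_def] by (rule holo_on_divide[OF A EV1 EV1]) (simp add: V1_def)
 define F where "F x = (\<chi> j. f j (inv_into U ph x))" for x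
 have Fh: "holo (ph`V1) (%x. F x$j)" for j using holo_on_iff[OF V1U, of "f j"] fh by (simp add: F_def)
 have pdF: "pd i (%x. F x$j) (ph p0) = cpd U ph i (f j) p0" for i j by (simp add: F_def cpd_def)
 have df: "E None i0 p0 * cpd U ph i (f j) p0 = kp * E (Some i) (sig i0 j) p0 - f j p0 * (kp * E (Some i) i0 p0)" for i j
 proof -
  have "cpd U ph i (E None (sig i0 j)) p0 = cpd U ph i (%p. f j p * E None i0 p) p0"
   by (rule cpd_cong[OF V1 pV1 pU]) (simp add: f_def V1_def)
  also have "... = f j p0 * cpd U ph i (E None i0) p0+E None i0 p0 * cpd U ph i (f j) p0"
   by (rule cpd_mult[OF pU holo_nearI[OF pV1 fh] holo_nearI[OF pV1 EV1]])
  finally show ?thesis unfolding cpd_None[of p0 E, OF pU dE[OF p0]] by (simp add: algebra_simps)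
 qed
 have inj: "h = 0" if h: "!!l. (SUM i. pd i (%x. F x$l) (ph p0) * h$i) = 0" for h
 proof -
  \<comment> \<open>A kernel vector \<open>h\<close> makes the derivative of the developing vector a
    multiple of that vector itself; the factor is read off in the coordinate
    \<open>i0\<close>.\<close>
  define c where "c = (SUM i. h$i * E (Some i) i0 p0) / E None i0 p0"
  have "(SUM i. h$i * E (Some i) b p0) = c * E None b p0" for b
  proof (cases "b = i0")
   case True
   thus ?thesis using i0 by (simp add: c_def)
  next
   case False
   then obtain j where j: "b = sig i0 j" using sig_sig_inv[of b i0] by metis
   have "E None i0 p0 * (SUM i. cpd U ph i (f j) p0 * h$i) = 0" using h[of j] by (simp add: pdF)
   hence "(SUM i. (kp * E (Some i) b p0 - f j p0 * (kp * E (Some i) i0 p0)) * h$i) = 0"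
    by (simp add: sum_distrib_left j mult.assoc[symmetric] df)
   hence "kp * ((SUM i. h$i * E (Some i) b p0) - f j p0 * (SUM i. h$i * E (Some i) i0 p0)) = 0"
    by (simp add: sum_distrib_left sum_subtractf algebra_simps)
   thus ?thesis using kp_nonzero i0 by (simp add: c_def f_def j)
  qed
  hence "h$i = 0" for i by (rule frame_Some_kernel[of "%k b. E k b p0", OF d[OF p0]])
  thus ?thesis by (simp add: vec_eq_iff)
 qed
 have php0: "ph p0 : ph`V1" using pV1 by blast
 have "EX S. open S & S <= ph`V1 & ph p0 : S & inj_on F S & (ALL l. holo (F`S) (%y. inv_into S F y$l))"
 proof (rule holo_inverse_function[where F=F, OF Fh php0])
  fix h assume "!!l. (SUM i. pd i (%x. F x$l) (ph p0) * h$i) = 0"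
  thus "h = 0" by (rule inj)
 next
  fix S assume S: "open S" "S <= ph`V1" "ph p0 : S" "inj_on F S" "!!l. holo (F`S) (%y. inv_into S F y$l)"
  show "EX S. open S & S <= ph`V1 & ph p0 : S & inj_on F S & (ALL l. holo (F`S) (%y. inv_into S F y$l))"
   by (intro exI[of _ S] conjI allI S)
 qed
 then obtain S where S: "open S" "S <= ph`V1" "ph p0 : S" "inj_on F S"
  and S': "ALL l. holo (F`S) (%y. inv_into S F y$l)" by (elim exE conjE)
 define W where "W = {p : V1. ph p : S}"
 have im: "ph`W = S" using S(2) by (auto simp: W_def)
 have WU: "W <= U" and WV: "W <= V" using V1U V1V by (auto simp: W_def)
 have W: "mopen A W" using mopen_iff[OF WU] im S(1) by simp
 have 1: "iso_on A affine_atlas W ph" by (rule iso_on_subset[OF ph W WU])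
 have 2: "iso_on affine_atlas affine_atlas S F" by (rule iso_on_affine[OF S(1,4) holo_subset[OF Fh S(1,2)] S'[THEN spec]])
 have cim: "cp_coord i0`cp_dom i0 = UNIV" using cp_coord_image[of i0 i0] by simp
 have "iso_on affine_atlas cp_atlas (cp_coord i0`cp_dom i0) (inv_into (cp_dom i0) (cp_coord i0))"
  by (rule iso_on_inv[OF cp_compat cp_coord_iso])
 hence 3: "iso_on affine_atlas cp_atlas (F`S) (%x. vec.span {cp_ins i0 x})"
  unfolding cim cp_inv[abs_def] by (rule iso_on_subset) (use iso_on_image_mopen[OF 2] in auto)
 have 12: "iso_on A affine_atlas W (%p. F (ph p))" by (rule iso_on_comp[OF 1]) (simp add: im 2)
 have "(%p. F (ph p))`W = F`S" unfolding im[symmetric] image_image ..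
 hence "iso_on A cp_atlas W (%p. vec.span {cp_ins i0 (F (ph p))})"
  using iso_on_comp[OF 12, of cp_atlas "%x. vec.span {cp_ins i0 x}"] 3 by simp
 hence "iso_on A cp_atlas W (%p. vec.span {\<chi> b. E None b p})"
 proof (rule iso_on_cong[OF A])
  fix p assume p: "p : W"
  have pU: "p : U" and nz: "E None i0 p ~= 0" using p WU by (auto simp: W_def V1_def)
  have "cp_ins i0 (F (ph p)) = inverse (E None i0 p) *s (\<chi> b. E None b p)" unfolding vec_eq_iff
  proof
   fix b show "cp_ins i0 (F (ph p))$b = (inverse (E None i0 p) *s (\<chi> b. E None b p))$b"
    using nz pU by (cases "b = i0") (simp_all add: cp_ins_def F_def f_def divide_inverse mult.commute)
  qed
  thus "vec.span {cp_ins i0 (F (ph p))} = vec.span {\<chi> b. E None b p}"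
   using span_scale[of "inverse (E None i0 p)" "\<chi> b. E None b p"] nz by simp
 qed
 moreover have "p0 : W" using pV1 S(3) by (simp add: W_def)
 ultimately show ?thesis using WV by blast
qed

text \<open>Along the geodesic let \<open>u\<close> be the image of the Euler section and
  \<open>w\<close> that of the lifted velocity; then \<open>u' = kp w\<close> and
  \<open>w' = R u\<close>. So the Pluecker coordinates \<open>u a w b - u b w a\<close> of the plane
  spanned by \<open>u\<close> and \<open>w\<close> are constant.\<close>

lemma frame_lines:
 fixes E :: "'n option => 'n option => 'a => complex"
 assumes V: "mopen A V" "V <= U" and E: "!!k b. holo_on A V (E k b)"
  and dE: "!!p i k b. p : V ==> cpd U ph i (E k b) p = (SUM l. Gm l (Some i) k p * E l b p)"
  and d: "!!p. p : V ==> det (\<chi> b k. E k b p) ~= 0"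
  and g: "param_geodesic A U conn (ball z0 r) gm" and r: "r > 0" and gmV: "gm`ball z0 r <= V"
 shows "EX Q. vec.subspace Q & vec.dim Q = 2 & (ALL z:ball z0 r. (\<chi> b. E None b (gm z)) : Q)"
proof -
 let ?D = "ball z0 r"
 have gm: "holo_map std_atlas A ?D gm" "gm`?D <= U" and vel: "!!z. z : ?D ==> velocity A gm z ~= 0"
  using param_geodesic_velocity[OF g] by auto
 have z0: "z0 : ?D" using r by simp
 have zV: "gm z : V" and zU: "gm z : U" if z: "z : ?D" for z using subsetD[OF gmV imageI[OF z]] V(2) by auto
 define f where "f i = deriv (ccoord gm i)" for i
 define u where "u b z = E None b (gm z)" for b z
 define w where "w b z = (SUM i. f i z * E (Some i) b (gm z))" for b z
 have D_E: "((%z. E k b (gm z)) has_field_derivative (SUM i. f i z * cpd U ph i (E k b) (gm z))) (at z)" if z: "z : ?D" for k b z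
 proof -
  have "{w : ?D. gm w : V} = ?D" using zV by auto
  hence "(%z. E k b (gm z)) holomorphic_on ?D" using curve_holomorphic(2)[OF A gm(1) E[of k b]] by simp
  from holomorphic_derivI[OF this open_ball z] show ?thesis unfolding curve_chain[OF gm(1) z zU[OF z] holo_nearI[OF zV[OF z] E]] f_def .
 qed
 have D_f: "(f i has_field_derivative deriv (f i) z) (at z)" if "z : ?D" for i z
  unfolding f_def by (rule holomorphic_derivI[OF holomorphic_deriv[OF ccoord_holomorphic[OF gm] open_ball] open_ball that])
 have D_u: "(u b has_field_derivative kp * w b z) (at z)" if z: "z : ?D" for b z
 proof -
  have "(SUM i. f i z * cpd U ph i (E None b) (gm z)) = kp * w b z"
   unfolding cpd_None[of "gm z" E, OF zU[OF z] dE[OF zV[OF z]]] w_def by (simp add: sum_distrib_left mult_ac)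
  thus ?thesis using D_E[OF z, of None b] by (simp add: u_def[abs_def])
 qed
 \<comment> \<open>The Euler component of the covariant acceleration; the other components vanish by
   the geodesic equation.\<close>
 define R where "R z = (SUM i. SUM j. f i z * f j z * Gm None (Some j) (Some i) (gm z))" for z
 have D_w: "(w b has_field_derivative R z * u b z) (at z)" if z: "z : ?D" for b z
 proof -
  have "(w b has_field_derivative (SUM i. deriv (f i) z * E (Some i) b (gm z)+(SUM j. f j z * cpd U ph j (E (Some i) b) (gm z)) * f i z)) (at z)"
   unfolding w_def[abs_def] by (intro DERIV_sum DERIV_mult D_f D_E z)
  moreover have "(SUM i. deriv (f i) z * E (Some i) b (gm z)+(SUM j. f j z * cpd U ph j (E (Some i) b) (gm z)) * f i z) = R z * u b z"
  proof -
   have 1: "(SUM i. (SUM j. f j z * cpd U ph j (E (Some i) b) (gm z)) * f i z) =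
    R z * u b z+(SUM m. (SUM i. SUM j. f i z * f j z * Gm (Some m) (Some j) (Some i) (gm z)) * E (Some m) b (gm z))"
   proof -
    have "(SUM i. (SUM j. f j z * cpd U ph j (E (Some i) b) (gm z)) * f i z) =
     (SUM i. SUM j. SUM l. f i z * f j z * Gm l (Some j) (Some i) (gm z) * E l b (gm z))"
     by (simp add: dE[OF zV[OF z]] sum_distrib_left sum_distrib_right mult_ac)
    also have "... = (SUM i. SUM l. SUM j. f i z * f j z * Gm l (Some j) (Some i) (gm z) * E l b (gm z))" by (intro sum.cong refl sum.swap)
    also have "... = (SUM l. SUM i. SUM j. f i z * f j z * Gm l (Some j) (Some i) (gm z) * E l b (gm z))" by (rule sum.swap)
    finally show ?thesis by (simp add: sum_UNIV_option[of "%l. SUM i. SUM j. f i z * f j z * Gm l (Some j) (Some i) (gm z) * E l b (gm z)"] R_def u_def sum_distrib_right)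
   qed
   have 2: "deriv (f m) z = - (SUM i. SUM j. f i z * f j z * Gm (Some m) (Some j) (Some i) (gm z))" for m
    using geodesic_equation[OF g z, of m] unfolding f_def[symmetric]
    by (simp add: Gm_sym[OF zU[OF z], of "Some m" "Some _" "Some _"] eq_neg_iff_add_eq_0)
   show ?thesis unfolding sum.distrib 1 2 by (simp add: sum_negf)
  qed
  ultimately show ?thesis by simp
 qed
 define m where "m a b z = u a z * w b z - u b z * w a z" for a b z
 have const: "m a b z = m a b z0" if z: "z : ?D" for a b z
 proof -
  have D: "(m a b has_field_derivative 0) (at z within ?D)" if "z : ?D" for z
  proof -
   have "(m a b has_field_derivative (kp * w a z * w b z+R z * u b z * u a z - (kp * w b z * w a z+R z * u a z * u b z))) (at z)"
    unfolding m_def[abs_def] by (intro DERIV_diff DERIV_mult D_u D_w that)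
   hence "(m a b has_field_derivative 0) (at z)" by (simp add: mult_ac)
   thus ?thesis by (rule has_field_derivative_at_within)
  qed
  from has_field_derivative_zero_constant[OF convex_ball D] z z0 show ?thesis by metis
 qed
 \<comment> \<open>If all minors vanished, \<open>w\<close> would be a multiple of \<open>u\<close>,
   and independence of the frame would make the velocity zero.\<close>
 have "EX b c. m b c z0 ~= 0"
 proof (rule ccontr)
  assume "\<nexists>b c. m b c z0 ~= 0"
  hence 0: "u b z0 * w c z0 = u c z0 * w b z0" for b c by (simp add: m_def)
  obtain b where b: "u b z0 ~= 0" using frame_None_nonzero[of "%k b. E k b (gm z0)", OF d[OF zV[OF z0]]] by (auto simp: u_def)
  have "(SUM i. f i z0 * E (Some i) c (gm z0)) = w b z0 / u b z0 * E None c (gm z0)" for c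
   using 0[of b c] b by (simp add: w_def[of c, symmetric] u_def[of c, symmetric] field_simps)
  hence "f i z0 = 0" for i by (rule frame_Some_kernel[of "%k b. E k b (gm z0)", OF d[OF zV[OF z0]]])
  hence "velocity A gm z0 = 0" using velocity_zero_iff[OF gm(1) z0 zU[OF z0]] by (simp add: f_def)
  thus False using vel[OF z0] by blast
 qed
 then obtain b c where bc: "m b c z0 ~= 0" by blast
 \<comment> \<open>Cramer's rule in the fixed plane: \<open>u\<close> equals \<open>u b\<close>
   times \<open>X\<close> plus \<open>u c\<close> times \<open>Y\<close>, with \<open>X\<close> and
   \<open>Y\<close> built from the constant minors.\<close>
 define X where "X = (\<chi> a. m a c z0 / m b c z0)"
 define Y where "Y = (\<chi> a. m b a z0 / m b c z0)"
 have XY: "X$b = 1" "X$c = 0" "Y$b = 0" "Y$c = 1" using bc by (simp_all add: X_def Y_def m_def[of b b] m_def[of c c])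
 have ne: "X ~= Y" using XY by auto
 have "X ~: vec.span {Y}" using XY unfolding span_line by (metis (no_types, lifting) imageE mult_zero_right vector_smult_component zero_neq_one)
 moreover have "Y ~= 0" using XY(4) by auto
 ultimately have ind: "vec.independent {X, Y}" using ne by (simp add: vec.independent_insert)
 have dim: "vec.dim (vec.span {X, Y}) = 2" using vec.dim_span_eq_card_independent[OF ind] ne by simp
 have "(\<chi> a. E None a (gm z)) : vec.span {X, Y}" if z: "z : ?D" for z
 proof -
  have comb: "u a z = u b z * (m a c z0 / m b c z0)+u c z * (m b a z0 / m b c z0)" for a
  proof -
   have "u a z * m b c z = u b z * m a c z+u c z * m b a z" by (simp add: m_def algebra_simps)
   thus ?thesis using bc by (simp add: const[OF z] field_simps)
  qed
  have "(\<chi> a. E None a (gm z)) = u b z *s X+u c z *s Y" unfolding vec_eq_iff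
  proof
   fix a show "(\<chi> a. E None a (gm z))$a = (u b z *s X+u c z *s Y)$a" using comb[of a] by (simp add: X_def Y_def u_def)
  qed
  thus ?thesis by (simp add: vec.span_add vec.span_scale vec.span_base)
 qed
 thus ?thesis using dim vec.subspace_span by blast
qed

end

section \<open>Geodesics of the covering and projective lines\<close>

lemma iso_std_plane:
 assumes S: "open S" and g: "iso_on std_atlas (plane_atlas S) W g"
 shows "iso_on std_atlas std_atlas W g" unfolding iso_on_def
proof (intro conjI allI impI)
 show "mopen std_atlas W" "inj_on g W" using iso_on_mopen[OF g] iso_on_inj[OF g] .
 fix V h assume V: "V <= W"
 have "g`W <= S" using iso_on_image_mopen[OF g] by (simp add: mopen_plane)
 hence "g`V <= S" using V by blast
 thus "holo_on std_atlas V (%x. h (g x)) \<longleftrightarrow> holo_on std_atlas (g`V) h"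
  using iso_on_holo[OF g V, of h] by (simp add: holo_on_plane)
qed

text \<open>Projective equivalence compares whole immersed curves, so the geodesic is first
  restricted to a disc that it maps into the overlap; there the other connection has the same curve
  as a geodesic, up to the reparametrization \<open>g2\<close>.\<close>

lemma equivalent_step:
 assumes A: "atlas_compat A" and pe: "projectively_equivalent A (U Int U') D D'" and D: "torsion_free_connection A U D"
  and U': "mopen A U'" and g: "param_geodesic A U D W gm" and W: "open W" "z0 : W" "gm z0 : U'"
 obtains W2 g2 z2 where "iso_on std_atlas std_atlas W2 g2" "z2 : W2" "g2 z2 = z0" "g2`W2 <= W"
  "param_geodesic A U' D' W2 (%z. gm (g2 z))"
proof -
 note v = param_geodesic_velocity[OF g]
 have "holo_on A U' (%_. 0)" using U' by simp
 from curve_holomorphic(1)[OF A v[THEN conjunct1] this] have "open {w : W. gm w : U'}" .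
 moreover have "z0 : {w : W. gm w : U'}" using W by blast
 ultimately obtain r where r: "r > 0" "ball z0 r <= {w : W. gm w : U'}" using open_contains_ball by blast
 let ?D = "ball z0 r"
 have DW: "?D <= W" and DU': "gm`?D <= U'" using r(2) by auto
 have gD: "param_geodesic A (U Int U') D ?D gm" by (rule param_geodesic_shrink[OF A g D U' DU' open_ball DW])
 note vD = param_geodesic_velocity[OF gD]
 have im: "immersed_curve A (U Int U') (plane_atlas ?D) gm" by (rule immersed_disc[OF A]) (use vD in auto)
 have "ALL x:points (plane_atlas ?D). geodesic_near A (U Int U') D (plane_atlas ?D) gm x"
  unfolding points_plane by (intro ballI geodesic_near_plane[OF open_ball open_ball order_refl gD])
 hence "ALL x:points (plane_atlas ?D). geodesic_near A (U Int U') D' (plane_atlas ?D) gm x"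
  using pe[unfolded projectively_equivalent_def, THEN spec, THEN spec, THEN mp, OF im] by blast
 moreover have "z0 : points (plane_atlas ?D)" using r(1) by simp
 ultimately have "geodesic_near A (U Int U') D' (plane_atlas ?D) gm z0" by blast
 then obtain W2 g2 where g2: "biholo_on std_atlas (plane_atlas ?D) W2 g2" "z0 : g2`W2"
  and p: "param_geodesic A (U Int U') D' W2 (%z. gm (g2 z))" unfolding geodesic_near_def by blast
 have i: "iso_on std_atlas (plane_atlas ?D) W2 g2" using g2(1) biholo_on_iff_iso_on[OF std_compat plane_compat[OF open_ball]] by blast
 obtain z2 where z2: "z2 : W2" "g2 z2 = z0" using g2(2) by blast
 have "g2`W2 <= ?D" using iso_on_image_mopen[OF i] by (simp add: mopen_plane)
 hence "g2`W2 <= W" using DW by blast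
 thus ?thesis using that[OF iso_std_plane[OF open_ball i] z2 _ param_geodesic_mono[OF p]] by blast
qed

lemma iso_std_comp:
 assumes g: "iso_on std_atlas B W g" and h: "iso_on std_atlas std_atlas W' h" "h`W' <= W"
 shows "iso_on std_atlas B W' (%z. g (h z))" by (rule iso_on_comp[OF h(1) iso_on_subset[OF g iso_on_image_mopen[OF h(1)] h(2)]])

text \<open>The connection \<open>D\<close> that witnesses a geodesic belongs to a covering merely
  equivalent to a pulled back one. It is exchanged for a pulled back connection \<open>D'\<close>,
  and this for the pull-back of \<open>D0\<close>, which is adjoined to the same covering of the
  base; then the curve is pushed down by \<open>q\<close>.\<close>

lemma (in covering) geodesic_in_chart:
 assumes ps: "projective_structure A P" and ins: "!!C. C : P ==> insert (U, D0) C : P"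
  and g: "geodesic B (pull_structure A B q P) S c" and x: "x : points S"
  and T: "openin Y T" "inj_on q T" "q`T <= U" "c x : T"
 shows "EX W G z. iso_on std_atlas S W G & z : W & G z = x & (ALL w:W. c (G w) : T) &
  param_geodesic A U D0 W (%w. q (c (G w)))"
proof -
 have im: "immersed_curve B (points B) S c" using g by (simp add: geodesic_def)
 have S: "atlas_compat S" using im complex_manifold_compat by (auto simp: immersed_curve_def)
 obtain C V D where C: "C : pull_structure A B q P" "(V, D) : C" "geodesic_near B V D S c x" using g x unfolding geodesic_def by blast
 obtain C' where C': "C' : P" "C : covering_class B (pull_covering A B q C')" using C(1) unfolding pull_structure_def by blast
 let ?P' = "pull_covering A B q C'" and ?C'' = "insert (U, D0) C'"
 have PA: "projective_covering A C" if "C : P" for C using that ps unfolding projective_structure_def covering_class_def by blast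
 have pcC: "projective_covering B C" and pcU: "projective_covering B (?P' Un C)" using C'(2) by (auto simp: covering_class_def)
 have pcP: "projective_covering B ?P'" by (rule pull_covering_projective[OF PA[OF C'(1)]])
 have pcA: "projective_covering A ?C''" by (rule PA[OF ins[OF C'(1)]])
 have pcP'': "projective_covering B (pull_covering A B q ?C'')" by (rule pull_covering_projective[OF pcA])
 obtain W1 g1 where g1: "biholo_on std_atlas S W1 g1" "x : g1`W1" and p1: "param_geodesic B V D W1 (%z. c (g1 z))"
  using C(3) unfolding geodesic_near_def by blast
 have i1: "iso_on std_atlas S W1 g1" using g1(1) biholo_on_iff_iso_on[OF std_compat S] by blast
 obtain z1 where z1: "z1 : W1" "g1 z1 = x" using g1(2) by blast
 have oW1: "open W1" using iso_on_mopen[OF i1] by simp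
 have cV: "c x : V" using param_geodesic_velocity[OF p1] z1 by blast
 have "c x : points B" using openin_subset[OF T(1)] T(4) points_B by blast
 hence "c x : \<Union> (fst`?P')" using projective_coveringD(1)[OF pcP] by simp
 then obtain T' D' where T': "(T', D') : ?P'" "c x : T'" by auto
 have TP: "(T, pull_conn A B q D0) : pull_covering A B q ?C''" unfolding pull_covering_def using T mopen_B by blast
 have T'': "(T', D') : pull_covering A B q ?C''" using T'(1) unfolding pull_covering_def by blast
 have pe1: "projectively_equivalent B (V Int T') D D'" by (rule projective_coveringD(4)[OF pcU]) (use C(2) T' cV in auto)
 have tV: "torsion_free_connection B V D" by (rule projective_coveringD(3)[OF pcC C(2)]) (use cV in auto)
 have mT': "mopen B T'" by (rule projective_coveringD(2)[OF pcP T'(1)])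
 have "c (g1 z1) : T'" using z1 T' by simp
 from equivalent_step[OF cB pe1 tV mT' p1 oW1 z1(1) this]
 obtain W2 g2 z2 where i2: "iso_on std_atlas std_atlas W2 g2" and z2: "z2 : W2" "g2 z2 = z1" "g2`W2 <= W1"
  and p2: "param_geodesic B T' D' W2 (%z. c (g1 (g2 z)))" by blast
 have oW2: "open W2" using iso_on_mopen[OF i2] by simp
 have pe2: "projectively_equivalent B (T' Int T) D' (pull_conn A B q D0)"
  by (rule projective_coveringD(4)[OF pcP'' T'' TP]) (use T' T in auto)
 have tT': "torsion_free_connection B T' D'" by (rule projective_coveringD(3)[OF pcP T'(1)]) (use T' in auto)
 have mT: "mopen B T" using T(1) mopen_B by simp
 have "c (g1 (g2 z2)) : T" using z1 z2 T by simp
 from equivalent_step[OF cB pe2 tT' mT p2 oW2 z2(1) this]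
 obtain W3 g3 z3 where i3: "iso_on std_atlas std_atlas W3 g3" and z3: "z3 : W3" "g3 z3 = z2" "g3`W3 <= W2"
  and p3: "param_geodesic B T (pull_conn A B q D0) W3 (%z. c (g1 (g2 (g3 z))))" by blast
 interpret qp: iso_pair B A T q by (rule pair_q[OF T(1,2)])
 have "torsion_free_connection A U D0" by (rule projective_coveringD(3)[OF pcA]) (use T in auto)
 hence "torsion_free_connection A (q`T) D0" by (rule torsion_free_subset[OF _ T(3)])
 from param_geodesic_mono[OF qp.param_geodesic_push[OF p3 this] T(3)]
 have "param_geodesic A U D0 W3 (%z. q (c (g1 (g2 (g3 z)))))" .
 moreover have "iso_on std_atlas S W3 (%z. g1 (g2 (g3 z)))" by (rule iso_std_comp[OF iso_std_comp[OF i1 i2 z2(3)] i3 z3(3)])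
 moreover have "ALL w:W3. c (g1 (g2 (g3 w))) : T" using param_geodesic_velocity[OF p3] by blast
 ultimately show ?thesis using z1 z2 z3 by (intro exI[of _ W3] exI[of _ "%z. g1 (g2 (g3 z))"] exI[of _ z3]) simp
qed

lemma plane_unique:
 fixes Q Q' :: "(complex ^ 'k::finite) set"
 assumes Q: "vec.subspace Q" "vec.dim Q = 2" and Q': "vec.subspace Q'" "vec.dim Q' = 2"
  and u: "u : Q" "u : Q'" and v: "v : Q" "v : Q'" and ne: "u ~= 0" "v ~= 0" "vec.span {u} ~= vec.span {v}"
 shows "Q = Q'"
proof -
 have "u ~: vec.span {v}"
 proof
  assume "u : vec.span {v}"
  then obtain c where c: "u = c *s v" unfolding span_line by blast
  hence "c ~= 0" using ne(1) by auto
  thus False using span_scale[of c v] c ne(3) by simp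
 qed
 hence ind: "vec.independent {u, v}" and uv: "u ~= v" using ne vec.span_base[of v "{v}"] by (auto simp: vec.independent_insert)
 have eq: "Q = vec.span {u, v}" if "vec.subspace Q" "vec.dim Q = 2" "u : Q" "v : Q" for Q
 proof
  have s: "{u, v} <= Q" using that by blast
  show "vec.span {u, v} <= Q" by (rule vec.span_minimal[OF s that(1)])
  show "Q <= vec.span {u, v}" by (rule vec.card_ge_dim_independent[OF s ind]) (use that(2) uv in simp)
 qed
 show ?thesis using eq[OF Q u(1) v(1)] eq[OF Q' u(2) v(2)] by simp
qed

context rho_chart
begin

definition flat_frame :: "'a set => ('n option => 'n option => 'a => complex) => bool" where
 "flat_frame V E \<longleftrightarrow> mopen A V & V <= U & (ALL k b. holo_on A V (E k b)) &
  (ALL p:V. ALL i k b. cpd U ph i (E k b) p = (SUM l. Gm l (Some i) k p * E l b p)) &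
  (ALL p:V. det (\<chi> b k. E k b p) ~= 0)"

lemma flat_frameD:
 assumes "flat_frame V E"
 shows "mopen A V" "V <= U" "holo_on A V (E k b)"
  "p : V ==> cpd U ph i (E k b) p = (SUM l. Gm l (Some i) k p * E l b p)"
  "p : V ==> det (\<chi> b k. E k b p) ~= 0" using assms unfolding flat_frame_def by (elim conjE; simp)+

end

section \<open>Developing maps from flat frames\<close>

text \<open>Serves the empty curve, which counts as connected.\<close>

lemma projective_line_exists: "EX l. l : (projective_lines :: (complex ^ ('n::finite option)) set set set)"
proof -
 obtain i :: 'n where True by simp
 let ?X = "axis None 1 :: complex ^ ('n option)" and ?Y = "axis (Some i) 1 :: complex ^ ('n option)"
 have ne: "?X ~= ?Y" "?Y ~= 0" by (simp_all add: axis_eq_axis)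
 have "?X ~: vec.span {?Y}"
 proof
  assume "?X : vec.span {?Y}"
  then obtain c where c: "?X = c *s ?Y" unfolding span_line by blast
  show False using arg_cong[OF c, of "%v. v$None"] by (simp add: axis_def)
 qed
 hence ind: "vec.independent {?X, ?Y}" using ne by (simp add: vec.independent_insert)
 have "vec.dim (vec.span {?X, ?Y}) = 2" using vec.dim_span_eq_card_independent[OF ind] ne by simp
 thus ?thesis unfolding projective_lines_def using vec.subspace_span by blast
qed

lemma connected_locally_constant:
 assumes X: "connected_space X" and g: "!!x. x : topspace X ==> EX N. openin X N & x : N & (ALL y:N. g y = g x)"
  and x: "x : topspace X" and y: "y : topspace X"
 shows "g y = g x"
proof (rule ccontr)
 assume ne: "g y ~= g x"
 have o: "openin X {z : topspace X. R (g z)}" for R unfolding openin_subopen[of X "{z : topspace X. R (g z)}"]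
 proof
  fix z assume z: "z : {z : topspace X. R (g z)}"
  then obtain N where N: "openin X N" "z : N" "ALL y:N. g y = g z" using g[of z] by blast
  have "y : topspace X & R (g y)" if "y : N" for y using openin_subset[OF N(1)] bspec[OF N(3) that] z that by auto
  thus "EX T. openin X T & z : T & T <= {z : topspace X. R (g z)}" using N(1,2) by blast
 qed
 let ?E = "{z : topspace X. g z = g x}" and ?F = "{z : topspace X. g z ~= g x}"
 have "topspace X <= ?E Un ?F" "?E Int ?F = {}" "?E ~= {}" "?F ~= {}" using x y ne by auto
 moreover have "openin X ?E" "openin X ?F" using o[of "%w. w = g x"] o[of "%w. w ~= g x"] .
 ultimately have "EX E F. openin X E & openin X F & topspace X <= E Un F & E Int F = {} & E ~= {} & F ~= {}"
  by (intro exI[of _ ?E] exI[of _ ?F] conjI)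
 thus False using X unfolding connected_space_def by (rule notE[rotated])
qed

context covering
begin

lemma frame_biholo:
 assumes T: "openin Y T" "y : T" "inj_on q T" "q`T <= V" and c: "rho_chart A N U ph"
  and E: "rho_chart.flat_frame A N U ph V E" and de: "!!t. t : T ==> de t = vec.span {\<chi> b. E None b (q t)}"
 shows "EX W. y : W & iso_on B cp_atlas W de"
proof -
 interpret c: rho_chart A N U ph by (rule c)
 note fD = c.flat_frameD[OF E]
 have "q y : V" using T by blast
 from c.frame_developing[OF fD this] obtain W where W: "q y : W" "W <= V"
  and i: "iso_on A cp_atlas W (%p. vec.span {\<chi> b. E None b p})" by blast
 let ?T = "T Int {y : topspace Y. q y : W}"
 have oT: "openin Y ?T" by (rule openin_Int[OF T(1) q_cont[OF iso_on_mopen[OF i]]])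
 have iT: "iso_on B A ?T q" by (rule iso_q[OF oT inj_on_subset[OF T(3)]]) blast
 have "iso_on A cp_atlas (q`?T) (%p. vec.span {\<chi> b. E None b p})" by (rule iso_on_subset[OF i iso_on_image_mopen[OF iT]]) blast
 from iso_on_comp[OF iT this] have "iso_on B cp_atlas ?T (%y. vec.span {\<chi> b. E None b (q y)})" .
 hence "iso_on B cp_atlas ?T de" by (rule iso_on_cong[OF cB]) (simp add: de)
 moreover have "y : ?T" using T W openin_subset[OF T(1)] by blast
 ultimately show ?thesis by (intro exI[of _ ?T] conjI)
qed

text \<open>The last clause, that the developed curve is constant on no open piece, is what makes
  the plane \<open>Q\<close> unique and lets local planes be glued. It holds because the velocity
  does not vanish and \<open>de\<close> is injective on \<open>T\<close>.\<close>

lemma frame_local_lines: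
 assumes ps: "projective_structure A P" and gs: "gives_structure A N P"
  and T: "openin Y T" "inj_on q T" "q`T <= V" and c: "rho_chart A N U ph"
  and E: "rho_chart.flat_frame A N U ph V E" and de: "!!t. t : T ==> de t = vec.span {\<chi> b. E None b (q t)}"
  and inj: "inj_on de T" and g: "geodesic B (pull_structure A B q P) S c" and x: "x : points S" "c x : T"
 shows "EX M Q. mopen S M & x : M & vec.subspace Q & vec.dim Q = 2 & (ALL s:M. EX u. u ~= 0 & u : Q & de (c s) = vec.span {u}) &
  (ALL M'. mopen S M' & M' <= M & M' ~= {} --> (EX s:M'. EX s':M'. de (c s) ~= de (c s')))"
proof -
 interpret c: rho_chart A N U ph by (rule c)
 note fD = c.flat_frameD[OF E]
 have qx: "q (c x) : V" using T x by blast
 hence "U ~= {}" using fD(2) by blast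
 hence ins: "insert (U, c.conn) C : P" if "C : P" for C using gs c.U_mopen c.rho_section_hsec that unfolding gives_structure_def by blast
 have qU: "q`T <= U" using T(3) fD(2) by blast
 from geodesic_in_chart[OF ps ins g x(1) T(1,2) qU x(2)]
 obtain W G z where G: "iso_on std_atlas S W G" "z : W" "G z = x" and GT: "ALL w:W. c (G w) : T"
  and p: "param_geodesic A U c.conn W (%w. q (c (G w)))" by blast
 have "open W" using iso_on_mopen[OF G(1)] by simp
 then obtain r where r: "r > 0" "ball z r <= W" using G(2) open_contains_ball by blast
 let ?D = "ball z r"
 obtain C0 where C0: "C0 : P" using ps unfolding projective_structure_def covering_class_def by fastforce
 have Cp: "projective_covering A (insert (U, c.conn) C0)" using ins[OF C0] ps unfolding projective_structure_def covering_class_def by blast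
 have tf: "torsion_free_connection A U c.conn" by (rule projective_coveringD(3)[OF Cp]) (use \<open>U ~= {}\<close> in auto)
 have DV: "(%w. q (c (G w)))`?D <= V" using GT r(2) T(3) by blast
 have "U Int V = V" using fD(2) by blast
 with param_geodesic_shrink[OF cA p tf fD(1) DV open_ball r(2)]
 have "param_geodesic A V c.conn ?D (%w. q (c (G w)))" by simp
 hence pD: "param_geodesic A U c.conn ?D (%w. q (c (G w)))" by (rule param_geodesic_mono[OF _ fD(2)])
 from c.frame_lines[OF fD pD r(1) DV] obtain Q where Q: "vec.subspace Q" "vec.dim Q = 2"
  "ALL w:?D. (\<chi> b. E None b (q (c (G w)))) : Q" by blast
 have GD: "iso_on std_atlas S ?D G" by (rule iso_on_subset[OF G(1) _ r(2)]) simp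
 have M: "mopen S (G`?D)" by (rule iso_on_image_mopen[OF GD])
 have "EX u. u ~= 0 & u : Q & de (c s) = vec.span {u}" if s: "s : G`?D" for s
 proof -
  obtain w where w: "w : ?D" "s = G w" using s by blast
  have cw: "c (G w) : T" using GT r(2) w by blast
  hence "q (c (G w)) : V" using T(3) by blast
  from c.frame_None_nonzero[of "%k b. E k b (q (c (G w)))", OF fD(5)[OF this]]
  have "(\<chi> b. E None b (q (c (G w)))) ~= 0" by (auto simp: vec_eq_iff)
  thus ?thesis using Q(3) w de[OF cw] by blast
 qed
 moreover have "EX s:M'. EX s':M'. de (c s) ~= de (c s')" if M': "mopen S M' & M' <= G`?D & M' ~= {}" for M'
 proof (rule ccontr)
  assume con: "\<not> (EX s:M'. EX s':M'. de (c s) ~= de (c s'))"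
  define Z where "Z = {w : ?D. G w : M'}"
  have ZD: "Z <= ?D" and "G`Z = M'" using M' by (auto simp: Z_def)
  hence oZ: "open Z" using iso_on_mopen_iff[OF GD ZD] M' by simp
  obtain w0 where w0: "w0 : Z" using \<open>G`Z = M'\<close> M' by blast
  have ZT: "c (G w) : T" if "w : Z" for w using that GT r(2) by (auto simp: Z_def)
  have e: "q (c (G w)) = q (c (G w0))" if w: "w : Z" for w
  proof -
   have "de (c (G w)) = de (c (G w0))" using con w w0 by (auto simp: Z_def)
   thus ?thesis using inj_onD[OF inj _ ZT[OF w] ZT[OF w0]] by simp
  qed
  have "velocity A (%w. q (c (G w))) w0 = velocity A (%_. q (c (G w0))) w0" by (rule velocity_cong[OF oZ w0 e])
  also have "... = 0" by (simp add: velocity_def fun_eq_iff)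
  finally show False using param_geodesic_velocity[OF pD] w0 by (auto simp: Z_def)
 qed
 moreover have "x : G`?D" using G(3) r(1) by force
 ultimately show ?thesis using M Q(1,2) by (intro exI[of _ "G`?D"] exI[of _ Q]) blast
qed

text \<open>Planes from overlapping pieces of the curve share two distinct points of projective
  space, hence coincide. The plane is thus locally constant along the curve, and constant because
  the surface is connected.\<close>

lemma frames_developing:
 assumes ps: "projective_structure A P" and gs: "gives_structure A N P"
  and loc: "!!y. y : topspace Y ==> EX T U ph V E. openin Y T & y : T & inj_on q T & q`T <= V &
   rho_chart A N U ph & rho_chart.flat_frame A N U ph V E & (ALL t:T. de t = vec.span {\<chi> b. E None b (q t)})"
 shows "developing_map A P Y q de"
proof -
 have bi: "EX W. y : W & iso_on B cp_atlas W de" if y: "y : topspace Y" for y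
 proof -
  obtain T U ph V E where "openin Y T" "y : T" "inj_on q T" "q`T <= V"
   "rho_chart A N U ph" "rho_chart.flat_frame A N U ph V E" "ALL t:T. de t = vec.span {\<chi> b. E None b (q t)}"
   using loc[OF y] by (elim exE conjE)
  thus ?thesis by (intro frame_biholo[of T y V N U ph E de]) auto
 qed
 have "local_biholo B cp_atlas de" unfolding local_biholo_def points_B using bi biholo_on_iff_iso_on[OF cB cp_compat] by blast
 moreover have "EX l:projective_lines. de`c`points S <= l" if g: "geodesic B (pull_structure A B q P) S c" for S c
 proof (cases "points S = {}")
  case True
  thus ?thesis using projective_line_exists by auto
 next
  case False
  then obtain x0 where x0: "x0 : points S" by blast
  have im: "immersed_curve B (points B) S c" using g by (simp add: geodesic_def)
  have S: "atlas_compat S" and con: "connected_space (mtop S)" and cB: "c`points S <= topspace Y"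
   using im complex_manifold_compat points_B by (auto simp: immersed_curve_def)
  define good where "good x M Q \<longleftrightarrow> mopen S M & x : M & vec.subspace Q & vec.dim Q = 2 & (ALL s:M. EX u. u ~= 0 & u : Q & de (c s) = vec.span {u}) &
   (ALL M'. mopen S M' & M' <= M & M' ~= {} --> (EX s:M'. EX s':M'. de (c s) ~= de (c s')))" for x M Q
  have gd: "mopen S M" "x : M" "vec.subspace Q" "vec.dim Q = 2" "s : M ==> EX u. u ~= 0 & u : Q & de (c s) = vec.span {u}"
   "mopen S M' ==> M' <= M ==> M' ~= {} ==> EX s:M'. EX s':M'. de (c s) ~= de (c s')" if "good x M Q" for x M Q s M'
   using that unfolding good_def by (elim conjE; simp)+
  have ex: "EX M Q. good x M Q" if x: "x : points S" for x
  proof -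
   have y: "c x : topspace Y" using cB x by blast
   obtain T U ph V E where T: "openin Y T" "c x : T" "inj_on q T" "q`T <= V"
    and c: "rho_chart A N U ph" "rho_chart.flat_frame A N U ph V E" and de: "ALL t:T. de t = vec.span {\<chi> b. E None b (q t)}"
    using loc[OF y] by (elim exE conjE)
   obtain W where W: "c x : W" "iso_on B cp_atlas W de" using bi[OF y] by blast
   have "openin Y W" using iso_on_mopen[OF W(2)] mopen_B by simp
   hence o: "openin Y (T Int W)" by (rule openin_Int[OF T(1)])
   have i: "inj_on q (T Int W)" "inj_on de (T Int W)" using T(3) iso_on_inj[OF W(2)] by (auto intro: inj_on_subset)
   have s: "q`(T Int W) <= V" using T(4) by blast
   show ?thesis unfolding good_def by (rule frame_local_lines[OF ps gs o i(1) s c _ i(2) g x]) (use de T(2) W(1) in auto)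
  qed
  have uniq: "Q = Q'" if "good x M Q" "good x' M' Q'" "z : M" "z : M'" for x M Q x' M' Q' z
  proof -
   note h = that
   have M: "mopen S (M Int M')" "M Int M' ~= {}" using h(3,4) mopen_Int[OF S gd(1)[OF h(1)] gd(1)[OF h(2)]] by auto
   obtain s s' where s: "s : M Int M'" "s' : M Int M'" "de (c s) ~= de (c s')" using gd(6)[OF h(1) M(1) Int_lower1 M(2)] by blast
   have Q: "vec.subspace Q" "vec.dim Q = 2" "vec.subspace Q'" "vec.dim Q' = 2" using gd(3,4)[OF h(1)] gd(3,4)[OF h(2)] by auto
   obtain u v where u: "u ~= 0" "u : Q" "de (c s) = vec.span {u}" and v: "v ~= 0" "v : Q" "de (c s') = vec.span {v}"
    using gd(5)[OF h(1), of s] gd(5)[OF h(1), of s'] s(1,2) by blast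
   have "w : Q'" if w: "s : M'" "de (c s) = vec.span {w}" for s w
   proof -
    obtain w' where w': "w' : Q'" "vec.span {w} = vec.span {w'}" using gd(5)[OF h(2) w(1)] w(2) by auto
    have "vec.span {w'} <= Q'" by (rule vec.span_minimal) (use w' Q in auto)
    thus ?thesis using vec.span_base[of w "{w}"] w'(2) by auto
   qed
   hence "u : Q'" "v : Q'" using s u v by auto
   thus ?thesis using plane_unique[OF Q u(2) _ v(2) _ u(1) v(1)] s(3) u(3) v(3) by simp
  qed
  define K where "K x = (SOME Q. EX M. good x M Q)" for x
  have K: "EX M. good x M (K x)" if "x : points S" for x unfolding K_def by (rule someI_ex) (use ex[OF that] in blast)
  have const: "K x = K x0" if x: "x : points S" for x
  proof (rule connected_locally_constant[OF con])
   show "x0 : topspace (mtop S)" "x : topspace (mtop S)" using x x0 topspace_mtop[OF S] by auto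
   fix y assume "y : topspace (mtop S)"
   hence y: "y : points S" using topspace_mtop[OF S] by simp
   obtain M where M: "good y M (K y)" using K[OF y] by blast
   note oM = gd(1,2)[OF M]
   have "K z = K y" if z: "z : M" for z
   proof -
    obtain M' where M': "good z M' (K z)" using K mopen_points[OF oM(1)] z by blast
    show ?thesis by (rule uniq[OF M' M gd(2)[OF M'] z])
   qed
   thus "EX M. openin (mtop S) M & y : M & (ALL z:M. K z = K y)" using oM openin_mtop[OF S] by blast
  qed
  obtain M0 where "good x0 M0 (K x0)" using K[OF x0] by blast
  note Q0 = gd(3,4)[OF this]
  have "de (c x) : {l : cp_points. l <= K x0}" if x: "x : points S" for x
  proof -
   obtain M where "good x M (K x0)" using K[OF x] const[OF x] by auto
   from gd(5)[OF this gd(2)[OF this]] obtain u where u: "u ~= 0" "u : K x0" "de (c x) = vec.span {u}" by blast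
   have "vec.span {u} <= K x0" by (rule vec.span_minimal) (use u Q0 in auto)
   thus ?thesis using u cp_points_span[OF u(1)] by simp
  qed
  hence "de`c`points S <= {l : cp_points. l <= K x0}" by blast
  moreover have "{l : cp_points. l <= K x0} : projective_lines" unfolding projective_lines_def using Q0 by blast
  ultimately show ?thesis by blast
 qed
 ultimately show ?thesis unfolding developing_map_def using cov by blast
qed

end

section \<open>The covering space of projective trivializations\<close>

context rho_chart
begin

definition fiso :: "('n option => 'n option => 'a => complex) => 'a => ('a, 'n) esec => complex ^ ('n option)" where
 "fiso E p = mk_iso p (%k b. E k b p)"

text \<open>Composition of the trivialization with a constant matrix. It preserves the equations of
  a flat frame because these act on the index \<open>k\<close> only.\<close>

abbreviation "ftrans g E \<equiv> (%k b p. SUM l. g$b$l * E k l p)"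

lemma fiso_Eisos: "flat_frame V E ==> p : V ==> fiso E p : Eisos A p"
 unfolding fiso_def by (rule mk_iso_Eisos) (use flat_frameD(2,5) in blast)+

lemma fiso_fr: "p : U ==> fiso E p (fr {p} k) = (\<chi> b. E k b p)" by (simp add: vec_eq_iff fiso_def mk_iso_fr)

lemma flat_frame_at:
 assumes fl: "rho_flat A N" and p0: "p0 : U" and h: "h : Eisos A p0"
 obtains V E where "flat_frame V E" "p0 : V" "fiso E p0 = h"
proof -
 obtain W E where W: "mopen A W" "p0 : W" "W <= U" and E: "!!k b. holo_on A W (E k b)" "!!k b. E k b p0 = h (fr {p0} k)$b"
  and dE: "!!p i k b. p : W ==> cpd U ph i (E k b) p = (SUM l. Gm l (Some i) k p * E l b p)"
  using flat_frame_exists[OF fl p0, of "%k b. h (fr {p0} k)$b"] by blast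
 define V where "V = {p : W. det (\<chi> b k. E k b p) ~= 0}"
 have dh: "holo_on A W (%p. det (\<chi> b k. E k b p))" by (rule holo_on_det[OF W(1)]) (simp add: E(1))
 have V: "mopen A V" unfolding V_def by (rule mopen_nonzero[OF A dh])
 have VW: "V <= W" by (auto simp: V_def)
 have p0V: "p0 : V" using Eisos_det[OF p0 h] W(2) by (simp add: V_def E(2))
 have f: "flat_frame V E" unfolding flat_frame_def using V VW W(3) dE holo_on_subset[OF E(1) V VW] by (auto simp: V_def)
 have "fiso E p0 = (%v. 1 *s h v)" by (rule Eisos_eqI[OF p0 h fiso_Eisos[OF f p0V]]) (simp add: fiso_fr[OF p0] E(2) vec_eq_iff)
 thus ?thesis using that[OF f p0V] by simp
qed

lemma flat_frame_ptriv: "flat_frame V E ==> ptriv A N V (fiso E)"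
 unfolding fiso_def[abs_def] by (rule coords_ptriv) (rule flat_frameD; assumption)+

lemma flat_frame_ftrans:
 assumes f: "flat_frame V E" and g: "det g ~= 0"
 shows "flat_frame V (ftrans g E)"
proof -
 note D = flat_frameD[OF f]
 have "holo_on A V (ftrans g E k b)" for k b by (rule holo_on_sum[OF holo_on_mult[OF _ D(3)] D(1)]) (simp add: D(1))
 moreover have "cpd U ph i (ftrans g E k b) p = (SUM l. Gm l (Some i) k p * ftrans g E l b p)" if p: "p : V" for p i k b
 proof -
  have pU: "p : U" using p D(2) by blast
  have n: "holo_near A p (E k l)" for l by (rule holo_nearI[OF p D(3)])
  have c: "holo_near A p (%_. g$b$l)" for l by (rule holo_nearI[OF p]) (simp add: D(1))
  have n': "holo_near A p (%p. g$b$l * E k l p)" for l by (rule holo_nearI[OF p holo_on_mult[OF _ D(3)]]) (simp add: D(1))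
  have "cpd U ph i (ftrans g E k b) p = (SUM l. g$b$l * cpd U ph i (E k l) p)"
   unfolding cpd_sum[OF pU n'] by (simp add: cpd_mult[OF pU c n] cpd_const)
  also have "... = (SUM l. SUM m. Gm m (Some i) k p * (g$b$l * E m l p))" by (simp add: D(4)[OF p] sum_distrib_left mult_ac)
  also have "... = (SUM m. Gm m (Some i) k p * ftrans g E m b p)" by (subst sum.swap) (simp add: sum_distrib_left)
  finally show ?thesis .
 qed
 moreover have "det (\<chi> b k. ftrans g E k b p) ~= 0" if p: "p : V" for p
 proof -
  have "(\<chi> b k. ftrans g E k b p) = g ** (\<chi> b k. E k b p)" by (simp add: vec_eq_iff matrix_matrix_mult_def)
  thus ?thesis using D(5)[OF p] g by (simp add: det_mul)
 qed
 ultimately show ?thesis unfolding flat_frame_def using D(1,2) by blast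
qed

lemma fiso_onto:
 assumes f: "flat_frame V E" and p: "p : V" and h: "h : Eisos A p"
 obtains g where "det g ~= 0" "fiso (ftrans g E) p = h"
proof -
 have pU: "p : U" using p flat_frameD(2)[OF f] by blast
 let ?M = "\<chi> b k. E k b p" and ?M' = "\<chi> b k. h (fr {p} k)$b"
 obtain J where J: "J ** ?M = mat 1" "?M ** J = mat 1"
  using flat_frameD(5)[OF f p] unfolding invertible_det_nz[symmetric] invertible_def by blast
 define g where "g = ?M' ** J"
 have "det ?M' ~= 0" by (rule Eisos_det[OF pU h])
 moreover have "det J * det ?M = 1" using arg_cong[OF J(1), of det] by (simp add: det_mul)
 ultimately have g: "det g ~= 0" by (auto simp: g_def det_mul)
 have "g ** ?M = ?M'" by (simp add: g_def J(1) flip: matrix_mul_assoc)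
 hence e: "ftrans g E k b p = h (fr {p} k)$b" for k b by (simp add: vec_eq_iff matrix_matrix_mult_def)
 have "fiso (ftrans g E) p = (%v. 1 *s h v)"
  by (rule Eisos_eqI[OF pU h fiso_Eisos[OF flat_frame_ftrans[OF f g] p]]) (simp add: fiso_fr[OF pU] e vec_eq_iff)
 thus ?thesis using that[OF g] by simp
qed

text \<open>Proportionality at one point forces \<open>g' = c g\<close>, and then it persists over
  all of \<open>V\<close> as both matrices are constant. This separates the sheets of the
  covering.\<close>

lemma fiso_scalar:
 assumes f: "flat_frame V E" and g: "det g ~= 0" "det g' ~= 0" and p: "p : V" and q: "q : V"
  and e: "fiso (ftrans g' E) p = (%v. c *s fiso (ftrans g E) p v)"
 shows "fiso (ftrans g' E) q = (%v. c *s fiso (ftrans g E) q v)"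
proof -
 have U: "p : U" "q : U" using p q flat_frameD(2)[OF f] by auto
 have "g'$b$l = c * g$b$l" for b l
 proof -
  have "ftrans g' E k b p = c * ftrans g E k b p" for k using fun_cong[OF e, of "fr {p} k"] by (simp add: fiso_fr[OF U(1)] vec_eq_iff)
  hence 0: "(SUM l. (g'$b$l - c * g$b$l) * E k l p) = 0" for k
   by (simp add: left_diff_distrib sum_subtractf sum_distrib_left mult.assoc)
  have "(\<chi> b k. E b k p) = transpose (\<chi> b k. E k b p)" by (simp add: transpose_def)
  hence "det (\<chi> b k. E b k p) ~= 0" using flat_frameD(5)[OF f p] by (simp add: det_transpose)
  from frame_kernel[of "%l k. E k l p" "%l. g'$b$l - c * g$b$l" l, OF this 0]
  show ?thesis by simp
 qed
 thus ?thesis by (intro Eisos_eqI[OF U(2) fiso_Eisos[OF flat_frame_ftrans[OF f g(1)] q] fiso_Eisos[OF flat_frame_ftrans[OF f g(2)] q]])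
   (simp add: fiso_fr[OF U(2)] vec_eq_iff sum_distrib_left mult.assoc)
qed

end

definition pclass :: "('e => complex ^ 'k) => ('e => complex ^ 'k::finite) set" where
 "pclass h = {(%v. c *s h v) | c. c ~= 0}"

lemma pclass_eq: "pclass h = pclass h' \<longleftrightarrow> (EX c. c ~= 0 & h' = (%v. c *s h v))"
proof
 have "h' = (%v. 1 *s h' v)" by simp
 hence "h' : pclass h'" unfolding pclass_def by (intro CollectI exI[of _ 1]) simp
 thus "EX c. c ~= 0 & h' = (%v. c *s h v)" if "pclass h = pclass h'" using that by (auto simp: pclass_def)
next
 assume "EX c. c ~= 0 & h' = (%v. c *s h v)"
 then obtain c where c: "c ~= 0" "h' = (%v. c *s h v)" by blast
 have "EX b. (%v. a *s h v) = (%v. b *s h' v) & b ~= 0" if "a ~= 0" for a using c that by (intro exI[of _ "a / c"]) (simp add: fun_eq_iff)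
 moreover have "EX b. (%v. a *s h' v) = (%v. b *s h v) & b ~= 0" if "a ~= 0" for a
  using c that by (intro exI[of _ "a * c"]) (simp add: fun_eq_iff)
 ultimately show "pclass h = pclass h'" unfolding pclass_def by blast
qed

lemma ptrivD: "ptriv A N W H ==> mopen A W" "ptriv A N W H ==> p : W ==> H p : Eisos A p" unfolding ptriv_def by (elim conjE; simp)+

section \<open>Topology and evenly covered sets of the covering space\<close>

text \<open>The points of the covering space are encoded by \<open>e\<close>, as they have to be taken in a given type.\<close>

locale flat_rho = rho_conn A N
 for A :: "('a, 'n::finite) atlas" and N +
 fixes e :: "'a => (('a, 'n) esec => complex ^ ('n option)) set => 'y"
 assumes fl: "rho_flat A N"
  and e_inj: "p : points A ==> h : Eisos A p ==> p' : points A ==> h' : Eisos A p' ==>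
   e p (pclass h) = e p' (pclass h') ==> p = p' & pclass h = pclass h'"
begin

text \<open>The sheet cut out by a trivialization; by \<open>sheet_Int\<close> these sets form a
  base of a topology.\<close>

definition "sh W H = (%p. e p (pclass (H p)))`W"

definition "Y = topology (%T. ALL y:T. EX W H. ptriv A N W H & y : sh W H & sh W H <= T)"

definition "rep y = (SOME (p, h). p : points A & h : Eisos A p & y = e p (pclass h))"

definition "base y = fst (rep y)"

definition "dev y = vec.span {snd (rep y) (euler A {base y})}"

text \<open>The code determines the point and the class; another representative differs by a nonzero
  scalar, which does not change the line spanned by its value on the Euler section.\<close>

lemma rep:
 assumes p: "p : points A" and h: "h : Eisos A p"
 shows base_e: "base (e p (pclass h)) = p" and dev_e: "dev (e p (pclass h)) = vec.span {h (euler A {p})}"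
proof -
 let ?R = "%(p', h'). p' : points A & h' : Eisos A p' & e p (pclass h) = e p' (pclass h')"
 obtain p' h' where r: "rep (e p (pclass h)) = (p', h')" by (cases "rep (e p (pclass h))")
 have "?R (rep (e p (pclass h)))" unfolding rep_def by (rule someI[of _ "(p, h)"]) (use p h in simp)
 hence "p = p'" "pclass h = pclass h'" using e_inj[OF p h, of p' h'] unfolding r by auto
 then obtain c where c: "c ~= 0" "h' = (%v. c *s h v)" "p = p'" unfolding pclass_eq by blast
 show "base (e p (pclass h)) = p" by (simp add: base_def r flip: c(3))
 show "dev (e p (pclass h)) = vec.span {h (euler A {p})}" unfolding dev_def base_def r by (simp add: c(1,2) span_scale flip: c(3))
qed

lemma rho_chart_at:
 assumes "p : points A"
 obtains U ph where "rho_chart A N U ph" "p : U"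
proof -
 obtain U ph where "chart A U ph" "p : U" using chart_at[OF cA assms] .
 thus ?thesis using that rho_chart.intro[OF rho_conn_axioms] by blast
qed

text \<open>At a common point the two trivializations are proportional; by
  \<open>ptriv_unique\<close> they are proportional nearby, so the sheets agree nearby.\<close>

lemma sheet_Int:
 assumes T: "ptriv A N W H" "ptriv A N W' H'" and y: "y : sh W H" "y : sh W' H'"
 shows "EX V. ptriv A N V H & y : sh V H & sh V H <= sh W H Int sh W' H'"
proof -
 obtain p p' where p: "p : W" "y = e p (pclass (H p))" and p': "p' : W'" "y = e p' (pclass (H' p'))" using y unfolding sh_def by blast
 have pp: "p : points A" "p' : points A" using mopen_points ptrivD(1) T p(1) p'(1) by blast+
 have pe: "p = p'" "pclass (H p) = pclass (H' p')"
  using e_inj[OF pp(1) ptrivD(2)[OF T(1) p(1)] pp(2) ptrivD(2)[OF T(2) p'(1)]] p(2) p'(2) by auto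
 obtain c where c: "c ~= 0" "H' p = (%v. c *s H p v)" using pe unfolding pclass_eq by blast
 obtain U ph where u: "rho_chart A N U ph" "p : U" using rho_chart_at[OF pp(1)] .
 interpret c: rho_chart A N U ph by (rule u(1))
 have m: "mopen A (W Int U)" "mopen A (W' Int U)" using mopen_Int[OF cA _ c.U_mopen] ptrivD(1) T by blast+
 from c.ptriv_unique[OF ptriv_subset[OF T(1) m(1) Int_lower1] ptriv_subset[OF T(2) m(2) Int_lower1] Int_lower2 Int_lower2 _ _ c]
 obtain V where V: "mopen A V" "p : V" "V <= W Int U" "V <= W' Int U" "!!q. q : V ==> EX d. d ~= 0 & H' q = (%v. d *s H q v)"
  using p(1) p'(1) pe(1) u(2) by blast
 have "e q (pclass (H q)) : sh W' H'" if "q : V" for q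
 proof -
  have "pclass (H q) = pclass (H' q)" using V(5)[OF that] unfolding pclass_eq .
  thus ?thesis using that V(4) unfolding sh_def by auto
 qed
 hence "sh V H <= sh W H Int sh W' H'" using V(3) unfolding sh_def by blast
 moreover have "ptriv A N V H" by (rule ptriv_subset[OF T(1) V(1)]) (use V(3) in blast)
 moreover have "y : sh V H" using V(2) p(2) unfolding sh_def by blast
 ultimately show ?thesis by (intro exI[of _ V] conjI)
qed

lemma openin_Y: "openin Y T \<longleftrightarrow> (ALL y:T. EX W H. ptriv A N W H & y : sh W H & sh W H <= T)"
proof -
 have "istopology (%T. ALL y:T. EX W H. ptriv A N W H & y : sh W H & sh W H <= T)" (is "istopology ?O") unfolding istopology_def
 proof (intro conjI allI impI)
  fix S T assume S: "?O S" and T: "?O T"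
  show "?O (S Int T)"
  proof
   fix y assume y: "y : S Int T"
   hence yST: "y : S" "y : T" by auto
   obtain W H where W: "ptriv A N W H" "y : sh W H" "sh W H <= S" using bspec[OF S yST(1)] by (elim exE conjE)
   obtain W' H' where W': "ptriv A N W' H'" "y : sh W' H'" "sh W' H' <= T" using bspec[OF T yST(2)] by (elim exE conjE)
   obtain V where V: "ptriv A N V H" "y : sh V H" "sh V H <= sh W H Int sh W' H'"
    using sheet_Int[OF W(1) W'(1) W(2) W'(2)] by (elim exE conjE)
   thus "EX W H. ptriv A N W H & y : sh W H & sh W H <= S Int T" using W(3) W'(3) by (intro exI[of _ V] exI[of _ H]) auto
  qed
 next
  fix K assume K: "ALL T:K. ?O T"
  show "?O (\<Union>K)"
  proof
   fix y assume "y : \<Union>K"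
   then obtain T where T: "T : K" "y : T" by blast
   obtain W H where "ptriv A N W H" "y : sh W H" "sh W H <= T" using bspec[OF bspec[OF K T(1)] T(2)] by (elim exE conjE)
   thus "EX W H. ptriv A N W H & y : sh W H & sh W H <= \<Union>K" using T(1) by (intro exI[of _ W] exI[of _ H]) auto
  qed
 qed
 thus ?thesis unfolding Y_def by (simp add: topology_inverse')
qed

lemma open_sheet: "ptriv A N W H ==> openin Y (sh W H)" unfolding openin_Y by (intro ballI exI[of _ W] exI[of _ H] conjI order_refl)

lemma topspace_Y: "y : topspace Y \<longleftrightarrow> (EX p h. p : points A & h : Eisos A p & y = e p (pclass h))"
proof
 assume "y : topspace Y"
 then obtain W H where W: "ptriv A N W H" "y : sh W H" using openin_topspace[of Y] unfolding openin_Y by blast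
 then obtain p where "p : W" "y = e p (pclass (H p))" unfolding sh_def by blast
 thus "EX p h. p : points A & h : Eisos A p & y = e p (pclass h)"
  using ptrivD[OF W(1)] mopen_points by (intro exI[of _ p] exI[of _ "H p"]) auto
next
 assume "EX p h. p : points A & h : Eisos A p & y = e p (pclass h)"
 then obtain p h where p: "p : points A" "h : Eisos A p" "y = e p (pclass h)" by blast
 obtain U ph where u: "rho_chart A N U ph" "p : U" using rho_chart_at[OF p(1)] .
 interpret c: rho_chart A N U ph by (rule u(1))
 obtain V E where V: "c.flat_frame V E" "p : V" "c.fiso E p = h" using c.flat_frame_at[OF fl u(2) p(2)] .
 have "y : sh V (c.fiso E)" unfolding sh_def using V p(3) by blast
 thus "y : topspace Y" using openin_subset[OF open_sheet[OF c.flat_frame_ptriv[OF V(1)]]] by blast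
qed

lemma base_sheet: "ptriv A N W H ==> p : W ==> base (e p (pclass (H p))) = p"
 by (rule base_e[OF subsetD[OF mopen_points[OF ptrivD(1)]] ptrivD(2)])

lemma base_image: "ptriv A N W H ==> base`sh W H = W" "ptriv A N W H ==> inj_on base (sh W H)"
 unfolding sh_def by (auto simp: base_sheet image_image inj_on_def)

lemma sheet_subset: "ptriv A N W H ==> V <= W ==> {y : sh W H. base y : V} = sh V H" unfolding sh_def by (auto simp: base_sheet)

lemma base_open: "openin Y T ==> mopen A (base`T)"
proof (rule mopen_local)
 fix p assume T: "openin Y T" and "p : base`T"
 then obtain y where y: "y : T" "p = base y" by blast
 obtain W H where W: "ptriv A N W H" "y : sh W H" "sh W H <= T" using bspec[OF T[unfolded openin_Y] y(1)] by (elim exE conjE)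
 thus "EX V. p : V & V <= base`T & mopen A V" using base_image(1)[OF W(1)] ptrivD(1)[OF W(1)] y(2) by (intro exI[of _ W]) blast
qed

lemma base_cont: "mopen A V ==> openin Y {y : topspace Y. base y : V}" unfolding openin_Y
proof
 fix y assume V: "mopen A V" and y: "y : {y : topspace Y. base y : V}"
 hence "y : topspace Y" by simp
 from bspec[OF openin_topspace[of Y, unfolded openin_Y] this]
 obtain W H where W: "ptriv A N W H" "y : sh W H" by (elim exE conjE)
 have T: "ptriv A N (W Int V) H" by (rule ptriv_subset[OF W(1) mopen_Int[OF cA ptrivD(1)[OF W(1)] V] Int_lower1])
 have "base y : W" using base_image(1)[OF W(1)] W(2) by blast
 hence "y : sh (W Int V) H" using sheet_subset[OF W(1), of "W Int V"] W(2) y by auto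
 moreover have "base`sh (W Int V) H = W Int V" by (rule base_image[OF T])
 ultimately show "EX W H. ptriv A N W H & y : sh W H & sh W H <= {y : topspace Y. base y : V}"
  using T openin_subset[OF open_sheet[OF T]] by (intro exI[of _ "W Int V"] exI[of _ H]) blast
qed

lemma sheet_homeomorphic:
 assumes T: "ptriv A N W H"
 shows "homeomorphic_map (subtopology Y (sh W H)) (subtopology (mtop A) W) base"
proof (rule bijective_open_imp_homeomorphic_map)
 have o: "openin Y (sh W H)" by (rule open_sheet[OF T])
 have t: "topspace (subtopology Y (sh W H)) = sh W H" using openin_subset[OF o] by auto
 have W: "openin (mtop A) W" using ptrivD(1)[OF T] openin_mtop[OF cA] by simp
 have t': "topspace (subtopology (mtop A) W) = W" using openin_subset[OF W] by auto
 show "base`topspace (subtopology Y (sh W H)) = topspace (subtopology (mtop A) W)" unfolding t t' by (rule base_image[OF T])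
 show "inj_on base (topspace (subtopology Y (sh W H)))" unfolding t by (rule base_image[OF T])
 show "open_map (subtopology Y (sh W H)) (subtopology (mtop A) W) base" unfolding open_map_def
 proof (intro allI impI)
  fix S assume "openin (subtopology Y (sh W H)) S"
  hence S: "openin Y S" "S <= sh W H" using openin_open_subtopology[OF o] by auto
  have "base`S <= W" using base_image(1)[OF T] S(2) by blast
  thus "openin (subtopology (mtop A) W) (base`S)" using base_open[OF S(1)] openin_open_subtopology[OF W] openin_mtop[OF cA] by simp
 qed
 show "continuous_map (subtopology Y (sh W H)) (subtopology (mtop A) W) base" unfolding continuous_map_def t t'
 proof (intro conjI allI impI)
  show "base : sh W H \<rightarrow> W" using base_image(1)[OF T] by blast
  fix S assume "openin (subtopology (mtop A) W) S"
  hence S: "mopen A S" "S <= W" using openin_open_subtopology[OF W] openin_mtop[OF cA] by auto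
  have "openin Y (sh S H)" by (rule open_sheet[OF ptriv_subset[OF T S]])
  moreover have "sh S H <= sh W H" using S(2) unfolding sh_def by blast
  ultimately show "openin (subtopology Y (sh W H)) {x : sh W H. base x : S}"
   unfolding sheet_subset[OF T S(2)] using openin_open_subtopology[OF o] by simp
 qed
qed

lemma sheets_over:
 assumes p: "p : points A"
 obtains U ph V E where "rho_chart A N U ph" "rho_chart.flat_frame A N U ph V E" "p : V"
proof -
 obtain U ph where u: "rho_chart A N U ph" "p : U" using rho_chart_at[OF p] .
 interpret c: rho_chart A N U ph by (rule u(1))
 have "(\<chi> b k. if k = b then 1 else 0) = (mat 1 :: complex ^ 'n option ^ 'n option)" by (simp add: mat_def vec_eq_iff)
 hence "c.mk_iso p (%k b. if k = b then 1 else 0) : Eisos A p" by (intro c.mk_iso_Eisos[OF u(2)]) simp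
 then obtain V E where "c.flat_frame V E" "p : V" using c.flat_frame_at[OF fl u(2)] by blast
 thus ?thesis by (rule that[OF u(1)])
qed

text \<open>A set \<open>V\<close> carrying a flat frame \<open>E\<close> is evenly covered by the
  sheets of the constant changes of frame \<open>g\<close>. These exhaust the preimage since
  \<open>g\<close> can be adjusted to any isomorphism at a point (\<open>fiso_onto\<close>), and two
  of them are disjoint or equal by \<open>fiso_scalar\<close>.\<close>

lemma covering_Y: "covering_map Y (mtop A) base" unfolding covering_map_def topspace_mtop[OF cA]
proof (intro conjI ballI)
 have sub: "base y : points A" if "y : topspace Y" for y using that base_e unfolding topspace_Y by auto
 show "continuous_map Y (mtop A) base" unfolding continuous_map_def topspace_mtop[OF cA] openin_mtop[OF cA] using sub base_cont by blast
 show "base`topspace Y = points A"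
 proof
  show "base`topspace Y <= points A" using sub by blast
  show "points A <= base`topspace Y"
  proof
   fix p assume p: "p : points A"
   obtain U ph V E where u: "rho_chart A N U ph" "rho_chart.flat_frame A N U ph V E" "p : V" using sheets_over[OF p] .
   interpret c: rho_chart A N U ph by (rule u(1))
   show "p : base`topspace Y"
    using base_image(1)[OF c.flat_frame_ptriv[OF u(2)]] openin_subset[OF open_sheet[OF c.flat_frame_ptriv[OF u(2)]]] u(3) by blast
  qed
 qed
 fix p assume p: "p : points A"
 obtain U ph V E where u: "rho_chart A N U ph" "rho_chart.flat_frame A N U ph V E" "p : V" using sheets_over[OF p] .
 interpret c: rho_chart A N U ph by (rule u(1))
 define S where "S g = sh V (c.fiso (c.ftrans g E))" for g
 have T: "ptriv A N V (c.fiso (c.ftrans g E))" if "det g ~= 0" for g by (rule c.flat_frame_ptriv[OF c.flat_frame_ftrans[OF u(2) that]])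
 have V: "mopen A V" "V <= points A" using c.flat_frameD(1)[OF u(2)] mopen_points by blast+
 let ?V = "{S g | g. det g ~= 0}"
 show "EX U \<V>. openin (mtop A) U & p : U & (ALL V:\<V>. openin Y V) & disjoint \<V> &
   \<Union>\<V> = {y : topspace Y. base y : U} & (ALL V:\<V>. homeomorphic_map (subtopology Y V) (subtopology (mtop A) U) base)"
 proof (intro exI[of _ V] exI[of _ ?V] conjI)
  show "openin (mtop A) V" using V(1) openin_mtop[OF cA] by simp
  show "p : V" by (rule u(3))
  show "ALL X:?V. openin Y X" using open_sheet[OF T] unfolding S_def by blast
  show "ALL X:?V. homeomorphic_map (subtopology Y X) (subtopology (mtop A) V) base" using sheet_homeomorphic[OF T] unfolding S_def by blast
  show "disjoint ?V"
  proof (rule disjointI)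
   fix X X' assume "X : ?V" "X' : ?V" and ne: "X ~= X'"
   then obtain g g' where g: "X = S g" "det g ~= 0" "X' = S g'" "det g' ~= 0" by blast
   show "X Int X' = {}"
   proof (rule ccontr)
    assume "X Int X' ~= {}"
    then obtain y where y: "y : S g" "y : S g'" using g by blast
    obtain a b where a: "a : V" "y = e a (pclass (c.fiso (c.ftrans g E) a))" and b: "b : V" "y = e b (pclass (c.fiso (c.ftrans g' E) b))"
     using y unfolding S_def sh_def by blast
    have "a = b & pclass (c.fiso (c.ftrans g E) a) = pclass (c.fiso (c.ftrans g' E) b)"
     by (rule e_inj[OF subsetD[OF V(2) a(1)] ptrivD(2)[OF T[OF g(2)] a(1)] subsetD[OF V(2) b(1)] ptrivD(2)[OF T[OF g(4)] b(1)]])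
      (simp only: a(2)[symmetric] b(2)[symmetric])
    then obtain d where d: "d ~= 0" "c.fiso (c.ftrans g' E) a = (%v. d *s c.fiso (c.ftrans g E) a v)" unfolding pclass_eq by blast
    have "pclass (c.fiso (c.ftrans g E) q) = pclass (c.fiso (c.ftrans g' E) q)" if q: "q : V" for q
     unfolding pclass_eq using c.fiso_scalar[OF u(2) g(2,4) a(1) q d(2)] d(1) by blast
    hence "X = X'" unfolding g(1,3) S_def sh_def by (intro image_cong refl) simp
    thus False using ne by blast
   qed
  qed
  show "\<Union>?V = {y : topspace Y. base y : V}"
  proof
   show "\<Union>?V <= {y : topspace Y. base y : V}"
   proof
    fix y assume "y : \<Union>?V"
    then obtain g where g: "det g ~= 0" "y : S g" by blast
    thus "y : {y : topspace Y. base y : V}"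
     using base_image(1)[OF T[OF g(1)]] openin_subset[OF open_sheet[OF T[OF g(1)]]] unfolding S_def by blast
   qed
   show "{y : topspace Y. base y : V} <= \<Union>?V"
   proof
    fix y assume y: "y : {y : topspace Y. base y : V}"
    hence "y : topspace Y" by simp
    then obtain a h where a: "a : points A" "h : Eisos A a" "y = e a (pclass h)" unfolding topspace_Y by (elim exE conjE)
    have aV: "a : V" using y base_e[OF a(1,2)] a(3) by simp
    obtain g where g: "det g ~= 0" "c.fiso (c.ftrans g E) a = h" using c.fiso_onto[OF u(2) aV a(2)] .
    hence "y : S g" unfolding S_def sh_def using aV a(3) by blast
    thus "y : \<Union>?V" using g(1) by blast
   qed
  qed
 qed
qed

lemma developing_Y:
 assumes ps: "projective_structure A P" and gs: "gives_structure A N P"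
 shows "developing_map A P Y base dev"
proof -
 interpret covering A Y base using cA covering_Y by unfold_locales
 show ?thesis
 proof (rule frames_developing[OF ps gs])
  fix y assume "y : topspace Y"
  then obtain p h where p: "p : points A" "h : Eisos A p" "y = e p (pclass h)" unfolding topspace_Y by (elim exE conjE)
  obtain U ph where u: "rho_chart A N U ph" "p : U" using rho_chart_at[OF p(1)] .
  interpret c: rho_chart A N U ph by (rule u(1))
  obtain V E where V: "c.flat_frame V E" "p : V" "c.fiso E p = h" using c.flat_frame_at[OF fl u(2) p(2)] .
  note T = c.flat_frame_ptriv[OF V(1)] and VU = c.flat_frameD(2)[OF V(1)]
  let ?T = "sh V (c.fiso E)"
  have "dev t = vec.span {\<chi> b. E None b (base t)}" if t: "t : ?T" for t
  proof -
   obtain a where a: "a : V" "t = e a (pclass (c.fiso E a))" using t unfolding sh_def by blast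
   have aU: "a : U" using a(1) VU by blast
   have ap: "a : points A" by (rule c.U_points[OF aU])
   have "c.fiso E a (euler A {a}) = (\<chi> b. E None b a)" using c.euler_fr[of "{a}"] c.fiso_fr[OF aU] aU by simp
   thus ?thesis using dev_e[OF ap ptrivD(2)[OF T a(1)]] base_sheet[OF T a(1)] a(2) by simp
  qed
  moreover have "y : ?T" unfolding sh_def using V(2,3) p(3) by blast
  ultimately show "EX T U ph V E. openin Y T & y : T & inj_on base T & base`T <= V &
   rho_chart A N U ph & rho_chart.flat_frame A N U ph V E & (ALL t:T. dev t = vec.span {\<chi> b. E None b (base t)})"
   using open_sheet[OF T] base_image[OF T] u(1) V(1)
   by (intro exI[of _ ?T] exI[of _ U] exI[of _ ph] exI[of _ V] exI[of _ E] conjI ballI) auto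
 qed
qed

end

section \<open>Coding projective classes in the type of sets of functions\<close>

lemma pairing_reals: "EX f :: real \<times> real => real. inj f"
proof -
 have "infinite (UNIV :: real set)" by (rule infinite_UNIV_char_0)
 from card_of_Times_same_infinite[OF this]
 have "ordLeq3 (card_of (UNIV \<times> UNIV :: (real \<times> real) set)) (card_of (UNIV :: real set))" by (rule ordIso_imp_ordLeq)
 then obtain f :: "real \<times> real => real" where "inj_on f (UNIV \<times> UNIV)" unfolding card_of_ordLeq[symmetric] by blast
 thus ?thesis by auto
qed

text \<open>The code is the graph of \<open>m\<close>, its triples of index, real part and imaginary
  part being paired into single reals.\<close>

lemma real_set_code: "EX f :: ('k::finite => complex) => real set. inj f & (ALL m. f m ~= {})"
proof -
 obtain ps :: "real \<times> real => real" where ps: "inj ps" using pairing_reals by blast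
 obtain \<iota> :: "'k => nat" where \<iota>: "inj \<iota>" using finite_imp_inj_to_nat_seg[of "UNIV :: 'k set"] by auto
 define f where "f m = range (%i. ps (real (\<iota> i), ps (Re (m i), Im (m i))))" for m :: "'k => complex"
 have "m i = m' i" if e: "f m = f m'" for m m' i
 proof -
  have "ps (real (\<iota> i), ps (Re (m i), Im (m i))) : f m'" unfolding e[symmetric] unfolding f_def by (rule rangeI)
  then obtain j where "ps (real (\<iota> i), ps (Re (m i), Im (m i))) = ps (real (\<iota> j), ps (Re (m' j), Im (m' j)))"
   unfolding f_def by blast
  hence "i = j & Re (m i) = Re (m' j) & Im (m i) = Im (m' j)" by (simp add: inj_eq[OF ps] inj_eq[OF \<iota>] cong: conj_cong)
  thus ?thesis using complex_eqI by blast
 qed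
 hence "inj f" by (intro injI ext) blast
 moreover have "f m ~= {}" for m by (simp add: f_def)
 ultimately show ?thesis by blast
qed

text \<open>
 A point \<open>p\<close> and a nonempty set \<open>S\<close> of reals can be recovered from the set of functions
 \<open>real => 'a\<close> taking the value \<open>p\<close> on \<open>S\<close>, provided that there is a further point \<open>z\<close>.
\<close>

lemma point_set_code:
 assumes e: "{f :: real => 'a. EX r:S. f r = p} = {f. EX r:S'. f r = p'}" and S: "S ~= {}" "S' ~= {}" and z: "z ~= p"
 shows "p = p' & S = S'"
proof -
 have "(%_. p) : {f. EX r:S'. f r = p'}" unfolding e[symmetric] using S by auto
 hence p: "p' = p" by auto
 have c: "(%x. if x = r then p else z) : {f :: real => 'a. EX r:S. f r = p} \<longleftrightarrow> r : S" for r S using z by auto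
 have "r : S \<longleftrightarrow> r : S'" for r unfolding c[symmetric] e p ..
 hence "S = S'" by (rule set_eqI)
 thus ?thesis using p by simp
qed

text \<open>A class is coded by the matrix, in a chosen chart, of a chosen representative. The chart
  depends only on the point and the representative only on point and class, so equal codes give
  equal representatives.\<close>

lemma Eisos_code:
 fixes A :: "('a, 'n::finite) atlas"
 assumes A: "atlas_compat A"
 obtains e :: "'a => (('a, 'n) esec => complex ^ ('n option)) set => (real => 'a) set"
 where "!!p h p' h'. p : points A ==> h : Eisos A p ==> p' : points A ==> h' : Eisos A p' ==>
   e p (pclass h) = e p' (pclass h') ==> p = p' & pclass h = pclass h'"
proof -
 obtain code :: "('n option \<times> 'n option => complex) => real set" where code: "inj code" "!!m. code m ~= {}"
  using real_set_code by blast
 define m where "m p h = (%(k, b). h (case SOME (U, ph). chart A U ph & p : U of (U, ph) => chart.fr A U ph {p} k)$b :: complex)"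
  for p and h :: "('a, 'n) esec => complex ^ ('n option)"
 define pick where "pick p K = (SOME h. h : Eisos A p & pclass h = K)" for p K
 define e where "e p K = {f :: real => 'a. EX r:code (m p (pick p K)). f r = p}" for p K
 show ?thesis
 proof (rule that[of e])
  fix p h p' h' assume p: "p : points A" and h: "h : Eisos A p" and p': "p' : points A" and h': "h' : Eisos A p'"
   and eq: "e p (pclass h) = e p' (pclass h')"
  have pick: "pick p (pclass h) : Eisos A p & pclass (pick p (pclass h)) = pclass h" if "h : Eisos A p" for p h
   unfolding pick_def by (rule someI[of _ h]) (use that in simp)
  obtain U ph where S: "(SOME (U, ph). chart A U ph & p : U) = (U, ph)" by (rule prod.exhaust)
  have "case (SOME (U, ph). chart A U ph & p : U) of (U, ph) => chart A U ph & p : U" by (rule someI_ex) (use chart_at[OF A p] in blast)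
  hence U: "chart A U ph" "p : U" unfolding S by auto
  interpret chart A U ph by (rule U(1))
  \<comment> \<open>A second point exists because an open set of coordinate space is not a single
    point; \<open>point_set_code\<close> uses it as the value off the coded set.\<close>
  have "\<not> ph`U <= {ph p}"
  proof
   assume "ph`U <= {ph p}"
   hence "ph`U = {ph p}" using U(2) by blast
   thus False using mopen_iff[of U] U_mopen not_open_singleton[of "ph p"] by simp
  qed
  then obtain z where "ph z ~= ph p" by blast
  hence z: "z ~= p" by auto
  from point_set_code[OF eq[unfolded e_def] code(2) code(2) z]
  have pp: "p = p'" and cc: "code (m p (pick p (pclass h))) = code (m p' (pick p' (pclass h')))" by auto
  let ?h = "pick p (pclass h)" and ?h' = "pick p (pclass h')"
  have P: "?h : Eisos A p" "pclass ?h = pclass h" "?h' : Eisos A p" "pclass ?h' = pclass h'" using pick h h' pp by auto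
  have m: "m p g (k, b) = g (fr {p} k)$b" for g k b by (simp add: m_def S)
  have "m p ?h = m p ?h'" using injD[OF code(1)] cc pp by simp
  hence "?h' (fr {p} k)$b = ?h (fr {p} k)$b" for k b unfolding m[symmetric] by simp
  hence "?h' = (%v. 1 *s ?h v)" by (intro Eisos_eqI[OF U(2) P(1,3)]) (simp add: vec_eq_iff)
  hence "?h' = ?h" by simp
  thus "p = p' & pclass h = pclass h'" using pp P(2,4) by simp
 qed
qed

text \<open>The equivalence fixes one type of points for the covering space that is large enough for
  the construction; the second conjunct lets the points lie in any type \<open>'b\<close> in the
  direction towards flatness.\<close>

theorem corollary3p1:
  fixes A :: "('a, 'n::finite) atlas"
    and P :: "('a set \<times> 'a conn) set set"
    and N :: "('a, 'n) econn"
    and sc :: "complex \<Rightarrow> 'v::ab_group_add \<Rightarrow> 'v"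
  assumes "complex_manifold A"
    and "CARD('n) \<ge> 2"
    and "projective_structure A P"
    and "projective_rho_connection A P N"
    and "\<exists>F \<F> \<Phi>. line_bundle A sc F \<F> \<and> power_iso_det A sc F \<F> \<Phi>"
  shows "(rho_flat A N \<longleftrightarrow>
           (\<exists>(Y :: (real \<Rightarrow> 'a) set topology) q \<delta>. developing_map A P Y q \<delta>)) \<and>
         ((\<exists>(Y :: 'b topology) q \<delta>. developing_map A P Y q \<delta>) \<longrightarrow> rho_flat A N)"
proof -
 have A: "atlas_compat A" by (rule complex_manifold_compat[OF assms(1)])
 have N: "rho_conn A N" and rf: "Ricci_flat A N" and gs: "gives_structure A N P"
  using assms(4) A unfolding projective_rho_connection_def rho_conn_def by blast+
 note flat = covering.developing_flat[OF _ N assms(2) rf gs assms(3)]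
 have "rho_flat A N" if "developing_map A P Y q de" for Y :: "(real => 'a) set topology" and q de
  by (rule flat[OF _ that]) (use A that in \<open>simp add: covering_def developing_map_def\<close>)
 moreover have "rho_flat A N" if "developing_map A P Y q de" for Y :: "'b topology" and q de
  by (rule flat[OF _ that]) (use A that in \<open>simp add: covering_def developing_map_def\<close>)
 moreover have "EX (Y :: (real => 'a) set topology) q de. developing_map A P Y q de" if fl: "rho_flat A N"
 proof -
  obtain e :: "'a => (('a, 'n) esec => complex ^ ('n option)) set => (real => 'a) set"
   where e: "!!p h p' h'. p : points A ==> h : Eisos A p ==> p' : points A ==> h' : Eisos A p' ==>
    e p (pclass h) = e p' (pclass h') ==> p = p' & pclass h = pclass h'" using Eisos_code[OF A] by blast
  have "flat_rho A N e" by (intro flat_rho.intro N flat_rho_axioms.intro fl e)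
  from flat_rho.developing_Y[OF this assms(3) gs] show ?thesis by blast
 qed
 ultimately show ?thesis by blast
qed

end
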